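(* Let $0<\Delta<1$. There exist positive constants $C_1,C_2,C_3$ depending only on $\Delta$ such that for all sufficiently small $h>0$ the following holds. First, $$2\pi\Delta^2h^2\left(\log\frac1h-C_1\right)\leq \min_{y\in W^{2,2}(B_1;\mathbb{R}^3)}I_{h,\Delta}(y)\leq 2\pi\Delta^2h^2\left(\log\frac1h+C_2\right).$$ Furthermore, if $y\in W^{2,2}(B_1;\mathbb{R}^3)$ satisfies $$I_{h,\Delta}(y)\leq 2\pi\Delta^2h^2\left(\log\frac1h+C_2\right),$$ then $$\int_{B_1\setminus B_R}|D^2y|^2\,d\mathcal{L}^2\leq 2\pi\Delta^2\log\frac1R+C_3\quad\text{for all }R\in(2h,1),$$ and $$\int_{B_1}|g_y-g_\Delta|^2\,d\mathcal{L}^2\leq C_3h^2.$$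
   Context: For $r>0$, $B_r=\{x\in\mathbb{R}^2:|x|<r\}$, and $\mathcal{L}^2$ is two-dimensional Lebesgue measure. For $0<\Delta<1$ the singular cone is the map $y^\Delta:B_1\to\mathbb{R}^3$, $y^\Delta(x)=\sqrt{1-\Delta^2}\,x+\Delta|x|e_3$, where $x\in\mathbb{R}^2$ is identified with $(x_1,x_2,0)\in\mathbb{R}^3$. The reference metric is $g_\Delta(x)=Dy^\Delta(x)^TDy^\Delta(x)=\mathrm{Id}_{2\times2}-\Delta^2\,\hat x^\perp\otimes\hat x^\perp$ for $x\neq0$, with $\hat x^\perp=(-x_2,x_1)/|x|$. For $y\in W^{2,2}(B_1;\mathbb{R}^3)$, the induced metric is $g_y=Dy^TDy$. For $h>0$ the free elastic energy $I_{h,\Delta}:W^{2,2}(B_1;\mathbb{R}^3)\to\mathbb{R}$ is $$I_{h,\Delta}(y)=\int_{B_1}\left(|g_y-g_\Delta|^2+h^2|D^2y|^2\right)d\mathcal{L}^2,$$ where $|\cdot|$ denotes the Euclidean (Frobenius) norm of matrices and tensors; in particular $|D^2y|^2=\sum_{i=1}^3|D^2y_i|^2$. *)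

theory Defs
  imports "HOL-Analysis.Analysis"
begin

section \<open>Weak derivatives and Sobolev spaces\<close>

primrec iter_deriv :: "'a list \<Rightarrow> ('a::real_normed_vector \<Rightarrow> 'b::real_normed_vector) \<Rightarrow> 'a \<Rightarrow> 'b" where
  "iter_deriv [] f = f"
| "iter_deriv (v # vs) f = (\<lambda>x. frechet_derivative (iter_deriv vs f) (at x) v)"

text \<open>
  The space of smooth functions with compact support in \<open>U\<close>. All iterated partial derivatives
  are required to be totally differentiable, hence they are all continuous.
\<close>

definition test_functions :: "'a::euclidean_space set \<Rightarrow> ('a \<Rightarrow> real) set" where
  "test_functions U = {\<phi>.
     (\<forall>vs. set vs \<subseteq> Basis \<longrightarrow> (\<forall>x. iter_deriv vs \<phi> differentiable (at x))) \<and>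
     compact (closure {x. \<phi> x \<noteq> 0}) \<and> closure {x. \<phi> x \<noteq> 0} \<subseteq> U}"

definition locally_integrable_on ::
  "('a::euclidean_space \<Rightarrow> 'b::euclidean_space) \<Rightarrow> 'a set \<Rightarrow> bool" (infix "locally'_integrable'_on" 50)
  where "f locally_integrable_on U \<longleftrightarrow> (\<forall>K. compact K \<and> K \<subseteq> U \<longrightarrow> integrable (lebesgue_on K) f)"

text \<open>
  Multi-indices are represented by lists of basis vectors. Local integrability is what makes a
  weak derivative unique almost everywhere on an open set (and keeps the Bochner integrals below
  from taking the default value \<open>0\<close>).
\<close>

definition has_weak_deriv ::
  "'a set \<Rightarrow> 'a list \<Rightarrow> ('a::euclidean_space \<Rightarrow> 'b::euclidean_space) \<Rightarrow> ('a \<Rightarrow> 'b) \<Rightarrow> bool" where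
  "has_weak_deriv U vs f g \<longleftrightarrow>
     f locally_integrable_on U \<and> g locally_integrable_on U \<and>
     (\<forall>\<phi>\<in>test_functions U.
        (LINT x|lebesgue_on U. iter_deriv vs \<phi> x *\<^sub>R f x) =
        (-1) ^ length vs *\<^sub>R (LINT x|lebesgue_on U. \<phi> x *\<^sub>R g x))"

text \<open>
  A representative of the almost everywhere equality class; only meaningful if a weak derivative
  exists. Everything below depends on the class only.
\<close>

definition weak_deriv ::
  "'a set \<Rightarrow> 'a list \<Rightarrow> ('a::euclidean_space \<Rightarrow> 'b::euclidean_space) \<Rightarrow> 'a \<Rightarrow> 'b" where
  "weak_deriv U vs f = (SOME g. has_weak_deriv U vs f g)"

definition square_integrable :: "'a::euclidean_space set \<Rightarrow> ('a \<Rightarrow> 'b::euclidean_space) set" where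
  "square_integrable U = {f. f \<in> borel_measurable (lebesgue_on U) \<and>
     integrable (lebesgue_on U) (\<lambda>x. (norm (f x))\<^sup>2)}"

text \<open>
  The space \<open>W\<^bsup>k,2\<^esup>(U)\<close>, as a set of functions rather than of equivalence classes; the values
  of the functions outside \<open>U\<close> are irrelevant.
\<close>

definition sobolev2 :: "nat \<Rightarrow> 'a::euclidean_space set \<Rightarrow> ('a \<Rightarrow> 'b::euclidean_space) set" where
  "sobolev2 k U = {f \<in> square_integrable U.
     \<forall>vs. set vs \<subseteq> Basis \<and> length vs \<le> k \<longrightarrow>
       (\<exists>g\<in>square_integrable U. has_weak_deriv U vs f g)}"

definition weak_jacobian :: "(real^'n) set \<Rightarrow> (real^'n \<Rightarrow> real^'m) \<Rightarrow> real^'n \<Rightarrow> real^'n^'m" where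
  "weak_jacobian U f x = (\<chi> k i. weak_deriv U [axis i 1] f x $ k)"

definition weak_hessian :: "(real^'n) set \<Rightarrow> (real^'n \<Rightarrow> real^'m) \<Rightarrow> real^'n \<Rightarrow> real^'n^'n^'m" where
  "weak_hessian U f x = (\<chi> k i j. weak_deriv U [axis i 1, axis j 1] f x $ k)"

section \<open>The elastic energy of the singular cone\<close>

abbreviation disc :: "real \<Rightarrow> (real^2) set" where
  "disc r \<equiv> ball 0 r"

definition cone_map :: "real \<Rightarrow> real^2 \<Rightarrow> real^3" where
  "cone_map \<Delta> x = sqrt (1 - \<Delta>\<^sup>2) *\<^sub>R vector [x $ 1, x $ 2, 0] + (\<Delta> * norm x) *\<^sub>R axis 3 1"

text \<open>The value at the origin, where the cone is not differentiable, is irrelevant.\<close>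

definition cone_metric :: "real \<Rightarrow> real^2 \<Rightarrow> real^2^2" where
  "cone_metric \<Delta> x =
     transpose (jacobian (cone_map \<Delta>) (at x)) ** jacobian (cone_map \<Delta>) (at x)"

lemma cone_map_has_derivative:
  assumes "x \<noteq> 0"
  shows "(cone_map \<Delta> has_derivative
    (\<lambda>v. sqrt (1 - \<Delta>\<^sup>2) *\<^sub>R vector [v $ 1, v $ 2, 0] + (\<Delta> * (x \<bullet> v / norm x)) *\<^sub>R axis 3 1)) (at x)"
proof -
  have lin: "linear (\<lambda>v::real^2. vector [v $ 1, v $ 2, 0] :: real^3)"
    by (rule linearI) (simp_all add: vec_eq_iff forall_3)
  have 1: "((\<lambda>v::real^2. vector [v $ 1, v $ 2, 0] :: real^3) has_derivative
      (\<lambda>v. vector [v $ 1, v $ 2, 0])) (at x)"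
    using linear_imp_has_derivative[OF lin] .
  have 2: "(norm has_derivative (\<lambda>v. x \<bullet> v / norm x)) (at x)"
    using has_derivative_norm[OF assms]
    by (simp add: sgn_div_norm inner_commute divide_inverse mult.commute)
  show ?thesis
    unfolding cone_map_def
    by (intro has_derivative_add has_derivative_scaleR_right[OF 1]
        has_derivative_scaleR_left has_derivative_mult_right 2)
qed

lemma cone_metric_eq:
  assumes "\<bar>\<Delta>\<bar> \<le> 1" and "x \<noteq> 0"
  defines "n \<equiv> (1 / norm x) *\<^sub>R vector [- (x $ 2), x $ 1] :: real^2"
  shows "cone_metric \<Delta> x = mat 1 - (\<chi> i j. \<Delta>\<^sup>2 * (n $ i * n $ j))"
proof -
  define a b s where "a = x $ 1 / norm x" and "b = x $ 2 / norm x" and "s = sqrt (1 - \<Delta>\<^sup>2)"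
  have s: "s * s = 1 - \<Delta> * \<Delta>"
    using assms(1) abs_square_le_1[of \<Delta>] by (simp add: s_def power2_eq_square)
  have "(norm x)\<^sup>2 = (x $ 1)\<^sup>2 + (x $ 2)\<^sup>2"
    using power2_norm_eq_inner[of x] by (simp add: power2_eq_square inner_vec_def sum_2)
  moreover have "a * a + b * b = ((x $ 1)\<^sup>2 + (x $ 2)\<^sup>2) / (norm x)\<^sup>2"
    by (simp add: a_def b_def power2_eq_square add_divide_distrib)
  moreover have "(norm x)\<^sup>2 \<noteq> 0"
    using assms(2) by simp
  ultimately have ab: "a * a + b * b = 1"
    by (metis divide_self)
  have n: "n $ 1 = - b" "n $ 2 = a"
    by (simp_all add: n_def a_def b_def)
  have d: "frechet_derivative (cone_map \<Delta>) (at x) =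
      (\<lambda>v. s *\<^sub>R vector [v $ 1, v $ 2, 0] + (\<Delta> * (a * v $ 1 + b * v $ 2)) *\<^sub>R axis 3 1)"
    unfolding frechet_derivative_at[OF cone_map_has_derivative[OF assms(2)], symmetric]
    by (simp add: s_def a_def b_def inner_vec_def sum_2 add_divide_distrib)

  have sq: "a * a = 1 - b * b"
    using ab by simp
  have "s * s + \<Delta> * a * (\<Delta> * a) = 1 - \<Delta> * \<Delta> * (b * b)"
    "s * s + \<Delta> * b * (\<Delta> * b) = 1 - \<Delta> * \<Delta> * (a * a)"
    unfolding s by (simp_all add: sq algebra_simps)
  then show ?thesis
    unfolding cone_metric_def jacobian_def d
    by (simp add: vec_eq_iff forall_2 matrix_matrix_mult_def transpose_def matrix_def
        sum_3 mat_def axis_def n power2_eq_square)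
qed

definition induced_metric :: "(real^2 \<Rightarrow> real^3) \<Rightarrow> real^2 \<Rightarrow> real^2^2" where
  "induced_metric y x = transpose (weak_jacobian (disc 1) y x) ** weak_jacobian (disc 1) y x"

text \<open>
  The norm of nested vectors is the Euclidean norm of the family of all entries (the Frobenius
  norm). The integrals are taken as nonnegative extended integrals, so that no integrability has
  to be known in advance; they are finite on \<open>W\<^bsup>2,2\<^esup>\<close> because \<open>W\<^bsup>1,2\<^esup>(disc 1)\<close> embeds
  into \<open>L\<^sup>4\<close>.
\<close>

definition energy :: "real \<Rightarrow> real \<Rightarrow> (real^2 \<Rightarrow> real^3) \<Rightarrow> ennreal" where
  "energy h \<Delta> y =
     (\<integral>\<^sup>+x\<in>disc 1. ennreal ((norm (induced_metric y x - cone_metric \<Delta> x))\<^sup>2 +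
        h\<^sup>2 * (norm (weak_hessian (disc 1) y x))\<^sup>2) \<partial>lebesgue)"

end

theory Submission
  imports Defs "HOL-Complex_Analysis.Great_Picard" "HOL-Computational_Algebra.Polynomial" "HOL-Real_Asymp.Real_Asymp"
begin

text \<open>
  For \<open>y\<close> with induced metric \<open>g\<close>, Wirtinger's inequality for antiperiodic functions on circles gives the sharp
  bound \<open>\<integral> \<zeta>(|x|\<^sup>2) |x|\<^sup>2 |D\<^sup>2y|\<^sup>2 \<ge> \<integral> \<zeta> tr g + 2 \<zeta>' x\<^sup>\<bottom> \<bullet> g x\<^sup>\<bottom>\<close> for nonnegative radial weights, first for smooth \<open>y\<close> and
  then by mollification. With \<open>\<zeta>\<close> a cut-off of \<open>1 / (|x|\<^sup>2 + h\<^sup>2)\<close> the right-hand side is explicit for the cone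
  metric \<open>g\<^sub>\<Delta>\<close> and linear in \<open>g\<close>, so that the deviation \<open>g - g\<^sub>\<Delta>\<close> is absorbed by half of the membrane
  energy. This gives the lower bound on every disc; compared with the energy of the cone smoothed at scale
  \<open>h\<close> it yields the two final estimates. Minimizers exist by Rellich's theorem, Fatou's lemma for the
  membrane term and convexity of the bending term.
\<close>

section \<open>Square integrable functions\<close>

text \<open>Put \<open>s = x \<bullet> x\<close>. For the cone metric the right-hand side of the
  curvature inequality is the integral of
  \<open>2 (1 - \<Delta>^2) (s \<zeta>)' + \<Delta>^2 \<zeta>\<close>. The exact derivative drops
  out because the weight is cut off, and \<open>\<Delta>^2\<close> times the integral of
  \<open>\<zeta>\<close> gives the logarithm with its sharp factor once \<open>\<zeta>\<close> is
  close to \<open>1 / s\<close>; \<open>s \<zeta> \<le> 1\<close> keeps the left-hand side below the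
  bending energy. Shifting the denominator by \<open>h^2\<close> closes the estimate: the deviation
  contributes at most a multiple of \<open>|g - g_\<Delta>| / (s + h^2)\<close>, and in Young's
  inequality the remainder \<open>h^2 / (s + h^2)^2\<close> has an integral over the plane that does
  not depend on \<open>h\<close>. Since the bound holds on every disc of radius
  \<open>R < 1\<close>, subtracting it from the upper bound leaves \<open>log (1 / R)\<close> and a
  constant for the rest. Mollification commutes with weak derivatives only away from the boundary,
  so weights and sets stay inside the open disc until a limit is taken. The membrane term is quartic
  and not convex in the gradient, so a minimizing sequence must have gradients converging almost
  everywhere.\<close>

definition L2 :: "('a::euclidean_space \<Rightarrow> 'b::euclidean_space) set" where
  "L2 = {f \<in> borel_measurable borel. integrable lborel (\<lambda>x. (norm (f x))\<^sup>2)}"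

definition sqn :: "('a::euclidean_space \<Rightarrow> 'b::euclidean_space) \<Rightarrow> real" where
  "sqn f = (\<integral>x. (norm (f x))\<^sup>2 \<partial>lborel)"

lemma L2_borel [measurable_dest]: "f \<in> L2 \<Longrightarrow> f \<in> borel_measurable borel"
  by (simp add: L2_def)

lemma L2_integrable: "f \<in> L2 \<Longrightarrow> integrable lborel (\<lambda>x. (norm (f x))\<^sup>2)"
  by (simp add: L2_def)

lemma sqn_nonneg [simp]: "0 \<le> sqn f"
  by (simp add: sqn_def)

lemma norm_add_sq_le: "(norm (a + b))\<^sup>2 \<le> 2 * (norm a)\<^sup>2 + 2 * (norm (b::'b::real_inner))\<^sup>2"
proof -
  have "(norm (a + b))\<^sup>2 + (norm (a - b))\<^sup>2 = 2 * (norm a)\<^sup>2 + 2 * (norm b)\<^sup>2"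
    by (simp add: power2_norm_eq_inner inner_add inner_diff inner_commute)
  then show ?thesis
    by (smt (verit) zero_le_power2)
qed

lemma norm_diff_sq_le: "(norm (a - b))\<^sup>2 \<le> 2 * (norm a)\<^sup>2 + 2 * (norm (b::'b::real_inner))\<^sup>2"
  using norm_add_sq_le[of a "- b"] by simp

lemma L2I_bound:
  assumes [measurable]: "f \<in> borel_measurable borel" and "integrable lborel g"
    and le: "\<And>x. (norm (f x))\<^sup>2 \<le> g x"
  shows "f \<in> L2"
proof -
  have "integrable lborel (\<lambda>x. (norm (f x))\<^sup>2)"
    by (rule Bochner_Integration.integrable_bound[OF assms(2)])
      (auto simp: intro: order_trans[OF le abs_ge_self])
  then show ?thesis
    by (simp add: L2_def)
qed

lemma L2_add: assumes [measurable]: "f \<in> L2" "g \<in> L2" shows "(\<lambda>x. f x + g x) \<in> L2"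
  by (rule L2I_bound[where g="\<lambda>x. 2 * (norm (f x))\<^sup>2 + 2 * (norm (g x))\<^sup>2"])
    (auto intro!: norm_add_sq_le L2_integrable assms)

lemma L2_mult:
  assumes [measurable]: "f \<in> L2" "w \<in> borel_measurable borel" and w: "\<And>x. \<bar>w x\<bar> \<le> M"
  shows "(\<lambda>x. w x *\<^sub>R f x) \<in> L2"
proof (rule L2I_bound[where g="\<lambda>x. M\<^sup>2 * (norm (f x))\<^sup>2"])
  show "(norm (w x *\<^sub>R f x))\<^sup>2 \<le> M\<^sup>2 * (norm (f x))\<^sup>2" for x
    using power_mono[OF w[of x], of 2] by (simp add: power_mult_distrib mult_right_mono)
qed (auto intro!: L2_integrable assms)

lemma L2_scaleR: "f \<in> L2 \<Longrightarrow> (\<lambda>x. c *\<^sub>R f x) \<in> L2"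
  using L2_mult[of f "\<lambda>_. c" "\<bar>c\<bar>"] by simp

lemma L2_diff: assumes "f \<in> L2" "g \<in> L2" shows "(\<lambda>x. f x - g x) \<in> L2"
  using L2_add[OF assms(1) L2_scaleR[OF assms(2), of "-1"]] by simp

lemma L2_zero: "(\<lambda>x. 0) \<in> L2"
  by (simp add: L2_def)

lemma L2_sum: "finite I \<Longrightarrow> (\<And>i. i \<in> I \<Longrightarrow> f i \<in> L2) \<Longrightarrow> (\<lambda>x. \<Sum>i\<in>I. f i x) \<in> L2"
  by (induction I rule: finite_induct) (auto intro: L2_add L2_zero)

lemma L2_inner_integrable:
  assumes [measurable]: "f \<in> L2" "g \<in> L2" shows "integrable lborel (\<lambda>x. f x \<bullet> g x)"
proof (rule Bochner_Integration.integrable_bound[where f="\<lambda>x. (norm (f x))\<^sup>2 + (norm (g x))\<^sup>2"])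
  show "AE x in lborel. norm (f x \<bullet> g x) \<le> norm ((norm (f x))\<^sup>2 + (norm (g x))\<^sup>2)"
  proof (rule AE_I2)
    fix x
    have "\<bar>f x \<bullet> g x\<bar> \<le> norm (f x) * norm (g x)" by (rule Cauchy_Schwarz_ineq2)
    also have "\<dots> \<le> (norm (f x))\<^sup>2 + (norm (g x))\<^sup>2"
      using sum_squares_bound[of "norm (f x)" "norm (g x)"]
        mult_nonneg_nonneg[OF norm_ge_zero[of "f x"] norm_ge_zero[of "g x"]] by linarith
    finally show "norm (f x \<bullet> g x) \<le> norm ((norm (f x))\<^sup>2 + (norm (g x))\<^sup>2)" by simp
  qed
qed (auto intro!: L2_integrable assms)

lemma L2_norm: "f \<in> L2 \<Longrightarrow> (\<lambda>x. norm (f x)) \<in> L2"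
  by (auto simp: L2_def)

lemma L2_scaleR_integrable:
  assumes [measurable]: "(f :: _ \<Rightarrow> real) \<in> L2" "g \<in> L2" shows "integrable lborel (\<lambda>x. f x *\<^sub>R g x)"
  by (rule Bochner_Integration.integrable_bound[OF L2_inner_integrable[OF L2_norm[OF assms(1)] L2_norm[OF assms(2)]]])
    auto

lemma sqn_add_le: assumes [measurable]: "f \<in> L2" "g \<in> L2"
  shows "sqn (\<lambda>x. f x + g x) \<le> 2 * sqn f + 2 * sqn g"
proof -
  have "sqn (\<lambda>x. f x + g x) \<le> (\<integral>x. 2 * (norm (f x))\<^sup>2 + 2 * (norm (g x))\<^sup>2 \<partial>lborel)"
    unfolding sqn_def
    by (intro integral_mono norm_add_sq_le Bochner_Integration.integrable_add integrable_mult_right L2_integrable assms L2_add)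
  then show ?thesis
    by (simp add: sqn_def L2_integrable assms)
qed

lemma sqn_scaleR: "sqn (\<lambda>x. c *\<^sub>R f x) = c\<^sup>2 * sqn f"
  by (simp add: sqn_def power_mult_distrib)

lemma sqn_diff_le: assumes "f \<in> L2" "g \<in> L2"
  shows "sqn (\<lambda>x. f x - g x) \<le> 2 * sqn f + 2 * sqn g"
  using sqn_add_le[OF assms(1) L2_scaleR[OF assms(2), of "-1"]] sqn_scaleR[of "-1" g] by simp

lemma L2_nn_integral:
  assumes "f \<in> L2" shows "(\<integral>\<^sup>+x. ennreal ((norm (f x))\<^sup>2) \<partial>lborel) = ennreal (sqn f)"
  unfolding sqn_def using nn_integral_eq_integral[OF L2_integrable[OF assms]] by simp

lemma L2I_nn_integral:
  assumes [measurable]: "f \<in> borel_measurable borel"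
    and "(\<integral>\<^sup>+x. ennreal ((norm (f x))\<^sup>2) \<partial>lborel) < \<infinity>"
  shows "f \<in> L2"
  using assms by (auto simp: L2_def integrable_iff_bounded)

text \<open>The square of \<open>a * g - b * f\<close> has a nonnegative integral. With
  \<open>a = sqn f\<close> and \<open>b\<close> the integral of the product this is the discriminant
  argument without a division; only the degenerate case \<open>sqn f = 0\<close> has to be treated
  apart.\<close>

lemma L2_Cauchy_Schwarz_real:
  fixes f g :: "'a::euclidean_space \<Rightarrow> real"
  assumes [measurable]: "f \<in> L2" "g \<in> L2"
  shows "(\<integral>x. f x * g x \<partial>lborel)\<^sup>2 \<le> sqn f * sqn g"
proof -
  define C where "C = (\<integral>x. f x * g x \<partial>lborel)"
  have int: "integrable lborel (\<lambda>x. f x * g x)"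
    using L2_inner_integrable[OF assms] by simp
  have int': "integrable lborel (\<lambda>x. (f x)\<^sup>2)" "integrable lborel (\<lambda>x. (g x)\<^sup>2)"
    using L2_integrable[OF assms(1)] L2_integrable[OF assms(2)] by simp_all
  have "0 \<le> (\<integral>x. (a * g x - b * f x)\<^sup>2 \<partial>lborel)" for a b
    by simp
  also have "\<And>a b. (\<integral>x. (a * g x - b * f x)\<^sup>2 \<partial>lborel) =
      (\<integral>x. a\<^sup>2 * (g x)\<^sup>2 - 2 * a * b * (f x * g x) + b\<^sup>2 * (f x)\<^sup>2 \<partial>lborel)"
    by (intro Bochner_Integration.integral_cong) (auto simp: power2_eq_square algebra_simps)
  also have "\<And>a b. \<dots> a b = a\<^sup>2 * sqn g - 2 * a * b * C + b\<^sup>2 * sqn f"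
    using int int' by (simp add: sqn_def C_def)
  finally have *: "0 \<le> a\<^sup>2 * sqn g - 2 * a * b * C + b\<^sup>2 * sqn f" for a b .
  show ?thesis
  proof (cases "sqn f = 0")
    case True
    then have "AE x in lborel. (f x)\<^sup>2 = 0"
      using int' integral_nonneg_eq_0_iff_AE[of lborel "\<lambda>x. (f x)\<^sup>2"] by (simp add: sqn_def)
    then have "AE x in lborel. f x * g x = 0" by eventually_elim auto
    then have "C = 0" unfolding C_def by (rule integral_eq_zero_AE)
    then show ?thesis using True by (simp add: C_def)
  next
    case False
    then have "sqn f > 0" using sqn_nonneg[of f] by linarith
    have "0 \<le> sqn f * (sqn f * sqn g - C\<^sup>2)"
      using *[of "sqn f" C] by (simp add: power2_eq_square algebra_simps)
    then show ?thesis
      using \<open>sqn f > 0\<close> by (simp add: zero_le_mult_iff C_def)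
  qed
qed

lemma L2_Cauchy_Schwarz:
  assumes "f \<in> L2" "g \<in> L2"
  shows "(\<integral>x. norm (f x) * norm (g x) \<partial>lborel) \<le> sqrt (sqn f) * sqrt (sqn g)"
proof -
  have "(\<integral>x. norm (f x) * norm (g x) \<partial>lborel)\<^sup>2 \<le> sqn f * sqn g"
    using L2_Cauchy_Schwarz_real[OF L2_norm[OF assms(1)] L2_norm[OF assms(2)]]
    unfolding sqn_def real_norm_def abs_norm_cancel .
  then show ?thesis
    unfolding real_sqrt_mult[symmetric] by (rule real_le_rsqrt)
qed

text \<open>The difference of the squares factors as \<open>(f - g) \<bullet> (f + g)\<close>, so
  Cauchy-Schwarz and mean-square convergence suffice. The weight may have either sign, which matters
  because the derivative of the cut-off weight is negative.\<close>

lemma L2_tendsto_weighted: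
  assumes f: "\<And>n. f n \<in> L2" "g \<in> L2" and lim: "(\<lambda>n. sqn (\<lambda>x. f n x - g x)) \<longlonglongrightarrow> 0"
    and w [measurable]: "w \<in> borel_measurable borel" and wM: "\<And>x. \<bar>w x\<bar> \<le> M"
  shows "(\<lambda>n. \<integral>x. w x * (norm (f n x))\<^sup>2 \<partial>lborel) \<longlonglongrightarrow> (\<integral>x. w x * (norm (g x))\<^sup>2 \<partial>lborel)"
proof -
  have M: "0 \<le> M" using wM[of undefined] by linarith
  have [measurable]: "f n \<in> borel_measurable borel" "g \<in> borel_measurable borel" for n
    using f by auto
  have int: "integrable lborel (\<lambda>x. w x * (norm (h x))\<^sup>2)" if "h \<in> L2" for h :: "'a \<Rightarrow> 'b"
  proof (rule Bochner_Integration.integrable_bound[OF integrable_mult_right[OF L2_integrable[OF that], of M]])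
    show "AE x in lborel. norm (w x * (norm (h x))\<^sup>2) \<le> norm (M * (norm (h x))\<^sup>2)"
      using wM by (auto simp: abs_mult M intro!: mult_right_mono)
  qed (use that in measurable)
  define e where "e n = sqn (\<lambda>x. f n x - g x)" for n
  have bound: "norm ((\<integral>x. w x * (norm (f n x))\<^sup>2 \<partial>lborel) - (\<integral>x. w x * (norm (g x))\<^sup>2 \<partial>lborel))
      \<le> M * (sqrt (e n) * sqrt (2 * e n + 8 * sqn g))" for n
  proof -
    let ?d = "\<lambda>x. f n x - g x" and ?s = "\<lambda>x. f n x + g x"
    have "sqn ?s = sqn (\<lambda>x. ?d x + 2 *\<^sub>R g x)"
      by (simp add: scaleR_2 algebra_simps)
    also have "\<dots> \<le> 2 * e n + 8 * sqn g"
      using sqn_add_le[OF L2_diff[OF f(1)[of n] f(2)] L2_scaleR[OF f(2), of 2]]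
      by (simp add: sqn_scaleR e_def)
    finally have s: "sqn ?s \<le> 2 * e n + 8 * sqn g" .
    have int2: "integrable lborel (\<lambda>x. norm (?d x) * norm (?s x))"
      using L2_inner_integrable[OF L2_norm[OF L2_diff[OF f(1)[of n] f(2)]] L2_norm[OF L2_add[OF f(1)[of n] f(2)]]]
      by simp
    have pw: "norm (w x * (norm (f n x))\<^sup>2 - w x * (norm (g x))\<^sup>2) \<le> M * (norm (?d x) * norm (?s x))" for x
    proof -
      have "(norm (f n x))\<^sup>2 - (norm (g x))\<^sup>2 = ?d x \<bullet> ?s x"
        by (simp add: power2_norm_eq_inner inner_add inner_diff inner_commute)
      then have "norm (w x * (norm (f n x))\<^sup>2 - w x * (norm (g x))\<^sup>2) = \<bar>w x\<bar> * \<bar>?d x \<bullet> ?s x\<bar>"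
        by (metis abs_mult real_norm_def right_diff_distrib)
      also have "\<dots> \<le> M * (norm (?d x) * norm (?s x))"
        by (intro mult_mono wM Cauchy_Schwarz_ineq2 M) auto
      finally show ?thesis .
    qed
    have "norm ((\<integral>x. w x * (norm (f n x))\<^sup>2 \<partial>lborel) - (\<integral>x. w x * (norm (g x))\<^sup>2 \<partial>lborel))
      = norm (\<integral>x. w x * (norm (f n x))\<^sup>2 - w x * (norm (g x))\<^sup>2 \<partial>lborel)"
      using int f by simp
    also have "\<dots> \<le> (\<integral>x. M * (norm (?d x) * norm (?s x)) \<partial>lborel)"
      by (rule Bochner_Integration.integral_norm_bound_integral)
        (use int f int2 pw in auto)
    also have "\<dots> = M * (\<integral>x. norm (?d x) * norm (?s x) \<partial>lborel)"
      by simp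
    also have "\<dots> \<le> M * (sqrt (sqn ?d) * sqrt (sqn ?s))"
      by (intro mult_left_mono M L2_Cauchy_Schwarz L2_diff L2_add f)
    also have "\<dots> \<le> M * (sqrt (e n) * sqrt (2 * e n + 8 * sqn g))"
      using s unfolding e_def by (intro mult_left_mono M real_sqrt_le_mono) auto
    finally show ?thesis .
  qed
  have "e \<longlonglongrightarrow> 0" using lim by (simp add: e_def[abs_def])
  then have "(\<lambda>n. M * (sqrt (e n) * sqrt (2 * e n + 8 * sqn g))) \<longlonglongrightarrow> M * (sqrt 0 * sqrt (2 * 0 + 8 * sqn g))"
    by (intro tendsto_intros)
  then have "(\<lambda>n. M * (sqrt (e n) * sqrt (2 * e n + 8 * sqn g))) \<longlonglongrightarrow> 0" by simp
  then show ?thesis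
    by (rule LIM_zero_cancel[OF Lim_null_comparison[OF always_eventually[OF allI[OF bound]]]])
qed

lemma L2_tendsto_integral:
  fixes \<phi> :: "'a::euclidean_space \<Rightarrow> real"
  assumes f: "\<And>n. f n \<in> L2" "g \<in> L2" and lim: "(\<lambda>n. sqn (\<lambda>x. f n x - g x)) \<longlonglongrightarrow> 0"
    and \<phi>: "\<phi> \<in> L2"
  shows "(\<lambda>n. \<integral>x. \<phi> x *\<^sub>R f n x \<partial>lborel) \<longlonglongrightarrow> (\<integral>x. \<phi> x *\<^sub>R g x \<partial>lborel)"
proof (rule LIM_zero_cancel, rule Lim_null_comparison[OF always_eventually])
  show "\<forall>n. norm ((\<integral>x. \<phi> x *\<^sub>R f n x \<partial>lborel) - (\<integral>x. \<phi> x *\<^sub>R g x \<partial>lborel))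
      \<le> sqrt (sqn \<phi>) * sqrt (sqn (\<lambda>x. f n x - g x))"
  proof
    fix n
    have "norm ((\<integral>x. \<phi> x *\<^sub>R f n x \<partial>lborel) - (\<integral>x. \<phi> x *\<^sub>R g x \<partial>lborel))
      = norm (\<integral>x. \<phi> x *\<^sub>R (f n x - g x) \<partial>lborel)"
      using L2_scaleR_integrable[OF \<phi> f(1)[of n]] L2_scaleR_integrable[OF \<phi> f(2)]
      by (simp add: scaleR_diff_right)
    also have "\<dots> \<le> (\<integral>x. norm (\<phi> x *\<^sub>R (f n x - g x)) \<partial>lborel)"
      by (rule integral_norm_bound)
    also have "\<dots> = (\<integral>x. norm (\<phi> x) * norm (f n x - g x) \<partial>lborel)"
      by simp
    also have "\<dots> \<le> sqrt (sqn \<phi>) * sqrt (sqn (\<lambda>x. f n x - g x))"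
      by (intro L2_Cauchy_Schwarz \<phi> L2_diff f)
    finally show "norm ((\<integral>x. \<phi> x *\<^sub>R f n x \<partial>lborel) - (\<integral>x. \<phi> x *\<^sub>R g x \<partial>lborel))
      \<le> sqrt (sqn \<phi>) * sqrt (sqn (\<lambda>x. f n x - g x))" .
  qed
  have "(\<lambda>n. sqrt (sqn \<phi>) * sqrt (sqn (\<lambda>x. f n x - g x))) \<longlonglongrightarrow> sqrt (sqn \<phi>) * sqrt 0"
    by (intro tendsto_intros lim)
  then show "(\<lambda>n. sqrt (sqn \<phi>) * sqrt (sqn (\<lambda>x. f n x - g x))) \<longlonglongrightarrow> 0" by simp
qed

section \<open>Completeness of the square integrable functions\<close>

lemma Cauchy_if_weighted_square_summable:
  fixes X :: "nat \<Rightarrow> 'b::euclidean_space"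
  assumes "summable (\<lambda>k. 2 ^ k * (norm (X (Suc k) - X k))\<^sup>2)"
  shows "convergent X"
proof -
  have "(\<lambda>k. 2 ^ k * (norm (X (Suc k) - X k))\<^sup>2) \<longlonglongrightarrow> 0"
    using assms by (rule summable_LIMSEQ_zero)
  from convergent_imp_Bseq[OF convergentI[OF this]]
  obtain K where K: "\<And>k. norm (2 ^ k * (norm (X (Suc k) - X k))\<^sup>2) \<le> K"
    by (elim BseqE) auto
  have le: "norm (X (Suc k) - X k) \<le> sqrt K * sqrt (1/2) ^ k" for k
  proof -
    have "(norm (X (Suc k) - X k))\<^sup>2 \<le> K / 2 ^ k"
      using K[of k] by (simp add: field_simps)
    then have "norm (X (Suc k) - X k) \<le> sqrt (K / 2 ^ k)"
      by (rule real_le_rsqrt)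
    then show ?thesis
      by (simp add: real_sqrt_divide real_sqrt_power power_divide)
  qed
  have "summable (\<lambda>k. sqrt K * sqrt (1/2) ^ k)"
    by (intro summable_mult summable_geometric) simp
  then have "summable (\<lambda>k. X (Suc k) - X k)"
    by (rule summable_comparison_test'[of _ 0]) (use le in auto)
  then have "convergent (\<lambda>n. \<Sum>k<n. X (Suc k) - X k)"
    by (simp add: summable_iff_convergent)
  then have "convergent (\<lambda>n. X n - X 0)"
    by (simp add: sum_lessThan_telescope)
  then have "convergent (\<lambda>n. (X n - X 0) + X 0)"
    by (intro convergent_add convergent_const)
  then show ?thesis by simp
qed

text \<open>The Riesz-Fischer theorem for genuine functions instead of classes. The pointwise limit
  is the total function \<open>lim\<close>, hence Borel on the whole space, and the last conclusion
  lets limits inherit the value 0 outside the disc without a change of representative.\<close>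

lemma L2_complete:
  fixes f :: "nat \<Rightarrow> 'a::euclidean_space \<Rightarrow> 'b::euclidean_space"
  assumes f: "\<And>n. f n \<in> L2"
    and cauchy: "\<And>e. e > 0 \<Longrightarrow> \<exists>N. \<forall>m\<ge>N. \<forall>n\<ge>N. sqn (\<lambda>x. f m x - f n x) \<le> e"
  obtains g r where "g \<in> L2" "strict_mono r" "AE x in lborel. (\<lambda>n. f (r n) x) \<longlonglongrightarrow> g x"
    "(\<lambda>n. sqn (\<lambda>x. f n x - g x)) \<longlonglongrightarrow> 0" "\<And>x. (\<forall>n. f n x = 0) \<Longrightarrow> g x = 0"
proof -
  have [measurable]: "f n \<in> borel_measurable borel" for n using f by auto
  obtain N where N: "\<And>e m n. e > 0 \<Longrightarrow> m \<ge> N e \<Longrightarrow> n \<ge> N e \<Longrightarrow> sqn (\<lambda>x. f m x - f n x) \<le> e"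
    using cauchy by metis
  \<comment> \<open>The increments along \<open>r\<close> have squared norm at most
    \<open>(1/4) ^ k\<close>. Multiplied by \<open>2 ^ k\<close> they are still summable, and this
    extra factor is what makes the pointwise increments decay geometrically almost
    everywhere.\<close>
  define r where "r = rec_nat (N 1) (\<lambda>k m. max (Suc m) (N ((1/4) ^ Suc k)))"
  have r_Suc: "r (Suc k) = max (Suc (r k)) (N ((1/4) ^ Suc k))" for k
    by (simp add: r_def)
  have r: "strict_mono r"
    by (rule strict_monoI_Suc) (simp add: r_Suc)
  have rN: "N ((1/4) ^ k) \<le> r k" for k
    by (cases k) (auto simp: r_Suc, simp add: r_def)
  define d where "d k x = 2 ^ k * (norm (f (r (Suc k)) x - f (r k) x))\<^sup>2" for k x
  have [measurable]: "d k \<in> borel_measurable borel" for k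
    unfolding d_def by measurable
  have d0: "0 \<le> d k x" for k x by (simp add: d_def)
  have nd: "(\<integral>\<^sup>+x. ennreal (d k x) \<partial>lborel) \<le> ennreal ((1/2) ^ k)" for k
  proof -
    have "(\<integral>\<^sup>+x. ennreal (d k x) \<partial>lborel) =
        ennreal (2 ^ k) * (\<integral>\<^sup>+x. ennreal ((norm (f (r (Suc k)) x - f (r k) x))\<^sup>2) \<partial>lborel)"
      unfolding d_def by (subst ennreal_mult') (auto intro!: nn_integral_cmult)
    also have "\<dots> = ennreal (2 ^ k) * ennreal (sqn (\<lambda>x. f (r (Suc k)) x - f (r k) x))"
      by (subst L2_nn_integral[OF L2_diff[OF f f]]) simp
    also have "\<dots> \<le> ennreal (2 ^ k) * ennreal ((1/4) ^ k)"
    proof (intro mult_left_mono ennreal_leI N)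
      show "N ((1/4) ^ k) \<le> r (Suc k)"
        using rN[of k] strict_mono_less_eq[OF r, of k "Suc k"] by simp
    qed (auto intro: rN)
    also have "\<dots> = ennreal ((1/2) ^ k)"
      by (subst ennreal_mult'[symmetric]) (auto simp: power_divide field_simps simp flip: power_mult_distrib)
    finally show ?thesis .
  qed
  have "(\<integral>\<^sup>+x. (\<Sum>k. ennreal (d k x)) \<partial>lborel) = (\<Sum>k. \<integral>\<^sup>+x. ennreal (d k x) \<partial>lborel)"
    by (rule nn_integral_suminf) measurable
  also have "\<dots> \<le> (\<Sum>k. ennreal ((1/2) ^ k))"
    by (intro suminf_le nd) auto
  also have "\<dots> < \<infinity>"
    by (subst suminf_ennreal2) (auto simp: summable_geometric)
  finally have "AE x in lborel. (\<Sum>k. ennreal (d k x)) \<noteq> \<infinity>"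
    by (intro nn_integral_PInf_AE) auto
  then have conv: "AE x in lborel. convergent (\<lambda>k. f (r k) x)"
  proof eventually_elim
    case (elim x)
    then have "summable (\<lambda>k. d k x)"
      using summable_suminf_not_top[of "\<lambda>k. d k x"] d0 by (simp add: infinity_ennreal_def)
    then show ?case
      unfolding d_def by (rule Cauchy_if_weighted_square_summable)
  qed
  define g where "g x = lim (\<lambda>k. f (r k) x)" for x
  have g_meas [measurable]: "g \<in> borel_measurable borel"
    unfolding g_def by measurable
  have lim: "AE x in lborel. (\<lambda>k. f (r k) x) \<longlonglongrightarrow> g x"
    using conv by eventually_elim (simp add: g_def convergent_LIMSEQ_iff)
  \<comment> \<open>Fatou's lemma is applied in the second index only; thus the Cauchy estimate
    yields convergence of the full sequence although the pointwise limit exists along a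
    subsequence.\<close>
  have le: "(\<integral>\<^sup>+x. ennreal ((norm (f m x - g x))\<^sup>2) \<partial>lborel) \<le> ennreal e" if "e > 0" "m \<ge> N e" for m e
  proof -
    have "(\<integral>\<^sup>+x. ennreal ((norm (f m x - g x))\<^sup>2) \<partial>lborel)
       = (\<integral>\<^sup>+x. liminf (\<lambda>k. ennreal ((norm (f m x - f (r k) x))\<^sup>2)) \<partial>lborel)"
    proof (rule nn_integral_cong_AE)
      show "AE x in lborel. ennreal ((norm (f m x - g x))\<^sup>2) = liminf (\<lambda>k. ennreal ((norm (f m x - f (r k) x))\<^sup>2))"
        using lim
      proof eventually_elim
        case (elim x)
        have "(\<lambda>k. ennreal ((norm (f m x - f (r k) x))\<^sup>2)) \<longlonglongrightarrow> ennreal ((norm (f m x - g x))\<^sup>2)"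
          by (intro tendsto_intros elim)
        then show ?case by (metis lim_imp_Liminf sequentially_bot)
      qed
    qed
    also have "\<dots> \<le> liminf (\<lambda>k. \<integral>\<^sup>+x. ennreal ((norm (f m x - f (r k) x))\<^sup>2) \<partial>lborel)"
      by (rule nn_integral_liminf) measurable
    also have "\<dots> \<le> ennreal e"
    proof (rule Liminf_le)
      have "eventually (\<lambda>k. N e \<le> r k) sequentially"
        using filterlim_at_top[THEN iffD1, OF filterlim_subseq[OF r]] by blast
      then show "eventually (\<lambda>k. (\<integral>\<^sup>+x. ennreal ((norm (f m x - f (r k) x))\<^sup>2) \<partial>lborel) \<le> ennreal e) sequentially"
      proof eventually_elim
        case (elim k)
        show ?case
          by (subst L2_nn_integral[OF L2_diff[OF f f]]) (intro ennreal_leI N that elim)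
      qed
    qed simp
    finally show ?thesis .
  qed
  have "(\<lambda>x. f (N 1) x - g x) \<in> L2"
    by (rule L2I_nn_integral) (use le[of 1 "N 1"] in \<open>auto simp: less_top[symmetric] top_unique\<close>)
  then have g: "g \<in> L2"
    using L2_diff[OF f[of "N 1"], of "\<lambda>x. f (N 1) x - g x"] by simp
  have "(\<lambda>n. sqn (\<lambda>x. f n x - g x)) \<longlonglongrightarrow> 0"
  proof (rule LIMSEQ_I)
    fix e :: real assume "e > 0"
    have "norm (sqn (\<lambda>x. f n x - g x) - 0) < e" if "n \<ge> N (e/2)" for n
      using le[of "e/2" n] that \<open>e > 0\<close> L2_nn_integral[OF L2_diff[OF f g], of n] by simp
    then show "\<exists>no. \<forall>n\<ge>no. norm (sqn (\<lambda>x. f n x - g x) - 0) < e" by blast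
  qed
  moreover have "g x = 0" if "\<forall>n. f n x = 0" for x
    using that by (simp add: g_def)
  ultimately show ?thesis
    using that[OF g r lim] by blast
qed

section \<open>Continuity of translations in the mean square\<close>

text \<open>Formulated with null sequences of shifts because dominated convergence is used along
  sequences; a modulus of continuity in terms of \<open>norm z\<close> is recovered by contradiction
  in \<open>transl_cont_eps\<close>.\<close>

definition transl_cont :: "('a::euclidean_space \<Rightarrow> 'b::euclidean_space) \<Rightarrow> bool" where
  "transl_cont f \<longleftrightarrow> (\<forall>z. z \<longlonglongrightarrow> 0 \<longrightarrow> (\<lambda>n. sqn (\<lambda>x. f (x - z n) - f x)) \<longlonglongrightarrow> 0)"

lemma lborel_integral_translate:
  fixes f :: "'a::euclidean_space \<Rightarrow> 'b::{banach, second_countable_topology}"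
  assumes [measurable]: "f \<in> borel_measurable borel"
  shows "(\<integral>x. f (x - z) \<partial>lborel) = (\<integral>x. f x \<partial>lborel)"
proof -
  have "(\<integral>x. f x \<partial>lborel) = (\<integral>x. f x \<partial>distr lborel borel ((+) (- z)))"
    by (simp add: lborel_distr_plus)
  also have "\<dots> = (\<integral>x. f (x - z) \<partial>lborel)"
    by (subst integral_distr) (auto simp: algebra_simps)
  finally show ?thesis by simp
qed

lemma lborel_integrable_translate:
  fixes f :: "'a::euclidean_space \<Rightarrow> 'b::{banach, second_countable_topology}"
  assumes "integrable lborel f"
  shows "integrable lborel (\<lambda>x. f (x - z))"
proof -
  have "integrable (distr lborel borel ((+) (- z))) f"
    using assms by (simp add: lborel_distr_plus)
  then show ?thesis
    by (subst (asm) integrable_distr_eq) (use assms in \<open>auto simp: algebra_simps\<close>)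
qed

lemma L2_translate: "f \<in> L2 \<Longrightarrow> (\<lambda>x. f (x - z)) \<in> L2"
  unfolding L2_def using lborel_integrable_translate[of "\<lambda>x. (norm (f x))\<^sup>2" z] by auto

lemma sqn_translate: "f \<in> L2 \<Longrightarrow> sqn (\<lambda>x. f (x - z)) = sqn f"
  unfolding sqn_def by (rule lborel_integral_translate[of "\<lambda>x. (norm (f x))\<^sup>2"]) (auto dest!: L2_borel)

lemma transl_cont_add:
  assumes "f \<in> L2" "g \<in> L2" "transl_cont f" "transl_cont g"
  shows "transl_cont (\<lambda>x. f x + g x)"
  unfolding transl_cont_def
proof safe
  fix z :: "nat \<Rightarrow> 'a" assume z: "z \<longlonglongrightarrow> 0"
  show "(\<lambda>n. sqn (\<lambda>x. f (x - z n) + g (x - z n) - (f x + g x))) \<longlonglongrightarrow> 0"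
  proof (rule Lim_null_comparison[OF always_eventually], rule allI)
    fix n
    have "sqn (\<lambda>x. (f (x - z n) - f x) + (g (x - z n) - g x))
        \<le> 2 * sqn (\<lambda>x. f (x - z n) - f x) + 2 * sqn (\<lambda>x. g (x - z n) - g x)"
      by (intro sqn_add_le L2_diff L2_translate assms)
    then show "norm (sqn (\<lambda>x. f (x - z n) + g (x - z n) - (f x + g x)))
        \<le> 2 * sqn (\<lambda>x. f (x - z n) - f x) + 2 * sqn (\<lambda>x. g (x - z n) - g x)"
      by (simp add: algebra_simps)
  next
    have "(\<lambda>n. 2 * sqn (\<lambda>x. f (x - z n) - f x) + 2 * sqn (\<lambda>x. g (x - z n) - g x)) \<longlonglongrightarrow> 2 * 0 + 2 * 0"
      using assms z by (intro tendsto_intros) (auto simp: transl_cont_def)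
    then show "(\<lambda>n. 2 * sqn (\<lambda>x. f (x - z n) - f x) + 2 * sqn (\<lambda>x. g (x - z n) - g x)) \<longlonglongrightarrow> 0"
      by simp
  qed
qed

lemma transl_cont_sum:
  assumes "finite I" "\<And>i. i \<in> I \<Longrightarrow> f i \<in> L2" "\<And>i. i \<in> I \<Longrightarrow> transl_cont (f i)"
  shows "transl_cont (\<lambda>x. \<Sum>i\<in>I. f i x)"
  using assms
proof (induction I rule: finite_induct)
  case empty
  then show ?case by (simp add: transl_cont_def sqn_def)
next
  case (insert i I)
  then show ?case
    using transl_cont_add[of "f i" "\<lambda>x. \<Sum>i\<in>I. f i x"] L2_sum[of I f] by simp
qed

text \<open>Translation is an isometry, so the error \<open>f - g\<close> enters twice with the same
  norm. This gives the factor 8, and \<open>e / 12\<close> is chosen to make 8 + 2 twelfths of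
  \<open>e\<close> smaller than \<open>e\<close>.\<close>

lemma transl_cont_limit:
  assumes f: "f \<in> L2"
    and approx: "\<And>e. e > 0 \<Longrightarrow> \<exists>g\<in>L2. transl_cont g \<and> sqn (\<lambda>x. f x - g x) \<le> e"
  shows "transl_cont f"
  unfolding transl_cont_def
proof safe
  fix z :: "nat \<Rightarrow> 'a" assume z: "z \<longlonglongrightarrow> 0"
  show "(\<lambda>n. sqn (\<lambda>x. f (x - z n) - f x)) \<longlonglongrightarrow> 0"
  proof (rule LIMSEQ_I)
    fix e :: real assume "e > 0"
    obtain g where g: "g \<in> L2" "transl_cont g" and le: "sqn (\<lambda>x. f x - g x) \<le> e / 12"
      using approx[of "e/12"] \<open>e > 0\<close> by auto
    have "(\<lambda>n. sqn (\<lambda>x. g (x - z n) - g x)) \<longlonglongrightarrow> 0"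
      using g z by (simp add: transl_cont_def)
    then obtain N where N: "\<And>n. n \<ge> N \<Longrightarrow> norm (sqn (\<lambda>x. g (x - z n) - g x) - 0) < e/12"
      using \<open>e > 0\<close> by (meson LIMSEQ_D divide_pos_pos zero_less_numeral)
    have "norm (sqn (\<lambda>x. f (x - z n) - f x) - 0) < e" if "n \<ge> N" for n
    proof -
      let ?d = "\<lambda>x. f x - g x"
      have d: "?d \<in> L2" by (intro L2_diff f g)
      have "sqn (\<lambda>x. f (x - z n) - f x) = sqn (\<lambda>x. (?d (x - z n) - ?d x) + (g (x - z n) - g x))"
        by (simp add: algebra_simps)
      also have "\<dots> \<le> 2 * sqn (\<lambda>x. ?d (x - z n) - ?d x) + 2 * sqn (\<lambda>x. g (x - z n) - g x)"
        by (intro sqn_add_le L2_diff d g L2_translate[OF d] L2_translate[OF g(1)])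
      also have "sqn (\<lambda>x. ?d (x - z n) - ?d x) \<le> 2 * sqn (\<lambda>x. ?d (x - z n)) + 2 * sqn ?d"
        by (rule sqn_diff_le[OF L2_translate[OF d] d])
      also have "sqn (\<lambda>x. ?d (x - z n)) = sqn ?d"
        by (rule sqn_translate[OF d])
      finally have "sqn (\<lambda>x. f (x - z n) - f x) \<le> 8 * sqn ?d + 2 * sqn (\<lambda>x. g (x - z n) - g x)"
        by simp
      then show ?thesis
        using N[OF that] le \<open>e > 0\<close> unfolding real_norm_def diff_zero abs_of_nonneg[OF sqn_nonneg]
        by linarith
    qed
    then show "\<exists>no. \<forall>n\<ge>no. norm (sqn (\<lambda>x. f (x - z n) - f x) - 0) < e" by blast
  qed
qed

lemma L2_indicator_const:
  assumes "A \<in> sets borel" "emeasure lborel A < \<infinity>"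
  shows "(\<lambda>x. indicator A x *\<^sub>R c) \<in> L2" "sqn (\<lambda>x. indicator A x *\<^sub>R c) = measure lborel A * (norm c)\<^sup>2"
proof -
  have eq: "(\<lambda>x. (norm (indicator A x *\<^sub>R c))\<^sup>2) = (\<lambda>x. indicator A x * (norm c)\<^sup>2)"
    by (auto simp: indicator_def)
  have int: "integrable lborel (\<lambda>x. indicator A x * (norm c)\<^sup>2 :: real)"
    using assms by (intro integrable_mult_left integrable_real_indicator) auto
  show "(\<lambda>x. indicator A x *\<^sub>R c) \<in> L2"
    using assms int eq by (simp add: L2_def)
  show "sqn (\<lambda>x. indicator A x *\<^sub>R c) = measure lborel A * (norm c)\<^sup>2"
    unfolding sqn_def eq using assms by simp
qed

text \<open>Openness replaces any regularity of the boundary: a point of \<open>U\<close> stays in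
  \<open>U\<close> after all sufficiently small shifts. Hence the overlap of \<open>U\<close> with
  its translates tends to the full measure, and expanding the square expresses the error by this
  overlap alone.\<close>

lemma transl_cont_open:
  fixes U :: "'a::euclidean_space set"
  assumes U: "open U" "emeasure lborel U < \<infinity>"
  shows "transl_cont (\<lambda>x. indicator U x *\<^sub>R c)"
  unfolding transl_cont_def
proof safe
  fix z :: "nat \<Rightarrow> 'a" assume z: "z \<longlonglongrightarrow> 0"
  have [measurable]: "U \<in> sets borel" using U by simp
  let ?i = "indicator U :: 'a \<Rightarrow> real"
  have int: "integrable lborel ?i" "integrable lborel (\<lambda>x. ?i (x - z n))" for n
    using U by (auto intro!: lborel_integrable_translate integrable_real_indicator)
  have int2: "integrable lborel (\<lambda>x. ?i (x - z n) * ?i x)" for n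
    by (rule Bochner_Integration.integrable_bound[OF int(1)]) (auto simp: indicator_def)
  have eq: "sqn (\<lambda>x. indicator U (x - z n) *\<^sub>R c - indicator U x *\<^sub>R c) =
      (2 * (\<integral>x. ?i x \<partial>lborel) - 2 * (\<integral>x. ?i (x - z n) * ?i x \<partial>lborel)) * (norm c)\<^sup>2" for n
  proof -
    have "(norm (?i (x - z n) *\<^sub>R c - ?i x *\<^sub>R c))\<^sup>2 =
       (?i (x - z n) + ?i x - 2 * (?i (x - z n) * ?i x)) * (norm c)\<^sup>2" for x
      by (auto simp: indicator_def)
    then have "sqn (\<lambda>x. indicator U (x - z n) *\<^sub>R c - indicator U x *\<^sub>R c) =
      (\<integral>x. (?i (x - z n) + ?i x - 2 * (?i (x - z n) * ?i x)) * (norm c)\<^sup>2 \<partial>lborel)"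
      unfolding sqn_def by simp
    also have "\<dots> = ((\<integral>x. ?i (x - z n) \<partial>lborel) + (\<integral>x. ?i x \<partial>lborel) - 2 * (\<integral>x. ?i (x - z n) * ?i x \<partial>lborel)) * (norm c)\<^sup>2"
      using int int2 by simp
    also have "(\<integral>x. ?i (x - z n) \<partial>lborel) = (\<integral>x. ?i x \<partial>lborel)"
      by (rule lborel_integral_translate) simp
    finally show ?thesis by simp
  qed
  have "(\<lambda>n. \<integral>x. ?i (x - z n) * ?i x \<partial>lborel) \<longlonglongrightarrow> (\<integral>x. ?i x \<partial>lborel)"
  proof (rule integral_dominated_convergence[OF _ _ int(1)])
    show "AE x in lborel. (\<lambda>n. ?i (x - z n) * ?i x) \<longlonglongrightarrow> ?i x"
    proof (rule AE_I2)
      fix x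
      show "(\<lambda>n. ?i (x - z n) * ?i x) \<longlonglongrightarrow> ?i x"
      proof (cases "x \<in> U")
        case True
        have "(\<lambda>n. x - z n) \<longlonglongrightarrow> x - 0" by (intro tendsto_intros z)
        then have "eventually (\<lambda>n. x - z n \<in> U) sequentially"
          using True U by (simp add: topological_tendstoD)
        then have "eventually (\<lambda>n. ?i (x - z n) * ?i x = 1) sequentially"
          by eventually_elim (use True in simp)
        then show ?thesis using True by (simp add: tendsto_eventually)
      qed simp
    qed
  qed (auto simp: indicator_def)
  then have "(\<lambda>n. (2 * (\<integral>x. ?i x \<partial>lborel) - 2 * (\<integral>x. ?i (x - z n) * ?i x \<partial>lborel)) * (norm c)\<^sup>2) \<longlonglongrightarrow>
     (2 * (\<integral>x. ?i x \<partial>lborel) - 2 * (\<integral>x. ?i x \<partial>lborel)) * (norm c)\<^sup>2"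
    by (intro tendsto_intros)
  then show "(\<lambda>n. sqn (\<lambda>x. indicator U (x - z n) *\<^sub>R c - indicator U x *\<^sub>R c)) \<longlonglongrightarrow> 0"
    unfolding eq by simp
qed

lemma transl_cont_indicator:
  fixes A :: "'a::euclidean_space set"
  assumes A [measurable]: "A \<in> sets borel" and fin: "emeasure lborel A < \<infinity>"
  shows "transl_cont (\<lambda>x. indicator A x *\<^sub>R c)"
proof (rule transl_cont_limit)
  show "(\<lambda>x. indicator A x *\<^sub>R c) \<in> L2" by (rule L2_indicator_const(1)[OF A fin])
  fix e :: real assume "e > 0"
  define \<delta> where "\<delta> = e / ((norm c)\<^sup>2 + 1)"
  have \<delta>: "\<delta> > 0" "\<delta> * (norm c)\<^sup>2 \<le> e"
    using \<open>e > 0\<close> by (auto simp: \<delta>_def field_simps add_pos_nonneg)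
  obtain U where U: "open U" "A \<subseteq> U" "emeasure lborel (U - A) < ennreal \<delta>"
    using outer_regular_lborel[OF A \<delta>(1)] by auto
  have [measurable]: "U \<in> sets borel" using U by simp
  have fin2: "emeasure lborel (U - A) < \<infinity>"
    using U(3) by (metis ennreal_less_top infinity_ennreal_def less_trans)
  have "emeasure lborel U = emeasure lborel A + emeasure lborel (U - A)"
    using U by (subst plus_emeasure) (auto simp: Un_absorb1)
  then have finU: "emeasure lborel U < \<infinity>"
    using fin fin2 by simp
  have "sqn (\<lambda>x. indicator A x *\<^sub>R c - indicator U x *\<^sub>R c) = sqn (\<lambda>x. indicator (U - A) x *\<^sub>R c)"
    unfolding sqn_def using U(2) by (intro Bochner_Integration.integral_cong) (auto simp: indicator_def)
  also have "\<dots> = measure lborel (U - A) * (norm c)\<^sup>2"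
    using fin2 by (intro L2_indicator_const) auto
  also have "\<dots> \<le> \<delta> * (norm c)\<^sup>2"
  proof (rule mult_right_mono)
    show "measure lborel (U - A) \<le> \<delta>"
      using U(3) \<delta>(1) by (simp add: measure_def enn2real_leI less_imp_le)
  qed simp
  also have "\<dots> \<le> e" by fact
  finally show "\<exists>g\<in>L2. transl_cont g \<and> sqn (\<lambda>x. indicator A x *\<^sub>R c - g x) \<le> e"
    using transl_cont_open[OF U(1) finU] L2_indicator_const(1)[OF _ finU] by auto
qed

lemma transl_cont_L2:
  assumes f: "f \<in> L2"
  shows "transl_cont f"
proof (rule transl_cont_limit[OF f])
  have [measurable]: "f \<in> borel_measurable borel" using f by auto
  obtain F where F: "\<And>i. simple_function lborel (F i)" "\<And>x. (\<lambda>i. F i x) \<longlonglongrightarrow> f x"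
    and F2: "\<And>i x. norm (F i x) \<le> 2 * norm (f x)"
    using borel_measurable_implies_sequence_metric[of f lborel 0] by auto
  have Fm [measurable]: "F i \<in> borel_measurable borel" for i
    using borel_measurable_simple_function[OF F(1)] by simp
  have FL2: "F i \<in> L2" for i
  proof (rule L2I_bound[where g="\<lambda>x. 4 * (norm (f x))\<^sup>2"])
    show "(norm (F i x))\<^sup>2 \<le> 4 * (norm (f x))\<^sup>2" for x
      using power_mono[OF F2[of i x], of 2] by (simp add: power_mult_distrib)
  qed (auto intro: L2_integrable f)
  have tc: "transl_cont (F i)" for i
  proof -
    have fin: "finite (range (F i))" using simple_functionD(1)[OF F(1)[of i]] by simp
    let ?A = "\<lambda>y. F i -` {y}"
    have A: "?A y \<in> sets borel" for y
      using measurable_sets[OF Fm, of "{y}" i] by simp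
    \<comment> \<open>Chebyshev's inequality: level sets of nonzero values have finite measure. The
      level set of 0 may be infinite, but it contributes the zero function.\<close>
    have "emeasure lborel (?A y) < \<infinity>" if "y \<noteq> 0" for y
    proof -
      have "ennreal ((norm y)\<^sup>2) * emeasure lborel (?A y) = (\<integral>\<^sup>+x. ennreal ((norm y)\<^sup>2) * indicator (?A y) x \<partial>lborel)"
        using A by (subst nn_integral_cmult_indicator) auto
      also have "\<dots> \<le> (\<integral>\<^sup>+x. ennreal ((norm (F i x))\<^sup>2) \<partial>lborel)"
        by (intro nn_integral_mono) (auto simp: indicator_def)
      also have "\<dots> < \<infinity>" using L2_nn_integral[OF FL2[of i]] by simp
      finally show ?thesis
        using that by (auto simp: ennreal_mult_less_top)
    qed
    then have part: "(\<lambda>x. indicator (?A y) x *\<^sub>R y) \<in> L2 \<and> transl_cont (\<lambda>x. indicator (?A y) x *\<^sub>R y)" for y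
    proof (cases "y = 0")
      case True
      then show ?thesis by (simp add: L2_zero transl_cont_def sqn_def)
    next
      case False
      then show ?thesis using transl_cont_indicator[OF A] L2_indicator_const(1)[OF A]
          \<open>\<And>y. y \<noteq> 0 \<Longrightarrow> emeasure lborel (?A y) < \<infinity>\<close> by blast
    qed
    have "F i x = (\<Sum>y\<in>range (F i). indicator (?A y) x *\<^sub>R y)" for x
    proof -
      have "(\<Sum>y\<in>range (F i). indicator (?A y) x *\<^sub>R y) = (\<Sum>y\<in>{F i x}. indicator (?A y) x *\<^sub>R y)"
        using fin by (intro sum.mono_neutral_right) (auto simp: indicator_def)
      then show ?thesis by simp
    qed
    then have "F i = (\<lambda>x. \<Sum>y\<in>range (F i). indicator (?A y) x *\<^sub>R y)" by blast
    then show ?thesis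
      using transl_cont_sum[OF fin, of "\<lambda>y x. indicator (?A y) x *\<^sub>R y"] part by simp
  qed
  have "(\<lambda>i. sqn (\<lambda>x. f x - F i x)) \<longlonglongrightarrow> integral\<^sup>L lborel (\<lambda>x::'a. 0)"
    unfolding sqn_def
  proof (rule integral_dominated_convergence[where w="\<lambda>x. 10 * (norm (f x))\<^sup>2"])
    show "AE x in lborel. (\<lambda>i. (norm (f x - F i x))\<^sup>2) \<longlonglongrightarrow> 0"
    proof (rule AE_I2)
      fix x
      have "(\<lambda>i. (norm (f x - F i x))\<^sup>2) \<longlonglongrightarrow> (norm (f x - f x))\<^sup>2"
        by (intro tendsto_intros F)
      then show "(\<lambda>i. (norm (f x - F i x))\<^sup>2) \<longlonglongrightarrow> 0" by simp
    qed
    have "(norm (f x - F i x))\<^sup>2 \<le> 10 * (norm (f x))\<^sup>2" for i x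
      using norm_diff_sq_le[of "f x" "F i x"] power_mono[OF F2[of i x], of 2] by (simp add: power_mult_distrib)
    then show "AE x in lborel. norm ((norm (f x - F i x))\<^sup>2) \<le> 10 * (norm (f x))\<^sup>2" for i by simp
  qed (auto intro: L2_integrable f)
  then have lim: "(\<lambda>i. sqn (\<lambda>x. f x - F i x)) \<longlonglongrightarrow> 0" by simp
  fix e :: real assume "e > 0"
  then obtain i where "norm (sqn (\<lambda>x. f x - F i x) - 0) < e"
    using LIMSEQ_D[OF lim] by blast
  then show "\<exists>g\<in>L2. transl_cont g \<and> sqn (\<lambda>x. f x - g x) \<le> e"
    using FL2 tc by (intro bexI[of _ "F i"]) auto
qed

lemma transl_cont_eps:
  assumes f: "f \<in> L2" and "e > 0"
  shows "\<exists>\<delta>>0. \<forall>z. norm z < \<delta> \<longrightarrow> sqn (\<lambda>x. f (x - z) - f x) < e"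
proof (rule ccontr)
  assume "\<not> ?thesis"
  then have "\<And>\<delta>. \<delta> > 0 \<Longrightarrow> \<exists>z. norm z < \<delta> \<and> \<not> sqn (\<lambda>x. f (x - z) - f x) < e"
    by blast
  from this[of "1 / real (Suc _)"]
  have "\<forall>n. \<exists>z. norm z < 1 / real (Suc n) \<and> \<not> sqn (\<lambda>x. f (x - z) - f x) < e"
    by simp
  from choice[OF this]
  obtain z where z: "\<And>n. norm (z n) < 1 / real (Suc n)" "\<And>n. \<not> sqn (\<lambda>x. f (x - z n) - f x) < e"
    by blast
  have "z \<longlonglongrightarrow> 0"
    by (rule Lim_null_comparison[OF always_eventually LIMSEQ_inverse_real_of_nat])
      (use z(1) less_imp_le in \<open>auto simp: inverse_eq_divide\<close>)
  then have "(\<lambda>n. sqn (\<lambda>x. f (x - z n) - f x)) \<longlonglongrightarrow> 0"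
    using transl_cont_L2[OF f] by (simp add: transl_cont_def)
  from LIMSEQ_D[OF this \<open>e > 0\<close>] obtain N where "norm (sqn (\<lambda>x. f (x - z N) - f x) - 0) < e" by blast
  with z(2)[of N] show False by simp
qed

section \<open>Test functions\<close>

lemma power_le_fact_exp: "(t::real) \<ge> 0 \<Longrightarrow> t ^ n \<le> fact n * exp t"
proof -
  assume "t \<ge> 0"
  have "t ^ n / fact n \<le> (\<Sum>i<Suc n. t ^ i / fact i)"
    using \<open>t \<ge> 0\<close> by (auto intro!: sum_nonneg)
  also have "\<dots> \<le> exp t"
    unfolding exp_def using \<open>t \<ge> 0\<close> summable_exp[of t]
    by (intro order_trans[OF sum_le_suminf[where f="\<lambda>i. t ^ i / fact i"]])
      (auto simp: divide_inverse mult.commute)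
  finally show ?thesis by (simp add: field_simps)
qed

lemma poly_exp_bounded: "\<exists>C. \<forall>t\<ge>0. \<bar>poly p t * exp (- t)\<bar> \<le> (C::real)"
proof (intro exI allI impI)
  fix t :: real assume "t \<ge> 0"
  have "\<bar>poly p t * exp (- t)\<bar> = \<bar>\<Sum>i\<le>degree p. coeff p i * t ^ i * exp (- t)\<bar>"
    by (simp add: poly_altdef sum_distrib_right)
  also have "\<dots> \<le> (\<Sum>i\<le>degree p. \<bar>coeff p i\<bar> * fact i)"
  proof (rule order_trans[OF sum_abs sum_mono])
    fix i
    have "t ^ i * exp (- t) \<le> fact i"
      using power_le_fact_exp[OF \<open>t \<ge> 0\<close>, of i] by (simp add: exp_minus field_simps)
    then show "\<bar>coeff p i * t ^ i * exp (- t)\<bar> \<le> \<bar>coeff p i\<bar> * fact i"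
      using \<open>t \<ge> 0\<close> by (simp add: abs_mult mult.assoc mult_left_mono)
  qed
  finally show "\<bar>poly p t * exp (- t)\<bar> \<le> (\<Sum>i\<le>degree p. \<bar>coeff p i\<bar> * fact i)" .
qed

text \<open>The classical flat function in \<open>t = 1 / (1 - s)\<close> with a polynomial
  prefactor. Differentiation only changes the polynomial, so smoothness reduces to one derivative
  formula for the whole family.\<close>

definition bump :: "real poly \<Rightarrow> real \<Rightarrow> real" where
  "bump p s = (if s < 1 then poly p (1 / (1 - s)) * exp (- (1 / (1 - s))) else 0)"

text \<open>Since \<open>t * (1 - s) = 1\<close>, the factor \<open>(s - 1)\<^sup>2\<close> is paid
  for by two more powers of \<open>t\<close> in the polynomial, which the exponential still
  dominates. Quadratic decay is what gives derivative 0 at the junction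
  \<open>s = 1\<close>.\<close>

lemma bump_quadratic: "\<exists>C. \<forall>s. \<bar>bump p s\<bar> \<le> C * (s - 1)\<^sup>2"
proof -
  obtain C where C: "\<And>t. t \<ge> 0 \<Longrightarrow> \<bar>poly (p * monom 1 2) t * exp (- t)\<bar> \<le> C"
    using poly_exp_bounded[of "p * monom 1 2"] by blast
  have "C \<ge> 0" using C[of 0] by linarith
  have "\<bar>bump p s\<bar> \<le> C * (s - 1)\<^sup>2" for s
  proof (cases "s < 1")
    case True
    define t where "t = 1 / (1 - s)"
    have t: "t > 0" "t * (1 - s) = 1" using True by (simp_all add: t_def)
    have "\<bar>bump p s\<bar> = \<bar>poly p t * exp (- t)\<bar> * (t * (1 - s))\<^sup>2"
      using True t by (simp add: bump_def t_def)
    also have "\<dots> = \<bar>poly (p * monom 1 2) t * exp (- t)\<bar> * (s - 1)\<^sup>2"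
      by (simp add: poly_monom abs_mult power_mult_distrib power2_commute[of 1 s] mult_ac)
    also have "\<dots> \<le> C * (s - 1)\<^sup>2"
      using C[of t] t by (intro mult_right_mono) auto
    finally show ?thesis .
  qed (auto simp: bump_def \<open>C \<ge> 0\<close>)
  then show ?thesis by blast
qed

text \<open>With \<open>t = 1 / (1 - s)\<close> one has \<open>t' = t\<^sup>2\<close>, the origin of
  \<open>monom 1 2\<close>; \<open>pderiv p - p\<close> comes from the product rule with
  \<open>exp (- t)\<close>.\<close>

lemma bump_has_derivative:
  "(bump p has_real_derivative bump ((pderiv p - p) * monom 1 2) s) (at s)"
proof -
  consider "s < 1" | "s = 1" | "s > 1" by linarith
  then show ?thesis
  proof cases
    case 1
    have "((\<lambda>s. poly p (1 / (1 - s)) * exp (- (1 / (1 - s)))) has_real_derivative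
        bump ((pderiv p - p) * monom 1 2) s) (at s)"
      using 1 by (auto intro!: derivative_eq_intros simp: bump_def poly_monom power2_eq_square field_simps)
    moreover have "eventually (\<lambda>s. bump p s = poly p (1 / (1 - s)) * exp (- (1 / (1 - s)))) (nhds s)"
      using eventually_nhds_in_open[of "{..<1}" s] 1 by (auto elim: eventually_mono simp: bump_def)
    ultimately show ?thesis
      by (rule DERIV_cong_ev[OF refl _ refl, THEN iffD2, rotated])
  next
    case 3
    have "((\<lambda>s. 0) has_real_derivative bump ((pderiv p - p) * monom 1 2) s) (at s)"
      using 3 by (auto simp: bump_def)
    moreover have "eventually (\<lambda>s. bump p s = 0) (nhds s)"
      using eventually_nhds_in_open[of "{1<..}" s] 3 by (auto elim: eventually_mono simp: bump_def)
    ultimately show ?thesis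
      by (rule DERIV_cong_ev[OF refl _ refl, THEN iffD2, rotated])
  next
    case 2
    obtain C where C: "\<And>s. \<bar>bump p s\<bar> \<le> C * (s - 1)\<^sup>2"
      using bump_quadratic by blast
    have "(\<lambda>h. (bump p (1 + h) - bump p 1) / h) \<midarrow>0\<rightarrow> 0"
    proof (rule Lim_null_comparison[where g="\<lambda>h. C * \<bar>h\<bar>"])
      show "\<forall>\<^sub>F h in at 0. norm ((bump p (1 + h) - bump p 1) / h) \<le> C * \<bar>h\<bar>"
      proof (rule eventually_at_filter[THEN iffD2, OF always_eventually], safe)
        fix h :: real assume "h \<noteq> 0"
        then have "\<bar>h\<bar> > 0" by simp
        have "\<bar>bump p (1 + h)\<bar> \<le> C * \<bar>h\<bar> * \<bar>h\<bar>"
          using C[of "1 + h"] by (simp add: power2_eq_square mult.assoc)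
        then show "norm ((bump p (1 + h) - bump p 1) / h) \<le> C * \<bar>h\<bar>"
          using \<open>\<bar>h\<bar> > 0\<close> by (simp add: bump_def[of p 1] pos_divide_le_eq)
      qed
      show "(\<lambda>h. C * \<bar>h\<bar>) \<midarrow>0\<rightarrow> 0"
        by (auto intro!: tendsto_eq_intros)
    qed
    then show ?thesis
      using 2 by (simp add: DERIV_def bump_def[of "(pderiv p - p) * monom 1 2"])
  qed
qed

text \<open>A class of functions that contains the standard mollifiers and is closed under derivatives.\<close>

inductive_set bumps :: "real \<Rightarrow> 'a::euclidean_space \<Rightarrow> ('a \<Rightarrow> real) set" for c a where
  bump: "(\<lambda>x. bump p (c * ((x - a) \<bullet> (x - a)))) \<in> bumps c a"
| coord: "f \<in> bumps c a \<Longrightarrow> (\<lambda>x. ((x - a) \<bullet> v) * f x) \<in> bumps c a"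
| add: "f \<in> bumps c a \<Longrightarrow> g \<in> bumps c a \<Longrightarrow> (\<lambda>x. f x + g x) \<in> bumps c a"
| scale: "f \<in> bumps c a \<Longrightarrow> (\<lambda>x. k * f x) \<in> bumps c a"

lemma bumps_derivative:
  assumes "f \<in> bumps c a"
  shows "\<exists>f'. (\<forall>x. (f has_derivative (\<lambda>v. f' v x)) (at x)) \<and> (\<forall>v. f' v \<in> bumps c a)"
  using assms
proof induction
  case (bump p)
  let ?q = "(pderiv p - p) * monom 1 2"
  let ?f' = "\<lambda>v x. ((x - a) \<bullet> ((2 * c) *\<^sub>R v)) * bump ?q (c * ((x - a) \<bullet> (x - a)))"
  have "((\<lambda>x. bump p (c * ((x - a) \<bullet> (x - a)))) has_derivative (\<lambda>v. ?f' v x)) (at x)" for x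
    by (rule has_derivative_eq_rhs[OF has_derivative_compose[OF _ bump_has_derivative[THEN has_field_derivative_imp_has_derivative]]])
      (auto intro!: derivative_eq_intros simp: fun_eq_iff inner_commute algebra_simps)
  then show ?case
    by (intro exI[of _ ?f'] conjI allI bumps.coord bumps.bump)
next
  case (coord f w)
  then obtain f' where f': "\<And>x. (f has_derivative (\<lambda>v. f' v x)) (at x)" "\<And>v. f' v \<in> bumps c a" by blast
  let ?f' = "\<lambda>v x. (v \<bullet> w) * f x + ((x - a) \<bullet> w) * f' v x"
  have "((\<lambda>x. ((x - a) \<bullet> w) * f x) has_derivative (\<lambda>v. ?f' v x)) (at x)" for x
    by (auto intro!: derivative_eq_intros f' simp: fun_eq_iff algebra_simps)
  then show ?case
    by (intro exI[of _ ?f']) (auto intro!: bumps.intros f' coord)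
next
  case (add f g)
  then obtain f' g' where f': "\<And>x. (f has_derivative (\<lambda>v. f' v x)) (at x)" "\<And>v. f' v \<in> bumps c a"
    "\<And>x. (g has_derivative (\<lambda>v. g' v x)) (at x)" "\<And>v. g' v \<in> bumps c a" by blast
  then show ?case
    by (intro exI[of _ "\<lambda>v x. f' v x + g' v x"]) (auto intro!: bumps.intros has_derivative_add)
next
  case (scale f k)
  then obtain f' where f': "\<And>x. (f has_derivative (\<lambda>v. f' v x)) (at x)" "\<And>v. f' v \<in> bumps c a" by blast
  then show ?case
    by (intro exI[of _ "\<lambda>v x. k * f' v x"]) (auto intro!: bumps.intros has_derivative_mult_right)
qed

lemma bumps_iter_deriv: "f \<in> bumps c a \<Longrightarrow> iter_deriv vs f \<in> bumps c a"
proof (induction vs)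
  case (Cons v vs)
  then obtain f' where f': "\<And>x. (iter_deriv vs f has_derivative (\<lambda>v. f' v x)) (at x)" "\<And>v. f' v \<in> bumps c a"
    using bumps_derivative[of "iter_deriv vs f"] by blast
  have "iter_deriv (v # vs) f = f' v"
    using frechet_derivative_at[OF f'(1)] by (auto simp: fun_eq_iff)
  then show ?case using f' by simp
qed simp

lemma bumps_test_functions:
  assumes "f \<in> bumps c a" and "closure {x. f x \<noteq> 0} \<subseteq> U" "bounded {x. f x \<noteq> 0}"
  shows "f \<in> test_functions U"
  unfolding test_functions_def using assms bumps_derivative[OF bumps_iter_deriv[OF assms(1)]]
  by (auto simp: differentiable_def compact_closure) blast

section \<open>Directional derivatives and uniform bounds for test functions\<close>

definition pderiv_dir :: "'a::euclidean_space \<Rightarrow> ('a \<Rightarrow> 'b::real_normed_vector) \<Rightarrow> 'a \<Rightarrow> 'b" where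
  "pderiv_dir v f x = frechet_derivative f (at x) v"

lemma iter_deriv_single: "iter_deriv [v] f = pderiv_dir v f"
  by (simp add: pderiv_dir_def[abs_def])

lemma iter_deriv_append: "iter_deriv (vs @ ws) f = iter_deriv vs (iter_deriv ws f)"
  by (induction vs) simp_all

lemma test_functions_mono: "U \<subseteq> V \<Longrightarrow> \<phi> \<in> test_functions U \<Longrightarrow> \<phi> \<in> test_functions V"
  by (auto simp: test_functions_def)

lemma test_functions_has_derivative:
  assumes "\<phi> \<in> test_functions U"
  shows "(\<phi> has_derivative (\<lambda>v. pderiv_dir v \<phi> x)) (at x)"
  using assms unfolding test_functions_def pderiv_dir_def
  by (auto dest!: spec[of _ "[]"] simp: frechet_derivative_works)

lemma test_functions_outside:
  assumes "\<phi> \<in> test_functions U" "x \<notin> closure {x. \<phi> x \<noteq> 0}"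
  shows "\<phi> x = 0" "pderiv_dir v \<phi> x = 0"
proof -
  show "\<phi> x = 0" using assms(2) closure_subset[of "{x. \<phi> x \<noteq> 0}"] by auto
  have "((\<lambda>x. 0) has_derivative (\<lambda>v. 0)) (at x)" by simp
  then have "(\<phi> has_derivative (\<lambda>v. 0)) (at x)"
  proof (rule has_derivative_transform_within_open[of _ _ _ _ "- closure {x. \<phi> x \<noteq> 0}"])
    show "0 = \<phi> y" if "y \<in> - closure {x. \<phi> x \<noteq> 0}" for y
      using that closure_subset[of "{x. \<phi> x \<noteq> 0}"] by auto
  qed (use assms in auto)
  then show "pderiv_dir v \<phi> x = 0"
    using frechet_derivative_at[of \<phi> "\<lambda>v. 0" x] by (metis pderiv_dir_def)
qed

lemma test_functions_pderiv:
  assumes \<phi>: "\<phi> \<in> test_functions U" and "v \<in> Basis"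
  shows "pderiv_dir v \<phi> \<in> test_functions U"
proof -
  have sub: "{x. pderiv_dir v \<phi> x \<noteq> 0} \<subseteq> closure {x. \<phi> x \<noteq> 0}"
    using test_functions_outside(2)[OF \<phi>] by blast
  then have cl: "closure {x. pderiv_dir v \<phi> x \<noteq> 0} \<subseteq> closure {x. \<phi> x \<noteq> 0}"
    by (rule closure_minimal) simp
  have c: "compact (closure {x. \<phi> x \<noteq> 0})" "closure {x. \<phi> x \<noteq> 0} \<subseteq> U"
    using \<phi> by (auto simp: test_functions_def)
  have "compact (closure {x. pderiv_dir v \<phi> x \<noteq> 0})"
    using compact_Int_closed[OF c(1) closed_closure, of "{x. pderiv_dir v \<phi> x \<noteq> 0}"] cl
    by (simp add: Int_absorb1)
  moreover have "iter_deriv vs (pderiv_dir v \<phi>) differentiable (at x)" if "set vs \<subseteq> Basis" for vs x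
    using \<phi> that \<open>v \<in> Basis\<close> unfolding iter_deriv_single[symmetric] iter_deriv_append[symmetric]
    by (auto simp: test_functions_def)
  ultimately show ?thesis
    using cl c by (auto simp: test_functions_def)
qed

lemma test_functions_continuous: "\<phi> \<in> test_functions U \<Longrightarrow> continuous_on S \<phi>"
  using test_functions_has_derivative
  by (metis continuous_at_imp_continuous_on has_derivative_continuous)

lemma test_functions_borel [measurable_dest]: "\<phi> \<in> test_functions U \<Longrightarrow> \<phi> \<in> borel_measurable borel"
  by (intro borel_measurable_continuous_onI test_functions_continuous)

lemma test_functions_bounded:
  assumes "\<phi> \<in> test_functions U" obtains M where "M \<ge> 0" "\<And>x. \<bar>\<phi> x\<bar> \<le> M"
proof -
  have "compact (\<phi> ` closure {x. \<phi> x \<noteq> 0})"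
    using assms by (intro compact_continuous_image test_functions_continuous) (auto simp: test_functions_def)
  then obtain M where M: "M > 0" "\<And>y. y \<in> \<phi> ` closure {x. \<phi> x \<noteq> 0} \<Longrightarrow> norm y \<le> M"
    using compact_imp_bounded bounded_pos by metis
  have "\<bar>\<phi> x\<bar> \<le> M" for x
    using M(2)[of "\<phi> x"] M(1) test_functions_outside(1)[OF assms, of x]
    by (cases "x \<in> closure {x. \<phi> x \<noteq> 0}") auto
  then show ?thesis using that[of M] M(1) by auto
qed

lemma test_functions_L2:
  assumes "\<phi> \<in> test_functions U" shows "\<phi> \<in> L2"
proof -
  let ?K = "closure {x. \<phi> x \<noteq> 0}"
  obtain M where M: "M \<ge> 0" "\<And>x. \<bar>\<phi> x\<bar> \<le> M" using test_functions_bounded[OF assms] by metis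
  have K: "compact ?K" using assms by (simp add: test_functions_def)
  show ?thesis
  proof (rule L2I_bound[where g="\<lambda>x. M\<^sup>2 * indicator ?K x"])
    show "integrable lborel (\<lambda>x. M\<^sup>2 * indicator ?K x :: real)"
      using emeasure_compact_finite[OF K]
      by (intro integrable_mult_right integrable_real_indicator) (auto intro!: borel_closed)
    show "(norm (\<phi> x))\<^sup>2 \<le> M\<^sup>2 * indicator ?K x" for x
      using M(2)[of x] M(1) test_functions_outside(1)[OF assms, of x] abs_le_square_iff[of "\<phi> x" M]
      by (auto simp: indicator_def)
  qed (use assms in auto)
qed

lemma pderiv_dir_expand:
  assumes "(f has_derivative (\<lambda>v. pderiv_dir v f x)) (at x)"
  shows "pderiv_dir v f x = (\<Sum>b\<in>Basis. (v \<bullet> b) *\<^sub>R pderiv_dir b f x)"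
proof -
  have lin: "linear (\<lambda>v. pderiv_dir v f x)"
    by (rule has_derivative_linear[OF assms])
  have "pderiv_dir v f x = pderiv_dir (\<Sum>b\<in>Basis. (v \<bullet> b) *\<^sub>R b) f x"
    by (simp add: euclidean_representation)
  also have "\<dots> = (\<Sum>b\<in>Basis. (v \<bullet> b) *\<^sub>R pderiv_dir b f x)"
    unfolding linear_sum[OF lin] linear_scale[OF lin] ..
  finally show ?thesis .
qed

lemma test_functions_Lipschitz:
  fixes \<phi> :: "'a::euclidean_space \<Rightarrow> real"
  assumes \<phi>: "\<phi> \<in> test_functions U"
  obtains L where "L \<ge> 0" "\<And>x y. \<bar>\<phi> x - \<phi> y\<bar> \<le> L * norm (x - y)"
proof -
  have "\<forall>b\<in>Basis. \<exists>M. M \<ge> 0 \<and> (\<forall>x. \<bar>pderiv_dir b \<phi> x\<bar> \<le> M)"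
    using test_functions_bounded[OF test_functions_pderiv[OF \<phi>]] by metis
  then obtain M where M: "\<And>b x. b \<in> Basis \<Longrightarrow> M b \<ge> 0 \<and> \<bar>pderiv_dir b \<phi> x\<bar> \<le> M b"
    by metis
  let ?L = "\<Sum>b\<in>(Basis::'a set). M b"
  have "\<bar>pderiv_dir v \<phi> x\<bar> \<le> norm v * ?L" for v x
  proof -
    have "pderiv_dir v \<phi> x = (\<Sum>b\<in>Basis. (v \<bullet> b) * pderiv_dir b \<phi> x)"
      using pderiv_dir_expand[OF test_functions_has_derivative[OF \<phi>], of v] by simp
    also have "\<bar>\<dots>\<bar> \<le> (\<Sum>b\<in>Basis. norm v * M b)"
      using M by (intro order_trans[OF sum_abs sum_mono]) (auto simp: abs_mult Basis_le_norm intro!: mult_mono)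
    finally show ?thesis by (simp add: sum_distrib_left)
  qed
  then have on: "onorm (\<lambda>v. pderiv_dir v \<phi> x) \<le> ?L" for x
    by (intro onorm_le) (simp add: mult.commute)
  have "\<bar>\<phi> x - \<phi> y\<bar> \<le> ?L * norm (x - y)" for x y
    using differentiable_bound[of UNIV \<phi> "\<lambda>x v. pderiv_dir v \<phi> x" ?L x y] on
      test_functions_has_derivative[OF \<phi>] by (simp add: has_derivative_at_withinI)
  moreover have "?L \<ge> 0" using M by (intro sum_nonneg) auto
  ultimately show ?thesis using that by blast
qed

text \<open>The second-order Taylor estimate, from Lipschitz first derivatives. Its uniformity in
  \<open>x\<close> is the point: it permits differentiation under a convolution integral when the
  other factor is merely integrable.\<close>

lemma test_functions_remainder:
  fixes \<phi> :: "'a::euclidean_space \<Rightarrow> real"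
  assumes \<phi>: "\<phi> \<in> test_functions U"
  obtains C where "C \<ge> 0"
    "\<And>x k. \<bar>\<phi> (x + k) - \<phi> x - (\<Sum>b\<in>Basis. (k \<bullet> b) * pderiv_dir b \<phi> x)\<bar> \<le> C * (norm k)\<^sup>2"
proof -
  have "\<forall>b\<in>Basis. \<exists>L. L \<ge> 0 \<and> (\<forall>x y. \<bar>pderiv_dir b \<phi> x - pderiv_dir b \<phi> y\<bar> \<le> L * norm (x - y))"
    using test_functions_Lipschitz[OF test_functions_pderiv[OF \<phi>]] by metis
  then obtain L where L: "\<And>b. b \<in> Basis \<Longrightarrow> L b \<ge> 0"
    "\<And>b x y. b \<in> Basis \<Longrightarrow> \<bar>pderiv_dir b \<phi> x - pderiv_dir b \<phi> y\<bar> \<le> L b * norm (x - y)"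
    by metis
  let ?C = "\<Sum>b\<in>(Basis::'a set). L b"
  have C0: "?C \<ge> 0" using L by (intro sum_nonneg) auto
  have expand: "pderiv_dir v \<phi> x = (\<Sum>b\<in>Basis. (v \<bullet> b) * pderiv_dir b \<phi> x)" for v x
    using pderiv_dir_expand[OF test_functions_has_derivative[OF \<phi>], of v] by simp
  have "\<bar>\<phi> (x + k) - \<phi> x - (\<Sum>b\<in>Basis. (k \<bullet> b) * pderiv_dir b \<phi> x)\<bar> \<le> ?C * (norm k)\<^sup>2" for x k
  proof -
    have "\<bar>pderiv_dir v \<phi> y - pderiv_dir v \<phi> x\<bar> \<le> (?C * norm k) * norm v" if "norm (y - x) \<le> norm k" for v y
    proof -
      have "pderiv_dir v \<phi> y - pderiv_dir v \<phi> x = (\<Sum>b\<in>Basis. (v \<bullet> b) * (pderiv_dir b \<phi> y - pderiv_dir b \<phi> x))"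
        unfolding expand[of v] by (simp add: algebra_simps sum_subtractf)
      also have "\<bar>\<dots>\<bar> \<le> (\<Sum>b\<in>Basis. norm v * (L b * norm k))"
      proof (rule order_trans[OF sum_abs sum_mono])
        fix b :: 'a assume b: "b \<in> Basis"
        have "\<bar>pderiv_dir b \<phi> y - pderiv_dir b \<phi> x\<bar> \<le> L b * norm k"
          using L(2)[OF b, of y x] mult_left_mono[OF that L(1)[OF b]] by linarith
        then show "\<bar>v \<bullet> b * (pderiv_dir b \<phi> y - pderiv_dir b \<phi> x)\<bar> \<le> norm v * (L b * norm k)"
          using b by (simp add: abs_mult Basis_le_norm mult_mono)
      qed
      finally show ?thesis by (simp add: sum_distrib_left sum_distrib_right mult_ac)
    qed
    then have on: "onorm (\<lambda>v. pderiv_dir v \<phi> y - pderiv_dir v \<phi> x) \<le> ?C * norm k" if "norm (y - x) \<le> norm k" for y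
      using that by (intro onorm_le) auto
    have "norm (\<phi> (x + k) - \<phi> x - pderiv_dir (x + k - x) \<phi> x) \<le> norm (x + k - x) * (?C * norm k)"
    proof (rule differentiable_bound_linearization[where S="cball x (norm k)" and f'="\<lambda>x v. pderiv_dir v \<phi> x"])
      show "x + t *\<^sub>R (x + k - x) \<in> cball x (norm k)" if "t \<in> {0..1}" for t
        using that by (simp add: dist_norm mult_left_le_one_le)
      show "(\<phi> has_derivative (\<lambda>v. pderiv_dir v \<phi> y)) (at y within cball x (norm k))" for y
        using test_functions_has_derivative[OF \<phi>] by (rule has_derivative_at_withinI)
      show "onorm ((\<lambda>i. pderiv_dir i \<phi> y) - (\<lambda>i. pderiv_dir i \<phi> x)) \<le> ?C * norm k" if "y \<in> cball x (norm k)" for y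
        unfolding fun_diff_def using that by (intro on) (simp add: dist_norm norm_minus_commute)
    qed simp
    then show ?thesis
      unfolding expand[of "x + k - x"] by (simp add: power2_eq_square mult_ac)
  qed
  from that[OF C0 this] show ?thesis .
qed

section \<open>Mollification\<close>

definition conv :: "('a::euclidean_space \<Rightarrow> real) \<Rightarrow> ('a \<Rightarrow> 'b::euclidean_space) \<Rightarrow> 'a \<Rightarrow> 'b" where
  "conv \<phi> f x = (\<integral>z. \<phi> (x - z) *\<^sub>R f z \<partial>lborel)"

lemma test_integrable:
  fixes f :: "'a::euclidean_space \<Rightarrow> 'b::euclidean_space"
  assumes \<phi>: "\<phi> \<in> test_functions U" and f: "integrable lborel f"
  shows "integrable lborel (\<lambda>z. \<phi> (x - z) *\<^sub>R f z)"
proof -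
  obtain M where M: "M \<ge> 0" "\<And>x. \<bar>\<phi> x\<bar> \<le> M" by (rule test_functions_bounded[OF \<phi>]) blast
  have [measurable]: "\<phi> \<in> borel_measurable borel" using \<phi> by (rule test_functions_borel)
  show ?thesis
    by (rule Bochner_Integration.integrable_bound[OF integrable_mult_right[OF integrable_norm[OF f], of M]])
      (use f M in \<open>auto intro!: mult_right_mono\<close>)
qed

lemma conv_has_derivative:
  fixes f :: "'a::euclidean_space \<Rightarrow> 'b::euclidean_space"
  assumes \<phi>: "\<phi> \<in> test_functions U" and f: "integrable lborel f"
  shows "(conv \<phi> f has_derivative (\<lambda>k. \<Sum>b\<in>Basis. (k \<bullet> b) *\<^sub>R conv (pderiv_dir b \<phi>) f x)) (at x)"
proof -
  obtain C where C: "C \<ge> 0"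
    "\<And>x k. \<bar>\<phi> (x + k) - \<phi> x - (\<Sum>b\<in>Basis. (k \<bullet> b) * pderiv_dir b \<phi> x)\<bar> \<le> C * (norm k)\<^sup>2"
    by (rule test_functions_remainder[OF \<phi>]) blast
  let ?D = "\<lambda>k. \<Sum>b\<in>Basis. (k \<bullet> b) *\<^sub>R conv (pderiv_dir b \<phi>) f x"
  let ?I = "\<integral>z. norm (f z) \<partial>lborel"
  note int = test_integrable[OF \<phi> f] test_integrable[OF test_functions_pderiv[OF \<phi>] f]
  have le: "norm (conv \<phi> f y - conv \<phi> f x - ?D (y - x)) \<le> C * (norm (y - x))\<^sup>2 * ?I" for y
  proof -
    have "conv \<phi> f y - conv \<phi> f x - ?D (y - x) =
      (\<integral>z. \<phi> (y - z) *\<^sub>R f z - \<phi> (x - z) *\<^sub>R f z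
        - (\<Sum>b\<in>Basis. ((y - x) \<bullet> b) *\<^sub>R (pderiv_dir b \<phi> (x - z) *\<^sub>R f z)) \<partial>lborel)"
      using int by (simp add: conv_def del: scaleR_scaleR)
    also have "norm \<dots> \<le> (\<integral>z. C * (norm (y - x))\<^sup>2 * norm (f z) \<partial>lborel)"
    proof (rule Bochner_Integration.integral_norm_bound_integral)
      fix z
      have "norm (\<phi> (y - z) *\<^sub>R f z - \<phi> (x - z) *\<^sub>R f z
        - (\<Sum>b\<in>Basis. ((y - x) \<bullet> b) *\<^sub>R (pderiv_dir b \<phi> (x - z) *\<^sub>R f z)))
        = norm ((\<phi> (y - z) - \<phi> (x - z) - (\<Sum>b\<in>Basis. ((y - x) \<bullet> b) * pderiv_dir b \<phi> (x - z))) *\<^sub>R f z)"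
        by (simp add: scaleR_diff_left scaleR_sum_left)
      also have "\<dots> \<le> C * (norm (y - x))\<^sup>2 * norm (f z)"
        using mult_right_mono[OF C(2)[of "x - z" "y - x"] norm_ge_zero[of "f z"]] by simp
      finally show "norm (\<phi> (y - z) *\<^sub>R f z - \<phi> (x - z) *\<^sub>R f z
        - (\<Sum>b\<in>Basis. ((y - x) \<bullet> b) *\<^sub>R (pderiv_dir b \<phi> (x - z) *\<^sub>R f z))) \<le> C * (norm (y - x))\<^sup>2 * norm (f z)" .
    qed (use int f in \<open>auto intro!: Bochner_Integration.integrable_diff Bochner_Integration.integrable_sum simp del: scaleR_scaleR\<close>)
    finally show ?thesis by simp
  qed
  show ?thesis
  proof (rule has_derivativeI_sandwich[where e=1 and H="\<lambda>y. C * norm (y - x) * ?I"])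
    show "bounded_linear ?D"
      by (intro bounded_linear_sum bounded_linear_scaleR_const bounded_linear_inner_left)
    show "norm (conv \<phi> f y - conv \<phi> f x - ?D (y - x)) / norm (y - x) \<le> C * norm (y - x) * ?I" if "y \<noteq> x" for y
      using le[of y] that by (simp add: pos_divide_le_eq power2_eq_square mult_ac)
    show "((\<lambda>y. C * norm (y - x) * ?I) \<longlongrightarrow> 0) (at x)"
      by (auto intro!: tendsto_eq_intros)
  qed simp
qed

lemma conv_continuous:
  assumes "\<phi> \<in> test_functions U" "integrable lborel f"
  shows "continuous_on S (conv \<phi> f)"
  by (intro continuous_at_imp_continuous_on ballI has_derivative_continuous[OF conv_has_derivative[OF assms]])

lemma pderiv_dir_conv:
  assumes "\<phi> \<in> test_functions U" "integrable lborel f" "b \<in> Basis"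
  shows "pderiv_dir b (conv \<phi> f) x = conv (pderiv_dir b \<phi>) f x"
proof -
  have "pderiv_dir b (conv \<phi> f) x = (\<Sum>c\<in>Basis. (b \<bullet> c) *\<^sub>R conv (pderiv_dir c \<phi>) f x)"
    by (simp add: pderiv_dir_def frechet_derivative_at[OF conv_has_derivative[OF assms(1,2)], symmetric])
  also have "\<dots> = (\<Sum>c\<in>{b}. (b \<bullet> c) *\<^sub>R conv (pderiv_dir c \<phi>) f x)"
    using assms(3) by (intro sum.mono_neutral_right) (auto simp: inner_Basis)
  finally show ?thesis using assms(3) by simp
qed

lemma conv_has_derivative':
  assumes "\<phi> \<in> test_functions U" "integrable lborel f"
  shows "(conv \<phi> f has_derivative (\<lambda>v. pderiv_dir v (conv \<phi> f) x)) (at x)"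
  using conv_has_derivative[OF assms, of x]
  by (simp add: pderiv_dir_def frechet_derivative_at[OF conv_has_derivative[OF assms], symmetric])

lemma lborel_reflect:
  "lborel = distr lborel borel (\<lambda>z::'a::euclidean_space. x - z)"
  using lborel_affine[of "-1" x] by (simp add: density_1)

lemma lborel_integral_reflect:
  fixes h :: "'a::euclidean_space \<Rightarrow> 'b::{banach, second_countable_topology}"
  assumes [measurable]: "h \<in> borel_measurable borel"
  shows "(\<integral>z. h (x - z) \<partial>lborel) = (\<integral>z. h z \<partial>lborel)"
  by (subst (2) lborel_reflect[of x], subst integral_distr) auto

section \<open>Standard mollifiers supported in balls of radius 1 / (n + 1)\<close>

definition ubump :: "nat \<Rightarrow> 'a::euclidean_space \<Rightarrow> real" where
  "ubump n x = bump 1 ((real n + 1)\<^sup>2 * (x \<bullet> x))"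

definition mollifier :: "nat \<Rightarrow> 'a::euclidean_space \<Rightarrow> real" where
  "mollifier n x = ubump n x / (integral\<^sup>L lborel (ubump n :: 'a \<Rightarrow> real))"

context
  fixes n :: nat
begin

lemma unnormalized_zero: "norm x \<ge> 1 / (real n + 1) \<Longrightarrow> ubump n x = 0"
proof -
  assume "norm x \<ge> 1 / (real n + 1)"
  then have "1 \<le> (real n + 1) * norm x" by (simp add: field_simps)
  then have "1 \<le> ((real n + 1) * norm x)\<^sup>2" by (simp add: one_le_power)
  then show ?thesis by (simp add: ubump_def bump_def power_mult_distrib power2_norm_eq_inner)
qed

lemma unnormalized_nonneg: "0 \<le> ubump n x"
  by (simp add: ubump_def bump_def)

lemma ubump_minus: "ubump n (- x) = ubump n x"
  by (simp add: ubump_def)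

text \<open>Weak derivatives are tested with the kernel as a function of the integration variable
  \<open>z\<close>, centred at \<open>x\<close>; this is why the class \<open>bumps\<close> carries
  a centre.\<close>

lemma bumps_reflected:
  "(\<lambda>z. ubump n (x - z)) \<in> bumps ((real n + 1)\<^sup>2) x"
  using bumps.bump[of 1 "(real n + 1)\<^sup>2" x] unfolding ubump_def by (simp add: inner_diff_left inner_diff_right algebra_simps)

lemma reflected_support:
  "closure {z. ubump n (x - z) \<noteq> 0} \<subseteq> cball x (1 / (real n + 1))"
proof (rule closure_minimal)
  show "{z. ubump n (x - z) \<noteq> 0} \<subseteq> cball x (1 / (real n + 1))"
  proof safe
    fix z assume "ubump n (x - z) \<noteq> 0"
    then have "\<not> 1 / (real n + 1) \<le> norm (x - z)"
      using unnormalized_zero by blast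
    then show "z \<in> cball x (1 / (real n + 1))"
      by (simp only: mem_cball dist_norm not_le less_imp_le)
  qed
qed simp

lemma reflected_test:
  assumes "cball x (1 / (real n + 1)) \<subseteq> U"
  shows "(\<lambda>z. ubump n (x - z)) \<in> test_functions U"
proof (rule bumps_test_functions[OF bumps_reflected])
  show "bounded {z. ubump n (x - z) \<noteq> 0}"
    by (rule bounded_subset[OF bounded_cball order_trans[OF closure_subset reflected_support]])
qed (use reflected_support[of x] assms in blast)

lemma normalization_pos: "0 < (integral\<^sup>L lborel (ubump n :: 'a::euclidean_space \<Rightarrow> real))"
proof -
  let ?f = "\<lambda>x::'a. ubump n x"
  have "(\<lambda>z::'a. ubump n (0 - z)) \<in> test_functions UNIV"
    by (rule reflected_test) (rule subset_UNIV)
  then have test: "?f \<in> test_functions UNIV"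
    by (simp only: diff_0 ubump_minus)
  have int: "integrable lborel ?f"
  proof -
    obtain M where M: "M \<ge> 0" "\<And>x. \<bar>?f x\<bar> \<le> M" by (rule test_functions_bounded[OF test]) blast
    show ?thesis
    proof (rule Bochner_Integration.integrable_bound[where f="\<lambda>x. M * indicator (cball 0 (1 / (real n + 1))) x"])
      show "integrable lborel (\<lambda>x::'a. M * indicator (cball 0 (1 / (real n + 1))) x :: real)"
        using emeasure_compact_finite[OF compact_cball[of "0::'a" "1 / (real n + 1)"]]
        by (intro integrable_mult_right integrable_real_indicator) auto
      show "AE x in lborel. norm (?f x) \<le> norm (M * indicator (cball 0 (1 / (real n + 1))) x)"
        proof (rule AE_I2)
        fix x :: 'a
        show "norm (?f x) \<le> norm (M * indicator (cball 0 (1 / (real n + 1))) x)"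
        proof (cases "x \<in> cball 0 (1 / (real n + 1))")
          case True
          then show ?thesis using M by simp
        next
          case False
          then show ?thesis using unnormalized_zero[of x] by simp
        qed
      qed
    qed (use test in auto)
  qed
  have "(\<integral>x. ?f x \<partial>lborel) \<noteq> 0"
  proof
    assume "(\<integral>x. ?f x \<partial>lborel) = 0"
    then have "AE x in lborel. ?f x = 0"
      using int by (subst (asm) integral_nonneg_eq_0_iff_AE) (auto simp: unnormalized_nonneg)
    moreover have "?f x \<noteq> 0" if "x \<in> ball 0 (1 / (real n + 1))" for x
    proof -
      have "(real n + 1) * norm x < 1" using that by (simp add: field_simps)
      then have "((real n + 1) * norm x)\<^sup>2 < 1" by (simp add: abs_square_less_1)
      then show ?thesis by (simp add: ubump_def bump_def power_mult_distrib power2_norm_eq_inner)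
    qed
    ultimately have "AE x in lborel. x \<notin> ball (0::'a) (1 / (real n + 1))"
      by (auto elim!: eventually_mono)
    then have "emeasure lborel (ball (0::'a) (1 / (real n + 1))) = 0"
      using AE_iff_null_sets[of "ball (0::'a) (1 / (real n + 1))" lborel] by (simp only: null_sets_def) simp
    moreover have "emeasure lborel (ball (0::'a) (1 / (real n + 1)))
        = ennreal (unit_ball_vol (real DIM('a)) * (1 / (real n + 1)) ^ DIM('a))"
      by (rule emeasure_ball) simp
    moreover have "0 < unit_ball_vol (real DIM('a)) * (1 / (real n + 1)) ^ DIM('a)"
      by (intro mult_pos_pos unit_ball_vol_pos zero_less_power) auto
    ultimately show False
      by (metis ennreal_eq_0_iff not_le)
  qed
  moreover have "(\<integral>x. ?f x \<partial>lborel) \<ge> 0"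
    by (rule Bochner_Integration.integral_nonneg) (simp add: unnormalized_nonneg)
  ultimately show ?thesis by simp
qed

lemma mollifier_nonneg: "0 \<le> mollifier n x"
  unfolding mollifier_def using normalization_pos unnormalized_nonneg by (intro divide_nonneg_pos)

lemma mollifier_integral: "(integral\<^sup>L lborel (mollifier n :: 'a::euclidean_space \<Rightarrow> real)) = 1"
  unfolding mollifier_def using normalization_pos[where 'a='a] by simp

lemma mollifier_zero: "norm x \<ge> 1 / (real n + 1) \<Longrightarrow> mollifier n x = 0"
  by (simp add: mollifier_def unnormalized_zero)

lemma mollifier_test_reflected:
  assumes "cball x (1 / (real n + 1)) \<subseteq> U"
  shows "(\<lambda>z. mollifier n (x - z)) \<in> test_functions U"
proof (rule bumps_test_functions)
  let ?Z = "integral\<^sup>L lborel (ubump n :: 'a \<Rightarrow> real)"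
  have eq: "(\<lambda>z. mollifier n (x - z)) = (\<lambda>z. (1 / ?Z) * ubump n (x - z))"
    by (simp add: mollifier_def)
  show "(\<lambda>z. mollifier n (x - z)) \<in> bumps ((real n + 1)\<^sup>2) x"
    unfolding eq by (intro bumps.scale bumps_reflected)
  have set_eq: "{z. mollifier n (x - z) \<noteq> 0} = {z. ubump n (x - z) \<noteq> 0}"
    using normalization_pos[where 'a='a] by (simp add: mollifier_def)
  show "closure {z. mollifier n (x - z) \<noteq> 0} \<subseteq> U"
    unfolding set_eq using reflected_support[of x] assms by blast
  show "bounded {z. mollifier n (x - z) \<noteq> 0}"
    unfolding set_eq by (rule bounded_subset[OF bounded_cball order_trans[OF closure_subset reflected_support]])
qed

lemma mollifier_even: "mollifier n (- x) = mollifier n x"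
  by (simp add: mollifier_def ubump_def)

lemma mollifier_test: "mollifier n \<in> test_functions UNIV"
  using mollifier_test_reflected[of 0 UNIV] by (simp add: mollifier_even)

lemma mollifier_borel [measurable]: "mollifier n \<in> borel_measurable borel"
  by (rule test_functions_borel[OF mollifier_test])

lemma mollifier_integrable: "integrable lborel (mollifier n :: 'a::euclidean_space \<Rightarrow> real)"
  using mollifier_integral[where 'a='a] not_integrable_integral_eq by fastforce

end

section \<open>Mollification of weak derivatives and mean-square convergence\<close>

definition wderiv :: "'a::euclidean_space set \<Rightarrow> 'a \<Rightarrow> ('a \<Rightarrow> 'b::euclidean_space) \<Rightarrow> ('a \<Rightarrow> 'b) \<Rightarrow> bool" where
  "wderiv U v f g \<longleftrightarrow> (\<forall>\<phi>\<in>test_functions U.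
     (\<integral>x. pderiv_dir v \<phi> x *\<^sub>R f x \<partial>lborel) = - (\<integral>x. \<phi> x *\<^sub>R g x \<partial>lborel))"

text \<open>The reflected kernel is an admissible test function as soon as its supporting ball lies
  in \<open>U\<close>, so the identity is available only at some distance from the boundary. The
  sign from the reflection cancels the sign in the weak formulation.\<close>

lemma conv_wderiv:
  assumes w: "wderiv U b f g" and sub: "cball x (1 / (real n + 1)) \<subseteq> U"
  shows "conv (pderiv_dir b (mollifier n)) f x = conv (mollifier n) g x"
proof -
  have "pderiv_dir b (\<lambda>z. mollifier n (x - z)) z = - pderiv_dir b (mollifier n) (x - z)" for z
  proof -
    have D: "(mollifier n has_derivative (\<lambda>v. pderiv_dir v (mollifier n) (x - z))) (at (x - z))"
      by (rule test_functions_has_derivative[OF mollifier_test])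
    have "((\<lambda>z. mollifier n (x - z)) has_derivative (\<lambda>v. pderiv_dir (- v) (mollifier n) (x - z))) (at z)"
      by (rule has_derivative_compose[where f="\<lambda>z. x - z" and f'=uminus, OF _ D]) (auto intro!: derivative_eq_intros)
    from frechet_derivative_at[OF this, symmetric] have "pderiv_dir b (\<lambda>z. mollifier n (x - z)) z = pderiv_dir (- b) (mollifier n) (x - z)"
      by (simp add: pderiv_dir_def)
    also have "\<dots> = - pderiv_dir b (mollifier n) (x - z)"
      using linear_neg[OF has_derivative_linear[OF D]] .
    finally show ?thesis .
  qed
  note eq = this
  have "(\<integral>z. - (pderiv_dir b (mollifier n) (x - z) *\<^sub>R f z) \<partial>lborel) = - (\<integral>z. mollifier n (x - z) *\<^sub>R g z \<partial>lborel)"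
    using w[unfolded wderiv_def, rule_format, OF mollifier_test_reflected[OF sub]]
    unfolding eq scaleR_minus_left .
  then show ?thesis by (simp add: conv_def)
qed

text \<open>Jensen's inequality for the square. The mean is paired with itself and Young's
  inequality is applied under the integral; half of the squared mean is then absorbed on the
  left.\<close>

lemma norm_average_le:
  fixes g :: "'a::euclidean_space \<Rightarrow> 'b::euclidean_space"
  assumes \<rho>: "integrable lborel \<rho>" "\<And>z. 0 \<le> \<rho> z" "(\<integral>z. \<rho> z \<partial>lborel) = 1"
    and [measurable]: "g \<in> borel_measurable borel"
    and int2: "integrable lborel (\<lambda>z. \<rho> z * (norm (g z))\<^sup>2)"
  shows "(norm (\<integral>z. \<rho> z *\<^sub>R g z \<partial>lborel))\<^sup>2 \<le> (\<integral>z. \<rho> z * (norm (g z))\<^sup>2 \<partial>lborel)"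
    and "integrable lborel (\<lambda>z. \<rho> z *\<^sub>R g z)"
proof -
  have [measurable]: "\<rho> \<in> borel_measurable borel" using \<rho>(1) by auto
  show int1: "integrable lborel (\<lambda>z. \<rho> z *\<^sub>R g z)"
  proof (rule Bochner_Integration.integrable_bound[OF Bochner_Integration.integrable_add[OF \<rho>(1) int2]])
    show "AE z in lborel. norm (\<rho> z *\<^sub>R g z) \<le> norm (\<rho> z + \<rho> z * (norm (g z))\<^sup>2)"
    proof (rule AE_I2)
      fix z
      have "norm (g z) \<le> 1 + (norm (g z))\<^sup>2"
        using sum_squares_bound[of 1 "norm (g z)"] norm_ge_zero[of "g z"]
        unfolding power_one mult_1_right by linarith
      then have "\<rho> z * norm (g z) \<le> \<rho> z * (1 + (norm (g z))\<^sup>2)"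
        using \<rho>(2) by (rule mult_left_mono)
      then show "norm (\<rho> z *\<^sub>R g z) \<le> norm (\<rho> z + \<rho> z * (norm (g z))\<^sup>2)"
        using \<rho>(2)[of z] by (simp add: algebra_simps)
    qed
  qed simp
  let ?D = "\<integral>z. \<rho> z *\<^sub>R g z \<partial>lborel"
  have "(norm ?D)\<^sup>2 = (\<integral>z. (\<rho> z *\<^sub>R g z) \<bullet> ?D \<partial>lborel)"
    using int1 by (simp only: power2_norm_eq_inner integral_inner_left)
  also have "\<dots> \<le> (\<integral>z. (1/2) * (norm ?D)\<^sup>2 * \<rho> z + (1/2) * (\<rho> z * (norm (g z))\<^sup>2) \<partial>lborel)"
  proof (rule integral_mono)
    fix z
    have "g z \<bullet> ?D \<le> (1/2) * (norm ?D)\<^sup>2 + (1/2) * (norm (g z))\<^sup>2"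
      using norm_cauchy_schwarz[of "g z" ?D] sum_squares_bound[of "norm (g z)" "norm ?D"] by simp
    then have "\<rho> z * (g z \<bullet> ?D) \<le> \<rho> z * ((1/2) * (norm ?D)\<^sup>2 + (1/2) * (norm (g z))\<^sup>2)"
      using \<rho>(2) by (rule mult_left_mono)
    then show "(\<rho> z *\<^sub>R g z) \<bullet> ?D \<le> (1/2) * (norm ?D)\<^sup>2 * \<rho> z + (1/2) * (\<rho> z * (norm (g z))\<^sup>2)"
      by (simp add: algebra_simps)
  qed (intro integrable_inner_left int1 Bochner_Integration.integrable_add integrable_mult_right int2 \<rho>(1))+
  also have "\<dots> = (1/2) * (norm ?D)\<^sup>2 + (1/2) * (\<integral>z. \<rho> z * (norm (g z))\<^sup>2 \<partial>lborel)"
    by (simp only: Bochner_Integration.integral_add integrable_mult_right integral_mult_right_zero int2 \<rho>(1,3) mult_1_right)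
  finally show "(norm ?D)\<^sup>2 \<le> (\<integral>z. \<rho> z * (norm (g z))\<^sup>2 \<partial>lborel)" by simp
qed

text \<open>By Jensen's inequality and Tonelli's theorem the squared error is at most an average of
  \<open>sqn (\<lambda>x. f (x - z) - f x)\<close> over shifts of length below
  \<open>1 / (n + 1)\<close>. Continuity of translations makes it small, while the crude bound
  \<open>4 * sqn f\<close> already shows that the mollification is square integrable.\<close>

lemma mollify_L2:
  fixes f :: "'a::euclidean_space \<Rightarrow> 'b::euclidean_space"
  assumes f: "f \<in> L2" and fi: "integrable lborel f"
  shows "conv (mollifier n) f \<in> L2" and "(\<lambda>n. sqn (\<lambda>x. conv (mollifier n) f x - f x)) \<longlonglongrightarrow> 0"
proof -
  have [measurable]: "f \<in> borel_measurable borel" using f by auto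
  have cm [measurable]: "conv (mollifier n) f \<in> borel_measurable borel" for n
    by (intro borel_measurable_continuous_onI conv_continuous[OF mollifier_test fi])
  have pw: "ennreal ((norm (conv (mollifier n) f x - f x))\<^sup>2) \<le>
      (\<integral>\<^sup>+z. ennreal (mollifier n z * (norm (f (x - z) - f x))\<^sup>2) \<partial>lborel)" for n x
  proof -
    obtain M where M: "M \<ge> 0" "\<And>x::'a. \<bar>mollifier n x\<bar> \<le> M" by (rule test_functions_bounded[OF mollifier_test]) blast
    have L2r: "integrable lborel (\<lambda>z. (norm (f (x - z)))\<^sup>2)"
      using L2_integrable[OF f] by (subst (asm) lborel_reflect[of x]) (simp add: integrable_distr_eq)
    have int2: "integrable lborel (\<lambda>z. mollifier n z * (norm (f (x - z) - f x))\<^sup>2)"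
    proof (rule Bochner_Integration.integrable_bound[where f="\<lambda>z. M * (2 * (norm (f (x - z)))\<^sup>2) + mollifier n z * (2 * (norm (f x))\<^sup>2)"])
      show "AE z in lborel. norm (mollifier n z * (norm (f (x - z) - f x))\<^sup>2)
        \<le> norm (M * (2 * (norm (f (x - z)))\<^sup>2) + mollifier n z * (2 * (norm (f x))\<^sup>2))"
      proof (rule AE_I2)
        fix z
        have "mollifier n z * (norm (f (x - z) - f x))\<^sup>2 \<le> mollifier n z * (2 * (norm (f (x - z)))\<^sup>2 + 2 * (norm (f x))\<^sup>2)"
          by (intro mult_left_mono norm_diff_sq_le mollifier_nonneg)
        also have "\<dots> \<le> M * (2 * (norm (f (x - z)))\<^sup>2) + mollifier n z * (2 * (norm (f x))\<^sup>2)"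
          unfolding distrib_left using M(2)[of z] by (intro add_right_mono mult_right_mono) auto
        finally show "norm (mollifier n z * (norm (f (x - z) - f x))\<^sup>2)
          \<le> norm (M * (2 * (norm (f (x - z)))\<^sup>2) + mollifier n z * (2 * (norm (f x))\<^sup>2))"
          using mollifier_nonneg[of n z] by simp
      qed
    qed (intro Bochner_Integration.integrable_add integrable_mult_right integrable_mult_left L2r mollifier_integrable | simp)+
    have "conv (mollifier n) f x = (\<integral>z. mollifier n z *\<^sub>R f (x - z) \<partial>lborel)"
      using lborel_integral_reflect[of "\<lambda>z. mollifier n z *\<^sub>R f (x - z)" x] by (simp add: conv_def)
    moreover have "integrable lborel (\<lambda>z. mollifier n z *\<^sub>R f (x - z))"
    proof -
      have "integrable lborel (\<lambda>z. mollifier n z *\<^sub>R (f (x - z) - f x) + mollifier n z *\<^sub>R f x)"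
        using norm_average_le(2)[OF mollifier_integrable mollifier_nonneg mollifier_integral _ int2]
        by (intro Bochner_Integration.integrable_add integrable_scaleR_left mollifier_integrable) auto
      then show ?thesis by (simp add: algebra_simps)
    qed
    moreover have "integrable lborel (\<lambda>z::'a. mollifier n z *\<^sub>R f x)"
      by (intro integrable_scaleR_left mollifier_integrable)
    moreover have "integral\<^sup>L lborel (\<lambda>z::'a. mollifier n z *\<^sub>R f x) = f x"
      using integral_scaleR_left[of "f x" lborel "mollifier n :: 'a \<Rightarrow> real"] mollifier_integrable[of n, where 'a='a]
        mollifier_integral[of n, where 'a='a] by simp
    ultimately have "conv (mollifier n) f x - f x = (\<integral>z. mollifier n z *\<^sub>R (f (x - z) - f x) \<partial>lborel)"
      by (simp only: scaleR_diff_right Bochner_Integration.integral_diff)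
    then have "(norm (conv (mollifier n) f x - f x))\<^sup>2 \<le> (\<integral>z. mollifier n z * (norm (f (x - z) - f x))\<^sup>2 \<partial>lborel)"
      using norm_average_le(1)[OF mollifier_integrable mollifier_nonneg mollifier_integral _ int2] by simp
    then show ?thesis
      using nn_integral_eq_integral[OF int2] by (simp add: mollifier_nonneg ennreal_leI)
  qed
  have main: "(\<integral>\<^sup>+x. ennreal ((norm (conv (mollifier n) f x - f x))\<^sup>2) \<partial>lborel) \<le> ennreal e"
    if "\<And>z. norm z < 1 / (real n + 1) \<Longrightarrow> sqn (\<lambda>x. f (x - z) - f x) \<le> e" for n e
  proof -
    have "(\<integral>\<^sup>+x. ennreal ((norm (conv (mollifier n) f x - f x))\<^sup>2) \<partial>lborel)
      \<le> (\<integral>\<^sup>+x. \<integral>\<^sup>+z. ennreal (mollifier n z * (norm (f (x - z) - f x))\<^sup>2) \<partial>lborel \<partial>lborel)"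
      by (intro nn_integral_mono pw)
    also have "\<dots> = (\<integral>\<^sup>+z. \<integral>\<^sup>+x. ennreal (mollifier n z * (norm (f (x - z) - f x))\<^sup>2) \<partial>lborel \<partial>lborel)"
      by (rule lborel_pair.Fubini') measurable
    also have "\<dots> \<le> (\<integral>\<^sup>+z. ennreal (mollifier n z * e) \<partial>(lborel :: 'a measure))"
    proof (rule nn_integral_mono)
      fix z :: 'a
      have "(\<integral>\<^sup>+x. ennreal (mollifier n z * (norm (f (x - z) - f x))\<^sup>2) \<partial>lborel)
        = ennreal (mollifier n z) * (\<integral>\<^sup>+x. ennreal ((norm (f (x - z) - f x))\<^sup>2) \<partial>lborel)"
        by (simp add: ennreal_mult' mollifier_nonneg nn_integral_cmult)
      also have "\<dots> = ennreal (mollifier n z) * ennreal (sqn (\<lambda>x. f (x - z) - f x))"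
        by (subst L2_nn_integral[OF L2_diff[OF L2_translate[OF f] f]]) simp
      also have "\<dots> \<le> ennreal (mollifier n z * e)"
      proof (cases "norm z < 1 / (real n + 1)")
        case True
        then show ?thesis
          by (subst ennreal_mult'[symmetric]) (auto intro!: ennreal_leI mult_left_mono that simp: mollifier_nonneg)
      qed (simp add: mollifier_zero)
      finally show "(\<integral>\<^sup>+x. ennreal (mollifier n z * (norm (f (x - z) - f x))\<^sup>2) \<partial>lborel) \<le> ennreal (mollifier n z * e)" .
    qed
    also have "\<dots> = ennreal (integral\<^sup>L lborel (\<lambda>z::'a. mollifier n z * e))"
    proof (rule nn_integral_eq_integral)
      have "0 \<le> e" by (rule order_trans[OF sqn_nonneg that[of 0]]) simp
      then show "AE z::'a in lborel. 0 \<le> mollifier n z * e" by (simp add: mollifier_nonneg)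
    qed (intro integrable_mult_left mollifier_integrable)
    also have "(integral\<^sup>L lborel (\<lambda>z::'a. mollifier n z * e)) = e"
      using mollifier_integral[of n, where 'a='a] by simp
    finally show ?thesis .
  qed
  have D: "(\<lambda>x. conv (mollifier n) f x - f x) \<in> L2" for n
  proof (rule L2I_nn_integral)
    have "sqn (\<lambda>x. f (x - z) - f x) \<le> 4 * sqn f" for z
      using sqn_diff_le[OF L2_translate[OF f] f, of z] by (simp add: sqn_translate[OF f])
    from main[of n, OF this]
    show "(\<integral>\<^sup>+x. ennreal ((norm (conv (mollifier n) f x - f x))\<^sup>2) \<partial>lborel) < \<infinity>"
      by (auto simp: less_top[symmetric] top_unique)
  qed measurable
  show "conv (mollifier n) f \<in> L2"
    using L2_add[OF D[of n] f] by simp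
  show "(\<lambda>n. sqn (\<lambda>x. conv (mollifier n) f x - f x)) \<longlonglongrightarrow> 0"
  proof (rule LIMSEQ_I)
    fix e :: real assume "e > 0"
    then obtain \<delta> where \<delta>: "\<delta> > 0" "\<And>z. norm z < \<delta> \<Longrightarrow> sqn (\<lambda>x. f (x - z) - f x) < e/2"
      using transl_cont_eps[OF f, of "e/2"] by auto
    obtain N where "inverse (real (Suc N)) < \<delta>"
      using reals_Archimedean[OF \<delta>(1)] by blast
    then have N: "1 / (real N + 1) < \<delta>"
      by (simp add: inverse_eq_divide add.commute)
    have "norm (sqn (\<lambda>x. conv (mollifier n) f x - f x) - 0) < e" if "n \<ge> N" for n
    proof -
      have "1 / (real n + 1) \<le> 1 / (real N + 1)" using that by (simp add: field_simps)
      then have "(\<integral>\<^sup>+x. ennreal ((norm (conv (mollifier n) f x - f x))\<^sup>2) \<partial>lborel) \<le> ennreal (e/2)"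
        using N by (intro main less_imp_le[OF \<delta>(2)]) simp
      then have "sqn (\<lambda>x. conv (mollifier n) f x - f x) \<le> e/2"
        unfolding L2_nn_integral[OF D] using \<open>e > 0\<close> by (simp only: ennreal_le_iff)
      then show ?thesis
        using \<open>e > 0\<close> by (simp only: diff_zero real_norm_def abs_of_nonneg[OF sqn_nonneg])
    qed
    then show "\<exists>no. \<forall>n\<ge>no. norm (sqn (\<lambda>x. conv (mollifier n) f x - f x) - 0) < e"
      by (intro exI[of _ N] allI impI)
  qed
qed

section \<open>Integration by parts\<close>

lemma integrable_continuous_bounded_support:
  fixes f :: "'a::euclidean_space \<Rightarrow> 'b::euclidean_space"
  assumes c: "continuous_on UNIV f" and z: "\<And>x. norm x > r \<Longrightarrow> f x = 0"
  shows "integrable lborel f"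
proof -
  have "compact (f ` cball 0 r)"
    by (intro compact_continuous_image continuous_on_subset[OF c]) auto
  from compact_imp_bounded[OF this]
  obtain M where M: "\<And>y. y \<in> f ` cball 0 r \<Longrightarrow> norm y \<le> M"
    unfolding bounded_iff by blast
  have [measurable]: "f \<in> borel_measurable borel"
    using c by (rule borel_measurable_continuous_onI)
  show ?thesis
  proof (rule Bochner_Integration.integrable_bound[where f="\<lambda>x. M * indicator (cball 0 r) x"])
    show "integrable lborel (\<lambda>x::'a. M * indicator (cball 0 r) x :: real)"
      using emeasure_compact_finite[OF compact_cball[of "0::'a" r]]
      by (intro integrable_mult_right integrable_real_indicator) auto
    show "AE x in lborel. norm (f x) \<le> norm (M * indicator (cball 0 r) x)"
    proof (rule AE_I2)
      fix x :: 'a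
      show "norm (f x) \<le> norm (M * indicator (cball 0 r) x)"
      proof (cases "norm x \<le> r")
        case True
        then have "norm (f x) \<le> M" by (intro M imageI) simp
        then show ?thesis using True by simp
      next
        case False
        then show ?thesis using z[of x] by simp
      qed
    qed
  qed simp
qed

text \<open>Instead of integrating one variable after the other, translation invariance is
  differentiated: difference quotients of \<open>F\<close> have integral zero, and the mean value
  theorem dominates them by a bound for the derivative on a fixed ball.\<close>

lemma integral_pderiv_zero:
  fixes F :: "'a::euclidean_space \<Rightarrow> real"
  assumes D: "\<And>x. (F has_derivative F' x) (at x)"
    and c: "continuous_on UNIV (\<lambda>x. F' x b)" and z: "\<And>x. norm x > r \<Longrightarrow> F x = 0"
  shows "integrable lborel (\<lambda>x. F' x b)" "(\<integral>x. F' x b \<partial>lborel) = 0"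
proof -
  have z': "F' x b = 0" if "norm x > r" for x
  proof -
    have "open {x::'a. norm x > r}" by (intro open_Collect_less continuous_intros)
    then have "((\<lambda>x. 0) has_derivative F' x) (at x)"
      by (rule has_derivative_transform_within_open[OF D]) (use that z in auto)
    from has_derivative_unique[OF this has_derivative_const] have "F' x = (\<lambda>h. 0)" .
    then show ?thesis by simp
  qed
  show int: "integrable lborel (\<lambda>x. F' x b)"
    by (rule integrable_continuous_bounded_support[OF c z'])
  have cF: "continuous_on UNIV F"
    by (intro continuous_at_imp_continuous_on ballI has_derivative_continuous[OF D])
  have [measurable]: "F \<in> borel_measurable borel"
    using cF by (rule borel_measurable_continuous_onI)
  have intF: "integrable lborel F"
    by (rule integrable_continuous_bounded_support[OF cF z])
  have "compact ((\<lambda>x. F' x b) ` cball 0 r)"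
    by (intro compact_continuous_image continuous_on_subset[OF c]) auto
  from compact_imp_bounded[OF this]
  obtain M0 where M0: "\<And>y. y \<in> (\<lambda>x. F' x b) ` cball 0 r \<Longrightarrow> norm y \<le> M0"
    unfolding bounded_iff by blast
  define M where "M = max M0 0"
  have M: "\<bar>F' x b\<bar> \<le> M" for x
  proof (cases "norm x \<le> r")
    case True
    then have "norm (F' x b) \<le> M0" by (intro M0 imageI) simp
    then show ?thesis by (simp add: M_def)
  next
    case False
    then show ?thesis using z'[of x] by (simp add: M_def)
  qed
  \<comment> \<open>Steps of length at most 1 keep every difference quotient supported in the ball
    of radius \<open>r + norm b\<close>.\<close>
  define t where "t n = inverse (real (Suc n))" for n
  have t: "t n > 0" "t n \<le> 1" for n by (simp_all add: t_def inverse_le_1_iff)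
  have line: "((\<lambda>s. F (x + s *\<^sub>R b)) has_real_derivative F' (x + s *\<^sub>R b) b) (at s)" for x s
  proof -
    have "((\<lambda>s. F (x + s *\<^sub>R b)) has_derivative (\<lambda>h. F' (x + s *\<^sub>R b) (h *\<^sub>R b))) (at s)"
      by (rule has_derivative_compose[where f="\<lambda>s. x + s *\<^sub>R b" and f'="\<lambda>h. h *\<^sub>R b", OF _ D])
        (auto intro!: derivative_eq_intros)
    moreover have "F' (x + s *\<^sub>R b) (h *\<^sub>R b) = F' (x + s *\<^sub>R b) b * h" for h
      using linear_scale[OF has_derivative_linear[OF D]] by simp
    ultimately show ?thesis by (simp add: has_field_derivative_def)
  qed
  let ?q = "\<lambda>n x. (F (x + t n *\<^sub>R b) - F x) / t n"
  have lim: "(\<lambda>n. \<integral>x. ?q n x \<partial>lborel) \<longlonglongrightarrow> (\<integral>x. F' x b \<partial>lborel)"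
  proof (rule integral_dominated_convergence[where w="\<lambda>x. M * indicator (cball 0 (r + norm b)) x"])
    show "integrable lborel (\<lambda>x::'a. M * indicator (cball 0 (r + norm b)) x)"
      using emeasure_compact_finite[OF compact_cball[of "0::'a" "r + norm b"]]
      by (intro integrable_mult_right integrable_real_indicator) auto
    show "AE x in lborel. (\<lambda>n. ?q n x) \<longlonglongrightarrow> F' x b"
    proof (rule AE_I2)
      fix x
      have "(\<lambda>h. (F (x + (0 + h) *\<^sub>R b) - F (x + 0 *\<^sub>R b)) / h) \<midarrow>0\<rightarrow> F' (x + 0 *\<^sub>R b) b"
        using line[of x 0] unfolding DERIV_def .
      then have lim: "(\<lambda>h. (F (x + h *\<^sub>R b) - F x) / h) \<midarrow>0\<rightarrow> F' x b" by simp
      have "filterlim t (at 0) sequentially"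
        unfolding t_def using LIMSEQ_inverse_real_of_nat by (auto simp: filterlim_at)
      from filterlim_compose[OF lim this] show "(\<lambda>n. ?q n x) \<longlonglongrightarrow> F' x b" .
    qed
    fix n
    show "AE x in lborel. norm (?q n x) \<le> M * indicator (cball 0 (r + norm b)) x"
    proof (rule AE_I2)
      fix x
      show "norm (?q n x) \<le> M * indicator (cball 0 (r + norm b)) x"
      proof (cases "norm x \<le> r + norm b")
        case True
        have "\<exists>s>0. s < t n \<and> F (x + t n *\<^sub>R b) - F (x + 0 *\<^sub>R b) = (t n - 0) * F' (x + s *\<^sub>R b) b"
          by (rule MVT2[of 0 "t n" "\<lambda>s. F (x + s *\<^sub>R b)" "\<lambda>s. F' (x + s *\<^sub>R b) b", OF t(1) line])
        then obtain s where "F (x + t n *\<^sub>R b) - F (x + 0 *\<^sub>R b) = (t n - 0) * F' (x + s *\<^sub>R b) b"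
          by blast
        then have "?q n x = F' (x + s *\<^sub>R b) b" using t(1)[of n] by simp
        then show ?thesis using M True by simp
      next
        case False
        have "norm (t n *\<^sub>R b) \<le> norm b" using t[of n] by (simp add: mult_left_le_one_le)
        then have "norm (x + t n *\<^sub>R b) > r" using False norm_diff_ineq[of x "t n *\<^sub>R b"] by linarith
        moreover have "norm x > r" using False norm_ge_zero[of b] by linarith
        ultimately show ?thesis using z by (simp add: False)
      qed
    qed
  qed (use int in auto)
  have zero: "(\<integral>x. ?q n x \<partial>lborel) = 0" for n
  proof -
    have "(\<integral>x. F (x + t n *\<^sub>R b) \<partial>lborel) = (\<integral>x. F x \<partial>lborel)"
      using lborel_integral_translate[of F "- (t n *\<^sub>R b)"] by simp
    moreover have "integrable lborel (\<lambda>x. F (x + t n *\<^sub>R b))"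
      using lborel_integrable_translate[OF intF, of "- (t n *\<^sub>R b)"] by simp
    ultimately show ?thesis using intF by simp
  qed
  have "(\<lambda>n. 0) \<longlonglongrightarrow> (\<integral>x. F' x b \<partial>lborel)"
    using lim unfolding zero .
  then show "(\<integral>x. F' x b \<partial>lborel) = 0" by (simp add: LIMSEQ_const_iff)
qed

lemma test_functions_support_bound:
  assumes "\<phi> \<in> test_functions U"
  obtains r where "\<And>x. norm x > r \<Longrightarrow> \<phi> x = 0" "\<And>x v. norm x > r \<Longrightarrow> pderiv_dir v \<phi> x = 0"
proof -
  have "compact (closure {x. \<phi> x \<noteq> 0})"
    using assms unfolding test_functions_def by blast
  from compact_imp_bounded[OF this]
  obtain r where r: "\<And>x. x \<in> closure {x. \<phi> x \<noteq> 0} \<Longrightarrow> norm x \<le> r"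
    unfolding bounded_iff by blast
  have "x \<notin> closure {x. \<phi> x \<noteq> 0}" if "norm x > r" for x
    using r[of x] that by linarith
  from that[OF test_functions_outside(1)[OF assms this] test_functions_outside(2)[OF assms this]]
  show ?thesis .
qed

lemma wderiv_classical:
  fixes f :: "'a::euclidean_space \<Rightarrow> 'b::euclidean_space"
  assumes D: "\<And>x. (f has_derivative f' x) (at x)"
    and c: "continuous_on UNIV (\<lambda>x. f' x b)" and b: "b \<in> Basis"
  shows "wderiv U b f (\<lambda>x. f' x b)"
  unfolding wderiv_def
proof
  fix \<phi> assume \<phi>: "\<phi> \<in> test_functions U"
  obtain r where r: "\<And>x. norm x > r \<Longrightarrow> \<phi> x = 0" "\<And>x v. norm x > r \<Longrightarrow> pderiv_dir v \<phi> x = 0"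
    by (rule test_functions_support_bound[OF \<phi>]) blast
  have cf: "continuous_on UNIV f"
    by (intro continuous_at_imp_continuous_on ballI has_derivative_continuous[OF D])
  note c\<phi> = test_functions_continuous[OF \<phi>] test_functions_continuous[OF test_functions_pderiv[OF \<phi> b]]
  have i1: "integrable lborel (\<lambda>x. pderiv_dir b \<phi> x *\<^sub>R f x)"
    by (rule integrable_continuous_bounded_support[where r=r]) (use r in \<open>auto intro!: continuous_intros c\<phi> cf\<close>)
  have i2: "integrable lborel (\<lambda>x. \<phi> x *\<^sub>R f' x b)"
    by (rule integrable_continuous_bounded_support[where r=r]) (use r in \<open>auto intro!: continuous_intros c\<phi> c\<close>)
  have "((\<integral>x. pderiv_dir b \<phi> x *\<^sub>R f x \<partial>lborel) + (\<integral>x. \<phi> x *\<^sub>R f' x b \<partial>lborel)) \<bullet> e = 0" for e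
  proof -
    let ?F' = "\<lambda>x v. \<phi> x * (f' x v \<bullet> e) + pderiv_dir v \<phi> x * (f x \<bullet> e)"
    have "(\<integral>x. ?F' x b \<partial>lborel) = 0"
    proof (rule integral_pderiv_zero(2)[where F="\<lambda>x. \<phi> x * (f x \<bullet> e)" and r=r])
      show "((\<lambda>x. \<phi> x * (f x \<bullet> e)) has_derivative ?F' x) (at x)" for x
        by (intro has_derivative_mult has_derivative_inner_left test_functions_has_derivative[OF \<phi>] D)
      show "continuous_on UNIV (\<lambda>x. ?F' x b)"
        by (intro continuous_intros c\<phi> cf c)
    qed (use r in auto)
    then have "0 = (\<integral>x. (\<phi> x *\<^sub>R f' x b) \<bullet> e + (pderiv_dir b \<phi> x *\<^sub>R f x) \<bullet> e \<partial>lborel)"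
      by (simp only: inner_scaleR_left)
    also have "\<dots> = (\<integral>x. \<phi> x *\<^sub>R f' x b \<partial>lborel) \<bullet> e + (\<integral>x. pderiv_dir b \<phi> x *\<^sub>R f x \<partial>lborel) \<bullet> e"
      using i1 i2 by (simp only: Bochner_Integration.integral_add integrable_inner_left integral_inner_left)
    finally show ?thesis by (simp only: inner_add_left add.commute)
  qed
  \<comment> \<open>The sum of the two integrals is orthogonal to every vector; testing it with
    itself shows that it vanishes.\<close>
  note this[of "(\<integral>x. pderiv_dir b \<phi> x *\<^sub>R f x \<partial>lborel) + (\<integral>x. \<phi> x *\<^sub>R f' x b \<partial>lborel)"]
  then have "(\<integral>x. pderiv_dir b \<phi> x *\<^sub>R f x \<partial>lborel) + (\<integral>x. \<phi> x *\<^sub>R f' x b \<partial>lborel) = 0"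
    by (simp only: inner_eq_zero_iff)
  then show "(\<integral>x. pderiv_dir b \<phi> x *\<^sub>R f x \<partial>lborel) = - (\<integral>x. \<phi> x *\<^sub>R f' x b \<partial>lborel)"
    by (simp only: eq_neg_iff_add_eq_0)
qed

section \<open>The isoperimetric inequality for closed curves\<close>

text \<open>The Riccati trick: \<open>w = - k * tan (k * (t - c))\<close> solves
  \<open>w' = - k\<^sup>2 - w\<^sup>2\<close>. Therefore the integrand exceeds the derivative of
  \<open>w * v\<^sup>2\<close> by the perfect square \<open>(v' - w * v)\<^sup>2\<close>, and only
  boundary terms remain.\<close>

lemma tan_comparison:
  fixes v v' :: "real \<Rightarrow> real"
  assumes v: "\<And>t. (v has_real_derivative v' t) (at t)" and c: "continuous_on UNIV v'"
    and le: "l \<le> u" and k: "\<And>t. t \<in> {l..u} \<Longrightarrow> \<bar>k * (t - c)\<bar> < pi / 2"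
  shows "k * (v l)\<^sup>2 * tan (k * (l - c)) - k * (v u)\<^sup>2 * tan (k * (u - c))
    \<le> integral {l..u} (\<lambda>t. (v' t)\<^sup>2 - k\<^sup>2 * (v t)\<^sup>2)"
proof (rule has_integral_le)
  let ?g = "\<lambda>t. - k * (v t)\<^sup>2 * tan (k * (t - c))"
  let ?g' = "\<lambda>t. - k * (2 * v t * v' t) * tan (k * (t - c)) - k\<^sup>2 * (v t)\<^sup>2 * (1 + (tan (k * (t - c)))\<^sup>2)"
  have cos: "cos (k * (t - c)) \<noteq> 0" if "t \<in> {l..u}" for t
  proof -
    have "0 < cos (k * (t - c))"
      by (rule cos_gt_zero_pi) (use k[OF that] in linarith)+
    then show ?thesis by simp
  qed
  have "(?g has_real_derivative ?g' t) (at t)" if "t \<in> {l..u}" for t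
  proof -
    have "(tan has_real_derivative 1 + (tan (k * (t - c)))\<^sup>2) (at (k * (t - c)))"
      using DERIV_tan[OF cos[OF that]] unfolding tan_sec[OF cos[OF that]] power_inverse .
    moreover have "((\<lambda>t. k * (t - c)) has_real_derivative k) (at t)"
      by (auto intro!: derivative_eq_intros)
    ultimately have A: "((\<lambda>t. tan (k * (t - c))) has_real_derivative (1 + (tan (k * (t - c)))\<^sup>2) * k) (at t)"
      by (rule DERIV_chain2)
    have B: "((\<lambda>t. - k * (v t)\<^sup>2) has_real_derivative - k * (2 * v t * v' t)) (at t)"
      by (auto intro!: derivative_eq_intros v)
    show ?thesis
      by (rule DERIV_cong[OF DERIV_mult[OF B A]]) (simp add: power2_eq_square algebra_simps)
  qed
  then have "(?g' has_integral (?g u - ?g l)) {l..u}"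
    using le by (intro fundamental_theorem_of_calculus)
      (auto simp flip: has_real_derivative_iff_has_vector_derivative intro: has_field_derivative_at_within)
  then show "(?g' has_integral (k * (v l)\<^sup>2 * tan (k * (l - c)) - k * (v u)\<^sup>2 * tan (k * (u - c)))) {l..u}"
    by simp
  have "continuous_on {l..u} v"
    using v by (intro DERIV_continuous_on) (rule has_field_derivative_at_within)
  then have "continuous_on {l..u} (\<lambda>t. (v' t)\<^sup>2 - k\<^sup>2 * (v t)\<^sup>2)"
    by (intro continuous_intros continuous_on_subset[OF c]) auto
  then show "((\<lambda>t. (v' t)\<^sup>2 - k\<^sup>2 * (v t)\<^sup>2) has_integral integral {l..u} (\<lambda>t. (v' t)\<^sup>2 - k\<^sup>2 * (v t)\<^sup>2)) {l..u}"
    by (intro integrable_integral integrable_continuous_interval)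
  fix t
  have "0 \<le> (v' t + v t * (k * tan (k * (t - c))))\<^sup>2" by simp
  then show "?g' t \<le> (v' t)\<^sup>2 - k\<^sup>2 * (v t)\<^sup>2"
    by (simp add: power2_eq_square algebra_simps)
qed

text \<open>Antiperiodicity forces a zero \<open>a\<close>. Continued antiperiodically,
  \<open>v\<close> vanishes at both ends of an interval of length \<open>2 * pi\<close>, whose first
  Dirichlet eigenvalue is 1/4; no condition on the mean is needed, in contrast to the periodic
  case.\<close>

lemma wirtinger_antiperiodic:
  fixes v v' :: "real \<Rightarrow> real"
  assumes v: "\<And>t. (v has_real_derivative v' t) (at t)" and c: "continuous_on UNIV v'"
    and anti: "v (2 * pi) = - v 0"
  shows "integral {0..2*pi} (\<lambda>t. (v t)\<^sup>2) / 4 \<le> integral {0..2*pi} (\<lambda>t. (v' t)\<^sup>2)"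
proof -
  have cv: "continuous_on UNIV v"
    using v by (intro DERIV_continuous_on) (rule has_field_derivative_at_within)
  have ci: "continuous_on {l..u} v" "continuous_on {l..u} v'" for l u
    using cv c by (auto intro: continuous_on_subset)
  obtain a where a: "0 \<le> a" "a \<le> 2 * pi" "v a = 0"
  proof (cases "v 0 \<le> 0")
    case True
    then show ?thesis
      using IVT'[of v 0 0 "2 * pi"] anti ci that by auto
  next
    case False
    then show ?thesis
      using IVT2'[of v "2 * pi" 0 0] anti ci that by auto
  qed
  have int: "(\<lambda>t. (v' t)\<^sup>2 - k\<^sup>2 * (v t)\<^sup>2) integrable_on {l..u}" for k l u
    by (intro integrable_continuous_interval continuous_intros ci)
  have int2: "(\<lambda>t. (v' t)\<^sup>2) integrable_on {l..u}" "(\<lambda>t. k * (v t)\<^sup>2) integrable_on {l..u}" for k l u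
    by (intro integrable_continuous_interval continuous_intros ci)+
  \<comment> \<open>For \<open>k < 1/2\<close> the tangent has no pole within distance
    \<open>pi\<close> of its centre. The sharp value 1/2 is reached only as a limit, below.\<close>
  have key: "k\<^sup>2 * integral {0..2*pi} (\<lambda>t. (v t)\<^sup>2) \<le> integral {0..2*pi} (\<lambda>t. (v' t)\<^sup>2)"
    if k: "0 < k" "k < 1/2" for k
  proof -
    have small: "\<bar>k * s\<bar> < pi / 2" if "\<bar>s\<bar> \<le> pi" for s
    proof -
      have "\<bar>k * s\<bar> \<le> k * pi" using k that by (simp add: abs_mult)
      also have "\<dots> < (1/2) * pi" using k by (intro mult_strict_right_mono) auto
      finally show ?thesis by simp
    qed
    \<comment> \<open>The centres \<open>a + pi\<close> and \<open>a - pi\<close> agree modulo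
      \<open>2 * pi\<close>, so the two pieces form one comparison on the continued function.
      Boundary terms at \<open>a\<close> vanish with \<open>v a\<close>; those at 0 and
      \<open>2 * pi\<close> cancel because \<open>v\<close> takes opposite values there.\<close>
    have 1: "k * (v a)\<^sup>2 * tan (k * (a - (a + pi))) - k * (v (2*pi))\<^sup>2 * tan (k * (2*pi - (a + pi)))
      \<le> integral {a..2*pi} (\<lambda>t. (v' t)\<^sup>2 - k\<^sup>2 * (v t)\<^sup>2)"
      using a by (intro tan_comparison v c small) (auto simp: abs_le_iff)
    have 2: "k * (v 0)\<^sup>2 * tan (k * (0 - (a - pi))) - k * (v a)\<^sup>2 * tan (k * (a - (a - pi)))
      \<le> integral {0..a} (\<lambda>t. (v' t)\<^sup>2 - k\<^sup>2 * (v t)\<^sup>2)"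
      using a by (intro tan_comparison v c small) (auto simp: abs_le_iff)
    have "integral {0..a} (\<lambda>t. (v' t)\<^sup>2 - k\<^sup>2 * (v t)\<^sup>2) + integral {a..2*pi} (\<lambda>t. (v' t)\<^sup>2 - k\<^sup>2 * (v t)\<^sup>2)
      = integral {0..2*pi} (\<lambda>t. (v' t)\<^sup>2 - k\<^sup>2 * (v t)\<^sup>2)"
      using a int by (intro Henstock_Kurzweil_Integration.integral_combine) auto
    moreover have "2*pi - (a + pi) = pi - a" "0 - (a - pi) = pi - a" by auto
    moreover have "(v (2*pi))\<^sup>2 = (v 0)\<^sup>2" using anti by simp
    ultimately have "0 \<le> integral {0..2*pi} (\<lambda>t. (v' t)\<^sup>2 - k\<^sup>2 * (v t)\<^sup>2)"
      using 1 2 a by simp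
    also have "\<dots> = integral {0..2*pi} (\<lambda>t. (v' t)\<^sup>2) - integral {0..2*pi} (\<lambda>t. k\<^sup>2 * (v t)\<^sup>2)"
      by (intro Henstock_Kurzweil_Integration.integral_diff int2)
    finally show ?thesis by simp
  qed
  show ?thesis
  proof (rule field_le_mult_one_interval)
    fix z :: real assume z: "0 < z" "z < 1"
    have "sqrt z < sqrt 1" using z by (intro real_sqrt_less_mono) simp
    then have "0 < sqrt z / 2" "sqrt z / 2 < 1/2" using z by auto
    from key[OF this] show "z * (integral {0..2*pi} (\<lambda>t. (v t)\<^sup>2) / 4) \<le> integral {0..2*pi} (\<lambda>t. (v' t)\<^sup>2)"
      using z by (simp add: power_divide)
  qed
qed

text \<open>
  In complex notation the curve \<open>p + \<i> q\<close> is multiplied by \<open>exp (- \<i> t / 2)\<close>; this makes it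
  antiperiodic and turns the area functional into the inequality above.
\<close>

lemma isoperimetric:
  fixes p q p' q' :: "real \<Rightarrow> real"
  assumes p: "\<And>t. (p has_real_derivative p' t) (at t)" "continuous_on UNIV p'" "p (2 * pi) = p 0"
    and q: "\<And>t. (q has_real_derivative q' t) (at t)" "continuous_on UNIV q'" "q (2 * pi) = q 0"
  shows "0 \<le> integral {0..2*pi} (\<lambda>t. (p' t)\<^sup>2 + (q' t)\<^sup>2 - (p t * q' t - q t * p' t))"
proof -
  define v w where "v t = p t * cos (t/2) + q t * sin (t/2)"
    and "w t = q t * cos (t/2) - p t * sin (t/2)" for t
  define v' w' where "v' t = p' t * cos (t/2) + q' t * sin (t/2) + w t / 2"
    and "w' t = q' t * cos (t/2) - p' t * sin (t/2) - v t / 2" for t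
  have cp: "continuous_on S p" "continuous_on S q" "continuous_on S p'" "continuous_on S q'" for S
    using p q by (auto intro: continuous_on_subset[OF DERIV_continuous_on] has_field_derivative_at_within continuous_on_subset)
  have dv: "(v has_real_derivative v' t) (at t)" for t
    unfolding v_def v'_def w_def by (auto intro!: derivative_eq_intros p q simp: field_simps)
  have dw: "(w has_real_derivative w' t) (at t)" for t
    unfolding v_def w'_def w_def by (auto intro!: derivative_eq_intros p q simp: field_simps)
  have cv: "continuous_on S v" "continuous_on S w" "continuous_on S v'" "continuous_on S w'" for S
    unfolding v_def w_def v'_def w'_def by (intro continuous_intros cp; simp)+
  have a1: "integral {0..2*pi} (\<lambda>t. (v t)\<^sup>2) / 4 \<le> integral {0..2*pi} (\<lambda>t. (v' t)\<^sup>2)"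
    by (rule wirtinger_antiperiodic[OF dv cv(3)]) (use p q in \<open>simp add: v_def\<close>)
  have a2: "integral {0..2*pi} (\<lambda>t. (w t)\<^sup>2) / 4 \<le> integral {0..2*pi} (\<lambda>t. (w' t)\<^sup>2)"
    by (rule wirtinger_antiperiodic[OF dw cv(4)]) (use p q in \<open>simp add: w_def\<close>)
  have int: "(\<lambda>t. (f t)\<^sup>2) integrable_on {0..2*pi}" if "\<And>S. continuous_on S f" for f :: "real \<Rightarrow> real"
    using that by (intro integrable_continuous_interval continuous_intros)
  have "integral {0..2*pi} (\<lambda>t. (p' t)\<^sup>2 + (q' t)\<^sup>2 - (p t * q' t - q t * p' t))
    = integral {0..2*pi} (\<lambda>t. ((v' t)\<^sup>2 + (w' t)\<^sup>2) - (1/4) * ((v t)\<^sup>2 + (w t)\<^sup>2))"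
  proof (rule integral_cong)
    fix t :: real
    define c s where "c = cos (t/2)" and "s = sin (t/2)"
    have cs: "c * c = 1 - s * s"
      using sin_cos_squared_add[of "t/2"] by (simp add: c_def s_def power2_eq_square algebra_simps)
    have "((v' t)\<^sup>2 + (w' t)\<^sup>2) - (1/4) * ((v t)\<^sup>2 + (w t)\<^sup>2)
        = ((p' t)\<^sup>2 + (q' t)\<^sup>2 - (p t * q' t - q t * p' t)) * (c * c + s * s)"
      unfolding v'_def w'_def v_def w_def c_def[symmetric] s_def[symmetric]
      by (simp add: power2_eq_square field_simps)
    then show "(p' t)\<^sup>2 + (q' t)\<^sup>2 - (p t * q' t - q t * p' t) = ((v' t)\<^sup>2 + (w' t)\<^sup>2) - (1/4) * ((v t)\<^sup>2 + (w t)\<^sup>2)"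
      unfolding cs by simp
  qed
  also have "\<dots> = (integral {0..2*pi} (\<lambda>t. (v' t)\<^sup>2) + integral {0..2*pi} (\<lambda>t. (w' t)\<^sup>2))
      - (1/4) * (integral {0..2*pi} (\<lambda>t. (v t)\<^sup>2) + integral {0..2*pi} (\<lambda>t. (w t)\<^sup>2))"
    by (simp only: Henstock_Kurzweil_Integration.integral_diff Henstock_Kurzweil_Integration.integral_add
        Henstock_Kurzweil_Integration.integral_mult_right int[OF cv(1)] int[OF cv(2)] int[OF cv(3)] int[OF cv(4)]
        integrable_add integrable_on_mult_right)
  finally show ?thesis using a1 a2 by simp
qed

lemma isoperimetric_vector:
  fixes P Q P' Q' :: "real \<Rightarrow> 'b::euclidean_space"
  assumes P: "\<And>t. (P has_vector_derivative P' t) (at t)" "continuous_on UNIV P'" "P (2 * pi) = P 0"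
    and Q: "\<And>t. (Q has_vector_derivative Q' t) (at t)" "continuous_on UNIV Q'" "Q (2 * pi) = Q 0"
  shows "0 \<le> integral {0..2*pi} (\<lambda>t. (norm (P' t))\<^sup>2 + (norm (Q' t))\<^sup>2 - (P t \<bullet> Q' t - Q t \<bullet> P' t))"
proof -
  let ?f = "\<lambda>b t. (P' t \<bullet> b)\<^sup>2 + (Q' t \<bullet> b)\<^sup>2 - ((P t \<bullet> b) * (Q' t \<bullet> b) - (Q t \<bullet> b) * (P' t \<bullet> b))"
  have cP: "continuous_on S P" "continuous_on S Q" "continuous_on S P'" "continuous_on S Q'" for S
    using P Q by (auto intro: continuous_at_imp_continuous_on has_vector_derivative_continuous continuous_on_subset)
  have comp: "((\<lambda>t. R t \<bullet> b) has_real_derivative R' \<bullet> b) (at t)" if "(R has_vector_derivative R') (at t)"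
    for R :: "real \<Rightarrow> 'b" and R' b t
    using bounded_linear.has_vector_derivative[OF bounded_linear_inner_left that]
    by (simp add: has_real_derivative_iff_has_vector_derivative)
  have "0 \<le> (\<Sum>b\<in>(Basis::'b set). integral {0..2*pi} (?f b))"
    by (intro sum_nonneg isoperimetric comp P Q continuous_intros cP) (use P Q in auto)
  also have "\<dots> = integral {0..2*pi} (\<lambda>t. \<Sum>b\<in>(Basis::'b set). ?f b t)"
    by (rule Henstock_Kurzweil_Integration.integral_sum[symmetric])
      (auto intro!: integrable_continuous_interval continuous_intros cP)
  also have "\<dots> = integral {0..2*pi} (\<lambda>t. (norm (P' t))\<^sup>2 + (norm (Q' t))\<^sup>2 - (P t \<bullet> Q' t - Q t \<bullet> P' t))"
    by (rule integral_cong)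
      (simp add: power2_norm_eq_inner[unfolded power2_eq_square] sum.distrib sum_subtractf power2_eq_square euclidean_inner[symmetric])
  finally show ?thesis .
qed

section \<open>Rotations of the plane\<close>

abbreviation e1 :: "real^2" where "e1 \<equiv> axis 1 1"
abbreviation e2 :: "real^2" where "e2 \<equiv> axis 2 1"

definition quarter :: "real^2 \<Rightarrow> real^2" where
  "quarter x = vector [- (x $ 2), x $ 1]"

definition rot :: "real \<Rightarrow> real^2 \<Rightarrow> real^2" where
  "rot t x = cos t *\<^sub>R x + sin t *\<^sub>R quarter x"

lemma quarter_nth [simp]: "quarter x $ 1 = - (x $ 2)" "quarter x $ 2 = x $ 1"
  by (simp_all add: quarter_def)

lemma rot_nth: "rot t x $ 1 = cos t * x $ 1 - sin t * x $ 2" "rot t x $ 2 = cos t * x $ 2 + sin t * x $ 1"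
  by (simp_all add: rot_def)

lemma quarter_expand: "quarter x = (- (x $ 2)) *\<^sub>R e1 + (x $ 1) *\<^sub>R e2"
  by (simp add: vec_eq_iff forall_2 axis_def)

lemma linear_rot: "linear (rot t)"
  by (rule linearI) (simp_all add: vec_eq_iff forall_2 rot_nth algebra_simps)

lemma inner_2: "(x::real^2) \<bullet> y = x $ 1 * y $ 1 + x $ 2 * y $ 2"
  by (simp add: inner_vec_def sum_2)

lemma rot_inner: "rot t x \<bullet> rot t y = x \<bullet> y"
proof -
  have "cos t * cos t = 1 - sin t * sin t"
    using sin_cos_squared_add[of t] by (simp add: power2_eq_square algebra_simps)
  then show ?thesis unfolding inner_2 rot_nth by algebra
qed

lemma orthogonal_rot: "orthogonal_transformation (rot t)"
  by (simp add: orthogonal_transformation_def linear_rot rot_inner)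

lemma rot_inverse: "rot (- t) (rot t x) = x" "rot t (rot (- t) x) = x"
proof -
  have "cos t * cos t = 1 - sin t * sin t"
    using sin_cos_squared_add[of t] by (simp add: power2_eq_square algebra_simps)
  then show "rot (- t) (rot t x) = x" "rot t (rot (- t) x) = x"
    unfolding vec_eq_iff forall_2 rot_nth sin_minus cos_minus by algebra+
qed

lemma continuous_quarter: "continuous_on S quarter"
  unfolding quarter_expand[abs_def] by (intro continuous_intros)

lemma rot_borel [measurable]: "rot t \<in> borel_measurable borel"
  by (intro borel_measurable_continuous_onI linear_continuous_on linear_conv_bounded_linear[THEN iffD1] linear_rot)

lemma lborel_rot: "distr lborel borel (rot t) = lborel"
proof (rule lborel_eqI[symmetric])
  fix l u :: "real^2" assume "\<And>b. b \<in> Basis \<Longrightarrow> l \<bullet> b \<le> u \<bullet> b"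
  have eq: "rot t -` box l u = rot (- t) ` box l u"
    using rot_inverse(1)[of t] rot_inverse(2)[of t] by (auto simp: image_iff) metis
  have b: "rot t -` box l u \<in> sets borel"
    using measurable_sets[OF rot_borel[of t], of "box l u"] by simp
  have lm: "rot t -` box l u \<in> lmeasurable"
    unfolding eq by (intro measurable_orthogonal_image orthogonal_rot) simp
  have "measure lebesgue (rot t -` box l u) = measure lebesgue (box l u)"
    unfolding eq by (intro measure_orthogonal_image orthogonal_rot) simp
  then have "emeasure lebesgue (rot t -` box l u) = emeasure lebesgue (box l u)"
    using lm lmeasurable_box[of l u] by (simp only: emeasure_eq_measure2)
  then have "emeasure lborel (rot t -` box l u) = emeasure lborel (box l u)"
    using b by simp
  then show "emeasure (distr lborel borel (rot t)) (box l u) = (\<Prod>b\<in>Basis. (u - l) \<bullet> b)"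
    using \<open>\<And>b. b \<in> Basis \<Longrightarrow> l \<bullet> b \<le> u \<bullet> b\<close> by (simp add: emeasure_distr emeasure_lborel_box)
qed simp

lemma integral_rot:
  fixes f :: "real^2 \<Rightarrow> real"
  assumes [measurable]: "f \<in> borel_measurable borel"
  shows "(\<integral>x. f (rot t x) \<partial>lborel) = (\<integral>x. f x \<partial>lborel)"
proof -
  have "(\<integral>x. f x \<partial>lborel) = (\<integral>x. f x \<partial>distr lborel borel (rot t))"
    by (simp only: lborel_rot)
  also have "\<dots> = (\<integral>x. f (rot t x) \<partial>lborel)"
    by (rule integral_distr) auto
  finally show ?thesis by simp
qed

text \<open>A substitute for polar coordinates: rotations preserve Lebesgue measure, so by Fubini
  the integral of \<open>G\<close> equals that of its averages over circles, and nonnegativity may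
  be checked circle by circle.\<close>

lemma integral_nonneg_rotation_average:
  fixes G :: "real^2 \<Rightarrow> real"
  assumes c: "continuous_on UNIV G" and z: "\<And>x. norm x > r \<Longrightarrow> G x = 0"
    and avg: "\<And>x. 0 \<le> integral {0..2*pi} (\<lambda>t. G (rot t x))"
  shows "0 \<le> (\<integral>x. G x \<partial>lborel)"
proof -
  have [measurable]: "G \<in> borel_measurable borel" using c by (rule borel_measurable_continuous_onI)
  have int: "integrable lborel G" by (rule integrable_continuous_bounded_support[OF c z])
  have crot: "continuous_on UNIV (\<lambda>p. rot (fst p) (snd p))"
    unfolding rot_def quarter_expand by (intro continuous_intros)
  have [measurable]: "(\<lambda>p. rot (fst p) (snd p)) \<in> borel_measurable (lborel \<Otimes>\<^sub>M lborel)"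
    using borel_measurable_continuous_onI[OF crot] by (simp add: borel_prod lborel_prod)
  let ?H = "\<lambda>t x. indicator {0..2*pi} t * G (rot t x)"
  have meas: "case_prod ?H \<in> borel_measurable (lborel \<Otimes>\<^sub>M lborel)"
    unfolding split_beta by measurable
  have introt: "integrable lborel (\<lambda>x. G (rot t x))" for t
  proof -
    have "integrable (distr lborel borel (rot t)) G" using int by (simp only: lborel_rot)
    then show ?thesis by (subst (asm) integrable_distr_eq) auto
  qed
  have "integrable (lborel \<Otimes>\<^sub>M lborel) (case_prod ?H)"
  proof (rule lborel_pair.Fubini_integrable[OF meas])
    have "(\<integral>x. norm (case (t, x) of (t, x) \<Rightarrow> ?H t x) \<partial>lborel) = indicator {0..2*pi} t * (\<integral>x. \<bar>G x\<bar> \<partial>lborel)" for t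
      using integral_rot[of "\<lambda>x. \<bar>G x\<bar>" t] by (simp add: abs_mult)
    then show "integrable lborel (\<lambda>t. \<integral>x. norm (case (t, x) of (t, x) \<Rightarrow> ?H t x) \<partial>lborel)"
      by (simp only:) (intro integrable_mult_left integrable_real_indicator, simp_all)
    show "AE t in lborel. integrable lborel (\<lambda>x. case (t, x) of (t, x) \<Rightarrow> ?H t x)"
      using introt by (intro AE_I2) (simp only: split integrable_mult_right)
  qed
  then have "(\<integral>x. (\<integral>t. ?H t x \<partial>lborel) \<partial>lborel) = (\<integral>t. (\<integral>x. ?H t x \<partial>lborel) \<partial>lborel)"
    by (rule lborel_pair.Fubini_integral)
  also have "\<dots> = (\<integral>t. indicator {0..2*pi} t * (\<integral>x. G x \<partial>lborel) \<partial>lborel)"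
    by (simp only: integral_mult_right_zero integral_rot[of G] \<open>G \<in> borel_measurable borel\<close>)
  also have "\<dots> = 2 * pi * (\<integral>x. G x \<partial>lborel)"
    by (simp add: measure_def)
  finally have *: "2 * pi * (\<integral>x. G x \<partial>lborel) = (\<integral>x. (\<integral>t. ?H t x \<partial>lborel) \<partial>lborel)" by simp
  have "0 \<le> (\<integral>t. ?H t x \<partial>lborel)" for x
  proof -
    have "continuous_on {0..2*pi} (\<lambda>t. G (rot t x))"
      by (intro continuous_on_compose2[OF c]) (auto simp: rot_def intro!: continuous_intros)
    then have si: "set_integrable lborel {0..2*pi} (\<lambda>t. G (rot t x))"
      by (rule borel_integrable_atLeastAtMost'[unfolded set_integrable_def[symmetric]])
    show ?thesis
      using set_borel_integral_eq_integral(2)[OF si] avg[of x] by (simp add: set_lebesgue_integral_def)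
  qed
  then have "0 \<le> (\<integral>x. (\<integral>t. ?H t x \<partial>lborel) \<partial>lborel)"
    by (rule Bochner_Integration.integral_nonneg)
  with * have "0 \<le> (2 * pi) * (\<integral>x. G x \<partial>lborel)" by (simp only:)
  then show ?thesis by (simp only: zero_le_mult_iff) (use pi_gt_zero in linarith)
qed

section \<open>The curvature inequality for smooth maps\<close>

text \<open>The functions \<open>u\<close> and \<open>v\<close> stand for the two first derivatives
  of one map, and \<open>sym\<close> is the equality of mixed derivatives where the weight lives. On
  each circle the isoperimetric inequality bounds the area density \<open>J\<close> by the
  tangential second derivatives \<open>N\<close>. The density \<open>J\<close> contains second
  derivatives linearly; up to a divergence it equals \<open>K\<close>, which depends on the metric
  alone.\<close>

lemma curvature_inequality_smooth:
  fixes u v :: "real^2 \<Rightarrow> 'b::euclidean_space" and \<zeta> \<zeta>' :: "real \<Rightarrow> real"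
  assumes u: "\<And>x. (u has_derivative u' x) (at x)" and v: "\<And>x. (v has_derivative v' x) (at x)"
    and cu: "\<And>b. b \<in> {e1, e2} \<Longrightarrow> continuous_on UNIV (\<lambda>x. u' x b)"
    and cv: "\<And>b. b \<in> {e1, e2} \<Longrightarrow> continuous_on UNIV (\<lambda>x. v' x b)"
    and sym: "\<And>x. norm x < R \<Longrightarrow> u' x e2 = v' x e1"
    and \<zeta>: "\<And>s. s \<ge> 0 \<Longrightarrow> (\<zeta> has_real_derivative \<zeta>' s) (at s)" "continuous_on {0..} \<zeta>'" "\<And>s. s \<ge> 0 \<Longrightarrow> 0 \<le> \<zeta> s"
    and R: "0 < R" and zero: "\<And>s. s \<ge> R\<^sup>2 \<Longrightarrow> \<zeta> s = 0" "\<And>s. s \<ge> R\<^sup>2 \<Longrightarrow> \<zeta>' s = 0"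
  shows "(\<integral>x. \<zeta> (x \<bullet> x) * ((norm (u x))\<^sup>2 + (norm (v x))\<^sup>2)
        + 2 * \<zeta>' (x \<bullet> x) * (norm (x $ 1 *\<^sub>R v x - x $ 2 *\<^sub>R u x))\<^sup>2 \<partial>lborel)
    \<le> (\<integral>x. \<zeta> (x \<bullet> x) * (x \<bullet> x) * ((norm (u' x e1))\<^sup>2 + (norm (u' x e2))\<^sup>2 + (norm (v' x e1))\<^sup>2 + (norm (v' x e2))\<^sup>2) \<partial>lborel)"
proof -
  have cU: "continuous_on S u" "continuous_on S v" for S
    by (intro continuous_at_imp_continuous_on ballI has_derivative_continuous[OF u] has_derivative_continuous[OF v])+
  have c1: "continuous_on UNIV (\<lambda>x. u' x e1)" "continuous_on UNIV (\<lambda>x. u' x e2)"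
     "continuous_on UNIV (\<lambda>x. v' x e1)" "continuous_on UNIV (\<lambda>x. v' x e2)"
    using cu cv by auto
  have cc: "continuous_on {0..} \<zeta>"
    using \<zeta>(1) by (intro DERIV_continuous_on) (auto intro: has_field_derivative_at_within)
  have "continuous_on UNIV (\<lambda>x::real^2. \<zeta> (x \<bullet> x))"
    by (rule continuous_on_compose2[OF cc]) (auto intro!: continuous_intros)
  moreover have "continuous_on UNIV (\<lambda>x::real^2. \<zeta>' (x \<bullet> x))"
    by (rule continuous_on_compose2[OF \<zeta>(2)]) (auto intro!: continuous_intros)
  ultimately have cz: "continuous_on UNIV (\<lambda>x::real^2. \<zeta> (x \<bullet> x))" "continuous_on UNIV (\<lambda>x::real^2. \<zeta>' (x \<bullet> x))" .
  have out: "\<zeta> (x \<bullet> x) = 0 \<and> \<zeta>' (x \<bullet> x) = 0" if "norm x \<ge> R" for x :: "real^2"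
    using power_mono[OF that, of 2] R zero by (simp add: power2_norm_eq_inner)
  define U where "U x = (- (x $ 2)) *\<^sub>R u' x e1 + (x $ 1) *\<^sub>R u' x e2" for x
  define V where "V x = (- (x $ 2)) *\<^sub>R v' x e1 + (x $ 1) *\<^sub>R v' x e2" for x
  have cUV: "continuous_on UNIV U" "continuous_on UNIV V"
    unfolding U_def V_def by (intro continuous_intros c1)+
  have Uq: "u' x (quarter x) = U x" "v' x (quarter x) = V x" for x
    unfolding quarter_expand U_def V_def
    using has_derivative_linear[OF u[of x]] has_derivative_linear[OF v[of x]]
    by (simp_all only: linear_add linear_scale)
  define J where "J x = \<zeta> (x \<bullet> x) * (u x \<bullet> V x - v x \<bullet> U x)" for x
  define N where "N x = \<zeta> (x \<bullet> x) * ((norm (U x))\<^sup>2 + (norm (V x))\<^sup>2)" for x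
  define K where "K x = \<zeta> (x \<bullet> x) * ((norm (u x))\<^sup>2 + (norm (v x))\<^sup>2)
        + 2 * \<zeta>' (x \<bullet> x) * (norm (x $ 1 *\<^sub>R v x - x $ 2 *\<^sub>R u x))\<^sup>2" for x
  define E where "E x = \<zeta> (x \<bullet> x) * (x \<bullet> x) * ((norm (u' x e1))\<^sup>2 + (norm (u' x e2))\<^sup>2 + (norm (v' x e1))\<^sup>2 + (norm (v' x e2))\<^sup>2)" for x
  have cont: "continuous_on UNIV J" "continuous_on UNIV N" "continuous_on UNIV K" "continuous_on UNIV E"
    unfolding J_def N_def K_def E_def by (intro continuous_intros cz cU cUV c1)+
  have z0: "J x = 0" "N x = 0" "K x = 0" "E x = 0" if "norm x > R" for x
    using out[of x] that by (simp_all add: J_def N_def K_def E_def)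
  have int: "integrable lborel J" "integrable lborel N" "integrable lborel K" "integrable lborel E"
    by (rule integrable_continuous_bounded_support[where r=R], fact cont, fact z0)+
  have 1: "0 \<le> (\<integral>x. N x - J x \<partial>lborel)"
  proof (rule integral_nonneg_rotation_average)
    show "continuous_on UNIV (\<lambda>x. N x - J x)" by (intro continuous_intros cont)
    show "N x - J x = 0" if "norm x > R" for x using z0[OF that] by simp
    fix x
    let ?P = "\<lambda>t. u (rot t x)" and ?Q = "\<lambda>t. v (rot t x)"
    have dr: "((\<lambda>t. rot t x) has_derivative (\<lambda>h. h *\<^sub>R quarter (rot t x))) (at t)" for t
    proof -
      have "((\<lambda>t. rot t x) has_derivative (\<lambda>h. (- sin t * h) *\<^sub>R x + (cos t * h) *\<^sub>R quarter x)) (at t)"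
        unfolding rot_def by (auto intro!: derivative_eq_intros simp: mult.commute)
      moreover have "(- sin t * h) *\<^sub>R x + (cos t * h) *\<^sub>R quarter x = h *\<^sub>R quarter (rot t x)" for h
        by (simp add: vec_eq_iff forall_2 rot_nth algebra_simps)
      ultimately show ?thesis by (simp only:)
    qed
    have dP: "(?P has_vector_derivative U (rot t x)) (at t)" for t
      using has_derivative_compose[OF dr u, of t]
      unfolding has_vector_derivative_def linear_scale[OF has_derivative_linear[OF u]] Uq .
    have dQ: "(?Q has_vector_derivative V (rot t x)) (at t)" for t
      using has_derivative_compose[OF dr v, of t]
      unfolding has_vector_derivative_def linear_scale[OF has_derivative_linear[OF v]] Uq .
    have cr: "continuous_on UNIV (\<lambda>t. rot t x)"
      unfolding rot_def by (intro continuous_intros)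
    have per: "rot (2 * pi) x = rot 0 x" by (simp add: rot_def)
    have "0 \<le> integral {0..2*pi} (\<lambda>t. (norm (U (rot t x)))\<^sup>2 + (norm (V (rot t x)))\<^sup>2
        - (u (rot t x) \<bullet> V (rot t x) - v (rot t x) \<bullet> U (rot t x)))"
      by (rule isoperimetric_vector[OF dP _ _ dQ])
        (simp_all only: per continuous_on_compose2[OF cUV(1) cr subset_UNIV] continuous_on_compose2[OF cUV(2) cr subset_UNIV])
    then have "0 \<le> \<zeta> (x \<bullet> x) * integral {0..2*pi} (\<lambda>t. (norm (U (rot t x)))\<^sup>2 + (norm (V (rot t x)))\<^sup>2
        - (u (rot t x) \<bullet> V (rot t x) - v (rot t x) \<bullet> U (rot t x)))"
      using \<zeta>(3)[OF inner_ge_zero[of x]] by (rule mult_nonneg_nonneg[rotated])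
    also have "\<dots> = integral {0..2*pi} (\<lambda>t. N (rot t x) - J (rot t x))"
      unfolding N_def J_def rot_inner by (simp only: right_diff_distrib flip: Henstock_Kurzweil_Integration.integral_mult_right)
    finally show "0 \<le> integral {0..2*pi} (\<lambda>t. N (rot t x) - J (rot t x))" .
  qed
  have 2: "N x \<le> E x" for x
  proof -
    have *: "(norm ((- (x $ 2)) *\<^sub>R a + (x $ 1) *\<^sub>R b))\<^sup>2 \<le> (x \<bullet> x) * ((norm a)\<^sup>2 + (norm b)\<^sup>2)" for a b :: 'b
    proof -
      have "0 \<le> (norm ((x $ 1) *\<^sub>R a + (x $ 2) *\<^sub>R b))\<^sup>2" by simp
      then show ?thesis
        by (simp add: power2_norm_eq_inner inner_add_left inner_add_right inner_diff_left inner_diff_right inner_2 inner_commute algebra_simps)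
    qed
    have "(norm (U x))\<^sup>2 + (norm (V x))\<^sup>2
        \<le> (x \<bullet> x) * ((norm (u' x e1))\<^sup>2 + (norm (u' x e2))\<^sup>2) + (x \<bullet> x) * ((norm (v' x e1))\<^sup>2 + (norm (v' x e2))\<^sup>2)"
      unfolding U_def V_def by (intro add_mono *)
    from mult_left_mono[OF this \<zeta>(3)[OF inner_ge_zero[of x]]] show ?thesis
      unfolding N_def E_def by (simp only: distrib_left mult.assoc add.assoc)
  qed
  have dz: "((\<lambda>x::real^2. \<zeta> (x \<bullet> x)) has_derivative (\<lambda>h. \<zeta>' (x \<bullet> x) * (2 * (x \<bullet> h)))) (at x)" for x
  proof -
    have "((\<lambda>x::real^2. x \<bullet> x) has_derivative (\<lambda>h. 2 * (x \<bullet> h))) (at x)"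
      by (auto intro!: derivative_eq_intros simp: inner_commute)
    from has_derivative_compose[OF this \<zeta>(1)[OF inner_ge_zero, THEN has_field_derivative_imp_has_derivative]]
    show ?thesis .
  qed
  have dn: "((\<lambda>x::real^2. x $ i) has_derivative (\<lambda>h. h $ i)) (at x)" for i x
    by (rule bounded_linear.has_derivative[OF bounded_linear_vec_nth has_derivative_ident])
  note dg = has_derivative_inner[OF u v] has_derivative_inner[OF u u] has_derivative_inner[OF v v]
  let ?g12' = "\<lambda>x h. u x \<bullet> v' x h + u' x h \<bullet> v x" and ?g11' = "\<lambda>x h. u x \<bullet> u' x h + u' x h \<bullet> u x"
    and ?g22' = "\<lambda>x h. v x \<bullet> v' x h + v' x h \<bullet> v x"
  \<comment> \<open>The field is \<open>- \<zeta>\<close> times the cofactor matrix of the metric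
    applied to \<open>x\<close>. The derivative of the weight then produces
    \<open>- 2 * \<zeta>'\<close> times the square of
    \<open>x $ 1 *\<^sub>R v x - x $ 2 *\<^sub>R u x\<close>, exactly the second term of
    \<open>K\<close>.\<close>
  let ?F1 = "\<lambda>x. \<zeta> (x \<bullet> x) * (x $ 2 * (u x \<bullet> v x) - x $ 1 * (v x \<bullet> v x))"
  let ?F2 = "\<lambda>x. \<zeta> (x \<bullet> x) * (x $ 1 * (u x \<bullet> v x) - x $ 2 * (u x \<bullet> u x))"
  let ?F1' = "\<lambda>x h. \<zeta> (x \<bullet> x) * ((x $ 2 * ?g12' x h + h $ 2 * (u x \<bullet> v x)) - (x $ 1 * ?g22' x h + h $ 1 * (v x \<bullet> v x)))
    + \<zeta>' (x \<bullet> x) * (2 * (x \<bullet> h)) * (x $ 2 * (u x \<bullet> v x) - x $ 1 * (v x \<bullet> v x))"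
  let ?F2' = "\<lambda>x h. \<zeta> (x \<bullet> x) * ((x $ 1 * ?g12' x h + h $ 1 * (u x \<bullet> v x)) - (x $ 2 * ?g11' x h + h $ 2 * (u x \<bullet> u x)))
    + \<zeta>' (x \<bullet> x) * (2 * (x \<bullet> h)) * (x $ 1 * (u x \<bullet> v x) - x $ 2 * (u x \<bullet> u x))"
  have dF: "(?F1 has_derivative ?F1' x) (at x)" "(?F2 has_derivative ?F2' x) (at x)" for x
    by (intro has_derivative_mult has_derivative_diff dz dn dg)+
  have cF: "continuous_on UNIV (\<lambda>x. ?F1' x e1)" "continuous_on UNIV (\<lambda>x. ?F2' x e2)"
    by (intro continuous_intros cz cU c1)+
  have zF: "?F1 x = 0" "?F2 x = 0" if "norm x > R" for x using out[of x] that by simp_all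
  note I1 = integral_pderiv_zero[of ?F1 ?F1' e1 R, OF dF(1) cF(1) zF(1)]
    and I2 = integral_pderiv_zero[of ?F2 ?F2' e2 R, OF dF(2) cF(2) zF(2)]
  \<comment> \<open>The place where mixed derivatives must agree: without this the derivatives of
    the metric entries would not combine to \<open>J\<close>.\<close>
  have pw: "J x - K x = ?F1' x e1 + ?F2' x e2" for x
  proof (cases "norm x < R")
    case True
    have "x \<bullet> e1 = x $ 1" "x \<bullet> e2 = x $ 2" by (simp_all add: inner_axis)
    moreover have "e1 $ 1 = 1" "e1 $ 2 = 0" "e2 $ 1 = 0" "e2 $ 2 = 1" by (simp_all add: axis_def)
    ultimately show ?thesis
      unfolding J_def K_def U_def V_def sym[OF True]
      by (simp add: power2_norm_eq_inner inner_add_left inner_add_right inner_diff_left inner_diff_right inner_commute algebra_simps)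
  next
    case False
    then show ?thesis using out[of x] by (simp add: J_def K_def)
  qed
  have "(\<integral>x. J x - K x \<partial>lborel) = 0"
    unfolding pw using I1 I2 by (simp only: Bochner_Integration.integral_add add_0_left)
  then have "(\<integral>x. K x \<partial>lborel) = (\<integral>x. J x \<partial>lborel)"
    using int by (simp only: Bochner_Integration.integral_diff)
  also have "\<dots> \<le> (\<integral>x. N x \<partial>lborel)"
    using 1 int by (simp only: Bochner_Integration.integral_diff)
  also have "\<dots> \<le> (\<integral>x. E x \<partial>lborel)"
    using int 2 by (intro integral_mono)
  finally show ?thesis unfolding K_def E_def .
qed

section \<open>Symmetry of the second derivatives of mollifiers\<close>

lemma bumps_second_derivative:
  assumes "f \<in> bumps c a"
  shows "\<exists>f' f''. (\<forall>x. (f has_derivative (\<lambda>v. f' v x)) (at x)) \<and>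
    (\<forall>v x. (f' v has_derivative (\<lambda>w. f'' v w x)) (at x)) \<and> (\<forall>v w x. f'' v w x = f'' w v x)"
  using assms
proof (induction rule: bumps.induct)
  case (bump p)
  let ?D = "\<lambda>p. (pderiv p - p) * monom 1 2"
  let ?b = "\<lambda>p x. bump p (c * ((x - a) \<bullet> (x - a)))"
  let ?f' = "\<lambda>v x. (2 * c * ((x - a) \<bullet> v)) * ?b (?D p) x"
  let ?f'' = "\<lambda>v w x. 2 * c * (v \<bullet> w) * ?b (?D p) x + (2 * c * ((x - a) \<bullet> v)) * (2 * c * ((x - a) \<bullet> w)) * ?b (?D (?D p)) x"
  have b: "(?b q has_derivative (\<lambda>v. (2 * c * ((x - a) \<bullet> v)) * ?b (?D q) x)) (at x)" for q x
    by (rule has_derivative_eq_rhs[OF has_derivative_compose[OF _ bump_has_derivative[THEN has_field_derivative_imp_has_derivative]]])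
      (auto intro!: derivative_eq_intros simp: fun_eq_iff inner_commute algebra_simps)
  have "(?f' v has_derivative (\<lambda>w. ?f'' v w x)) (at x)" for v x
  proof -
    have "((\<lambda>x. 2 * c * ((x - a) \<bullet> v)) has_derivative (\<lambda>w. 2 * c * (w \<bullet> v))) (at x)"
      by (auto intro!: derivative_eq_intros)
    from has_derivative_mult[OF this b[of "?D p" x]] show ?thesis
      by (rule has_derivative_eq_rhs) (simp add: fun_eq_iff inner_commute algebra_simps)
  qed
  moreover have "?f'' v w x = ?f'' w v x" for v w x
    by (simp add: inner_commute algebra_simps)
  ultimately show ?case using b
    by (intro exI[of _ ?f'] exI[of _ ?f''] conjI allI)
next
  case (coord f k)
  then obtain f' f'' where "(\<forall>x. (f has_derivative (\<lambda>v. f' v x)) (at x)) \<and>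
    (\<forall>v x. (f' v has_derivative (\<lambda>w. f'' v w x)) (at x)) \<and> (\<forall>v w x. f'' v w x = f'' w v x)" by blast
  then have f: "\<And>x. (f has_derivative (\<lambda>v. f' v x)) (at x)"
    "\<And>v x. (f' v has_derivative (\<lambda>w. f'' v w x)) (at x)" "\<And>v w x. f'' v w x = f'' w v x" by simp_all
  let ?f' = "\<lambda>v x. ((x - a) \<bullet> k) * f' v x + (v \<bullet> k) * f x"
  let ?f'' = "\<lambda>v w x. (((x - a) \<bullet> k) * f'' v w x + (w \<bullet> k) * f' v x) + (v \<bullet> k) * f' w x"
  have k: "((\<lambda>x. (x - a) \<bullet> k) has_derivative (\<lambda>w. w \<bullet> k)) (at x)" for x
    by (auto intro!: derivative_eq_intros)
  have "((\<lambda>x. ((x - a) \<bullet> k) * f x) has_derivative (\<lambda>v. ?f' v x)) (at x)" for x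
    by (rule has_derivative_mult[OF k f(1)])
  moreover have "(?f' v has_derivative (\<lambda>w. ?f'' v w x)) (at x)" for v x
    by (intro has_derivative_add has_derivative_mult[OF k f(2)] has_derivative_mult_right f(1))
  moreover have "?f'' v w x = ?f'' w v x" for v w x
    using f(3)[of v w x] by simp
  ultimately show ?case
    by (intro exI[of _ ?f'] exI[of _ ?f''] conjI allI)
next
  case (add f g)
  obtain f' f'' where f0: "(\<forall>x. (f has_derivative (\<lambda>v. f' v x)) (at x)) \<and>
    (\<forall>v x. (f' v has_derivative (\<lambda>w. f'' v w x)) (at x)) \<and> (\<forall>v w x. f'' v w x = f'' w v x)" using add(3) by blast
  obtain g' g'' where g0: "(\<forall>x. (g has_derivative (\<lambda>v. g' v x)) (at x)) \<and>
    (\<forall>v x. (g' v has_derivative (\<lambda>w. g'' v w x)) (at x)) \<and> (\<forall>v w x. g'' v w x = g'' w v x)" using add(4) by blast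
  have f: "\<And>x. (f has_derivative (\<lambda>v. f' v x)) (at x)"
    "\<And>v x. (f' v has_derivative (\<lambda>w. f'' v w x)) (at x)" "\<And>v w x. f'' v w x = f'' w v x" using f0 by simp_all
  have g: "\<And>x. (g has_derivative (\<lambda>v. g' v x)) (at x)"
    "\<And>v x. (g' v has_derivative (\<lambda>w. g'' v w x)) (at x)" "\<And>v w x. g'' v w x = g'' w v x" using g0 by simp_all
  have "f'' v w x + g'' v w x = f'' w v x + g'' w v x" for v w x
    using f(3)[of v w x] g(3)[of v w x] by simp
  then show ?case
    by (intro exI[of _ "\<lambda>v x. f' v x + g' v x"] exI[of _ "\<lambda>v w x. f'' v w x + g'' v w x"] conjI allI has_derivative_add f(1,2) g(1,2))
next
  case (scale f k)
  then obtain f' f'' where "(\<forall>x. (f has_derivative (\<lambda>v. f' v x)) (at x)) \<and>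
    (\<forall>v x. (f' v has_derivative (\<lambda>w. f'' v w x)) (at x)) \<and> (\<forall>v w x. f'' v w x = f'' w v x)" by blast
  then have f: "\<And>x. (f has_derivative (\<lambda>v. f' v x)) (at x)"
    "\<And>v x. (f' v has_derivative (\<lambda>w. f'' v w x)) (at x)" "\<And>v w x. f'' v w x = f'' w v x" by simp_all
  have "k * f'' v w x = k * f'' w v x" for v w x using f(3)[of v w x] by simp
  then show ?case
    by (intro exI[of _ "\<lambda>v x. k * f' v x"] exI[of _ "\<lambda>v w x. k * f'' v w x"] conjI allI has_derivative_mult_right f(1,2))
qed

text \<open>Along the inductive construction both derivatives are explicit and the second one is
  visibly symmetric in its directions. Moving two derivatives onto the kernel transfers this
  symmetry to mollified weak Hessians.\<close>

lemma bumps_pderiv_commute: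
  assumes "f \<in> bumps c a"
  shows "pderiv_dir v (pderiv_dir w f) = pderiv_dir w (pderiv_dir v f)"
proof -
  obtain f' f'' where "(\<forall>x. (f has_derivative (\<lambda>v. f' v x)) (at x)) \<and>
    (\<forall>v x. (f' v has_derivative (\<lambda>w. f'' v w x)) (at x)) \<and> (\<forall>v w x. f'' v w x = f'' w v x)"
    using bumps_second_derivative[OF assms] by blast
  then have f: "\<And>x. (f has_derivative (\<lambda>v. f' v x)) (at x)"
    "\<And>v x. (f' v has_derivative (\<lambda>w. f'' v w x)) (at x)" "\<And>v w x. f'' v w x = f'' w v x" by simp_all
  have 1: "pderiv_dir v f = f' v" for v
    using frechet_derivative_at[OF f(1), symmetric] by (simp add: pderiv_dir_def fun_eq_iff)
  have 2: "pderiv_dir w (f' v) = f'' v w" for v w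
    using frechet_derivative_at[OF f(2), symmetric] by (simp add: pderiv_dir_def fun_eq_iff)
  show ?thesis unfolding 1 2 using f(3) by (simp add: fun_eq_iff)
qed

section \<open>Functions with two weak derivatives on the disc\<close>

text \<open>Borel on the whole plane and zero off the disc: integrals over the disc become integrals
  over \<open>lborel\<close>, and convolutions and translations make sense without a separate
  extension.\<close>

definition cL2 :: "(real^2 \<Rightarrow> 'b::euclidean_space) set" where
  "cL2 = {f \<in> L2. \<forall>x. x \<notin> disc 1 \<longrightarrow> f x = 0}"

text \<open>Derivatives are carried as data, because Borel representatives are what all integral
  estimates use. \<open>H i j\<close> differentiates \<open>Y i\<close> in direction
  \<open>j\<close>; its symmetry is not part of the data but follows after mollification.\<close>

definition weak_triple :: "(real^2 \<Rightarrow> 'b::euclidean_space) \<Rightarrow> (2 \<Rightarrow> real^2 \<Rightarrow> 'b) \<Rightarrow> (2 \<Rightarrow> 2 \<Rightarrow> real^2 \<Rightarrow> 'b) \<Rightarrow> bool" where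
  "weak_triple y Y H \<longleftrightarrow> y \<in> cL2 \<and> (\<forall>i. Y i \<in> cL2) \<and> (\<forall>i j. H i j \<in> cL2) \<and>
    (\<forall>i. wderiv (disc 1) (axis i 1) y (Y i)) \<and> (\<forall>i j. wderiv (disc 1) (axis j 1) (Y i) (H i j))"

lemma cL2_L2: "f \<in> cL2 \<Longrightarrow> f \<in> L2"
  by (simp add: cL2_def)

lemma cL2_integrable:
  assumes "f \<in> cL2" shows "integrable lborel f"
proof -
  have [measurable]: "f \<in> borel_measurable borel" using cL2_L2[OF assms] by auto
  have fin: "emeasure lborel (disc 1) < \<infinity>"
    using emeasure_bounded_finite[of "disc 1"] by simp
  show ?thesis
  proof (rule Bochner_Integration.integrable_bound[where f="\<lambda>x. indicator (disc 1) x + (norm (f x))\<^sup>2"])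
    show "integrable lborel (\<lambda>x. indicator (disc 1) x + (norm (f x))\<^sup>2)"
      using fin by (intro Bochner_Integration.integrable_add L2_integrable cL2_L2[OF assms] integrable_real_indicator) auto
    show "AE x in lborel. norm (f x) \<le> norm (indicator (disc 1) x + (norm (f x))\<^sup>2 :: real)"
    proof (rule AE_I2)
      fix x
      show "norm (f x) \<le> norm (indicator (disc 1) x + (norm (f x))\<^sup>2 :: real)"
      proof (cases "x \<in> disc 1")
        case True
        have "norm (f x) \<le> 1 + (norm (f x))\<^sup>2"
          using sum_squares_bound[of 1 "norm (f x)"] norm_ge_zero[of "f x"]
          unfolding power_one mult_1_right by linarith
        then show ?thesis using True by simp
      next
        case False
        then show ?thesis using assms by (simp add: cL2_def)
      qed
    qed
  qed simp
qed

lemma weak_tripleD: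
  assumes "weak_triple y Y H"
  shows "y \<in> cL2" "Y i \<in> cL2" "H i j \<in> cL2" "wderiv (disc 1) (axis i 1) y (Y i)"
    "wderiv (disc 1) (axis j 1) (Y i) (H i j)"
  using assms by (auto simp: weak_triple_def)

lemma axis_Basis2: "(axis i 1 :: real^2) \<in> Basis"
  by (simp add: axis_in_Basis_iff)

text \<open>Both entries equal the integral of \<open>y\<close> against a second derivative of the
  same kernel, where the order of differentiation is immaterial.\<close>

lemma conv_hessian_symmetric:
  assumes w: "weak_triple y Y H" and sub: "cball x (1 / (real n + 1)) \<subseteq> disc 1"
  shows "conv (mollifier n) (H i j) x = conv (mollifier n) (H j i) x"
proof -
  let ?\<phi> = "\<lambda>z. mollifier n (x - z)"
  have t: "?\<phi> \<in> test_functions (disc 1)" by (rule mollifier_test_reflected[OF sub])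
  have bb: "?\<phi> \<in> bumps ((real n + 1)\<^sup>2) x"
  proof -
    have eq: "?\<phi> = (\<lambda>z. (1 / integral\<^sup>L lborel (ubump n :: real^2 \<Rightarrow> real)) * ubump n (x - z))"
      by (simp add: mollifier_def)
    show ?thesis unfolding eq by (intro bumps.scale bumps_reflected)
  qed
  have *: "conv (mollifier n) (H i j) x = (\<integral>z. pderiv_dir (axis i 1) (pderiv_dir (axis j 1) ?\<phi>) z *\<^sub>R y z \<partial>lborel)" for i j
  proof -
    have "(\<integral>z. pderiv_dir (axis j 1) ?\<phi> z *\<^sub>R Y i z \<partial>lborel) = - conv (mollifier n) (H i j) x"
      using weak_tripleD(5)[OF w, unfolded wderiv_def, rule_format, OF t] by (simp add: conv_def)
    moreover have "(\<integral>z. pderiv_dir (axis i 1) (pderiv_dir (axis j 1) ?\<phi>) z *\<^sub>R y z \<partial>lborel)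
        = - (\<integral>z. pderiv_dir (axis j 1) ?\<phi> z *\<^sub>R Y i z \<partial>lborel)"
      by (rule weak_tripleD(4)[OF w, unfolded wderiv_def, rule_format, OF test_functions_pderiv[OF t axis_Basis2]])
    ultimately show ?thesis by simp
  qed
  show ?thesis unfolding * bumps_pderiv_commute[OF bb, of "axis i 1" "axis j 1"] ..
qed

section \<open>The curvature inequality\<close>

lemma bounded_continuous_bounded_support:
  fixes f :: "'a::euclidean_space \<Rightarrow> real"
  assumes c: "continuous_on UNIV f" and z: "\<And>x. norm x > r \<Longrightarrow> f x = 0"
  shows "\<exists>M. \<forall>x. \<bar>f x\<bar> \<le> M"
proof -
  have "compact (f ` cball 0 r)"
    by (intro compact_continuous_image continuous_on_subset[OF c]) auto
  from compact_imp_bounded[OF this]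
  obtain M where M: "\<And>y. y \<in> f ` cball 0 r \<Longrightarrow> norm y \<le> M"
    unfolding bounded_iff by blast
  have "\<bar>f x\<bar> \<le> max M 0" for x
  proof (cases "norm x \<le> r")
    case True
    then have "norm (f x) \<le> M" by (intro M imageI) simp
    then show ?thesis by simp
  next
    case False
    then show ?thesis using z[of x] by simp
  qed
  then show ?thesis by blast
qed

lemma mollify_weighted_tendsto:
  assumes f: "f \<in> cL2" and c: "continuous_on UNIV w" and z: "\<And>x. norm x > r \<Longrightarrow> w x = 0"
  shows "(\<lambda>n. \<integral>x. w x * (norm (conv (mollifier n) f x))\<^sup>2 \<partial>lborel) \<longlonglongrightarrow> (\<integral>x. w x * (norm (f x))\<^sup>2 \<partial>lborel)"
proof -
  obtain M where "\<forall>x. \<bar>w x\<bar> \<le> M"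
    using bounded_continuous_bounded_support[OF c z] by blast
  then have M: "\<bar>w x\<bar> \<le> M" for x by simp
  show ?thesis
    by (rule L2_tendsto_weighted[OF mollify_L2(1)[OF cL2_L2[OF f] cL2_integrable[OF f]] cL2_L2[OF f]
        mollify_L2(2)[OF cL2_L2[OF f] cL2_integrable[OF f]] borel_measurable_continuous_onI[OF c] M])
qed

lemma conv_add:
  assumes "\<phi> \<in> test_functions U" "integrable lborel f" "integrable lborel g"
  shows "conv \<phi> (\<lambda>x. f x + g x) x = conv \<phi> f x + conv \<phi> g x"
  unfolding conv_def scaleR_add_right
  by (rule Bochner_Integration.integral_add[OF test_integrable[OF assms(1,2)] test_integrable[OF assms(1,3)]])

lemma weighted_integrable:
  assumes f: "f \<in> L2" and c: "continuous_on UNIV w" and z: "\<And>x. norm x > r \<Longrightarrow> w x = 0"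
  shows "integrable lborel (\<lambda>x. w x * (norm (f x))\<^sup>2)"
proof -
  obtain M where "\<forall>x. \<bar>w x\<bar> \<le> M"
    using bounded_continuous_bounded_support[OF c z] by blast
  then have M: "\<bar>w x\<bar> \<le> M" for x by simp
  have [measurable]: "w \<in> borel_measurable borel" "f \<in> borel_measurable borel"
    using borel_measurable_continuous_onI[OF c] f by auto
  show ?thesis
  proof (rule Bochner_Integration.integrable_bound[OF integrable_mult_right[OF L2_integrable[OF f], of M]])
    show "AE x in lborel. norm (w x * (norm (f x))\<^sup>2) \<le> norm (M * (norm (f x))\<^sup>2)"
      using M by (intro AE_I2) (auto simp: abs_mult intro!: mult_right_mono intro: order_trans[OF M abs_ge_self])
  qed simp
qed

text \<open>Mollified gradients have matching mixed derivatives only where the kernel stays inside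
  the disc. Because the weight vanishes beyond \<open>R < 1\<close>, this covers its support for all
  large \<open>n\<close>, and all terms are weighted squares that pass to the mean-square
  limit.\<close>

lemma curvature_inequality:
  fixes y :: "real^2 \<Rightarrow> 'b::euclidean_space"
  assumes w: "weak_triple y Y H"
    and \<zeta>: "\<And>s. s \<ge> 0 \<Longrightarrow> (\<zeta> has_real_derivative \<zeta>' s) (at s)" "continuous_on {0..} \<zeta>'" "\<And>s. s \<ge> 0 \<Longrightarrow> 0 \<le> \<zeta> s"
    and R: "0 < R" "R < 1" and zero: "\<And>s. s \<ge> R\<^sup>2 \<Longrightarrow> \<zeta> s = 0" "\<And>s. s \<ge> R\<^sup>2 \<Longrightarrow> \<zeta>' s = 0"
  shows "(\<integral>x. \<zeta> (x \<bullet> x) * ((norm (Y 1 x))\<^sup>2 + (norm (Y 2 x))\<^sup>2)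
        + 2 * \<zeta>' (x \<bullet> x) * (norm (x $ 1 *\<^sub>R Y 2 x - x $ 2 *\<^sub>R Y 1 x))\<^sup>2 \<partial>lborel)
    \<le> (\<integral>x. \<zeta> (x \<bullet> x) * (x \<bullet> x) * ((norm (H 1 1 x))\<^sup>2 + (norm (H 1 2 x))\<^sup>2 + (norm (H 2 1 x))\<^sup>2 + (norm (H 2 2 x))\<^sup>2) \<partial>lborel)"
proof -
  note T = weak_tripleD[OF w]
  have cc: "continuous_on {0..} \<zeta>"
    using \<zeta>(1) by (intro DERIV_continuous_on) (auto intro: has_field_derivative_at_within)
  have "continuous_on UNIV (\<lambda>x::real^2. \<zeta> (x \<bullet> x))"
    by (rule continuous_on_compose2[OF cc]) (auto intro!: continuous_intros)
  moreover have "continuous_on UNIV (\<lambda>x::real^2. \<zeta>' (x \<bullet> x))"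
    by (rule continuous_on_compose2[OF \<zeta>(2)]) (auto intro!: continuous_intros)
  ultimately have cz: "continuous_on UNIV (\<lambda>x::real^2. \<zeta> (x \<bullet> x))" "continuous_on UNIV (\<lambda>x::real^2. \<zeta>' (x \<bullet> x))" .
  have out: "\<zeta> (x \<bullet> x) = 0 \<and> \<zeta>' (x \<bullet> x) = 0" if "norm x \<ge> R" for x :: "real^2"
    using power_mono[OF that, of 2] R zero by (simp add: power2_norm_eq_inner)
  \<comment> \<open>The coefficients are chosen to remove the mixed product: it is expressed through
    \<open>norm (p + q)\<close>, so that the quadratic form becomes a sum of three weighted squares
    and the convergence lemma for such squares applies to each.\<close>
  define a where "a x = \<zeta> (x \<bullet> x) + 2 * \<zeta>' (x \<bullet> x) * ((x $ 2)\<^sup>2 + x $ 1 * x $ 2)" for x :: "real^2"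
  define b where "b x = \<zeta> (x \<bullet> x) + 2 * \<zeta>' (x \<bullet> x) * ((x $ 1)\<^sup>2 + x $ 1 * x $ 2)" for x :: "real^2"
  define c where "c x = - (2 * \<zeta>' (x \<bullet> x) * (x $ 1 * x $ 2))" for x :: "real^2"
  define d where "d x = \<zeta> (x \<bullet> x) * (x \<bullet> x)" for x :: "real^2"
  have cont: "continuous_on UNIV a" "continuous_on UNIV b" "continuous_on UNIV c" "continuous_on UNIV d"
    unfolding a_def b_def c_def d_def by (intro continuous_intros cz)+
  have z0: "a x = 0" "b x = 0" "c x = 0" "d x = 0" if "norm x > R" for x
    using out[of x] that by (simp_all add: a_def b_def c_def d_def)
  have polar: "\<zeta> (x \<bullet> x) * ((norm p)\<^sup>2 + (norm q)\<^sup>2) + 2 * \<zeta>' (x \<bullet> x) * (norm (x $ 1 *\<^sub>R q - x $ 2 *\<^sub>R p))\<^sup>2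
      = a x * (norm p)\<^sup>2 + b x * (norm q)\<^sup>2 + c x * (norm (p + q))\<^sup>2" for p q :: 'b and x :: "real^2"
  proof -
    have 1: "(norm (r *\<^sub>R q - t *\<^sub>R p))\<^sup>2 = r * r * (q \<bullet> q) - 2 * (r * t * (p \<bullet> q)) + t * t * (p \<bullet> p)" for r t :: real
      by (simp add: power2_norm_eq_inner inner_diff_left inner_diff_right inner_commute algebra_simps)
    have 2: "(norm (p + q))\<^sup>2 = p \<bullet> p + 2 * (p \<bullet> q) + q \<bullet> q"
      by (simp add: power2_norm_eq_inner inner_add_left inner_add_right inner_commute)
    show ?thesis
      unfolding a_def b_def c_def 1 2 power2_norm_eq_inner
      by (simp add: power2_eq_square algebra_simps)
  qed
  have YY: "(\<lambda>x. Y 1 x + Y 2 x) \<in> cL2"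
    using L2_add[OF cL2_L2[OF T(2)[of 1]] cL2_L2[OF T(2)[of 2]]] T(2)[of 1] T(2)[of 2] by (simp add: cL2_def)
  let ?m = "\<lambda>n. conv (mollifier n)"
  let ?L = "\<lambda>n. (\<integral>x. a x * (norm (?m n (Y 1) x))\<^sup>2 \<partial>lborel) + (\<integral>x. b x * (norm (?m n (Y 2) x))\<^sup>2 \<partial>lborel)
      + (\<integral>x. c x * (norm (?m n (\<lambda>x. Y 1 x + Y 2 x) x))\<^sup>2 \<partial>lborel)"
  let ?Rn = "\<lambda>n. (\<integral>x. d x * (norm (?m n (H 1 1) x))\<^sup>2 \<partial>lborel) + (\<integral>x. d x * (norm (?m n (H 1 2) x))\<^sup>2 \<partial>lborel)
      + (\<integral>x. d x * (norm (?m n (H 2 1) x))\<^sup>2 \<partial>lborel) + (\<integral>x. d x * (norm (?m n (H 2 2) x))\<^sup>2 \<partial>lborel)"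
  let ?lim_l = "(\<integral>x. a x * (norm (Y 1 x))\<^sup>2 \<partial>lborel) + (\<integral>x. b x * (norm (Y 2 x))\<^sup>2 \<partial>lborel)
      + (\<integral>x. c x * (norm (Y 1 x + Y 2 x))\<^sup>2 \<partial>lborel)"
  let ?lim_r = "(\<integral>x. d x * (norm (H 1 1 x))\<^sup>2 \<partial>lborel) + (\<integral>x. d x * (norm (H 1 2 x))\<^sup>2 \<partial>lborel)
      + (\<integral>x. d x * (norm (H 2 1 x))\<^sup>2 \<partial>lborel) + (\<integral>x. d x * (norm (H 2 2 x))\<^sup>2 \<partial>lborel)"
  have limL: "?L \<longlonglongrightarrow> ?lim_l"
    by (intro tendsto_add mollify_weighted_tendsto T YY; fact cont z0)
  have limR: "?Rn \<longlonglongrightarrow> ?lim_r"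
    by (intro tendsto_add mollify_weighted_tendsto T; fact cont z0)
  have mL2: "?m n f \<in> L2" if "f \<in> cL2" for f :: "real^2 \<Rightarrow> 'b" and n
    by (rule mollify_L2(1)[OF cL2_L2[OF that] cL2_integrable[OF that]])
  have le: "?L n \<le> ?Rn n" if n: "1 / (real n + 1) < 1 - R" for n
  proof -
    have sub: "cball x (1 / (real n + 1)) \<subseteq> disc 1" if "norm x < R" for x :: "real^2"
    proof
      fix z assume "z \<in> cball x (1 / (real n + 1))"
      then have "norm (z - x) \<le> 1 / (real n + 1)" by (simp add: dist_norm norm_minus_commute)
      then have "norm z < 1" using norm_triangle_sub[of z x] that n by linarith
      then show "z \<in> disc 1" by simp
    qed
    let ?u' = "\<lambda>i x v. pderiv_dir v (?m n (Y i)) x"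
    have du: "(?m n (Y i) has_derivative ?u' i x) (at x)" for i x
      by (rule conv_has_derivative'[OF mollifier_test cL2_integrable[OF T(2)]])
    have pe: "?u' i x (axis j 1) = conv (pderiv_dir (axis j 1) (mollifier n)) (Y i) x" for i j x
      by (rule pderiv_dir_conv[OF mollifier_test cL2_integrable[OF T(2)] axis_Basis2])
    have cu: "continuous_on UNIV (\<lambda>x. ?u' i x (axis j 1))" for i j
      unfolding pe by (rule conv_continuous[OF test_functions_pderiv[OF mollifier_test axis_Basis2] cL2_integrable[OF T(2)]])
    have hess: "?u' i x (axis j 1) = ?m n (H i j) x" if "norm x < R" for i j x
      unfolding pe by (rule conv_wderiv[OF T(5) sub[OF that]])
    have "(\<integral>x. \<zeta> (x \<bullet> x) * ((norm (?m n (Y 1) x))\<^sup>2 + (norm (?m n (Y 2) x))\<^sup>2)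
        + 2 * \<zeta>' (x \<bullet> x) * (norm (x $ 1 *\<^sub>R ?m n (Y 2) x - x $ 2 *\<^sub>R ?m n (Y 1) x))\<^sup>2 \<partial>lborel)
      \<le> (\<integral>x. \<zeta> (x \<bullet> x) * (x \<bullet> x) * ((norm (?u' 1 x e1))\<^sup>2 + (norm (?u' 1 x e2))\<^sup>2 + (norm (?u' 2 x e1))\<^sup>2 + (norm (?u' 2 x e2))\<^sup>2) \<partial>lborel)"
    proof (rule curvature_inequality_smooth[OF du du _ _ _ \<zeta> R(1) zero])
      show "continuous_on UNIV (\<lambda>x. ?u' 1 x b)" if "b \<in> {e1, e2}" for b using that cu by auto
      show "continuous_on UNIV (\<lambda>x. ?u' 2 x b)" if "b \<in> {e1, e2}" for b using that cu by auto
      show "?u' 1 x e2 = ?u' 2 x e1" if "norm x < R" for x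
        unfolding hess[OF that] by (rule conv_hessian_symmetric[OF w sub[OF that]])
    qed
    also have "(\<integral>x. \<zeta> (x \<bullet> x) * ((norm (?m n (Y 1) x))\<^sup>2 + (norm (?m n (Y 2) x))\<^sup>2)
        + 2 * \<zeta>' (x \<bullet> x) * (norm (x $ 1 *\<^sub>R ?m n (Y 2) x - x $ 2 *\<^sub>R ?m n (Y 1) x))\<^sup>2 \<partial>lborel) = ?L n"
      unfolding polar conv_add[OF mollifier_test cL2_integrable[OF T(2)] cL2_integrable[OF T(2)], symmetric]
      by (simp only: Bochner_Integration.integral_add Bochner_Integration.integrable_add
          weighted_integrable[OF mL2[OF T(2)] cont(1) z0(1)] weighted_integrable[OF mL2[OF T(2)] cont(2) z0(2)]
          weighted_integrable[OF mL2[OF YY] cont(3) z0(3)])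
    also have "(\<integral>x. \<zeta> (x \<bullet> x) * (x \<bullet> x) * ((norm (?u' 1 x e1))\<^sup>2 + (norm (?u' 1 x e2))\<^sup>2 + (norm (?u' 2 x e1))\<^sup>2 + (norm (?u' 2 x e2))\<^sup>2) \<partial>lborel)
      = (\<integral>x. d x * (norm (?m n (H 1 1) x))\<^sup>2 + d x * (norm (?m n (H 1 2) x))\<^sup>2
        + d x * (norm (?m n (H 2 1) x))\<^sup>2 + d x * (norm (?m n (H 2 2) x))\<^sup>2 \<partial>lborel)"
    proof (rule Bochner_Integration.integral_cong[OF refl])
      fix x :: "real^2"
      show "\<zeta> (x \<bullet> x) * (x \<bullet> x) * ((norm (?u' 1 x e1))\<^sup>2 + (norm (?u' 1 x e2))\<^sup>2 + (norm (?u' 2 x e1))\<^sup>2 + (norm (?u' 2 x e2))\<^sup>2)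
        = d x * (norm (?m n (H 1 1) x))\<^sup>2 + d x * (norm (?m n (H 1 2) x))\<^sup>2
        + d x * (norm (?m n (H 2 1) x))\<^sup>2 + d x * (norm (?m n (H 2 2) x))\<^sup>2"
      proof (cases "norm x < R")
        case True
        show ?thesis unfolding hess[OF True] d_def by (simp only: distrib_left)
      next
        case False
        then show ?thesis using out[of x] by (simp add: d_def)
      qed
    qed
    also have "\<dots> = ?Rn n"
      by (simp only: Bochner_Integration.integral_add Bochner_Integration.integrable_add
          weighted_integrable[OF mL2[OF T(3)] cont(4) z0(4)])
    finally show ?thesis .
  qed
  obtain N where N: "inverse (real (Suc N)) < 1 - R" using reals_Archimedean[of "1 - R"] R by auto
  have "1 / (real n + 1) < 1 - R" if "n \<ge> N" for n
  proof -
    have "1 / (real n + 1) \<le> inverse (real (Suc N))"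
      using that by (simp add: field_simps)
    then show ?thesis using N by linarith
  qed
  then have "?lim_l \<le> ?lim_r"
    by (intro LIMSEQ_le[OF limL limR] exI[of _ N] allI impI le)
  also have "?lim_l = (\<integral>x. \<zeta> (x \<bullet> x) * ((norm (Y 1 x))\<^sup>2 + (norm (Y 2 x))\<^sup>2)
        + 2 * \<zeta>' (x \<bullet> x) * (norm (x $ 1 *\<^sub>R Y 2 x - x $ 2 *\<^sub>R Y 1 x))\<^sup>2 \<partial>lborel)"
    unfolding polar
    by (simp only: Bochner_Integration.integral_add Bochner_Integration.integrable_add
          weighted_integrable[OF cL2_L2[OF T(2)] cont(1) z0(1)] weighted_integrable[OF cL2_L2[OF T(2)] cont(2) z0(2)]
          weighted_integrable[OF cL2_L2[OF YY] cont(3) z0(3)])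
  also have "?lim_r = (\<integral>x. \<zeta> (x \<bullet> x) * (x \<bullet> x) * ((norm (H 1 1 x))\<^sup>2 + (norm (H 1 2 x))\<^sup>2 + (norm (H 2 1 x))\<^sup>2 + (norm (H 2 2 x))\<^sup>2) \<partial>lborel)"
    unfolding distrib_left d_def[symmetric]
    by (simp only: Bochner_Integration.integral_add Bochner_Integration.integrable_add
          weighted_integrable[OF cL2_L2[OF T(3)] cont(4) z0(4)])
  finally show ?thesis .
qed

section \<open>Radial integrals\<close>

text \<open>The disc of squared radius \<open>s\<close> has area \<open>pi * s\<close>, hence the
  constant density. The minus sign is there because finite measures of half-lines
  \<open>{a<..}\<close> are compared: under \<open>x \<bullet> x\<close> itself their preimages
  would be unbounded.\<close>

lemma distr_inner_self:
  "distr lborel borel (\<lambda>x::real^2. - (x \<bullet> x)) = density lborel (\<lambda>s. ennreal pi * indicator {..0} s)"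
proof (rule measure_eqI_lessThan)
  fix a :: real
  have M: "emeasure (distr lborel borel (\<lambda>x::real^2. - (x \<bullet> x))) {a<..} = ennreal (pi * max 0 (- a))"
  proof -
    have "(\<lambda>x::real^2. - (x \<bullet> x)) -` {a<..} = ball 0 (sqrt (max 0 (- a)))"
    proof -
      have "a < - (x \<bullet> x) \<longleftrightarrow> norm x < sqrt (max 0 (- a))" for x :: "real^2"
        unfolding norm_eq_sqrt_inner real_sqrt_less_iff less_max_iff_disj using inner_ge_zero[of x] by linarith
      then show ?thesis by auto
    qed
    then show ?thesis
      by (subst emeasure_distr) (auto simp: emeasure_ball unit_ball_vol_2 mult.commute)
  qed
  show "emeasure (distr lborel borel (\<lambda>x::real^2. - (x \<bullet> x))) {a<..} < \<infinity>"
    unfolding M by simp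
  have "emeasure (density lborel (\<lambda>s. ennreal pi * indicator {..0} s)) {a<..}
      = (\<integral>\<^sup>+s. ennreal pi * indicator {a<..0} s \<partial>lborel)"
    by (subst emeasure_density) (auto intro!: nn_integral_cong simp: indicator_def)
  also have "\<dots> = ennreal pi * emeasure lborel {a<..0}"
    by (rule nn_integral_cmult_indicator) simp
  also have "\<dots> = ennreal (pi * max 0 (- a))"
    by (cases "a \<le> 0") (auto simp: max_def simp flip: ennreal_mult')
  finally show "emeasure (distr lborel borel (\<lambda>x::real^2. - (x \<bullet> x))) {a<..}
      = emeasure (density lborel (\<lambda>s. ennreal pi * indicator {..0} s)) {a<..}"
    unfolding M ..
qed auto

lemma nn_integral_radial:
  fixes F :: "real \<Rightarrow> ennreal"
  assumes [measurable]: "F \<in> borel_measurable borel"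
  shows "(\<integral>\<^sup>+x. F ((x::real^2) \<bullet> x) \<partial>lborel) = ennreal pi * (\<integral>\<^sup>+s. F s * indicator {0..} s \<partial>lborel)"
proof -
  have "(\<integral>\<^sup>+x. F ((x::real^2) \<bullet> x) \<partial>lborel) = (\<integral>\<^sup>+s. F (- s) \<partial>distr lborel borel (\<lambda>x::real^2. - (x \<bullet> x)))"
    by (subst nn_integral_distr) auto
  also have "\<dots> = (\<integral>\<^sup>+s. ennreal pi * indicator {..0} s * F (- s) \<partial>lborel)"
    unfolding distr_inner_self by (subst nn_integral_density) auto
  also have "\<dots> = (\<integral>\<^sup>+s. ennreal pi * (F s * indicator {0..} s) \<partial>lborel)"
    by (subst nn_integral_real_affine[where c="-1" and t=0]) (auto intro!: nn_integral_cong simp: indicator_def mult_ac)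
  also have "\<dots> = ennreal pi * (\<integral>\<^sup>+s. F s * indicator {0..} s \<partial>lborel)"
    by (rule nn_integral_cmult) simp
  finally show ?thesis .
qed

lemma integral_radial:
  fixes F :: "real \<Rightarrow> real"
  assumes [measurable]: "F \<in> borel_measurable borel"
  shows "(\<integral>x. F ((x::real^2) \<bullet> x) \<partial>lborel) = pi * (\<integral>s. indicator {0..} s * F s \<partial>lborel)"
proof -
  have m: "(\<lambda>s. F (- s)) \<in> borel_measurable borel" by measurable
  have m2: "(\<lambda>s. pi * indicator {..0} s * F (- s)) \<in> borel_measurable borel"
    by (intro borel_measurable_times m) auto
  have dens: "density lborel (\<lambda>s. ennreal pi * indicator {..0} s) = density lborel (\<lambda>s. ennreal (pi * indicator {..0} s))"
    by (intro arg_cong[where f="density lborel"] ext) (auto simp: indicator_def)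
  have "(\<integral>x. F ((x::real^2) \<bullet> x) \<partial>lborel) = (\<integral>s. F (- s) \<partial>distr lborel borel (\<lambda>x::real^2. - (x \<bullet> x)))"
    by (subst integral_distr) auto
  also have "\<dots> = (\<integral>s. pi * indicator {..0} s * F (- s) \<partial>lborel)"
    unfolding distr_inner_self dens by (rule integral_real_density) (use m in auto)
  also have "\<dots> = (\<integral>s. pi * indicator {..0} (- s) * F s \<partial>lborel)"
    using lborel_integral_reflect[OF m2, of 0] unfolding diff_0 minus_minus by (rule sym)
  also have "\<dots> = (\<integral>s. pi * (indicator {0..} s * F s) \<partial>lborel)"
    by (intro Bochner_Integration.integral_cong) (auto simp: indicator_def)
  finally show ?thesis by simp
qed

section \<open>The lower bound\<close>

definition gram :: "(2 \<Rightarrow> real^2 \<Rightarrow> 'b::euclidean_space) \<Rightarrow> real^2 \<Rightarrow> real^2^2" where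
  "gram Y x = (\<chi> i j. Y i x \<bullet> Y j x)"

text \<open>The explicit cone metric with the unnormalized vector \<open>quarter x\<close>, hence
  the division by \<open>x \<bullet> x\<close>. At the origin the division convention makes it the
  identity matrix, a value on a null set.\<close>

definition coneg :: "real \<Rightarrow> real^2 \<Rightarrow> real^2^2" where
  "coneg \<Delta> x = (\<chi> i j. (if i = j then 1 else 0) - \<Delta>\<^sup>2 * (quarter x $ i * quarter x $ j) / (x \<bullet> x))"

definition hsq :: "(2 \<Rightarrow> 2 \<Rightarrow> real^2 \<Rightarrow> 'b::euclidean_space) \<Rightarrow> real^2 \<Rightarrow> real" where
  "hsq H x = (norm (H 1 1 x))\<^sup>2 + (norm (H 1 2 x))\<^sup>2 + (norm (H 2 1 x))\<^sup>2 + (norm (H 2 2 x))\<^sup>2"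

lemma cone_metric_coneg:
  assumes "\<bar>\<Delta>\<bar> \<le> 1" "x \<noteq> 0"
  shows "cone_metric \<Delta> x = coneg \<Delta> x"
proof -
  have "x \<bullet> x = norm x * norm x" by (simp add: power2_norm_eq_inner[symmetric] power2_eq_square)
  then show ?thesis
    unfolding cone_metric_eq[OF assms] coneg_def
    by (simp add: vec_eq_iff forall_2 mat_def)
qed

lemma norm_matrix_sq: "(norm (M :: real^2^2))\<^sup>2 = (M $ 1 $ 1)\<^sup>2 + (M $ 1 $ 2)\<^sup>2 + (M $ 2 $ 1)\<^sup>2 + (M $ 2 $ 2)\<^sup>2"
  unfolding power2_norm_eq_inner inner_vec_def by (simp add: sum_2 power2_eq_square)

lemma abs_entry_le: "\<bar>M $ i $ j\<bar> \<le> norm (M :: real^2^2)"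
  by (rule order_trans[OF component_le_norm_cart[of "M $ i" j] Finite_Cartesian_Product.norm_nth_le])

lemma measurable_matrix:
  assumes "\<And>i j. (\<lambda>x. M x $ i $ j) \<in> borel_measurable N"
  shows "(M :: 'a \<Rightarrow> real^2^2) \<in> borel_measurable N"
proof -
  have "M x = (\<Sum>i\<in>UNIV. \<Sum>j\<in>UNIV. (M x $ i $ j) *\<^sub>R axis i (axis j 1))" for x
    by (simp add: vec_eq_iff forall_2 sum_2 axis_def)
  then have "M = (\<lambda>x. \<Sum>i\<in>UNIV. \<Sum>j\<in>UNIV. (M x $ i $ j) *\<^sub>R axis i (axis j 1))" by blast
  then show ?thesis
    by (rule ssubst) (intro borel_measurable_sum borel_measurable_scaleR borel_measurable_const assms)
qed

lemma nth_borel [measurable]: "(\<lambda>x::real^2. x $ i) \<in> borel_measurable borel"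
  by (intro borel_measurable_continuous_onI continuous_intros)

lemma quarter_borel [measurable]: "(\<lambda>x. quarter x $ i) \<in> borel_measurable borel"
  by (intro borel_measurable_continuous_onI continuous_intros continuous_quarter)

lemma coneg_borel [measurable]: "coneg \<Delta> \<in> borel_measurable borel"
  by (rule measurable_matrix) (simp add: coneg_def)

lemma gram_borel:
  assumes [measurable]: "\<And>i. Y i \<in> borel_measurable borel"
  shows "gram Y \<in> borel_measurable borel"
  by (rule measurable_matrix) (simp add: gram_def)

lemma max0_square_deriv: "((\<lambda>t. (max 0 t)\<^sup>2) has_real_derivative 2 * max 0 t) (at t)" for t :: real
proof -
  consider "t < 0" | "t = 0" | "t > 0" by linarith
  then show ?thesis
  proof cases
    case 1
    have "((\<lambda>t. 0) has_real_derivative 2 * max 0 t) (at t)" using 1 by simp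
    moreover have "eventually (\<lambda>t::real. (max 0 t)\<^sup>2 = 0) (nhds t)"
      using eventually_nhds_in_open[of "{..<0}" t] 1 by (auto elim: eventually_mono)
    ultimately show ?thesis
      by (rule DERIV_cong_ev[OF refl _ refl, THEN iffD2, rotated])
  next
    case 3
    have "((\<lambda>t. t\<^sup>2) has_real_derivative 2 * max 0 t) (at t)" using 3 by (auto intro!: derivative_eq_intros)
    moreover have "eventually (\<lambda>t::real. (max 0 t)\<^sup>2 = t\<^sup>2) (nhds t)"
      using eventually_nhds_in_open[of "{0<..}" t] 3 by (auto elim: eventually_mono)
    ultimately show ?thesis
      by (rule DERIV_cong_ev[OF refl _ refl, THEN iffD2, rotated])
  next
    case 2
    have "(\<lambda>h::real. ((max 0 (0 + h))\<^sup>2 - (max 0 0)\<^sup>2) / h) \<midarrow>0\<rightarrow> 0"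
    proof (rule Lim_null_comparison[where g="\<lambda>h. \<bar>h\<bar>"])
      have "norm (((max 0 (0 + h))\<^sup>2 - (max 0 0)\<^sup>2) / h) \<le> \<bar>h\<bar>" for h :: real
        by (cases "h > 0") (auto simp: max_def power2_eq_square)
      then show "\<forall>\<^sub>F h::real in at 0. norm (((max 0 (0 + h))\<^sup>2 - (max 0 0)\<^sup>2) / h) \<le> \<bar>h\<bar>"
        by (rule always_eventually[OF allI])
      show "(\<lambda>h::real. \<bar>h\<bar>) \<midarrow>0\<rightarrow> 0" by (auto intro!: tendsto_eq_intros)
    qed
    then show ?thesis using 2 by (simp add: DERIV_def)
  qed
qed

section \<open>The cut-off weight and its radial integrals\<close>

context
  fixes R h :: real
  assumes R: "0 < R" "R < 1" and h: "0 < h"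
begin

text \<open>Affine in the squared radius and squared in the weight: the square is continuously
  differentiable where it reaches 0, and \<open>(cut s)\<^sup>2 \<ge> 1 - 2 * s / R\<^sup>2\<close>
  shows that cutting off costs the logarithm only an additive constant.\<close>

definition cut :: "real \<Rightarrow> real" where "cut s = max 0 (1 - s / R\<^sup>2)"
definition wgt :: "real \<Rightarrow> real" where "wgt s = (cut s)\<^sup>2 / (s + h\<^sup>2)"
definition wgt' :: "real \<Rightarrow> real" where
  "wgt' s = - (2 / R\<^sup>2 * cut s / (s + h\<^sup>2)) - (cut s)\<^sup>2 / (s + h\<^sup>2)\<^sup>2"

lemma cut_bounds: "0 \<le> cut s" "s \<ge> 0 \<Longrightarrow> cut s \<le> 1" "s \<ge> R\<^sup>2 \<Longrightarrow> cut s = 0"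
  using R by (auto simp: cut_def field_simps)

lemma shift_pos: "s \<ge> 0 \<Longrightarrow> 0 < s + h\<^sup>2"
  using h by (simp add: add_nonneg_pos)

lemma wgt_deriv:
  assumes "s \<ge> 0" shows "(wgt has_real_derivative wgt' s) (at s)"
proof -
  have "((\<lambda>s. (cut s)\<^sup>2) has_real_derivative (2 * cut s) * (- (1 / R\<^sup>2))) (at s)"
    unfolding cut_def
    by (rule DERIV_chain2[OF max0_square_deriv DERIV_cong[OF DERIV_diff[OF DERIV_const DERIV_cdivide[OF DERIV_ident]]]]) simp
  moreover have "((\<lambda>s. s + h\<^sup>2) has_real_derivative 1) (at s)" by (auto intro!: derivative_eq_intros)
  moreover have ne: "s + h\<^sup>2 \<noteq> 0" using shift_pos[OF assms] by simp
  ultimately have "(wgt has_real_derivative ((2 * cut s) * (- (1 / R\<^sup>2)) * (s + h\<^sup>2) - (cut s)\<^sup>2 * 1) / ((s + h\<^sup>2) * (s + h\<^sup>2))) (at s)"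
    unfolding wgt_def[abs_def] by (rule DERIV_divide)
  also have "((2 * cut s) * (- (1 / R\<^sup>2)) * (s + h\<^sup>2) - (cut s)\<^sup>2 * 1) / ((s + h\<^sup>2) * (s + h\<^sup>2)) = wgt' s"
    unfolding wgt'_def diff_divide_distrib using ne by (simp add: power2_eq_square)
  finally show ?thesis .
qed

lemma cut_cont: "continuous_on S cut"
  unfolding cut_def using R by (intro continuous_intros) auto

lemma wgt'_cont: "continuous_on {0..} wgt'"
  unfolding wgt'_def using R shift_pos by (intro continuous_intros cut_cont) (auto simp: less_imp_neq[symmetric])

lemma wgt_cont: "continuous_on {0..} wgt"
  unfolding wgt_def using shift_pos by (intro continuous_intros cut_cont) (auto simp: less_imp_neq[symmetric])

text \<open>The third bound compares weighted with unweighted bending energy. The second and the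
  fourth give the two perturbation terms the common factor \<open>1 / (s + h\<^sup>2)\<close>; the 3
  is 2 from differentiating the cut-off plus 1 from the denominator.\<close>

lemma wgt_bounds:
  assumes s: "s \<ge> 0"
  shows "0 \<le> wgt s" "wgt s \<le> 1 / (s + h\<^sup>2)" "wgt s * s \<le> 1" "s * \<bar>wgt' s\<bar> \<le> 3 / (s + h\<^sup>2)"
proof -
  note p = shift_pos[OF s]
  have c1: "(cut s)\<^sup>2 \<le> 1" using cut_bounds(1)[of s] cut_bounds(2)[OF s] by (simp add: power_le_one)
  show "0 \<le> wgt s" using p by (simp add: wgt_def)
  show w1: "wgt s \<le> 1 / (s + h\<^sup>2)" unfolding wgt_def using p c1 by (intro divide_right_mono) auto
  have "wgt s * s \<le> 1 / (s + h\<^sup>2) * s" using w1 s by (rule mult_right_mono)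
  also have "\<dots> \<le> 1" using p h by (simp add: pos_divide_le_eq)
  finally show "wgt s * s \<le> 1" .
  have 1: "s / R\<^sup>2 * cut s \<le> 1"
  proof (cases "s \<ge> R\<^sup>2")
    case True
    then show ?thesis using cut_bounds(3) by simp
  next
    case False
    then have "s / R\<^sup>2 \<le> 1" using R by (simp add: pos_divide_le_eq)
    then show ?thesis using cut_bounds(1)[of s] cut_bounds(2)[OF s] by (intro mult_le_one)
  qed
  have 2: "s * ((cut s)\<^sup>2 / (s + h\<^sup>2)\<^sup>2) \<le> 1 / (s + h\<^sup>2)"
  proof -
    have "s * ((cut s)\<^sup>2 / (s + h\<^sup>2)\<^sup>2) \<le> (s + h\<^sup>2) * (1 / (s + h\<^sup>2)\<^sup>2)"
      using c1 s h p by (intro mult_mono divide_right_mono) auto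
    also have "\<dots> = 1 / (s + h\<^sup>2)" using p by (simp add: power2_eq_square)
    finally show ?thesis .
  qed
  have "\<bar>wgt' s\<bar> = 2 / R\<^sup>2 * cut s / (s + h\<^sup>2) + (cut s)\<^sup>2 / (s + h\<^sup>2)\<^sup>2"
  proof -
    have "0 \<le> 2 / R\<^sup>2 * cut s / (s + h\<^sup>2)" "0 \<le> (cut s)\<^sup>2 / (s + h\<^sup>2)\<^sup>2"
      using cut_bounds(1)[of s] p by auto
    then show ?thesis unfolding wgt'_def by linarith
  qed
  then have "s * \<bar>wgt' s\<bar> = 2 * (s / R\<^sup>2 * cut s) / (s + h\<^sup>2) + s * ((cut s)\<^sup>2 / (s + h\<^sup>2)\<^sup>2)"
    by (simp only: distrib_left) simp
  also have "\<dots> \<le> 2 * 1 / (s + h\<^sup>2) + 1 / (s + h\<^sup>2)"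
    using 1 2 p by (intro add_mono divide_right_mono) auto
  finally show "s * \<bar>wgt' s\<bar> \<le> 3 / (s + h\<^sup>2)" by (simp add: add_divide_distrib[symmetric])
qed

text \<open>In the plane this integral scales like \<open>1 / h\<^sup>2\<close>; multiplied by
  \<open>h\<^sup>2\<close> it turns the remainder of Young's inequality into a constant.\<close>

lemma integral_inverse_square:
  "integrable lborel (\<lambda>x::real^2. 1 / (x \<bullet> x + h\<^sup>2)\<^sup>2)"
  "integral\<^sup>L lborel (\<lambda>x::real^2. 1 / (x \<bullet> x + h\<^sup>2)\<^sup>2) = pi / h\<^sup>2"
proof -
  have D: "((\<lambda>s. - (1 / (s + h\<^sup>2))) has_real_derivative 1 / (s + h\<^sup>2)\<^sup>2) (at s)" if "0 \<le> s" for s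
    using shift_pos[OF that] by (auto intro!: derivative_eq_intros simp: power2_eq_square)
  have "filterlim (\<lambda>s. h\<^sup>2 + s) at_top at_top"
    by (rule filterlim_tendsto_add_at_top[OF tendsto_const filterlim_ident])
  then have "filterlim (\<lambda>s. s + h\<^sup>2) at_top at_top" by (simp only: add.commute)
  from tendsto_divide_0[OF tendsto_const filterlim_at_top_imp_at_infinity[OF this], of 1]
  have lim: "((\<lambda>s. - (1 / (s + h\<^sup>2))) \<longlongrightarrow> 0) at_top"
    using tendsto_minus by fastforce
  have m: "(\<lambda>s. 1 / (s + h\<^sup>2)\<^sup>2) \<in> borel_measurable borel" by measurable
  have "(\<integral>\<^sup>+x. ennreal (1 / ((x::real^2) \<bullet> x + h\<^sup>2)\<^sup>2) \<partial>lborel)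
      = ennreal pi * (\<integral>\<^sup>+s. ennreal (1 / (s + h\<^sup>2)\<^sup>2) * indicator {0..} s \<partial>lborel)"
    by (rule nn_integral_radial) measurable
  also have "(\<integral>\<^sup>+s. ennreal (1 / (s + h\<^sup>2)\<^sup>2) * indicator {0..} s \<partial>lborel) = ennreal (0 - - (1 / (0 + h\<^sup>2)))"
    by (rule nn_integral_FTC_atLeast[OF m D _ lim]) simp_all
  also have "ennreal pi * ennreal (0 - - (1 / (0 + h\<^sup>2))) = ennreal (pi / h\<^sup>2)"
    by (simp flip: ennreal_mult')
  finally have "has_bochner_integral lborel (\<lambda>x::real^2. 1 / (x \<bullet> x + h\<^sup>2)\<^sup>2) (pi / h\<^sup>2)"
    by (intro has_bochner_integral_nn_integral) auto
  then show "integrable lborel (\<lambda>x::real^2. 1 / (x \<bullet> x + h\<^sup>2)\<^sup>2)"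
    "integral\<^sup>L lborel (\<lambda>x::real^2. 1 / (x \<bullet> x + h\<^sup>2)\<^sup>2) = pi / h\<^sup>2"
    by (simp_all add: has_bochner_integral_iff)
qed

text \<open>The cone metric has trace \<open>2 - \<Delta>\<^sup>2\<close> and tangential coefficient
  \<open>1 - \<Delta>\<^sup>2\<close>, which gives \<open>A\<close>. It can be regrouped as
  \<open>\<Delta>\<^sup>2 * wgt s\<close> plus \<open>2 * (1 - \<Delta>\<^sup>2)\<close> times the
  derivative of \<open>s * wgt s\<close>; the latter has zero boundary values, so the coefficient
  \<open>\<Delta>\<^sup>2\<close> alone survives.\<close>

lemma radial_main:
  assumes "0 \<le> \<Delta>" "\<Delta> \<le> 1"
  defines "A \<equiv> \<lambda>s. (2 - \<Delta>\<^sup>2) * wgt s + 2 * (1 - \<Delta>\<^sup>2) * (s * wgt' s)"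
  shows "2 * pi * \<Delta>\<^sup>2 * (ln (R / h) - 1) \<le> integral\<^sup>L lborel (\<lambda>x::real^2. A (x \<bullet> x))"
proof -
  have [measurable]: "cut \<in> borel_measurable borel"
    by (rule borel_measurable_continuous_onI[OF cut_cont])
  have A: "A \<in> borel_measurable borel"
    unfolding A_def wgt_def wgt'_def by measurable
  have A0: "A s = 0" if "s \<ge> R\<^sup>2" for s
    using cut_bounds(3)[OF that] by (simp add: A_def wgt_def wgt'_def)
  \<comment> \<open>\<open>?G\<close> is a primitive of a minorant of \<open>A\<close>: the exact
    derivative of \<open>s * wgt s\<close> is kept, and the remaining \<open>wgt\<close> is replaced
    by \<open>1 / (s + h\<^sup>2) - k\<close>.\<close>
  define k where "k = 2 / R\<^sup>2"
  let ?G = "\<lambda>s. (1 - \<Delta>\<^sup>2) * (2 * (s * wgt s)) + \<Delta>\<^sup>2 * (ln (s + h\<^sup>2) - k * s)"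
  let ?G' = "\<lambda>s. (1 - \<Delta>\<^sup>2) * (2 * (wgt s + s * wgt' s)) + \<Delta>\<^sup>2 * (1 / (s + h\<^sup>2) - k)"
  have G: "(?G has_real_derivative ?G' s) (at s)" if "s \<ge> 0" for s
    using shift_pos[OF that] by (auto intro!: derivative_eq_intros wgt_deriv[OF that] simp: algebra_simps)
  have "(?G' has_integral (?G (R\<^sup>2) - ?G 0)) {0..R\<^sup>2}"
  proof (rule fundamental_theorem_of_calculus)
    show "(?G has_vector_derivative ?G' s) (at s within {0..R\<^sup>2})" if "s \<in> {0..R\<^sup>2}" for s
      unfolding has_real_derivative_iff_has_vector_derivative[symmetric]
      by (rule has_field_derivative_at_within[OF G]) (use that in simp)
  qed simp
  moreover have cA: "continuous_on {0..R\<^sup>2} A"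
    unfolding A_def by (intro continuous_intros continuous_on_subset[OF wgt_cont] continuous_on_subset[OF wgt'_cont]) auto
  then have "(A has_integral integral {0..R\<^sup>2} A) {0..R\<^sup>2}"
    by (intro integrable_integral integrable_continuous_interval)
  moreover have "?G' s \<le> A s" if "s \<in> {0..R\<^sup>2}" for s
  proof -
    have s: "0 \<le> s" "s \<le> R\<^sup>2" using that by auto
    define t where "t = s / R\<^sup>2"
    note p = shift_pos[OF s(1)]
    have "t \<le> 1" using s R by (simp add: t_def pos_divide_le_eq)
    then have "(cut s)\<^sup>2 = 1 - 2 * t + t\<^sup>2" by (simp add: cut_def t_def[symmetric] power2_diff)
    then have "1 - 2 * t \<le> (cut s)\<^sup>2" by simp
    then have "(1 - 2 * t) / (s + h\<^sup>2) \<le> wgt s" unfolding wgt_def using p by (intro divide_right_mono) auto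
    moreover have "2 * t / (s + h\<^sup>2) \<le> 2 / R\<^sup>2"
    proof -
      have "s / (s + h\<^sup>2) \<le> 1" using p h by (simp add: pos_divide_le_eq)
      then have "2 / R\<^sup>2 * (s / (s + h\<^sup>2)) \<le> 2 / R\<^sup>2 * 1" by (intro mult_left_mono) auto
      then show ?thesis by (simp add: t_def)
    qed
    ultimately have "1 / (s + h\<^sup>2) - k \<le> wgt s" unfolding k_def by (simp only: diff_divide_distrib)
    from mult_left_mono[OF this, of "\<Delta>\<^sup>2"] show ?thesis
      unfolding A_def by (simp add: algebra_simps)
  qed
  ultimately have "?G (R\<^sup>2) - ?G 0 \<le> integral {0..R\<^sup>2} A"
    by (rule has_integral_le)
  moreover have "wgt (R\<^sup>2) = 0" using cut_bounds(3)[of "R\<^sup>2"] by (simp add: wgt_def)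
  then have "?G (R\<^sup>2) - ?G 0 = \<Delta>\<^sup>2 * (ln (R\<^sup>2 + h\<^sup>2) - ln (h\<^sup>2) - 2)"
    using R by (simp add: k_def algebra_simps)
  moreover have "2 * ln (R / h) \<le> ln (R\<^sup>2 + h\<^sup>2) - ln (h\<^sup>2)"
  proof -
    have "ln (R\<^sup>2) \<le> ln (R\<^sup>2 + h\<^sup>2)" using R by (subst ln_le_cancel_iff) (auto simp: add_pos_nonneg)
    then show ?thesis using R h by (simp add: ln_div ln_realpow)
  qed
  then have "\<Delta>\<^sup>2 * (2 * ln (R / h) - 2) \<le> \<Delta>\<^sup>2 * (ln (R\<^sup>2 + h\<^sup>2) - ln (h\<^sup>2) - 2)"
    by (intro mult_left_mono) auto
  ultimately have "\<Delta>\<^sup>2 * (2 * ln (R / h) - 2) \<le> integral {0..R\<^sup>2} A" by linarith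
  from mult_left_mono[OF this, of pi]
  have "2 * pi * \<Delta>\<^sup>2 * (ln (R / h) - 1) \<le> pi * integral {0..R\<^sup>2} A"
    by (simp add: algebra_simps)
  also have "integral {0..R\<^sup>2} A = (\<integral>s. indicator {0..} s * A s \<partial>lborel)"
  proof -
    have si: "set_integrable lborel {0..R\<^sup>2} A"
      using borel_integrable_atLeastAtMost'[OF cA] by (simp add: set_integrable_def)
    have "(\<integral>s. indicator {0..} s * A s \<partial>lborel) = (\<integral>s. indicator {0..R\<^sup>2} s *\<^sub>R A s \<partial>lborel)"
      by (intro Bochner_Integration.integral_cong) (auto simp: indicator_def A0)
    also have "\<dots> = integral {0..R\<^sup>2} A"
      using set_borel_integral_eq_integral(2)[OF si] by (simp only: set_lebesgue_integral_def)
    finally show ?thesis by simp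
  qed
  also have "pi * (\<integral>s. indicator {0..} s * A s \<partial>lborel) = integral\<^sup>L lborel (\<lambda>x::real^2. A (x \<bullet> x))"
    by (rule integral_radial[OF A, symmetric])
  finally show ?thesis .
qed

text \<open>The metric enters the curvature inequality linearly, so the inequality splits into the
  radial integral for the cone and a term linear in the deviation. Young's inequality trades the
  latter for half of the membrane energy over \<open>h\<^sup>2\<close> and the constant
  \<open>98 * pi\<close>. That only half is spent is what later yields control of the membrane
  energy itself.\<close>

lemma lower_bound:
  fixes y :: "real^2 \<Rightarrow> 'b::euclidean_space"
  assumes w: "weak_triple y Y H" and \<Delta>: "0 \<le> \<Delta>" "\<Delta> \<le> 1"
    and int: "integrable lborel (\<lambda>x. indicator (disc 1) x * (norm (gram Y x - coneg \<Delta> x))\<^sup>2)"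
  shows "2 * pi * \<Delta>\<^sup>2 * (ln (R / h) - 1) - 98 * pi
      - (\<integral>x. indicator (disc 1) x * (norm (gram Y x - coneg \<Delta> x))\<^sup>2 \<partial>lborel) / (2 * h\<^sup>2)
    \<le> (\<integral>x. indicator (disc R) x * hsq H x \<partial>lborel)"
proof -
  note T = weak_tripleD[OF w]
  let ?M = "\<lambda>x. gram Y x - coneg \<Delta> x"
  let ?A = "\<lambda>s. (2 - \<Delta>\<^sup>2) * wgt s + 2 * (1 - \<Delta>\<^sup>2) * (s * wgt' s)"
  let ?K = "\<lambda>x. wgt (x \<bullet> x) * ((norm (Y 1 x))\<^sup>2 + (norm (Y 2 x))\<^sup>2)
        + 2 * wgt' (x \<bullet> x) * (norm (x $ 1 *\<^sub>R Y 2 x - x $ 2 *\<^sub>R Y 1 x))\<^sup>2"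
  \<comment> \<open>A pointwise minorant of \<open>?K\<close>: the cone part, less the Young
    remainder and half of the membrane density over \<open>h\<^sup>2\<close>.\<close>
  let ?lo = "\<lambda>x. ?A (x \<bullet> x) - 98 * h\<^sup>2 * (1 / (x \<bullet> x + h\<^sup>2)\<^sup>2) - (1 / (2 * h\<^sup>2)) * (indicator (disc 1) x * (norm (?M x))\<^sup>2)"
  have wz: "wgt s = 0" "wgt' s = 0" if "s \<ge> R\<^sup>2" for s
    using cut_bounds(3)[OF that] by (simp_all add: wgt_def wgt'_def)
  have out: "wgt (x \<bullet> x) = 0" "wgt' (x \<bullet> x) = 0" if "norm x \<ge> R" for x :: "real^2"
    using power_mono[OF that, of 2] R wz by (simp_all add: power2_norm_eq_inner)
  have cz: "continuous_on UNIV (\<lambda>x::real^2. wgt (x \<bullet> x))"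
    by (rule continuous_on_compose2[OF wgt_cont]) (auto intro!: continuous_intros)
  have cz': "continuous_on UNIV (\<lambda>x::real^2. wgt' (x \<bullet> x))"
    by (rule continuous_on_compose2[OF wgt'_cont]) (auto intro!: continuous_intros)
  have main: "(\<integral>x. ?K x \<partial>lborel) \<le> (\<integral>x. wgt (x \<bullet> x) * (x \<bullet> x) * hsq H x \<partial>lborel)"
    unfolding hsq_def
    by (rule curvature_inequality[OF w wgt_deriv wgt'_cont wgt_bounds(1) R wz])
  have intH: "integrable lborel (hsq H)"
    unfolding hsq_def by (intro Bochner_Integration.integrable_add L2_integrable cL2_L2 T)
  have mH [measurable]: "hsq H \<in> borel_measurable borel" using intH by auto
  have mz [measurable]: "(\<lambda>x::real^2. wgt (x \<bullet> x)) \<in> borel_measurable borel" "(\<lambda>x::real^2. wgt' (x \<bullet> x)) \<in> borel_measurable borel"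
    using cz cz' by (auto intro: borel_measurable_continuous_onI)
  have H0: "0 \<le> hsq H x" for x by (simp add: hsq_def)
  have w1: "0 \<le> wgt (x \<bullet> x) * (x \<bullet> x)" "wgt (x \<bullet> x) * (x \<bullet> x) \<le> indicator (disc R) x" for x :: "real^2"
    using wgt_bounds(1,3)[OF inner_ge_zero[of x]] out[of x] by (auto simp: indicator_def)
  have "(\<integral>x. wgt (x \<bullet> x) * (x \<bullet> x) * hsq H x \<partial>lborel) \<le> (\<integral>x. indicator (disc R) x * hsq H x \<partial>lborel)"
  proof (rule integral_mono)
    show i2: "integrable lborel (\<lambda>x. indicator (disc R) x * hsq H x)"
      by (rule Bochner_Integration.integrable_bound[OF intH]) (auto simp: indicator_def)
    show "wgt (x \<bullet> x) * (x \<bullet> x) * hsq H x \<le> indicator (disc R) x * hsq H x" for x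
      by (intro mult_right_mono w1 H0)
    show "integrable lborel (\<lambda>x. wgt (x \<bullet> x) * (x \<bullet> x) * hsq H x)"
    proof (rule Bochner_Integration.integrable_bound[OF i2])
      show "AE x in lborel. norm (wgt (x \<bullet> x) * (x \<bullet> x) * hsq H x) \<le> norm (indicator (disc R) x * hsq H x)"
      proof (rule AE_I2)
        fix x
        have "norm (wgt (x \<bullet> x) * (x \<bullet> x) * hsq H x) = wgt (x \<bullet> x) * (x \<bullet> x) * hsq H x"
          unfolding real_norm_def by (rule abs_of_nonneg[OF mult_nonneg_nonneg[OF w1(1) H0]])
        also have "\<dots> \<le> indicator (disc R) x * hsq H x" by (rule mult_right_mono[OF w1(2) H0])
        also have "\<dots> \<le> norm (indicator (disc R) x * hsq H x)" by simp
        finally show "norm (wgt (x \<bullet> x) * (x \<bullet> x) * hsq H x) \<le> norm (indicator (disc R) x * hsq H x)" .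
      qed
    qed simp
  qed
  moreover have "(\<integral>x. ?lo x \<partial>lborel) \<le> (\<integral>x. ?K x \<partial>lborel)"
  proof (rule integral_mono_AE)
    show "integrable lborel ?lo"
    proof (intro Bochner_Integration.integrable_diff integrable_mult_right int integral_inverse_square(1))
      show "integrable lborel (\<lambda>x::real^2. ?A (x \<bullet> x))"
        by (rule integrable_continuous_bounded_support[where r=R])
          (use out in \<open>auto intro!: continuous_intros cz cz'\<close>)
    qed
    show "integrable lborel ?K"
    proof -
      \<comment> \<open>The coordinates are truncated to the disc, so that they are bounded
        multipliers and \<open>?D\<close> is square integrable; nothing changes because
        \<open>Y 1\<close> and \<open>Y 2\<close> vanish outside.\<close>
      let ?D = "\<lambda>x. indicator (disc 1) x *\<^sub>R (x $ 1 *\<^sub>R Y 2 x - x $ 2 *\<^sub>R Y 1 x)"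
      have b1: "integrable lborel (\<lambda>x. wgt (x \<bullet> x) * (norm (Y i x))\<^sup>2)" for i
        by (rule weighted_integrable[OF cL2_L2[OF T(2)] cz out(1)[OF less_imp_le]])
      have m: "\<bar>indicator (disc 1) x * x $ i\<bar> \<le> 1" for x :: "real^2" and i
        using component_le_norm_cart[of x i] by (auto simp: indicator_def)
      have mm: "(\<lambda>x::real^2. indicator (disc 1) x * x $ i :: real) \<in> borel_measurable borel" for i
        by (intro borel_measurable_times borel_measurable_indicator nth_borel) simp
      have "(\<lambda>x. (indicator (disc 1) x * x $ 1) *\<^sub>R Y 2 x - (indicator (disc 1) x * x $ 2) *\<^sub>R Y 1 x) \<in> L2"
        by (intro L2_diff L2_mult[OF cL2_L2[OF T(2)] mm m])
      then have D: "?D \<in> L2" by (simp add: scaleR_diff_right)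
      have b2: "integrable lborel (\<lambda>x. 2 * wgt' (x \<bullet> x) * (norm (?D x))\<^sup>2)"
        by (rule weighted_integrable[OF D, where r=R]) (use out in \<open>auto intro!: continuous_intros cz'\<close>)
      have eq: "?K x = wgt (x \<bullet> x) * (norm (Y 1 x))\<^sup>2 + wgt (x \<bullet> x) * (norm (Y 2 x))\<^sup>2 + 2 * wgt' (x \<bullet> x) * (norm (?D x))\<^sup>2" for x
        using T(2)[of 1] T(2)[of 2] by (cases "x \<in> disc 1") (auto simp: cL2_def distrib_left)
      show ?thesis unfolding eq by (intro Bochner_Integration.integrable_add b1 b2)
    qed
    have "AE x in lborel. x \<noteq> (0::real^2)"
      using AE_lborel_singleton[of "0::real^2"] .
    then show "AE x in lborel. ?lo x \<le> ?K x"
    proof eventually_elim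
      case (elim x)
      then have s: "x \<bullet> x > 0" by simp
      define s where "s = x \<bullet> x"
      have s0: "s > 0" "s \<ge> 0" using s by (simp_all add: s_def)
      have ss: "s = x $ 1 * x $ 1 + x $ 2 * x $ 2" by (simp add: s_def inner_2)
      let ?m = "\<lambda>i j. ?M x $ i $ j"
      have g: "Y 1 x \<bullet> Y 1 x = ?m 1 1 + 1 - \<Delta>\<^sup>2 * (x $ 2 * x $ 2) / s"
        "Y 2 x \<bullet> Y 2 x = ?m 2 2 + 1 - \<Delta>\<^sup>2 * (x $ 1 * x $ 1) / s"
        "Y 1 x \<bullet> Y 2 x = ?m 1 2 + \<Delta>\<^sup>2 * (x $ 1 * x $ 2) / s"
        by (simp_all add: gram_def coneg_def s_def)
      \<comment> \<open>The deviation evaluated on the tangential vector \<open>quarter x\<close>,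
        that is, the perturbation of the coefficient of \<open>2 * wgt'\<close>.\<close>
      define Q where "Q = x $ 1 * x $ 1 * ?m 2 2 + x $ 2 * x $ 2 * ?m 1 1 - 2 * (x $ 1 * x $ 2) * ?m 1 2"
      have t: "(norm (Y 1 x))\<^sup>2 + (norm (Y 2 x))\<^sup>2 = (?m 1 1 + ?m 2 2) + (2 - \<Delta>\<^sup>2)"
      proof -
        have "\<Delta>\<^sup>2 * (x $ 2 * x $ 2) / s + \<Delta>\<^sup>2 * (x $ 1 * x $ 1) / s = \<Delta>\<^sup>2 * s / s"
          unfolding ss by (simp add: add_divide_distrib[symmetric] algebra_simps)
        then show ?thesis unfolding power2_norm_eq_inner g using s0 by simp
      qed
      have q: "(norm (x $ 1 *\<^sub>R Y 2 x - x $ 2 *\<^sub>R Y 1 x))\<^sup>2 = Q + s * (1 - \<Delta>\<^sup>2)"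
      proof -
        have "(norm (x $ 1 *\<^sub>R Y 2 x - x $ 2 *\<^sub>R Y 1 x))\<^sup>2
          = x $ 1 * x $ 1 * (Y 2 x \<bullet> Y 2 x) - 2 * (x $ 1 * x $ 2) * (Y 1 x \<bullet> Y 2 x) + x $ 2 * x $ 2 * (Y 1 x \<bullet> Y 1 x)"
          by (simp add: power2_norm_eq_inner inner_diff_left inner_diff_right inner_commute algebra_simps)
        also have "\<dots> = Q + (x $ 1 * x $ 1 + x $ 2 * x $ 2)
          - \<Delta>\<^sup>2 * ((x $ 1 * x $ 1 + x $ 2 * x $ 2) * (x $ 1 * x $ 1 + x $ 2 * x $ 2)) / s"
          unfolding g Q_def by (simp add: field_simps add_divide_distrib)
        also have "\<dots> = Q + s * (1 - \<Delta>\<^sup>2)"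
          unfolding ss[symmetric] using s0 by (simp add: algebra_simps)
        finally show ?thesis .
      qed
      let ?n = "norm (?M x)"
      have "\<bar>Q\<bar> \<le> 2 * s * ?n"
      proof -
        have "\<bar>2 * (x $ 1 * x $ 2)\<bar> \<le> s"
          using sum_squares_bound[of "x $ 1" "x $ 2"] sum_squares_bound[of "- (x $ 1)" "x $ 2"]
          unfolding ss power2_eq_square by (simp add: abs_le_iff)
        then have "\<bar>2 * (x $ 1 * x $ 2) * ?m 1 2\<bar> \<le> s * ?n"
          unfolding abs_mult[of "2 * (x $ 1 * x $ 2)"] by (intro mult_mono abs_entry_le) (auto simp: s0)
        moreover have "\<bar>x $ 1 * x $ 1 * ?m 2 2\<bar> \<le> x $ 1 * x $ 1 * ?n" "\<bar>x $ 2 * x $ 2 * ?m 1 1\<bar> \<le> x $ 2 * x $ 2 * ?n"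
          by (simp_all only: abs_mult abs_mult_self_eq mult_left_mono[OF abs_entry_le] zero_le_square)
        moreover have "s * ?n = x $ 1 * x $ 1 * ?n + x $ 2 * x $ 2 * ?n" unfolding ss by (simp add: distrib_right)
        ultimately show ?thesis unfolding Q_def by linarith
      qed
      then have "\<bar>2 * wgt' s * Q\<bar> \<le> 12 / (s + h\<^sup>2) * ?n"
      proof -
        assume Q: "\<bar>Q\<bar> \<le> 2 * s * ?n"
        have "\<bar>2 * wgt' s * Q\<bar> = 2 * \<bar>wgt' s\<bar> * \<bar>Q\<bar>" by (simp add: abs_mult)
        also have "\<dots> \<le> 2 * \<bar>wgt' s\<bar> * (2 * s * ?n)" using Q by (intro mult_left_mono) auto
        also have "\<dots> = 4 * (s * \<bar>wgt' s\<bar>) * ?n" by simp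
        also have "\<dots> \<le> 4 * (3 / (s + h\<^sup>2)) * ?n"
          by (intro mult_right_mono mult_left_mono wgt_bounds(4)[OF s0(2)]) auto
        finally show ?thesis by simp
      qed
      moreover have "\<bar>wgt s * (?m 1 1 + ?m 2 2)\<bar> \<le> 2 / (s + h\<^sup>2) * ?n"
      proof -
        have "\<bar>wgt s * (?m 1 1 + ?m 2 2)\<bar> \<le> 1 / (s + h\<^sup>2) * (2 * ?n)"
          unfolding abs_mult
        proof (rule mult_mono)
          show "\<bar>wgt s\<bar> \<le> 1 / (s + h\<^sup>2)" using wgt_bounds(1,2)[OF s0(2)] by simp
          show "\<bar>?m 1 1 + ?m 2 2\<bar> \<le> 2 * ?n"
            using abs_entry_le[of "?M x" 1 1] abs_entry_le[of "?M x" 2 2] by linarith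
        qed (use less_imp_le[OF shift_pos[OF s0(2)]] in auto)
        then show ?thesis by simp
      qed
      moreover have "?K x = ?A s + (wgt s * (?m 1 1 + ?m 2 2) + 2 * wgt' s * Q)"
        unfolding t q s_def[symmetric] by (simp add: algebra_simps)
      moreover have "12 / (s + h\<^sup>2) * ?n + 2 / (s + h\<^sup>2) * ?n = 14 / (s + h\<^sup>2) * ?n"
        by (simp add: distrib_right[symmetric] add_divide_distrib[symmetric])
      ultimately have ge: "?K x \<ge> ?A s - 14 / (s + h\<^sup>2) * ?n" by linarith
      show "?lo x \<le> ?K x"
      proof (cases "norm x < R")
        case True
        then have "x \<in> disc 1" using R by simp
        define P W where "P = h\<^sup>2 / (s + h\<^sup>2)\<^sup>2" and "W = ?n\<^sup>2 / h\<^sup>2"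
        \<comment> \<open>Young's inequality for the coefficient 14, which is 12 from the tangential
          term plus 2 from the trace. The weights make exactly \<open>W / 2\<close> appear, and the
          rest is half of 14 squared, that is 98, times \<open>P\<close>.\<close>
        have "0 \<le> (14 * h / (s + h\<^sup>2) - ?n / h)\<^sup>2" by simp
        also have "\<dots> = 196 * P - 2 * (14 / (s + h\<^sup>2) * ?n) + W"
          using h shift_pos[OF s0(2)] by (simp add: P_def W_def power2_diff power_divide power_mult_distrib)
        finally have "14 / (s + h\<^sup>2) * ?n \<le> 98 * P + W / 2" by linarith
        moreover have "98 * h\<^sup>2 * (1 / (s + h\<^sup>2)\<^sup>2) = 98 * P" by (simp add: P_def)
        moreover have "(1 / (2 * h\<^sup>2)) * (indicator (disc 1) x * ?n\<^sup>2) = W / 2"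
          using \<open>x \<in> disc 1\<close> by (simp add: W_def)
        ultimately show ?thesis
          using ge unfolding s_def[symmetric] by linarith
      next
        case False
        have "0 \<le> 98 * h\<^sup>2 * (1 / (x \<bullet> x + h\<^sup>2)\<^sup>2)" "0 \<le> (1 / (2 * h\<^sup>2)) * (indicator (disc 1) x * (norm (?M x))\<^sup>2)" by simp_all
        moreover have "?K x = 0" "?A (x \<bullet> x) = 0" using False out[of x] by simp_all
        ultimately show ?thesis by linarith
      qed
    qed
  qed
  moreover have "(\<integral>x. ?lo x \<partial>lborel) = integral\<^sup>L lborel (\<lambda>x::real^2. ?A (x \<bullet> x)) - 98 * h\<^sup>2 * (pi / h\<^sup>2)
     - (1 / (2 * h\<^sup>2)) * (\<integral>x. indicator (disc 1) x * (norm (?M x))\<^sup>2 \<partial>lborel)"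
  proof -
    have iA: "integrable lborel (\<lambda>x::real^2. ?A (x \<bullet> x))"
      by (rule integrable_continuous_bounded_support[where r=R])
        (use out in \<open>auto intro!: continuous_intros cz cz'\<close>)
    show ?thesis
      by (simp only: Bochner_Integration.integral_diff Bochner_Integration.integrable_diff iA integrable_mult_right int
        integral_inverse_square integral_mult_right_zero)
  qed
  ultimately show ?thesis
    using main radial_main[OF \<Delta>] h by simp
qed

end

section \<open>The fundamental lemma of the calculus of variations\<close>

lemma conv_iter_deriv:
  assumes \<phi>: "\<phi> \<in> test_functions UNIV" and f: "integrable lborel f" and vs: "set vs \<subseteq> Basis"
  shows "iter_deriv vs (conv \<phi> f) = conv (iter_deriv vs \<phi>) f \<and> iter_deriv vs \<phi> \<in> test_functions UNIV"
  using vs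
proof (induction vs)
  case (Cons v vs)
  then have IH: "iter_deriv vs (conv \<phi> f) = conv (iter_deriv vs \<phi>) f" "iter_deriv vs \<phi> \<in> test_functions UNIV"
    and v: "v \<in> Basis" by auto
  have "iter_deriv (v # vs) (conv \<phi> f) = pderiv_dir v (conv (iter_deriv vs \<phi>) f)"
    by (simp add: IH pderiv_dir_def[abs_def])
  also have "\<dots> = conv (pderiv_dir v (iter_deriv vs \<phi>)) f"
    by (rule ext) (rule pderiv_dir_conv[OF IH(2) f v])
  finally show ?case
    using test_functions_pderiv[OF IH(2) v] by (simp add: pderiv_dir_def[abs_def])
qed (use \<phi> in simp)

lemma conv_mollifier_test:
  fixes f :: "'a::euclidean_space \<Rightarrow> real"
  assumes f: "integrable lborel f" and z: "\<And>x. norm x > r \<Longrightarrow> f x = 0" and U: "cball 0 (r + 1 / (real n + 1)) \<subseteq> U"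
  shows "conv (mollifier n) f \<in> test_functions U"
proof -
  have "conv (mollifier n) f x = 0" if "norm x > r + 1 / (real n + 1)" for x
  proof -
    have "mollifier n (x - z) *\<^sub>R f z = 0" for z
    proof (cases "norm z > r")
      case False
      then have "norm (x - z) \<ge> 1 / (real n + 1)"
        using that norm_triangle_sub[of x z] by linarith
      then show ?thesis by (simp add: mollifier_zero)
    qed (simp add: assms(2))
    then show ?thesis unfolding conv_def by (simp only: Bochner_Integration.integral_zero)
  qed
  then have "{x. conv (mollifier n) f x \<noteq> 0} \<subseteq> cball 0 (r + 1 / (real n + 1))"
    by (auto simp: not_less[symmetric])
  then have cl: "closure {x. conv (mollifier n) f x \<noteq> 0} \<subseteq> cball 0 (r + 1 / (real n + 1))"
    by (rule closure_minimal) simp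
  have "compact (closure {x. conv (mollifier n) f x \<noteq> 0})"
    using compact_Int_closed[OF compact_cball closed_closure, of 0 "r + 1 / (real n + 1)" "{x. conv (mollifier n) f x \<noteq> 0}"] cl
    by (simp add: Int_absorb1)
  moreover have "iter_deriv vs (conv (mollifier n) f) differentiable (at x)" if "set vs \<subseteq> Basis" for vs x
    using conv_iter_deriv[OF mollifier_test f that, of n] conv_has_derivative[OF _ f]
    by (auto simp: differentiable_def)
  ultimately show ?thesis
    using cl U by (auto simp: test_functions_def)
qed

text \<open>The indicator of \<open>A\<close> is not a test function, but its mollifications are:
  they are bounded by 1, supported in a slightly larger disc on which \<open>w\<close> is
  integrable, and converge almost everywhere along a subsequence. Dominated convergence then applies
  although \<open>w\<close> is only locally integrable.\<close>

lemma fundamental_lemma_bounded: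
  fixes w :: "real^2 \<Rightarrow> 'b::euclidean_space"
  assumes w: "\<And>r. r < 1 \<Longrightarrow> integrable lborel (\<lambda>x. indicator (cball 0 r) x *\<^sub>R w x)"
    and test: "\<And>\<phi>. \<phi> \<in> test_functions (disc 1) \<Longrightarrow> (\<integral>x. \<phi> x *\<^sub>R w x \<partial>lborel) = 0"
    and [measurable]: "w \<in> borel_measurable borel" "A \<in> sets borel" and A: "A \<subseteq> cball 0 r" and r: "0 \<le> r" "r < 1"
  shows "(\<integral>x. indicator A x *\<^sub>R w x \<partial>lborel) = 0"
proof -
  let ?\<psi> = "indicator A :: real^2 \<Rightarrow> real"
  have finA: "emeasure lborel A < \<infinity>"
    using emeasure_bounded_finite[OF bounded_subset[OF bounded_cball A]] .
  have \<psi>: "?\<psi> \<in> L2" using L2_indicator_const(1)[OF _ finA, of "1::real"] by simp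
  have i\<psi>: "integrable lborel ?\<psi>" using finA by (intro integrable_real_indicator) auto
  let ?m = "\<lambda>n. conv (mollifier n) ?\<psi>"
  define \<rho> where "\<rho> = (r + 1) / 2"
  have \<rho>: "r < \<rho>" "\<rho> < 1" using r by (auto simp: \<rho>_def)
  have bound: "\<bar>?m n x\<bar> \<le> 1" for n x
  proof -
    have "norm (?m n x) \<le> (\<integral>z. mollifier n (x - z) \<partial>lborel)"
      unfolding conv_def
    proof (rule Bochner_Integration.integral_norm_bound_integral)
      show "integrable lborel (\<lambda>z. mollifier n (x - z) *\<^sub>R ?\<psi> z)"
        by (rule test_integrable[OF mollifier_test i\<psi>])
      show "integrable lborel (\<lambda>z. mollifier n (x - z))"
        using mollifier_integrable[of n, where 'a="real^2"]
        by (subst (asm) lborel_reflect[of x]) (simp add: integrable_distr_eq)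
      show "norm (mollifier n (x - z) *\<^sub>R ?\<psi> z) \<le> mollifier n (x - z)" for z
        using mollifier_nonneg[of n "x - z"] by (simp add: indicator_def)
    qed
    also have "\<dots> = 1"
      using lborel_integral_reflect[OF mollifier_borel[of n], of x] mollifier_integral[of n, where 'a="real^2"] by simp
    finally show ?thesis by simp
  qed
  have lim: "(\<lambda>n. \<integral>x. norm ((?m n x - ?\<psi> x)\<^sup>2) \<partial>lborel) \<longlonglongrightarrow> 0"
    using mollify_L2(2)[OF \<psi> i\<psi>] by (simp add: sqn_def)
  have "integrable lborel (\<lambda>x. (?m n x - ?\<psi> x)\<^sup>2)" for n
    using L2_integrable[OF L2_diff[OF mollify_L2(1)[OF \<psi> i\<psi>] \<psi>], of n] by simp
  from tendsto_L1_AE_subseq[OF this lim]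
  obtain k :: "nat \<Rightarrow> nat" where k: "strict_mono k" and ae: "AE x in lborel. (\<lambda>n. (?m (k n) x - ?\<psi> x)\<^sup>2) \<longlonglongrightarrow> 0" by blast
  have ae2: "AE x in lborel. (\<lambda>n. ?m (k n) x) \<longlonglongrightarrow> ?\<psi> x"
    using ae
  proof eventually_elim
    case (elim x)
    have "(\<lambda>n. sqrt ((?m (k n) x - ?\<psi> x)\<^sup>2)) \<longlonglongrightarrow> sqrt 0" by (intro tendsto_intros elim)
    then have "(\<lambda>n. \<bar>?m (k n) x - ?\<psi> x\<bar>) \<longlonglongrightarrow> 0" by simp
    then show ?case by (simp add: tendsto_rabs_zero_iff LIM_zero_iff)
  qed
  obtain N where N: "inverse (real (Suc N)) < \<rho> - r" using reals_Archimedean[of "\<rho> - r"] \<rho> by auto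
  have small: "r + 1 / (real n + 1) < \<rho>" if "n \<ge> N" for n
  proof -
    have "1 / (real n + 1) \<le> inverse (real (Suc N))" using that by (simp add: field_simps)
    then show ?thesis using N by linarith
  qed
  have z\<psi>: "?\<psi> x = 0" if "norm x > r" for x using that A by (auto simp: indicator_def)
  have m0: "?m n \<in> test_functions (cball 0 \<rho>)" if "n \<ge> N" for n
  proof (rule conv_mollifier_test[OF i\<psi> z\<psi>])
    show "cball 0 (r + 1 / (real n + 1)) \<subseteq> cball 0 \<rho>" using small[OF that] by (intro subset_cball) simp
  qed
  have cm [measurable]: "?m n \<in> borel_measurable borel" for n
    by (intro borel_measurable_continuous_onI conv_continuous[OF mollifier_test i\<psi>])
  \<comment> \<open>The index is shifted by \<open>N\<close> because the supports fit into
    \<open>cball 0 \<rho>\<close> only from there on.\<close>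
  have "(\<lambda>n. \<integral>x. ?m (k (n + N)) x *\<^sub>R w x \<partial>lborel) \<longlonglongrightarrow> (\<integral>x. ?\<psi> x *\<^sub>R w x \<partial>lborel)"
  proof (rule integral_dominated_convergence[where w="\<lambda>x. norm (indicator (cball 0 \<rho>) x *\<^sub>R w x)"])
    show "integrable lborel (\<lambda>x. norm (indicator (cball 0 \<rho>) x *\<^sub>R w x))"
      by (intro integrable_norm w \<rho>)
    show "AE x in lborel. (\<lambda>n. ?m (k (n + N)) x *\<^sub>R w x) \<longlonglongrightarrow> ?\<psi> x *\<^sub>R w x"
      using ae2
    proof eventually_elim
      case (elim x)
      show ?case by (intro tendsto_scaleR tendsto_const LIMSEQ_ignore_initial_segment[OF elim])
    qed
    fix n
    have "k (n + N) \<ge> N" using seq_suble[OF k, of "n + N"] by linarith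
    note t = m0[OF this]
    show "AE x in lborel. norm (?m (k (n + N)) x *\<^sub>R w x) \<le> norm (indicator (cball 0 \<rho>) x *\<^sub>R w x)"
    proof (rule AE_I2)
      fix x
      show "norm (?m (k (n + N)) x *\<^sub>R w x) \<le> norm (indicator (cball 0 \<rho>) x *\<^sub>R w x)"
      proof (cases "x \<in> cball 0 \<rho>")
        case True
        then show ?thesis using bound[of "k (n + N)" x] by (simp add: mult_left_le_one_le)
      next
        case False
        moreover have "closure {x. ?m (k (n + N)) x \<noteq> 0} \<subseteq> cball 0 \<rho>"
          using t unfolding test_functions_def by blast
        ultimately have "x \<notin> closure {x. ?m (k (n + N)) x \<noteq> 0}" by (rule contra_subsetD[rotated])
        from test_functions_outside(1)[OF t this] have "?m (k (n + N)) x = 0" .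
        then show ?thesis by simp
      qed
    qed
  qed (intro borel_measurable_scaleR; simp add: cm)+
  moreover have "(\<integral>x. ?m (k (n + N)) x *\<^sub>R w x \<partial>lborel) = 0" for n
  proof (rule test)
    have "k (n + N) \<ge> N" using seq_suble[OF k, of "n + N"] by linarith
    from m0[OF this] show "?m (k (n + N)) \<in> test_functions (disc 1)"
      by (rule test_functions_mono[rotated]) (rule subsetI, use \<rho> in simp)
  qed
  ultimately show ?thesis by (simp add: LIMSEQ_const_iff)
qed

text \<open>Testing with the set where \<open>w \<bullet> b\<close> is positive makes the integrand
  nonnegative, so it vanishes almost everywhere. Applied to \<open>b\<close> and \<open>- b\<close>
  for all basis vectors and to countably many discs this gives the claim on the open disc.\<close>

lemma fundamental_lemma:
  fixes w :: "real^2 \<Rightarrow> 'b::euclidean_space"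
  assumes w: "\<And>r. r < 1 \<Longrightarrow> integrable lborel (\<lambda>x. indicator (cball 0 r) x *\<^sub>R w x)"
    and test: "\<And>\<phi>. \<phi> \<in> test_functions (disc 1) \<Longrightarrow> (\<integral>x. \<phi> x *\<^sub>R w x \<partial>lborel) = 0"
    and m [measurable]: "w \<in> borel_measurable borel"
  shows "AE x in lborel. x \<in> disc 1 \<longrightarrow> w x = 0"
proof -
  define \<rho> where "\<rho> n = 1 - 1 / (real n + 1)" for n
  have \<rho>: "0 \<le> \<rho> n" "\<rho> n < 1" for n by (auto simp: \<rho>_def)
  have comp: "AE x in lborel. norm x \<le> \<rho> n \<longrightarrow> w x \<bullet> b \<le> 0" for n and b :: 'b
  proof -
    let ?A = "{x. 0 < w x \<bullet> b} \<inter> cball 0 (\<rho> n)"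
    have A [measurable]: "?A \<in> sets borel"
      by (intro sets.Int borel_measurable_less[where f="\<lambda>_. 0", unfolded space_borel, simplified]) auto
    have iA: "integrable lborel (\<lambda>x. indicator ?A x *\<^sub>R w x)"
    proof (rule Bochner_Integration.integrable_bound[OF w[OF \<rho>(2)[of n]]])
      show "AE x in lborel. norm (indicator ?A x *\<^sub>R w x) \<le> norm (indicator (cball 0 (\<rho> n)) x *\<^sub>R w x)"
        by (intro AE_I2) (auto simp: indicator_def)
    qed simp
    have "(\<integral>x. (indicator ?A x *\<^sub>R w x) \<bullet> b \<partial>lborel) = 0 \<bullet> b"
      using fundamental_lemma_bounded[OF w test m A Int_lower2 \<rho>(1,2)] integral_inner_left[of b lborel "\<lambda>x. indicator ?A x *\<^sub>R w x"] iA
      by simp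
    then have "(\<integral>x. (indicator ?A x *\<^sub>R w x) \<bullet> b \<partial>lborel) = 0" by simp
    moreover have "integrable lborel (\<lambda>x. (indicator ?A x *\<^sub>R w x) \<bullet> b)"
      using iA by (rule integrable_inner_left)
    moreover have "0 \<le> (indicator ?A x *\<^sub>R w x) \<bullet> b" for x by (simp add: indicator_def)
    ultimately have "AE x in lborel. (indicator ?A x *\<^sub>R w x) \<bullet> b = 0"
      by (subst (asm) integral_nonneg_eq_0_iff_AE) auto
    then show ?thesis
      by eventually_elim (auto simp: indicator_def split: if_splits)
  qed
  have "AE x in lborel. \<forall>n. \<forall>b\<in>(Basis::'b set). (norm x \<le> \<rho> n \<longrightarrow> w x \<bullet> b \<le> 0) \<and> (norm x \<le> \<rho> n \<longrightarrow> w x \<bullet> (- b) \<le> 0)"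
    unfolding AE_all_countable by (intro allI AE_finite_allI AE_conjI comp finite_Basis)
  then show ?thesis
  proof eventually_elim
    case (elim x)
    show ?case
    proof
      assume "x \<in> disc 1"
      then obtain n where "inverse (real (Suc n)) < 1 - norm x" using reals_Archimedean[of "1 - norm x"] by auto
      then have "norm x \<le> \<rho> n" by (simp add: \<rho>_def inverse_eq_divide add.commute)
      then have *: "w x \<bullet> b = 0" if "b \<in> Basis" for b using bspec[OF spec[OF elim, of n] that] \<open>norm x \<le> \<rho> n\<close> by simp
      show "w x = 0" by (rule euclidean_eqI) (simp add: *)
    qed
  qed
qed

section \<open>Sobolev functions and weak triples\<close>

text \<open>Bridges two measures: the Sobolev space is built on \<open>lebesgue_on (disc 1)\<close>,
  while Fubini, translation and rotation arguments run on \<open>lborel\<close>. The representative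
  is found componentwise, since the theorem on completions is used for real functions.\<close>

lemma borel_representative:
  fixes f :: "real^2 \<Rightarrow> 'b::euclidean_space"
  assumes f: "f \<in> borel_measurable (lebesgue_on (disc 1))"
  shows "\<exists>g. g \<in> borel_measurable borel \<and> (AE x in lborel. x \<in> disc 1 \<longrightarrow> f x = g x) \<and> (\<forall>x. x \<notin> disc 1 \<longrightarrow> g x = 0)"
proof -
  have F: "(\<lambda>x. indicator (disc 1) x *\<^sub>R f x) \<in> borel_measurable lebesgue"
    using f by (subst (asm) borel_measurable_restrict_space_iff) auto
  have "\<exists>g'\<in>borel_measurable lborel. AE x in lborel. (indicator (disc 1) x *\<^sub>R f x) \<bullet> b = (g' x :: real)" for b
    by (rule completion_ex_borel_measurable_real) (intro borel_measurable_inner F borel_measurable_const)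
  then have "\<forall>b. \<exists>g'. g' \<in> borel_measurable borel \<and> (AE x in lborel. (indicator (disc 1) x *\<^sub>R f x) \<bullet> b = (g' x :: real))"
    by (simp add: Bex_def)
  from choice[OF this] obtain g' where
    "\<forall>b. g' b \<in> borel_measurable borel \<and> (AE x in lborel. (indicator (disc 1) x *\<^sub>R f x) \<bullet> b = (g' b x :: real))" by blast
  then have g': "\<And>b. g' b \<in> borel_measurable borel" "\<And>b. AE x in lborel. (indicator (disc 1) x *\<^sub>R f x) \<bullet> b = g' b x" by auto
  let ?g = "\<lambda>x. indicator (disc 1) x *\<^sub>R (\<Sum>b\<in>Basis. g' b x *\<^sub>R b)"
  have "?g \<in> borel_measurable borel"
    by (intro borel_measurable_scaleR borel_measurable_indicator borel_measurable_sum g' borel_measurable_const) simp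
  moreover have "AE x in lborel. x \<in> disc 1 \<longrightarrow> f x = ?g x"
  proof -
    have "AE x in lborel. \<forall>b\<in>(Basis::'b set). (indicator (disc 1) x *\<^sub>R f x) \<bullet> b = g' b x"
      by (intro AE_finite_allI g' finite_Basis)
    then show ?thesis
    proof eventually_elim
      case (elim x)
      show ?case
      proof
        assume "x \<in> disc 1"
        then have "f x = (\<Sum>b\<in>Basis. (f x \<bullet> b) *\<^sub>R b)" by (simp add: euclidean_representation)
        also have "\<dots> = ?g x"
          using elim \<open>x \<in> disc 1\<close> by (auto intro!: sum.cong)
        finally show "f x = ?g x" .
      qed
    qed
  qed
  moreover have "?g x = 0" if "x \<notin> disc 1" for x using that by (simp add: indicator_def)
  ultimately show ?thesis by (intro exI[of _ ?g] conjI allI impI)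
qed

lemma AE_disc_lebesgue: "AE x in lborel. P x \<Longrightarrow> AE x in lebesgue. P x"
  by (rule AE_completion)

lemma integral_disc_eq:
  fixes f g :: "real^2 \<Rightarrow> 'b::euclidean_space" and \<phi> :: "real^2 \<Rightarrow> real"
  assumes f: "f \<in> borel_measurable (lebesgue_on (disc 1))" and g: "g \<in> borel_measurable borel"
    and eq: "AE x in lborel. x \<in> disc 1 \<longrightarrow> f x = g x" and z: "\<And>x. x \<notin> disc 1 \<Longrightarrow> g x = 0"
    and \<phi>: "\<phi> \<in> borel_measurable borel"
  shows "(LINT x|lebesgue_on (disc 1). \<phi> x *\<^sub>R f x) = (\<integral>x. \<phi> x *\<^sub>R g x \<partial>lborel)"
proof -
  have F: "(\<lambda>x. indicator (disc 1) x *\<^sub>R f x) \<in> borel_measurable lebesgue"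
    using f by (subst (asm) borel_measurable_restrict_space_iff) auto
  have "(LINT x|lebesgue_on (disc 1). \<phi> x *\<^sub>R f x) = (LINT x|lebesgue. indicator (disc 1) x *\<^sub>R (\<phi> x *\<^sub>R f x))"
    by (rule integral_restrict_space) simp
  also have "\<dots> = (LINT x|lebesgue. \<phi> x *\<^sub>R (indicator (disc 1) x *\<^sub>R f x))"
    by (simp add: mult.commute)
  also have "\<dots> = (LINT x|lebesgue. \<phi> x *\<^sub>R g x)"
  proof (rule integral_cong_AE)
    show "(\<lambda>x. \<phi> x *\<^sub>R (indicator (disc 1) x *\<^sub>R f x)) \<in> borel_measurable lebesgue"
      by (intro borel_measurable_scaleR F measurable_completion) (use \<phi> in simp)
    show "(\<lambda>x. \<phi> x *\<^sub>R g x) \<in> borel_measurable lebesgue"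
      by (intro borel_measurable_scaleR measurable_completion) (use \<phi> g in simp_all)
    show "AE x in lebesgue. \<phi> x *\<^sub>R (indicator (disc 1) x *\<^sub>R f x) = \<phi> x *\<^sub>R g x"
      using AE_disc_lebesgue[OF eq] by eventually_elim (use z in \<open>auto simp: indicator_def\<close>)
  qed
  also have "\<dots> = (\<integral>x. \<phi> x *\<^sub>R g x \<partial>lborel)"
    by (rule integral_completion) (use \<phi> g in measurable)
  finally show ?thesis .
qed

section \<open>Local integrability and uniqueness of weak derivatives\<close>

lemma locally_integrable_measurable:
  fixes f :: "real^2 \<Rightarrow> 'b::euclidean_space"
  assumes f: "f locally_integrable_on (disc 1)"
  shows "f \<in> borel_measurable (lebesgue_on (disc 1))"
proof -
  define \<rho> where "\<rho> n = 1 - inverse (real (Suc n))" for n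
  have "\<rho> n < 1" for n by (simp add: \<rho>_def)
  then have sub: "cball 0 (\<rho> n) \<subseteq> disc 1" for n by auto (use \<open>\<And>n. \<rho> n < 1\<close> le_less_trans in blast)
  have m: "(\<lambda>x. indicator (cball 0 (\<rho> n)) x *\<^sub>R f x) \<in> borel_measurable lebesgue" for n
  proof -
    have "integrable (lebesgue_on (cball 0 (\<rho> n))) f"
      using f sub[of n] unfolding locally_integrable_on_def by auto
    then have "f \<in> borel_measurable (lebesgue_on (cball 0 (\<rho> n)))" by auto
    then show ?thesis by (subst (asm) borel_measurable_restrict_space_iff) auto
  qed
  have "(\<lambda>x. indicator (disc 1) x *\<^sub>R f x) \<in> borel_measurable lebesgue"
  proof (rule borel_measurable_LIMSEQ_metric[OF m])
    fix x
    show "(\<lambda>n. indicator (cball 0 (\<rho> n)) x *\<^sub>R f x) \<longlonglongrightarrow> indicator (disc 1) x *\<^sub>R f x"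
    proof (cases "x \<in> disc 1")
      case True
      then obtain N where N: "inverse (real (Suc N)) < 1 - norm x" using reals_Archimedean[of "1 - norm x"] by auto
      have "x \<in> cball 0 (\<rho> n)" if "n \<ge> N" for n
      proof -
        have "inverse (real (Suc n)) \<le> inverse (real (Suc N))" using that by (simp add: field_simps)
        then have "norm x \<le> \<rho> n" unfolding \<rho>_def using N by linarith
        then show ?thesis by simp
      qed
      then have "\<forall>\<^sub>F n in sequentially. indicator (cball 0 (\<rho> n)) x *\<^sub>R f x = indicator (disc 1) x *\<^sub>R f x"
        using True by (intro eventually_sequentiallyI[of N]) simp
      then show ?thesis by (rule tendsto_eventually)
    next
      case False
      then have "x \<notin> cball 0 (\<rho> n)" for n using sub[of n] by blast
      then show ?thesis using False by (simp add: indicator_def)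
    qed
  qed
  then show ?thesis by (subst borel_measurable_restrict_space_iff) auto
qed

lemma locally_integrable_representative:
  fixes f :: "real^2 \<Rightarrow> 'b::euclidean_space"
  assumes f: "f locally_integrable_on (disc 1)" and g: "g \<in> borel_measurable borel"
    and eq: "AE x in lborel. x \<in> disc 1 \<longrightarrow> f x = g x" and "r < 1"
  shows "integrable lborel (\<lambda>x. indicator (cball 0 r) x *\<^sub>R g x)"
proof -
  have sub: "cball 0 r \<subseteq> disc 1" using \<open>r < 1\<close> by auto
  have "integrable (lebesgue_on (cball 0 r)) f"
    using f sub unfolding locally_integrable_on_def by auto
  then have F: "integrable lebesgue (\<lambda>x. indicator (cball 0 r) x *\<^sub>R f x)"
    by (subst (asm) integrable_restrict_space) auto
  have G: "(\<lambda>x. indicator (cball 0 r) x *\<^sub>R g x) \<in> borel_measurable lborel"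
    using g by (intro borel_measurable_scaleR borel_measurable_indicator) auto
  have "integrable lebesgue (\<lambda>x. indicator (cball 0 r) x *\<^sub>R g x)"
  proof (rule integrable_cong_AE_imp[OF F measurable_completion[OF G]])
    show "AE x in lebesgue. indicator (cball 0 r) x *\<^sub>R f x = indicator (cball 0 r) x *\<^sub>R g x"
      using AE_disc_lebesgue[OF eq] by eventually_elim (use sub in \<open>auto simp: indicator_def\<close>)
  qed
  then show ?thesis using integrable_completion[OF G] by simp
qed

text \<open>Makes the choice in \<open>weak_deriv\<close> harmless: whichever weak derivative is
  selected, it agrees almost everywhere with any representative constructed in the proof.\<close>

lemma weak_deriv_unique:
  fixes f g g' :: "real^2 \<Rightarrow> 'b::euclidean_space"
  assumes g: "has_weak_deriv (disc 1) vs f g" and g': "has_weak_deriv (disc 1) vs f g'"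
  shows "AE x in lborel. x \<in> disc 1 \<longrightarrow> g x = g' x"
proof -
  have l: "g locally_integrable_on disc 1" "g' locally_integrable_on disc 1"
    using g g' by (auto simp: has_weak_deriv_def)
  note mm = locally_integrable_measurable[OF l(1)] locally_integrable_measurable[OF l(2)]
  obtain k where *: "k \<in> borel_measurable borel \<and> (AE x in lborel. x \<in> disc 1 \<longrightarrow> g x = k x) \<and> (\<forall>x. x \<notin> disc 1 \<longrightarrow> k x = 0)"
    using borel_representative[OF mm(1)] by (elim exE)
  have k: "k \<in> borel_measurable borel" "AE x in lborel. x \<in> disc 1 \<longrightarrow> g x = k x" "\<And>x. x \<notin> disc 1 \<Longrightarrow> k x = 0"
    using * by auto
  obtain k' where *: "k' \<in> borel_measurable borel \<and> (AE x in lborel. x \<in> disc 1 \<longrightarrow> g' x = k' x) \<and> (\<forall>x. x \<notin> disc 1 \<longrightarrow> k' x = 0)"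
    using borel_representative[OF mm(2)] by (elim exE)
  have k': "k' \<in> borel_measurable borel" "AE x in lborel. x \<in> disc 1 \<longrightarrow> g' x = k' x" "\<And>x. x \<notin> disc 1 \<Longrightarrow> k' x = 0"
    using * by auto
  note i = locally_integrable_representative[OF l(1) k(1,2)] locally_integrable_representative[OF l(2) k'(1,2)]
  have "AE x in lborel. x \<in> disc 1 \<longrightarrow> k x - k' x = 0"
  proof (rule fundamental_lemma)
    show "integrable lborel (\<lambda>x. indicator (cball 0 r) x *\<^sub>R (k x - k' x))" if "r < 1" for r
      unfolding scaleR_diff_right by (intro Bochner_Integration.integrable_diff i that)
    show "(\<lambda>x. k x - k' x) \<in> borel_measurable borel" using k k' by (intro borel_measurable_diff)
    fix \<phi> assume \<phi>: "\<phi> \<in> test_functions (disc 1)"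
    have mb: "\<phi> \<in> borel_measurable borel" by (rule test_functions_borel[OF \<phi>])
    have "(- 1) ^ length vs *\<^sub>R (LINT x|lebesgue_on (disc 1). \<phi> x *\<^sub>R g x) = (- 1) ^ length vs *\<^sub>R (LINT x|lebesgue_on (disc 1). \<phi> x *\<^sub>R g' x)"
      using g g' \<phi> by (simp add: has_weak_deriv_def)
    then have "(LINT x|lebesgue_on (disc 1). \<phi> x *\<^sub>R g x) = (LINT x|lebesgue_on (disc 1). \<phi> x *\<^sub>R g' x)"
      by simp
    moreover have "(LINT x|lebesgue_on (disc 1). \<phi> x *\<^sub>R g x) = (\<integral>x. \<phi> x *\<^sub>R k x \<partial>lborel)"
      by (rule integral_disc_eq[OF mm(1) k(1,2) _ mb]) (rule k(3))
    moreover have "(LINT x|lebesgue_on (disc 1). \<phi> x *\<^sub>R g' x) = (\<integral>x. \<phi> x *\<^sub>R k' x \<partial>lborel)"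
      by (rule integral_disc_eq[OF mm(2) k'(1,2) _ mb]) (rule k'(3))
    ultimately have eq: "(\<integral>x. \<phi> x *\<^sub>R k x \<partial>lborel) = (\<integral>x. \<phi> x *\<^sub>R k' x \<partial>lborel)"
      by (simp only:)
    \<comment> \<open>The support of a test function is compact in the open disc, hence contained in
      a strictly smaller one; there local integrability is integrability.\<close>
    have int: "integrable lborel (\<lambda>x. \<phi> x *\<^sub>R q x)"
      if q: "q \<in> borel_measurable borel" and qi: "\<And>r. r < 1 \<Longrightarrow> integrable lborel (\<lambda>x. indicator (cball 0 r) x *\<^sub>R q x)"
      for q :: "real^2 \<Rightarrow> 'b"
    proof -
      obtain M where M: "M \<ge> 0" "\<And>x. \<bar>\<phi> x\<bar> \<le> M" by (rule test_functions_bounded[OF \<phi>]) blast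
      define K where "K = closure {x. \<phi> x \<noteq> 0}"
      have K: "compact K" "K \<subseteq> disc 1" using \<phi> unfolding K_def test_functions_def by blast+
      have "\<exists>r<1. K \<subseteq> cball 0 r"
      proof (cases "K = {}")
        case False
        have "\<exists>x\<in>K. \<forall>y\<in>K. norm y \<le> norm x"
          by (rule continuous_attains_sup[OF K(1) False]) (intro continuous_intros)
        then obtain x where x: "x \<in> K" "\<forall>y\<in>K. norm y \<le> norm x" by (elim bexE)
        have "norm x < 1" using subsetD[OF K(2) x(1)] by simp
        moreover have "K \<subseteq> cball 0 (norm x)" using x(2) by (intro subsetI) simp
        ultimately show ?thesis by blast
      next
        case True
        then show ?thesis by (intro exI[of _ 0]) simp
      qed
      then obtain r where r: "r < 1" "K \<subseteq> cball 0 r" by blast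
      show ?thesis
      proof (rule Bochner_Integration.integrable_bound[OF integrable_mult_right[OF integrable_norm[OF qi[OF r(1)]], of M]])
        show "(\<lambda>x. \<phi> x *\<^sub>R q x) \<in> borel_measurable lborel" using mb q by measurable
        show "AE x in lborel. norm (\<phi> x *\<^sub>R q x) \<le> norm (M * norm (indicator (cball 0 r) x *\<^sub>R q x))"
        proof (rule AE_I2)
          fix x
          show "norm (\<phi> x *\<^sub>R q x) \<le> norm (M * norm (indicator (cball 0 r) x *\<^sub>R q x))"
          proof (cases "x \<in> K")
            case True
            then have "x \<in> cball 0 r" using r by blast
            then show ?thesis using M by (simp add: mult_right_mono)
          next
            case False
            from test_functions_outside(1)[OF \<phi> this[unfolded K_def]] have "\<phi> x = 0" .
            then show ?thesis by simp
          qed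
        qed
      qed
    qed
    show "(\<integral>x. \<phi> x *\<^sub>R (k x - k' x) \<partial>lborel) = 0"
      unfolding scaleR_diff_right
      using int[OF k(1) i(1)] int[OF k'(1) i(2)] eq by simp
  qed
  then show ?thesis using k(2) k'(2) by eventually_elim auto
qed

section \<open>Passage between Sobolev functions and triples of Borel functions\<close>

definition wenergy :: "real \<Rightarrow> real \<Rightarrow> (2 \<Rightarrow> real^2 \<Rightarrow> 'b::euclidean_space) \<Rightarrow> (2 \<Rightarrow> 2 \<Rightarrow> real^2 \<Rightarrow> 'b) \<Rightarrow> ennreal" where
  "wenergy h \<Delta> Y H = (\<integral>\<^sup>+x. indicator (disc 1) x *
     ennreal ((norm (gram Y x - coneg \<Delta> x))\<^sup>2 + h\<^sup>2 * hsq H x) \<partial>lborel)"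

text \<open>The energy and both conclusions about it see only the induced metric and the norm of the
  Hessian, so these two quantities are compared, up to null sets.\<close>

definition represents :: "(real^2 \<Rightarrow> real^3) \<Rightarrow> (2 \<Rightarrow> real^2 \<Rightarrow> real^3) \<Rightarrow> (2 \<Rightarrow> 2 \<Rightarrow> real^2 \<Rightarrow> real^3) \<Rightarrow> bool" where
  "represents y Y H \<longleftrightarrow> (AE x in lborel. x \<in> disc 1 \<longrightarrow>
     induced_metric y x = gram Y x \<and> (norm (weak_hessian (disc 1) y x))\<^sup>2 = hsq H x)"

lemma has_weak_deriv_of_borel:
  fixes f :: "real^2 \<Rightarrow> 'b::euclidean_space"
  assumes f: "f \<in> cL2" and g: "g \<in> cL2"
    and eq: "\<And>\<phi>. \<phi> \<in> test_functions (disc 1) \<Longrightarrow>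
      (\<integral>x. iter_deriv vs \<phi> x *\<^sub>R f x \<partial>lborel) = (-1) ^ length vs *\<^sub>R (\<integral>x. \<phi> x *\<^sub>R g x \<partial>lborel)"
    and vs: "set vs \<subseteq> Basis"
  shows "has_weak_deriv (disc 1) vs f g"
proof -
  have loc: "k locally_integrable_on disc 1" and mk: "k \<in> borel_measurable (lebesgue_on (disc 1))" if "k \<in> cL2" for k :: "real^2 \<Rightarrow> 'b"
  proof -
    have m: "k \<in> borel_measurable lborel" using cL2_L2[OF that] by auto
    have i: "integrable lebesgue k" using cL2_integrable[OF that] integrable_completion[OF m] by simp
    show "k locally_integrable_on disc 1"
      unfolding locally_integrable_on_def
    proof (intro allI impI)
      fix K :: "(real^2) set" assume "compact K \<and> K \<subseteq> disc 1"
      then have K: "K \<in> sets lebesgue" using compact_imp_closed borel_closed by (intro sets_completionI_sets) auto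
      have "integrable lebesgue (\<lambda>x. indicator K x *\<^sub>R k x)"
        using K i by (intro integrable_mult_indicator)
      then show "integrable (lebesgue_on K) k"
        using K by (subst integrable_restrict_space) auto
    qed
    show "k \<in> borel_measurable (lebesgue_on (disc 1))"
      using measurable_completion[OF m] by (rule measurable_restrict_space1)
  qed
  have id: "test \<in> test_functions (disc 1) \<Longrightarrow> iter_deriv ws test \<in> test_functions (disc 1)" if "set ws \<subseteq> Basis" for ws test
    using that
  proof (induction ws)
    case (Cons v ws)
    then have "iter_deriv (v # ws) test = pderiv_dir v (iter_deriv ws test)"
      by (simp add: pderiv_dir_def[abs_def])
    then show ?case using Cons test_functions_pderiv[of "iter_deriv ws test" "disc 1" v] by simp
  qed simp
  show ?thesis
    unfolding has_weak_deriv_def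
  proof (intro conjI ballI)
    fix \<phi> assume \<phi>: "\<phi> \<in> test_functions (disc 1)"
    have 1: "(LINT x|lebesgue_on (disc 1). iter_deriv vs \<phi> x *\<^sub>R f x) = (\<integral>x. iter_deriv vs \<phi> x *\<^sub>R f x \<partial>lborel)"
      by (rule integral_disc_eq[OF mk[OF f] L2_borel[OF cL2_L2[OF f]] _ _ test_functions_borel[OF id[OF vs \<phi>]]])
        (use f in \<open>auto simp: cL2_def\<close>)
    have 2: "(LINT x|lebesgue_on (disc 1). \<phi> x *\<^sub>R g x) = (\<integral>x. \<phi> x *\<^sub>R g x \<partial>lborel)"
      by (rule integral_disc_eq[OF mk[OF g] L2_borel[OF cL2_L2[OF g]] _ _ test_functions_borel[OF \<phi>]])
        (use g in \<open>auto simp: cL2_def\<close>)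
    show "(LINT x|lebesgue_on (disc 1). iter_deriv vs \<phi> x *\<^sub>R f x) = (-1) ^ length vs *\<^sub>R (LINT x|lebesgue_on (disc 1). \<phi> x *\<^sub>R g x)"
      unfolding 1 2 by (rule eq[OF \<phi>])
  qed (use loc f g in auto)
qed

lemma cL2_square_integrable:
  assumes "f \<in> cL2" shows "f \<in> square_integrable (disc 1)"
proof -
  have m: "f \<in> borel_measurable lborel" using cL2_L2[OF assms] by auto
  then have m2: "(\<lambda>x. (norm (f x))\<^sup>2) \<in> borel_measurable lborel" by measurable
  have "integrable lebesgue (\<lambda>x. (norm (f x))\<^sup>2)"
    using L2_integrable[OF cL2_L2[OF assms]] integrable_completion[OF m2] by simp
  then have "integrable lebesgue (\<lambda>x. indicator (disc 1) x *\<^sub>R (norm (f x))\<^sup>2)"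
    by (intro integrable_mult_indicator) auto
  then have "integrable (lebesgue_on (disc 1)) (\<lambda>x. (norm (f x))\<^sup>2)"
    by (subst integrable_restrict_space) auto
  moreover have "f \<in> borel_measurable (lebesgue_on (disc 1))"
    using measurable_completion[OF m] by (rule measurable_restrict_space1)
  ultimately show ?thesis by (simp add: square_integrable_def)
qed

lemma Basis_real2: "(Basis :: (real^2) set) = {axis i 1 |i. True}"
  by (auto simp: Basis_vec_def)

lemma weak_triple_second:
  assumes w: "weak_triple y Y H" and \<phi>: "\<phi> \<in> test_functions (disc 1)"
  shows "(\<integral>x. iter_deriv [axis i 1, axis j 1] \<phi> x *\<^sub>R y x \<partial>lborel) = (\<integral>x. \<phi> x *\<^sub>R H i j x \<partial>lborel)"
proof -
  have "(\<integral>x. pderiv_dir (axis i 1) (pderiv_dir (axis j 1) \<phi>) x *\<^sub>R y x \<partial>lborel)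
      = - (\<integral>x. pderiv_dir (axis j 1) \<phi> x *\<^sub>R Y i x \<partial>lborel)"
    by (rule weak_tripleD(4)[OF w, unfolded wderiv_def, rule_format, OF test_functions_pderiv[OF \<phi> axis_Basis2]])
  also have "\<dots> = (\<integral>x. \<phi> x *\<^sub>R H i j x \<partial>lborel)"
    using weak_tripleD(5)[OF w, unfolded wderiv_def, rule_format, OF \<phi>] by simp
  finally show ?thesis by (simp add: pderiv_dir_def[abs_def])
qed

lemma weak_triple_has_weak_deriv:
  assumes w: "weak_triple y Y H"
  shows "has_weak_deriv (disc 1) [] y y" "has_weak_deriv (disc 1) [axis i 1] y (Y i)"
    "has_weak_deriv (disc 1) [axis i 1, axis j 1] y (H i j)"
proof -
  note T = weak_tripleD[OF w]
  show "has_weak_deriv (disc 1) [] y y"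
    by (rule has_weak_deriv_of_borel[OF T(1) T(1)]) auto
  show "has_weak_deriv (disc 1) [axis i 1] y (Y i)"
  proof (rule has_weak_deriv_of_borel[OF T(1) T(2)])
    fix \<phi> assume "\<phi> \<in> test_functions (disc 1)"
    from T(4)[unfolded wderiv_def, rule_format, OF this, of i]
    show "(\<integral>x. iter_deriv [axis i 1] \<phi> x *\<^sub>R y x \<partial>lborel) = (- 1) ^ length [axis i 1 :: real^2] *\<^sub>R (\<integral>x. \<phi> x *\<^sub>R Y i x \<partial>lborel)"
      unfolding iter_deriv_single by simp
  qed (simp add: axis_Basis2)
  show "has_weak_deriv (disc 1) [axis i 1, axis j 1] y (H i j)"
  proof (rule has_weak_deriv_of_borel[OF T(1) T(3)])
    fix \<phi> assume "\<phi> \<in> test_functions (disc 1)"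
    from weak_triple_second[OF w this, of i j]
    show "(\<integral>x. iter_deriv [axis i 1, axis j 1] \<phi> x *\<^sub>R y x \<partial>lborel)
        = (- 1) ^ length [axis i 1, axis j 1 :: real^2] *\<^sub>R (\<integral>x. \<phi> x *\<^sub>R H i j x \<partial>lborel)"
      by simp
  qed (simp add: axis_Basis2)
qed

lemma norm_hessian_sq:
  assumes "\<And>i j. G i j = H i j"
  shows "(norm (\<chi> k i j. (G i j :: real^3) $ k :: real^2^2^3))\<^sup>2
    = (norm (H 1 1))\<^sup>2 + (norm (H 1 2))\<^sup>2 + (norm (H 2 1))\<^sup>2 + (norm (H 2 2))\<^sup>2"
  unfolding power2_norm_eq_inner inner_vec_def using assms by (simp add: sum_2 sum_3)

lemma represents_of_weak_deriv:
  assumes 1: "\<And>i. has_weak_deriv (disc 1) [axis i 1] y (g i)" "\<And>i. AE x in lborel. x \<in> disc 1 \<longrightarrow> g i x = Y i x"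
    and 2: "\<And>i j. has_weak_deriv (disc 1) [axis i 1, axis j 1] y (k i j)" "\<And>i j. AE x in lborel. x \<in> disc 1 \<longrightarrow> k i j x = H i j x"
  shows "represents y Y H"
proof -
  have a: "AE x in lborel. x \<in> disc 1 \<longrightarrow> weak_deriv (disc 1) [axis i 1] y x = Y i x" for i
  proof -
    have "has_weak_deriv (disc 1) [axis i 1] y (weak_deriv (disc 1) [axis i 1] y)"
      unfolding weak_deriv_def by (rule someI[of "has_weak_deriv (disc 1) [axis i 1] y" "g i", OF 1(1)])
    from weak_deriv_unique[OF this 1(1)] 1(2)[of i] show ?thesis by eventually_elim auto
  qed
  have b: "AE x in lborel. x \<in> disc 1 \<longrightarrow> weak_deriv (disc 1) [axis i 1, axis j 1] y x = H i j x" for i j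
  proof -
    have "has_weak_deriv (disc 1) [axis i 1, axis j 1] y (weak_deriv (disc 1) [axis i 1, axis j 1] y)"
      unfolding weak_deriv_def by (rule someI[of "has_weak_deriv (disc 1) [axis i 1, axis j 1] y" "k i j", OF 2(1)])
    from weak_deriv_unique[OF this 2(1)] 2(2)[of i j] show ?thesis by eventually_elim auto
  qed
  have a2: "AE x in lborel. \<forall>i\<in>UNIV. x \<in> disc 1 \<longrightarrow> weak_deriv (disc 1) [axis i 1] y x = Y i x"
    by (intro AE_finite_allI a) simp
  have b2: "AE x in lborel. \<forall>i\<in>UNIV. \<forall>j\<in>UNIV. x \<in> disc 1 \<longrightarrow> weak_deriv (disc 1) [axis i 1, axis j 1] y x = H i j x"
    by (intro AE_finite_allI b) simp_all
  show ?thesis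
    unfolding represents_def using a2 b2
  proof eventually_elim
    case (elim x)
    show ?case
    proof
      assume x: "x \<in> disc 1"
      have A: "weak_deriv (disc 1) [axis i 1] y x = Y i x" for i using elim(1) x by simp
      have B: "weak_deriv (disc 1) [axis i 1, axis j 1] y x = H i j x" for i j using elim(2) x by simp
      have "induced_metric y x = gram Y x"
        unfolding induced_metric_def weak_jacobian_def gram_def A
        by (simp add: vec_eq_iff matrix_matrix_mult_def transpose_def inner_vec_def)
      moreover have "(norm (weak_hessian (disc 1) y x))\<^sup>2 = hsq H x"
        unfolding weak_hessian_def hsq_def B by (rule norm_hessian_sq) simp
      ultimately show "induced_metric y x = gram Y x \<and> (norm (weak_hessian (disc 1) y x))\<^sup>2 = hsq H x" ..
    qed
  qed
qed

lemma length_le_2_cases: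
  assumes "length vs \<le> 2"
  obtains "vs = []" | v where "vs = [v]" | v w where "vs = [v, w]"
proof (cases vs)
  case (Cons v ws)
  then show ?thesis using assms that by (cases ws) auto
qed (use that in auto)

lemma weak_triple_sobolev:
  assumes w: "weak_triple y Y H"
  shows "y \<in> sobolev2 2 (disc 1)" "represents y Y H"
proof -
  note T = weak_tripleD[OF w]
  show "y \<in> sobolev2 2 (disc 1)"
    unfolding sobolev2_def mem_Collect_eq
  proof (intro conjI allI impI cL2_square_integrable T(1))
    fix vs :: "(real^2) list" assume vs: "set vs \<subseteq> Basis \<and> length vs \<le> 2"
    consider "vs = []" | v where "vs = [v]" | v w where "vs = [v, w]"
      using vs length_le_2_cases[of vs] by blast
    then show "\<exists>g\<in>square_integrable (disc 1). has_weak_deriv (disc 1) vs y g"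
    proof cases
      case 1
      then show ?thesis using weak_triple_has_weak_deriv(1)[OF w] cL2_square_integrable[OF T(1)] by blast
    next
      case 2
      then obtain i where "v = axis i 1" using vs by (auto simp: Basis_real2)
      then show ?thesis using 2 weak_triple_has_weak_deriv(2)[OF w, of i] cL2_square_integrable[OF T(2)[of i]] by blast
    next
      case 3
      then obtain i j where "v = axis i 1" "w = axis j 1" using vs by (auto simp: Basis_real2)
      then show ?thesis using 3 weak_triple_has_weak_deriv(3)[OF assms, of i j] cL2_square_integrable[OF T(3)[of i j]] by blast
    qed
  qed
  show "represents y Y H"
    by (rule represents_of_weak_deriv[OF weak_triple_has_weak_deriv(2)[OF w] _ weak_triple_has_weak_deriv(3)[OF w]]) simp_all
qed

lemma square_integrable_representative:
  fixes f :: "real^2 \<Rightarrow> 'b::euclidean_space"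
  assumes f: "f \<in> square_integrable (disc 1)"
  shows "\<exists>g. g \<in> cL2 \<and> (AE x in lborel. x \<in> disc 1 \<longrightarrow> f x = g x)"
proof -
  have m: "f \<in> borel_measurable (lebesgue_on (disc 1))" and i: "integrable (lebesgue_on (disc 1)) (\<lambda>x. (norm (f x))\<^sup>2)"
    using f by (auto simp: square_integrable_def)
  obtain g where "g \<in> borel_measurable borel \<and> (AE x in lborel. x \<in> disc 1 \<longrightarrow> f x = g x) \<and> (\<forall>x. x \<notin> disc 1 \<longrightarrow> g x = 0)"
    using borel_representative[OF m] by (elim exE)
  then have g: "g \<in> borel_measurable borel" "AE x in lborel. x \<in> disc 1 \<longrightarrow> f x = g x" "\<And>x. x \<notin> disc 1 \<Longrightarrow> g x = 0"
    by auto
  have F: "integrable lebesgue (\<lambda>x. indicator (disc 1) x *\<^sub>R (norm (f x))\<^sup>2)"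
    using i by (subst (asm) integrable_restrict_space) auto
  have G: "(\<lambda>x. (norm (g x))\<^sup>2) \<in> borel_measurable lborel" using g(1) by measurable
  have "integrable lebesgue (\<lambda>x. (norm (g x))\<^sup>2)"
  proof (rule integrable_cong_AE_imp[OF F measurable_completion[OF G]])
    show "AE x in lebesgue. indicator (disc 1) x *\<^sub>R (norm (f x))\<^sup>2 = (norm (g x))\<^sup>2"
      using AE_disc_lebesgue[OF g(2)] by eventually_elim (use g(3) in \<open>auto simp: indicator_def\<close>)
  qed
  then have "g \<in> L2" using integrable_completion[OF G] g(1) by (simp add: L2_def)
  then show ?thesis using g(2,3) by (intro exI[of _ g]) (simp add: cL2_def)
qed

lemma sobolev_weak_triple:
  assumes y: "y \<in> sobolev2 2 (disc 1)"
  shows "\<exists>y' Y H. weak_triple y' Y H \<and> represents y Y H"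
proof -
  have ysq: "y \<in> square_integrable (disc 1)" using y by (simp add: sobolev2_def)
  have ex: "\<exists>g\<in>square_integrable (disc 1). has_weak_deriv (disc 1) vs y g" if "set vs \<subseteq> Basis" "length vs \<le> 2" for vs
    using y that by (simp add: sobolev2_def)
  have "\<exists>g'. g' \<in> cL2 \<and> (\<exists>g\<in>square_integrable (disc 1). has_weak_deriv (disc 1) vs y g \<and> (AE x in lborel. x \<in> disc 1 \<longrightarrow> g x = g' x))"
    if vs: "set vs \<subseteq> Basis" "length vs \<le> 2" for vs
  proof -
    obtain g where g: "g \<in> square_integrable (disc 1)" "has_weak_deriv (disc 1) vs y g" using ex[OF vs] by (elim bexE)
    obtain g' where "g' \<in> cL2 \<and> (AE x in lborel. x \<in> disc 1 \<longrightarrow> g x = g' x)" using square_integrable_representative[OF g(1)] by (elim exE)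
    then show ?thesis using g by (intro exI[of _ g'] conjI bexI[of _ g]) auto
  qed
  then have "\<forall>vs. \<exists>g' g. set vs \<subseteq> Basis \<and> length vs \<le> 2 \<longrightarrow> g' \<in> cL2 \<and> g \<in> square_integrable (disc 1) \<and>
      has_weak_deriv (disc 1) vs y g \<and> (AE x in lborel. x \<in> disc 1 \<longrightarrow> g x = g' x)" by blast
  from choice[OF this] obtain G' where "\<forall>vs. \<exists>g. set vs \<subseteq> Basis \<and> length vs \<le> 2 \<longrightarrow> G' vs \<in> cL2 \<and> g \<in> square_integrable (disc 1) \<and>
      has_weak_deriv (disc 1) vs y g \<and> (AE x in lborel. x \<in> disc 1 \<longrightarrow> g x = G' vs x)" by (elim exE)
  from choice[OF this] obtain G where GG: "\<forall>vs. set vs \<subseteq> Basis \<and> length vs \<le> 2 \<longrightarrow> G' vs \<in> cL2 \<and> G vs \<in> square_integrable (disc 1) \<and>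
      has_weak_deriv (disc 1) vs y (G vs) \<and> (AE x in lborel. x \<in> disc 1 \<longrightarrow> G vs x = G' vs x)" by (elim exE)
  obtain y' where "y' \<in> cL2 \<and> (AE x in lborel. x \<in> disc 1 \<longrightarrow> y x = y' x)"
    using square_integrable_representative[OF ysq] by (elim exE)
  then have y': "y' \<in> cL2" "AE x in lborel. x \<in> disc 1 \<longrightarrow> y x = y' x" by auto
  define Y where "Y i = G' [axis i 1]" for i :: 2
  define H where "H i j = G' [axis i 1, axis j 1]" for i j :: 2
  have V1: "set [axis i 1 :: real^2] \<subseteq> Basis \<and> length [axis i 1 :: real^2] \<le> 2" for i :: 2 by (simp add: axis_Basis2)
  have V2: "set [axis i 1, axis j 1 :: real^2] \<subseteq> Basis \<and> length [axis i 1, axis j 1 :: real^2] \<le> 2" for i j :: 2 by (simp add: axis_Basis2)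
  note g1 = GG[rule_format, OF V1, folded Y_def] and g2 = GG[rule_format, OF V2, folded H_def]
  have my: "y \<in> borel_measurable (lebesgue_on (disc 1))" using ysq by (simp add: square_integrable_def)
  have eq: "(\<integral>x. iter_deriv vs \<phi> x *\<^sub>R y' x \<partial>lborel) = (-1) ^ length vs *\<^sub>R (\<integral>x. \<phi> x *\<^sub>R g' x \<partial>lborel)"
    if w: "has_weak_deriv (disc 1) vs y g" and g: "g \<in> square_integrable (disc 1)" "AE x in lborel. x \<in> disc 1 \<longrightarrow> g x = g' x" "g' \<in> cL2"
      and \<phi>: "\<phi> \<in> test_functions (disc 1)" "iter_deriv vs \<phi> \<in> borel_measurable borel" for vs g g' \<phi>
  proof -
    have 1: "(LINT x|lebesgue_on (disc 1). iter_deriv vs \<phi> x *\<^sub>R y x) = (\<integral>x. iter_deriv vs \<phi> x *\<^sub>R y' x \<partial>lborel)"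
      by (rule integral_disc_eq[OF my L2_borel[OF cL2_L2[OF y'(1)]] y'(2) _ \<phi>(2)]) (use y'(1) in \<open>auto simp: cL2_def\<close>)
    have mg: "g \<in> borel_measurable (lebesgue_on (disc 1))" using g(1) by (simp add: square_integrable_def)
    have 2: "(LINT x|lebesgue_on (disc 1). \<phi> x *\<^sub>R g x) = (\<integral>x. \<phi> x *\<^sub>R g' x \<partial>lborel)"
      by (rule integral_disc_eq[OF mg L2_borel[OF cL2_L2[OF g(3)]] g(2) _ test_functions_borel[OF \<phi>(1)]]) (use g(3) in \<open>auto simp: cL2_def\<close>)
    show ?thesis using w \<phi>(1) unfolding has_weak_deriv_def 1[symmetric] 2[symmetric] by blast
  qed
  have w1: "wderiv (disc 1) (axis i 1) y' (Y i)" for i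
    unfolding wderiv_def
  proof
    fix \<phi> assume \<phi>: "\<phi> \<in> test_functions (disc 1)"
    have "(\<integral>x. iter_deriv [axis i 1] \<phi> x *\<^sub>R y' x \<partial>lborel) = (-1) ^ length [axis i 1 :: real^2] *\<^sub>R (\<integral>x. \<phi> x *\<^sub>R Y i x \<partial>lborel)"
    proof (rule eq[OF _ _ _ _ \<phi>])
      show "iter_deriv [axis i 1] \<phi> \<in> borel_measurable borel"
        unfolding iter_deriv_single by (rule test_functions_borel[OF test_functions_pderiv[OF \<phi> axis_Basis2]])
    qed (use g1[of i] in auto)
    then show "(\<integral>x. pderiv_dir (axis i 1) \<phi> x *\<^sub>R y' x \<partial>lborel) = - (\<integral>x. \<phi> x *\<^sub>R Y i x \<partial>lborel)"
      unfolding iter_deriv_single by simp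
  qed
  \<comment> \<open>The Sobolev space provides second derivatives of \<open>y\<close>, whereas a
    triple asks for derivatives of \<open>Y i\<close>. Using
    \<open>pderiv_dir (axis j 1) \<phi>\<close> as a test function in the first-order identity
    identifies the two.\<close>
  have w2: "wderiv (disc 1) (axis j 1) (Y i) (H i j)" for i j
    unfolding wderiv_def
  proof
    fix \<phi> assume \<phi>: "\<phi> \<in> test_functions (disc 1)"
    note \<phi>' = test_functions_pderiv[OF \<phi> axis_Basis2[of j]]
    have it: "iter_deriv [axis i 1, axis j 1] \<phi> = pderiv_dir (axis i 1) (pderiv_dir (axis j 1) \<phi>)"
      by (simp add: pderiv_dir_def[abs_def])
    have "(\<integral>x. iter_deriv [axis i 1, axis j 1] \<phi> x *\<^sub>R y' x \<partial>lborel) = (-1) ^ length [axis i 1, axis j 1 :: real^2] *\<^sub>R (\<integral>x. \<phi> x *\<^sub>R H i j x \<partial>lborel)"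
    proof (rule eq[OF _ _ _ _ \<phi>])
      show "iter_deriv [axis i 1, axis j 1] \<phi> \<in> borel_measurable borel"
        unfolding it by (rule test_functions_borel[OF test_functions_pderiv[OF \<phi>' axis_Basis2]])
    qed (use g2[of i j] in auto)
    then have "(\<integral>x. pderiv_dir (axis i 1) (pderiv_dir (axis j 1) \<phi>) x *\<^sub>R y' x \<partial>lborel) = (\<integral>x. \<phi> x *\<^sub>R H i j x \<partial>lborel)"
      unfolding it by simp
    moreover have "(\<integral>x. pderiv_dir (axis i 1) (pderiv_dir (axis j 1) \<phi>) x *\<^sub>R y' x \<partial>lborel) = - (\<integral>x. pderiv_dir (axis j 1) \<phi> x *\<^sub>R Y i x \<partial>lborel)"
      by (rule w1[unfolded wderiv_def, rule_format, OF \<phi>'])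
    ultimately have "- (\<integral>x. pderiv_dir (axis j 1) \<phi> x *\<^sub>R Y i x \<partial>lborel) = (\<integral>x. \<phi> x *\<^sub>R H i j x \<partial>lborel)" by (rule trans[OF sym, rotated])
    from arg_cong[OF this, of uminus] show "(\<integral>x. pderiv_dir (axis j 1) \<phi> x *\<^sub>R Y i x \<partial>lborel) = - (\<integral>x. \<phi> x *\<^sub>R H i j x \<partial>lborel)"
      unfolding minus_minus .
  qed
  have "weak_triple y' Y H"
    unfolding weak_triple_def using y'(1) g1 g2 w1 w2 by blast
  moreover have "represents y Y H"
  proof (rule represents_of_weak_deriv)
    show "has_weak_deriv (disc 1) [axis i 1] y (G [axis i 1])" "AE x in lborel. x \<in> disc 1 \<longrightarrow> G [axis i 1] x = Y i x" for i
      using g1[of i] by auto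
    show "has_weak_deriv (disc 1) [axis i 1, axis j 1] y (G [axis i 1, axis j 1])"
      "AE x in lborel. x \<in> disc 1 \<longrightarrow> G [axis i 1, axis j 1] x = H i j x" for i j
      using g2[of i j] by auto
  qed
  ultimately show ?thesis by blast
qed

lemma represents_nn_integrals:
  assumes r: "represents y Y H" and \<Delta>: "\<bar>\<Delta>\<bar> \<le> 1"
  shows "energy h \<Delta> y = wenergy h \<Delta> Y H"
    "(\<integral>\<^sup>+x\<in>disc 1. ennreal ((norm (induced_metric y x - cone_metric \<Delta> x))\<^sup>2) \<partial>lebesgue)
      = (\<integral>\<^sup>+x. indicator (disc 1) x * ennreal ((norm (gram Y x - coneg \<Delta> x))\<^sup>2) \<partial>lborel)"
    "(\<integral>\<^sup>+x\<in>disc 1 - disc R. ennreal ((norm (weak_hessian (disc 1) y x))\<^sup>2) \<partial>lebesgue)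
      = (\<integral>\<^sup>+x. indicator (disc 1 - disc R) x * ennreal (hsq H x) \<partial>lborel)"
proof -
  have "AE x in lborel. x \<noteq> (0::real^2)" using AE_lborel_singleton[of "0::real^2"] .
  with r[unfolded represents_def]
  have ae: "AE x in lborel. x \<in> disc 1 \<longrightarrow> induced_metric y x = gram Y x \<and> (norm (weak_hessian (disc 1) y x))\<^sup>2 = hsq H x
    \<and> cone_metric \<Delta> x = coneg \<Delta> x"
    by eventually_elim (auto simp: cone_metric_coneg[OF \<Delta>])
  note ae' = AE_disc_lebesgue[OF ae]
  show "energy h \<Delta> y = wenergy h \<Delta> Y H"
    unfolding energy_def wenergy_def nn_integral_completion[of lborel, symmetric]
    by (rule nn_integral_cong_AE) (use ae' in eventually_elim, auto simp: indicator_def simp del: ennreal_plus)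
  show "(\<integral>\<^sup>+x\<in>disc 1. ennreal ((norm (induced_metric y x - cone_metric \<Delta> x))\<^sup>2) \<partial>lebesgue)
      = (\<integral>\<^sup>+x. indicator (disc 1) x * ennreal ((norm (gram Y x - coneg \<Delta> x))\<^sup>2) \<partial>lborel)"
    unfolding nn_integral_completion[of lborel, symmetric]
    by (rule nn_integral_cong_AE) (use ae' in eventually_elim, auto simp: indicator_def)
  show "(\<integral>\<^sup>+x\<in>disc 1 - disc R. ennreal ((norm (weak_hessian (disc 1) y x))\<^sup>2) \<partial>lebesgue)
      = (\<integral>\<^sup>+x. indicator (disc 1 - disc R) x * ennreal (hsq H x) \<partial>lborel)"
    unfolding nn_integral_completion[of lborel, symmetric]
    by (rule nn_integral_cong_AE) (use ae' in eventually_elim, auto simp: indicator_def)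
qed

section \<open>The smoothed cone\<close>

lemma wderiv_indicator:
  assumes "wderiv (disc 1) b f g" "b \<in> Basis"
  shows "wderiv (disc 1) b (\<lambda>x. indicator (disc 1) x *\<^sub>R f x) (\<lambda>x. indicator (disc 1) x *\<^sub>R g x)"
  unfolding wderiv_def
proof
  fix \<phi> assume \<phi>: "\<phi> \<in> test_functions (disc 1)"
  have z: "\<psi> x *\<^sub>R indicator (disc 1) x *\<^sub>R k x = \<psi> x *\<^sub>R k x" if "\<psi> \<in> test_functions (disc 1)" for \<psi> x and k :: "real^2 \<Rightarrow> 'a"
  proof (cases "x \<in> disc 1")
    case False
    moreover have "closure {x. \<psi> x \<noteq> 0} \<subseteq> disc 1" using that unfolding test_functions_def by blast
    ultimately have "x \<notin> closure {x. \<psi> x \<noteq> 0}" by (rule contra_subsetD[rotated])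
    from test_functions_outside(1)[OF that this] have "\<psi> x = 0" .
    then show ?thesis by simp
  qed simp
  show "(\<integral>x. pderiv_dir b \<phi> x *\<^sub>R indicator (disc 1) x *\<^sub>R f x \<partial>lborel) = - (\<integral>x. \<phi> x *\<^sub>R indicator (disc 1) x *\<^sub>R g x \<partial>lborel)"
    unfolding z[OF \<phi>] z[OF test_functions_pderiv[OF \<phi> assms(2)]]
    using assms(1)[unfolded wderiv_def, rule_format, OF \<phi>] .
qed

lemma cL2_continuous:
  fixes f :: "real^2 \<Rightarrow> 'b::euclidean_space"
  assumes c: "continuous_on UNIV f"
  shows "(\<lambda>x. indicator (disc 1) x *\<^sub>R f x) \<in> cL2"
proof -
  have "compact (f ` cball 0 1)"
    by (intro compact_continuous_image continuous_on_subset[OF c]) auto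
  from compact_imp_bounded[OF this]
  obtain M where M: "\<And>y. y \<in> f ` cball 0 1 \<Longrightarrow> norm y \<le> M"
    unfolding bounded_iff by blast
  have [measurable]: "f \<in> borel_measurable borel" using c by (rule borel_measurable_continuous_onI)
  have fin: "emeasure lborel (disc 1) < \<infinity>" using emeasure_bounded_finite[of "disc 1"] by simp
  have "(\<lambda>x. indicator (disc 1) x *\<^sub>R f x) \<in> L2"
  proof (rule L2I_bound[where g="\<lambda>x. M\<^sup>2 * indicator (disc 1) x"])
    show "integrable lborel (\<lambda>x::real^2. M\<^sup>2 * indicator (disc 1) x :: real)"
      using fin by (intro integrable_mult_right integrable_real_indicator) auto
    show "(norm (indicator (disc 1) x *\<^sub>R f x))\<^sup>2 \<le> M\<^sup>2 * indicator (disc 1) x" for x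
    proof (cases "x \<in> disc 1")
      case True
      then have "norm (f x) \<le> M" by (intro M imageI) simp
      then show ?thesis using True by (simp add: power_mono)
    qed simp
    show "(\<lambda>x. indicator (disc 1) x *\<^sub>R f x) \<in> borel_measurable borel"
      by (intro borel_measurable_scaleR borel_measurable_indicator borel_measurable_continuous_onI[OF c]) simp
  qed
  then show ?thesis by (simp add: cL2_def)
qed

lemma weak_triple_classical:
  fixes y :: "real^2 \<Rightarrow> 'b::euclidean_space"
  assumes y: "\<And>x. (y has_derivative y' x) (at x)" "\<And>i x. y' x (axis i 1) = Y i x"
    and Y: "\<And>i x. (Y i has_derivative Y' i x) (at x)" "\<And>i j x. Y' i x (axis j 1) = H i j x"
    and c: "\<And>i j. continuous_on UNIV (H i j)"
  shows "weak_triple (\<lambda>x. indicator (disc 1) x *\<^sub>R y x) (\<lambda>i x. indicator (disc 1) x *\<^sub>R Y i x) (\<lambda>i j x. indicator (disc 1) x *\<^sub>R H i j x)"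
proof -
  have cy: "continuous_on UNIV y"
    by (intro continuous_at_imp_continuous_on ballI has_derivative_continuous[OF y(1)])
  have cY: "continuous_on UNIV (Y i)" for i
    by (intro continuous_at_imp_continuous_on ballI has_derivative_continuous[OF Y(1)])
  have "wderiv (disc 1) (axis i 1) y (Y i)" for i
    using wderiv_classical[OF y(1) _ axis_Basis2, of i "disc 1"] cY[of i] unfolding y(2) by simp
  moreover have "wderiv (disc 1) (axis j 1) (Y i) (H i j)" for i j
    using wderiv_classical[OF Y(1) _ axis_Basis2, of i j "disc 1"] c[of i j] unfolding Y(2) by simp
  ultimately show ?thesis
    unfolding weak_triple_def by (intro conjI allI cL2_continuous cy cY c wderiv_indicator axis_Basis2)
qed

definition emb :: "2 \<Rightarrow> real^3" where "emb i = (if i = 1 then axis 1 1 else axis 2 1)"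

lemma emb_inner: "emb i \<bullet> emb j = (if i = j then 1 else 0)" "emb i \<bullet> axis 3 1 = 0" "axis 3 1 \<bullet> emb i = 0"
  using exhaust_2[of i] exhaust_2[of j] by (auto simp: emb_def inner_axis_axis)

context
  fixes h \<Delta> :: real
  assumes h: "0 < h" "h \<le> 1" and \<Delta>: "0 \<le> \<Delta>" "\<Delta> \<le> 1"
begin

definition \<rho> :: "real^2 \<Rightarrow> real" where "\<rho> x = sqrt (x \<bullet> x + h\<^sup>2)"

lemma \<rho>_pos: "\<rho> x > 0" and \<rho>_sq: "\<rho> x * \<rho> x = x \<bullet> x + h\<^sup>2"
proof -
  have "0 < x \<bullet> x + h\<^sup>2" using h by (intro add_nonneg_pos) auto
  then show "\<rho> x > 0" "\<rho> x * \<rho> x = x \<bullet> x + h\<^sup>2" by (simp_all add: \<rho>_def)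
qed

lemma \<rho>_deriv: "(\<rho> has_derivative (\<lambda>v. (x \<bullet> v) / \<rho> x)) (at x)"
proof -
  have p: "0 < x \<bullet> x + h\<^sup>2" using h by (intro add_nonneg_pos) auto
  have "((\<lambda>x. x \<bullet> x + h\<^sup>2) has_derivative (\<lambda>v. 2 * (x \<bullet> v))) (at x)"
    by (rule has_derivative_eq_rhs[OF has_derivative_add[OF has_derivative_inner[OF has_derivative_ident has_derivative_ident] has_derivative_const]])
      (simp add: fun_eq_iff inner_commute)
  then have "((\<lambda>x. sqrt (x \<bullet> x + h\<^sup>2)) has_derivative (\<lambda>v. 2 * (x \<bullet> v) * (inverse (sqrt (x \<bullet> x + h\<^sup>2)) / 2))) (at x)"
    by (rule DERIV_compose_FDERIV[where f=sqrt and g="\<lambda>x. x \<bullet> x + h\<^sup>2", OF DERIV_real_sqrt[OF p]])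
  then show ?thesis
    unfolding \<rho>_def[abs_def] by (rule has_derivative_eq_rhs) (simp add: fun_eq_iff inverse_eq_divide)
qed

lemma \<rho>_cont: "continuous_on S \<rho>"
proof (rule continuous_at_imp_continuous_on, rule ballI)
  show "continuous (at x) \<rho>" for x by (rule has_derivative_continuous[OF \<rho>_deriv[of x]])
qed

text \<open>The cone with \<open>norm x\<close> replaced by \<open>\<rho> x\<close>, a smoothing at
  scale \<open>h\<close>: the tip is rounded to curvature of order \<open>\<Delta> / h\<close>, and
  for \<open>norm x\<close> much larger than \<open>h\<close> the metric is nearly that of the
  cone.\<close>

definition hcone :: "real^2 \<Rightarrow> real^3" where
  "hcone x = sqrt (1 - \<Delta>\<^sup>2) *\<^sub>R ((x $ 1) *\<^sub>R emb 1 + (x $ 2) *\<^sub>R emb 2) + (\<Delta> * \<rho> x) *\<^sub>R axis 3 1"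
definition hcone1 :: "2 \<Rightarrow> real^2 \<Rightarrow> real^3" where
  "hcone1 i x = sqrt (1 - \<Delta>\<^sup>2) *\<^sub>R emb i + (\<Delta> * (x $ i / \<rho> x)) *\<^sub>R axis 3 1"
definition hcone2 :: "2 \<Rightarrow> 2 \<Rightarrow> real^2 \<Rightarrow> real^3" where
  "hcone2 i j x = (\<Delta> * ((if i = j then 1 else 0) / \<rho> x - x $ i * x $ j / \<rho> x ^ 3)) *\<^sub>R axis 3 1"

lemma hcone_triple:
  "weak_triple (\<lambda>x. indicator (disc 1) x *\<^sub>R hcone x) (\<lambda>i x. indicator (disc 1) x *\<^sub>R hcone1 i x) (\<lambda>i j x. indicator (disc 1) x *\<^sub>R hcone2 i j x)"
proof (rule weak_triple_classical)
  have nth: "((\<lambda>x::real^2. x $ i) has_derivative (\<lambda>v. v $ i)) (at x)" for i x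
    by (rule bounded_linear.has_derivative[OF bounded_linear_vec_nth has_derivative_ident])
  show "(hcone has_derivative (\<lambda>v. sqrt (1 - \<Delta>\<^sup>2) *\<^sub>R ((v $ 1) *\<^sub>R emb 1 + (v $ 2) *\<^sub>R emb 2) + (\<Delta> * ((x \<bullet> v) / \<rho> x)) *\<^sub>R axis 3 1)) (at x)" for x
    unfolding hcone_def[abs_def]
    by (intro has_derivative_add has_derivative_scaleR_right has_derivative_scaleR_left nth has_derivative_mult_right \<rho>_deriv)
  show "sqrt (1 - \<Delta>\<^sup>2) *\<^sub>R ((axis i 1 $ 1) *\<^sub>R emb 1 + (axis i 1 $ 2) *\<^sub>R emb 2) + (\<Delta> * ((x \<bullet> axis i 1) / \<rho> x)) *\<^sub>R axis 3 1 = hcone1 i x" for i x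
    using exhaust_2[of i] by (auto simp: hcone1_def inner_axis axis_eq_axis) (auto simp: axis_def)
  show "(hcone1 i has_derivative (\<lambda>v. (\<Delta> * (v $ i / \<rho> x - x $ i * (x \<bullet> v) / \<rho> x ^ 3)) *\<^sub>R axis 3 1)) (at x)" for i x
  proof -
    have "((\<lambda>x. x $ i / \<rho> x) has_derivative (\<lambda>v. v $ i / \<rho> x - x $ i * (x \<bullet> v) / \<rho> x ^ 3)) (at x)"
      by (rule has_derivative_eq_rhs[OF has_derivative_divide'[OF nth \<rho>_deriv]])
        (use \<rho>_pos[of x] in \<open>simp_all add: fun_eq_iff field_simps power3_eq_cube\<close>)
    then have "((\<lambda>x. sqrt (1 - \<Delta>\<^sup>2) *\<^sub>R emb i + (\<Delta> * (x $ i / \<rho> x)) *\<^sub>R (axis 3 1 :: real^3)) has_derivative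
        (\<lambda>v. 0 + (\<Delta> * (v $ i / \<rho> x - x $ i * (x \<bullet> v) / \<rho> x ^ 3)) *\<^sub>R axis 3 1)) (at x)"
      by (intro has_derivative_add has_derivative_const has_derivative_scaleR_left has_derivative_mult_right)
    then show ?thesis unfolding hcone1_def[abs_def] by simp
  qed
  show "(\<Delta> * (axis j 1 $ i / \<rho> x - x $ i * (x \<bullet> axis j 1) / \<rho> x ^ 3)) *\<^sub>R axis 3 1 = hcone2 i j x" for i j x
  proof -
    have "axis j (1::real) $ i = (if i = j then 1 else 0)" by (simp add: axis_def)
    then show ?thesis by (simp add: hcone2_def inner_axis)
  qed
  show "continuous_on UNIV (hcone2 i j)" for i j
    unfolding hcone2_def[abs_def] using \<rho>_pos by (intro continuous_intros \<rho>_cont) (auto simp: less_imp_neq[symmetric])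
qed

text \<open>Tangentially the smoothed cone has the same metric as the cone, so the deviation is
  radial, a multiple of the matrix with entries \<open>x $ i * x $ j\<close>. The Hessian of
  \<open>\<rho>\<close> has the eigenvalues \<open>1 / \<rho>\<close> and
  \<open>h\<^sup>2 / \<rho>^3\<close>; the square of the first produces the logarithm, and
  everything else falls under the integrable second term.\<close>

lemma hcone_pointwise:
  assumes "x \<in> disc 1" "x \<noteq> 0"
  shows "(norm (gram (\<lambda>i x. indicator (disc 1) x *\<^sub>R hcone1 i x) x - coneg \<Delta> x))\<^sup>2
     + h\<^sup>2 * hsq (\<lambda>i j x. indicator (disc 1) x *\<^sub>R hcone2 i j x) x
    \<le> h\<^sup>2 * \<Delta>\<^sup>2 * (1 / (x \<bullet> x + h\<^sup>2)) + 2 * h ^ 4 * \<Delta>\<^sup>2 * (1 / (x \<bullet> x + h\<^sup>2)\<^sup>2)"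
proof -
  define s where "s = x \<bullet> x"
  define a where "a = 1 / (s + h\<^sup>2)"
  have s: "s > 0" using assms by (simp add: s_def)
  have ss: "s = x $ 1 * x $ 1 + x $ 2 * x $ 2" by (simp add: s_def inner_2)
  have sh: "s + h\<^sup>2 > 0" using s by (intro add_pos_nonneg) auto
  have a: "a > 0" "a * (s + h\<^sup>2) = 1" using sh by (simp_all add: a_def)
  have sa: "s * a = 1 - h\<^sup>2 * a" using a(2) by (simp add: algebra_simps)
  have t1: "h\<^sup>2 * a \<le> 1" using sa mult_pos_pos[OF s a(1)] by linarith
  have i1: "indicator (disc 1) x = (1::real)" using assms by simp
  have root: "sqrt (1 - \<Delta>\<^sup>2) * sqrt (1 - \<Delta>\<^sup>2) = 1 - \<Delta>\<^sup>2" using \<Delta> by (simp add: power_le_one)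
  have ra: "1 / \<rho> x * (1 / \<rho> x) = a" using \<rho>_sq[of x] by (simp add: a_def s_def)
  \<comment> \<open>Compares the squared radial slope: \<open>\<Delta>\<^sup>2\<close> on the cone,
    \<open>\<Delta>\<^sup>2 * (s * a)\<close> after smoothing. The difference is
    \<open>k * s\<close>.\<close>
  define k where "k = \<Delta>\<^sup>2 * (1 / s - a)"
  have "k * s = \<Delta>\<^sup>2 * (1 - s * a)" using s by (simp add: k_def field_simps)
  also have "\<dots> = \<Delta>\<^sup>2 * (h\<^sup>2 * a)" unfolding sa by simp
  finally have k: "k * s = \<Delta>\<^sup>2 * (h\<^sup>2 * a)" .
  have g: "(gram (\<lambda>i x. indicator (disc 1) x *\<^sub>R hcone1 i x) x - coneg \<Delta> x) $ i $ j = - (k * (x $ i * x $ j))" for i j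
  proof -
    have "hcone1 i x \<bullet> hcone1 j x = (sqrt (1 - \<Delta>\<^sup>2) * sqrt (1 - \<Delta>\<^sup>2)) * (if i = j then 1 else 0) + \<Delta>\<^sup>2 * (x $ i * x $ j) * (1 / \<rho> x * (1 / \<rho> x))"
      unfolding hcone1_def inner_add_left inner_add_right inner_scaleR_left inner_scaleR_right emb_inner
      by (simp add: inner_axis_axis power2_eq_square)
    then have A: "hcone1 i x \<bullet> hcone1 j x = (1 - \<Delta>\<^sup>2) * (if i = j then 1 else 0) + \<Delta>\<^sup>2 * (x $ i * x $ j) * a"
      unfolding root ra .
    have B: "quarter x $ i * quarter x $ j = s * (if i = j then 1 else 0) - x $ i * x $ j"
      using exhaust_2[of i] exhaust_2[of j] unfolding ss by auto
    have C: "\<Delta>\<^sup>2 * (s * d - u) / s = \<Delta>\<^sup>2 * d - \<Delta>\<^sup>2 * u * (1 / s)" for d u :: real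
      using s by (simp add: field_simps)
    have "(gram (\<lambda>i x. indicator (disc 1) x *\<^sub>R hcone1 i x) x - coneg \<Delta> x) $ i $ j
      = hcone1 i x \<bullet> hcone1 j x - ((if i = j then 1 else 0) - \<Delta>\<^sup>2 * (quarter x $ i * quarter x $ j) / s)"
      by (simp add: gram_def coneg_def i1 s_def)
    also have "\<dots> = - (k * (x $ i * x $ j))"
      unfolding A B C k_def by (simp add: algebra_simps)
    finally show ?thesis .
  qed
  have M: "(norm (gram (\<lambda>i x. indicator (disc 1) x *\<^sub>R hcone1 i x) x - coneg \<Delta> x))\<^sup>2 = (\<Delta>\<^sup>2 * (h\<^sup>2 * a))\<^sup>2"
  proof -
    have "(norm (gram (\<lambda>i x. indicator (disc 1) x *\<^sub>R hcone1 i x) x - coneg \<Delta> x))\<^sup>2 = (k * s)\<^sup>2"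
      unfolding norm_matrix_sq g ss by (simp add: power2_eq_square algebra_simps)
    then show ?thesis unfolding k .
  qed
  have d4: "\<Delta>\<^sup>2 * \<Delta>\<^sup>2 \<le> \<Delta>\<^sup>2"
    using \<Delta> by (intro mult_left_le) (auto simp: power_le_one)
  have M2: "(\<Delta>\<^sup>2 * (h\<^sup>2 * a))\<^sup>2 \<le> h ^ 4 * \<Delta>\<^sup>2 * a\<^sup>2"
  proof -
    have "(\<Delta>\<^sup>2 * (h\<^sup>2 * a))\<^sup>2 = (\<Delta>\<^sup>2 * \<Delta>\<^sup>2) * (h\<^sup>2 * a)\<^sup>2" by (simp add: power2_eq_square)
    also have "\<dots> \<le> \<Delta>\<^sup>2 * (h\<^sup>2 * a)\<^sup>2" by (intro mult_right_mono d4) auto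
    also have "\<dots> = h ^ 4 * \<Delta>\<^sup>2 * a\<^sup>2" by (simp add: power_mult_distrib mult_ac flip: power_mult)
    finally show ?thesis .
  qed
  have Hij: "(norm (indicator (disc 1) x *\<^sub>R hcone2 i j x))\<^sup>2 = \<Delta>\<^sup>2 * (a * ((if i = j then 1 else 0) - x $ i * x $ j * a)\<^sup>2)" for i j
  proof -
    have "(norm (indicator (disc 1) x *\<^sub>R hcone2 i j x))\<^sup>2 = (\<Delta> * ((if i = j then 1 else 0) / \<rho> x - x $ i * x $ j / \<rho> x ^ 3))\<^sup>2"
      by (simp add: i1 hcone2_def norm_axis_1)
    also have "(if i = j then 1 else 0) / \<rho> x - x $ i * x $ j / \<rho> x ^ 3
       = (1 / \<rho> x) * ((if i = j then 1 else 0) - x $ i * x $ j * (1 / \<rho> x * (1 / \<rho> x)))"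
      by (simp add: power3_eq_cube right_diff_distrib)
    also have "(\<Delta> * \<dots>)\<^sup>2 = \<Delta>\<^sup>2 * ((1 / \<rho> x * (1 / \<rho> x)) * ((if i = j then 1 else 0) - x $ i * x $ j * (1 / \<rho> x * (1 / \<rho> x)))\<^sup>2)"
      by (simp add: power2_eq_square)
    finally show ?thesis unfolding ra .
  qed
  have "hsq (\<lambda>i j x. indicator (disc 1) x *\<^sub>R hcone2 i j x) x
      = \<Delta>\<^sup>2 * (a * (2 - 2 * (s * a) + (s * a)\<^sup>2))"
    unfolding hsq_def Hij ss by (simp add: power2_eq_square algebra_simps)
  also have "\<dots> = \<Delta>\<^sup>2 * (a * (1 + (h\<^sup>2 * a) * (h\<^sup>2 * a)))"
    unfolding sa by (simp add: power2_eq_square algebra_simps)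
  also have "\<dots> \<le> \<Delta>\<^sup>2 * (a * (1 + h\<^sup>2 * a))"
    using t1 a by (intro mult_left_mono add_left_mono mult_left_le) auto
  finally have "h\<^sup>2 * hsq (\<lambda>i j x. indicator (disc 1) x *\<^sub>R hcone2 i j x) x \<le> h\<^sup>2 * (\<Delta>\<^sup>2 * (a * (1 + h\<^sup>2 * a)))"
    by (rule mult_left_mono) simp
  also have "\<dots> = h\<^sup>2 * \<Delta>\<^sup>2 * a + h ^ 4 * \<Delta>\<^sup>2 * a\<^sup>2"
    by (simp add: power2_eq_square power4_eq_xxxx algebra_simps)
  finally have "(norm (gram (\<lambda>i x. indicator (disc 1) x *\<^sub>R hcone1 i x) x - coneg \<Delta> x))\<^sup>2
     + h\<^sup>2 * hsq (\<lambda>i j x. indicator (disc 1) x *\<^sub>R hcone2 i j x) x \<le> h\<^sup>2 * \<Delta>\<^sup>2 * a + 2 * h ^ 4 * \<Delta>\<^sup>2 * a\<^sup>2"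
    unfolding M using M2 by linarith
  then show ?thesis unfolding a_def s_def by (simp add: power_divide)
qed

text \<open>In the variable \<open>s\<close> the first term integrates to a difference of
  logarithms, at most \<open>ln 2 + 2 * ln (1 / h)\<close> up to the prefactor; the second has the
  explicit integral \<open>pi / h\<^sup>2\<close>. The 2 in the result is a generous bound for
  \<open>1 + ln 2 / 2\<close>.\<close>

lemma upper_bound:
  "wenergy h \<Delta> (\<lambda>i x. indicator (disc 1) x *\<^sub>R hcone1 i x) (\<lambda>i j x. indicator (disc 1) x *\<^sub>R hcone2 i j x)
    \<le> ennreal (2 * pi * \<Delta>\<^sup>2 * h\<^sup>2 * (ln (1 / h) + 2))"
proof -
  have p: "0 < s + h\<^sup>2" if "0 \<le> s" for s using h that by (simp add: add_nonneg_pos)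
  let ?f = "\<lambda>x::real^2. indicator (disc 1) x * ennreal (1 / (x \<bullet> x + h\<^sup>2))"
  let ?g = "\<lambda>x::real^2. ennreal (1 / (x \<bullet> x + h\<^sup>2)\<^sup>2)"
  have ae: "AE x in lborel. x \<noteq> (0::real^2)" using AE_lborel_singleton[of "0::real^2"] .
  have "wenergy h \<Delta> (\<lambda>i x. indicator (disc 1) x *\<^sub>R hcone1 i x) (\<lambda>i j x. indicator (disc 1) x *\<^sub>R hcone2 i j x)
    \<le> (\<integral>\<^sup>+x. ennreal (h\<^sup>2 * \<Delta>\<^sup>2) * ?f x + ennreal (2 * h ^ 4 * \<Delta>\<^sup>2) * ?g x \<partial>lborel)"
    unfolding wenergy_def
  proof (rule nn_integral_mono_AE, use ae in eventually_elim)
    case (elim x)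
    show ?case
    proof (cases "x \<in> disc 1")
      case True
      have "ennreal (h\<^sup>2 * \<Delta>\<^sup>2) * ennreal (1 / (x \<bullet> x + h\<^sup>2)) + ennreal (2 * h ^ 4 * \<Delta>\<^sup>2) * ennreal (1 / (x \<bullet> x + h\<^sup>2)\<^sup>2)
        = ennreal (h\<^sup>2 * \<Delta>\<^sup>2 * (1 / (x \<bullet> x + h\<^sup>2)) + 2 * h ^ 4 * \<Delta>\<^sup>2 * (1 / (x \<bullet> x + h\<^sup>2)\<^sup>2))"
      proof -
        have q: "0 \<le> 1 / (x \<bullet> x + h\<^sup>2)" "0 \<le> 1 / (x \<bullet> x + h\<^sup>2)\<^sup>2" using p[of "x \<bullet> x"] by auto
        have c: "0 \<le> h\<^sup>2 * \<Delta>\<^sup>2" "0 \<le> 2 * h ^ 4 * \<Delta>\<^sup>2" by auto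
        show ?thesis
          unfolding ennreal_mult[OF c(1) q(1), symmetric] ennreal_mult[OF c(2) q(2), symmetric]
          by (rule ennreal_plus[OF mult_nonneg_nonneg[OF c(1) q(1)] mult_nonneg_nonneg[OF c(2) q(2)], symmetric])
      qed
      moreover have "indicator (disc 1) x = (1::ennreal)" using True by simp
      ultimately show ?thesis
        using ennreal_leI[OF hcone_pointwise[OF True elim]] by (simp only: mult_1)
    qed simp
  qed
  also have "\<dots> = ennreal (h\<^sup>2 * \<Delta>\<^sup>2) * (\<integral>\<^sup>+x. ?f x \<partial>lborel) + ennreal (2 * h ^ 4 * \<Delta>\<^sup>2) * (\<integral>\<^sup>+x. ?g x \<partial>lborel)"
  proof -
    have f: "(\<lambda>x. ?f x) \<in> borel_measurable lborel"
      by (intro borel_measurable_times_ennreal borel_measurable_indicator) (simp, measurable)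
    have g: "(\<lambda>x. ?g x) \<in> borel_measurable lborel" by measurable
    show ?thesis
      unfolding nn_integral_add[OF borel_measurable_times_ennreal[OF borel_measurable_const f] borel_measurable_times_ennreal[OF borel_measurable_const g]]
        nn_integral_cmult[OF f] nn_integral_cmult[OF g] ..
  qed
  also have "(\<integral>\<^sup>+x. ?g x \<partial>lborel) = ennreal (pi / h\<^sup>2)"
    using nn_integral_eq_integral[OF integral_inverse_square(1)[of "1/2" h]] integral_inverse_square(2)[of "1/2" h] h by simp
  also have "(\<integral>\<^sup>+x. ?f x \<partial>lborel) \<le> ennreal (pi * (ln 2 + 2 * ln (1 / h)))"
  proof -
    have "(\<integral>\<^sup>+x. ?f x \<partial>lborel) = (\<integral>\<^sup>+x. indicator {..<1} ((x::real^2) \<bullet> x) * ennreal (1 / (x \<bullet> x + h\<^sup>2)) \<partial>lborel)"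
    proof (rule nn_integral_cong)
      fix x :: "real^2"
      have "x \<in> disc 1 \<longleftrightarrow> x \<bullet> x < 1" by (simp add: norm_eq_sqrt_inner)
      then show "?f x = indicator {..<1} (x \<bullet> x) * ennreal (1 / (x \<bullet> x + h\<^sup>2))" by (simp add: indicator_def)
    qed
    also have "\<dots> = ennreal pi * (\<integral>\<^sup>+s. indicator {..<1} s * ennreal (1 / (s + h\<^sup>2)) * indicator {0..} s \<partial>lborel)"
      by (rule nn_integral_radial) measurable
    also have "\<dots> \<le> ennreal pi * (\<integral>\<^sup>+s. ennreal (1 / (s + h\<^sup>2)) * indicator {0..1} s \<partial>lborel)"
      by (intro mult_left_mono nn_integral_mono) (auto simp: indicator_def)
    also have "(\<integral>\<^sup>+s. ennreal (1 / (s + h\<^sup>2)) * indicator {0..1} s \<partial>lborel) = ennreal (ln (1 + h\<^sup>2) - ln (0 + h\<^sup>2))"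
    proof (rule nn_integral_FTC_Icc)
      show "((\<lambda>s. ln (s + h\<^sup>2)) has_real_derivative 1 / (s + h\<^sup>2)) (at s)" if "s \<in> {0..1}" for s
        using p[of s] that by (auto intro!: derivative_eq_intros)
      show "0 \<le> 1 / (s + h\<^sup>2)" if "s \<in> {0..1}" for s using p[of s] that by simp
    qed (auto intro!: borel_measurable_divide)
    also have "ennreal pi * ennreal (ln (1 + h\<^sup>2) - ln (0 + h\<^sup>2)) = ennreal (pi * (ln (1 + h\<^sup>2) - ln (0 + h\<^sup>2)))"
      by (simp add: ennreal_mult')
    also have "\<dots> \<le> ennreal (pi * (ln 2 + 2 * ln (1 / h)))"
    proof (intro ennreal_leI mult_left_mono)
      have "h\<^sup>2 \<le> 1" using h by (simp add: power_le_one)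
      then have "ln (1 + h\<^sup>2) \<le> ln 2" by (subst ln_le_cancel_iff) (auto simp: add_pos_nonneg)
      then show "ln (1 + h\<^sup>2) - ln (0 + h\<^sup>2) \<le> ln 2 + 2 * ln (1 / h)" using h by (simp add: ln_div ln_realpow)
    qed simp
    finally show ?thesis .
  qed
  also have "ennreal (h\<^sup>2 * \<Delta>\<^sup>2) * ennreal (pi * (ln 2 + 2 * ln (1 / h))) + ennreal (2 * h ^ 4 * \<Delta>\<^sup>2) * ennreal (pi / h\<^sup>2)
     = ennreal (h\<^sup>2 * \<Delta>\<^sup>2 * (pi * (ln 2 + 2 * ln (1 / h))) + 2 * h ^ 4 * \<Delta>\<^sup>2 * (pi / h\<^sup>2))"
  proof -
    have "0 \<le> ln (1 / h)" using h by (simp add: ln_div)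
    then have "0 \<le> pi * (ln 2 + 2 * ln (1 / h))" by (intro mult_nonneg_nonneg add_nonneg_nonneg) auto
    then have q: "0 \<le> pi * (ln 2 + 2 * ln (1 / h))" "0 \<le> pi / h\<^sup>2" by auto
    have c: "0 \<le> h\<^sup>2 * \<Delta>\<^sup>2" "0 \<le> 2 * h ^ 4 * \<Delta>\<^sup>2" by auto
    show ?thesis
      unfolding ennreal_mult[OF c(1) q(1), symmetric] ennreal_mult[OF c(2) q(2), symmetric]
      by (rule ennreal_plus[OF mult_nonneg_nonneg[OF c(1) q(1)] mult_nonneg_nonneg[OF c(2) q(2)], symmetric])
  qed
  also have "\<dots> \<le> ennreal (2 * pi * \<Delta>\<^sup>2 * h\<^sup>2 * (ln (1 / h) + 2))"
  proof (rule ennreal_leI)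
    have "2 * h ^ 4 * \<Delta>\<^sup>2 * (pi / h\<^sup>2) = 2 * (pi * \<Delta>\<^sup>2 * h\<^sup>2)"
      using h by (simp add: power2_eq_square power4_eq_xxxx)
    moreover have "(pi * \<Delta>\<^sup>2 * h\<^sup>2) * ln 2 \<le> (pi * \<Delta>\<^sup>2 * h\<^sup>2) * 2"
      using ln_2_less_1 by (intro mult_left_mono) auto
    ultimately show "h\<^sup>2 * \<Delta>\<^sup>2 * (pi * (ln 2 + 2 * ln (1 / h))) + 2 * h ^ 4 * \<Delta>\<^sup>2 * (pi / h\<^sup>2) \<le> 2 * pi * \<Delta>\<^sup>2 * h\<^sup>2 * (ln (1 / h) + 2)"
      by (simp add: algebra_simps)
  qed
  finally show ?thesis
    by (simp add: add_mono mult_left_mono)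
qed

end

section \<open>The Poincare inequality on convex sets\<close>

text \<open>The fundamental theorem of calculus along the segment is paired with
  \<open>E = f x - f z\<close>. Young's inequality leaves half of the squared norm of
  \<open>E\<close> on the right, and absorbing it yields the square of the difference with constant
  1.\<close>

lemma segment_difference_le:
  fixes f :: "real^2 \<Rightarrow> 'b::euclidean_space"
  assumes D: "\<And>x. (f has_derivative (\<lambda>v. v $ 1 *\<^sub>R f1 x + v $ 2 *\<^sub>R f2 x)) (at x)"
    and c: "continuous_on UNIV f1" "continuous_on UNIV f2" and d: "norm (x - z) \<le> d"
  shows "ennreal ((norm (f x - f z))\<^sup>2)
    \<le> (\<integral>\<^sup>+t. indicator {0..1} t * ennreal (d\<^sup>2 * ((norm (f1 (z + t *\<^sub>R (x - z))))\<^sup>2 + (norm (f2 (z + t *\<^sub>R (x - z))))\<^sup>2)) \<partial>lborel)"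
proof -
  define v where "v = x - z"
  define E where "E = f x - f z"
  define p where "p t = z + t *\<^sub>R v" for t :: real
  define G where "G t = (norm (f1 (p t)))\<^sup>2 + (norm (f2 (p t)))\<^sup>2" for t
  have G0: "0 \<le> G t" for t by (simp add: G_def)
  have cp: "continuous_on S p" for S unfolding p_def by (intro continuous_intros)
  have cf: "continuous_on S (\<lambda>t. f1 (p t))" "continuous_on S (\<lambda>t. f2 (p t))" for S
    by (rule continuous_on_compose2[OF c(1) cp] continuous_on_compose2[OF c(2) cp]; simp)+
  have cG: "continuous_on S G" for S
    unfolding G_def by (intro continuous_intros cf)
  let ?g = "\<lambda>t. (v $ 1 *\<^sub>R f1 (p t) + v $ 2 *\<^sub>R f2 (p t)) \<bullet> E"
  have cg: "continuous_on S ?g" for S by (intro continuous_intros cf)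
  have deriv: "((\<lambda>t. f (p t) \<bullet> E) has_real_derivative ?g t) (at t)" for t
  proof -
    have "(p has_derivative (\<lambda>s. s *\<^sub>R v)) (at t)"
      unfolding p_def[abs_def] by (auto intro!: derivative_eq_intros)
    from has_derivative_compose[OF this D[of "p t"]]
    have "((\<lambda>t. f (p t)) has_derivative (\<lambda>s. s *\<^sub>R (v $ 1 *\<^sub>R f1 (p t) + v $ 2 *\<^sub>R f2 (p t)))) (at t)"
      by (simp add: scaleR_add_right)
    from has_derivative_inner_left[OF this, of E]
    show ?thesis unfolding has_field_derivative_def
      by (rule has_derivative_eq_rhs) (simp add: fun_eq_iff mult.commute)
  qed
  have atI: "isCont k t" if "continuous_on UNIV k" for k :: "real \<Rightarrow> real" and t
    using that by (simp add: continuous_on_eq_continuous_at)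
  have F: "has_bochner_integral lborel (\<lambda>t. ?g t * indicator {0..1} t) (f (p 1) \<bullet> E - f (p 0) \<bullet> E)"
    by (rule has_bochner_integral_FTC_Icc_real[OF _ deriv atI[OF cg]]) simp
  have "f (p 1) \<bullet> E - f (p 0) \<bullet> E = (norm E)\<^sup>2"
    by (simp add: p_def v_def E_def power2_norm_eq_inner inner_diff_left)
  then have F2: "(\<integral>t. ?g t * indicator {0..1} t \<partial>lborel) = (norm E)\<^sup>2"
    using has_bochner_integral_integral_eq[OF F] by simp
  have iG: "integrable lborel (\<lambda>t. G t * indicator {0..1} t)"
    using borel_integrable_atLeastAtMost[of 0 1 G] atI[OF cG] by (simp add: mult.commute)
  have ii: "integrable lborel (\<lambda>t::real. indicator {0..1} t :: real)"
    by (rule integrable_real_indicator) (simp_all)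
  have pw: "?g t \<le> (norm E)\<^sup>2 / 2 + d\<^sup>2 * G t / 2" for t
  proof -
    define a b where "a = norm (f1 (p t))" and "b = norm (f2 (p t))"
    have "norm (v $ 1 *\<^sub>R f1 (p t) + v $ 2 *\<^sub>R f2 (p t)) \<le> \<bar>v $ 1\<bar> * a + \<bar>v $ 2\<bar> * b"
      unfolding a_def b_def by (rule norm_triangle_le) simp
    then have "(norm (v $ 1 *\<^sub>R f1 (p t) + v $ 2 *\<^sub>R f2 (p t)))\<^sup>2 \<le> (\<bar>v $ 1\<bar> * a + \<bar>v $ 2\<bar> * b)\<^sup>2"
      by (intro power_mono) auto
    also have "\<dots> \<le> ((v $ 1)\<^sup>2 + (v $ 2)\<^sup>2) * (a\<^sup>2 + b\<^sup>2)"
    proof -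
      have "0 \<le> (\<bar>v $ 1\<bar> * b - \<bar>v $ 2\<bar> * a)\<^sup>2" by simp
      then show ?thesis by (simp add: power2_sum power2_diff power_mult_distrib algebra_simps)
    qed
    also have "(v $ 1)\<^sup>2 + (v $ 2)\<^sup>2 = (norm v)\<^sup>2"
      unfolding power2_norm_eq_inner by (simp add: inner_vec_def sum_2 power2_eq_square)
    also have "(norm v)\<^sup>2 * (a\<^sup>2 + b\<^sup>2) \<le> d\<^sup>2 * G t"
      unfolding G_def a_def b_def using d by (intro mult_right_mono power_mono) (auto simp: v_def)
    finally have "(norm (v $ 1 *\<^sub>R f1 (p t) + v $ 2 *\<^sub>R f2 (p t)))\<^sup>2 \<le> d\<^sup>2 * G t" .
    moreover have "2 * ((v $ 1 *\<^sub>R f1 (p t) + v $ 2 *\<^sub>R f2 (p t)) \<bullet> E)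
        \<le> (norm (v $ 1 *\<^sub>R f1 (p t) + v $ 2 *\<^sub>R f2 (p t)))\<^sup>2 + (norm E)\<^sup>2"
    proof -
      have "0 \<le> (norm ((v $ 1 *\<^sub>R f1 (p t) + v $ 2 *\<^sub>R f2 (p t)) - E))\<^sup>2" by simp
      then show ?thesis unfolding power2_norm_eq_inner inner_diff_left inner_diff_right by (simp add: inner_commute)
    qed
    ultimately show ?thesis by linarith
  qed
  have "(norm E)\<^sup>2 = (\<integral>t. ?g t * indicator {0..1} t \<partial>lborel)" using F2 by simp
  also have "\<dots> \<le> (\<integral>t. (norm E)\<^sup>2 / 2 * indicator {0..1} t + d\<^sup>2 / 2 * (G t * indicator {0..1} t) \<partial>lborel)"
  proof (rule integral_mono)
    show "integrable lborel (\<lambda>t. ?g t * indicator {0..1} t)" using F by (rule integrable.intros)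
    show "integrable lborel (\<lambda>t. (norm E)\<^sup>2 / 2 * indicator {0..1} t + d\<^sup>2 / 2 * (G t * indicator {0..1} t))"
      by (intro Bochner_Integration.integrable_add integrable_mult_right ii iG)
    show "?g t * indicator {0..1} t \<le> (norm E)\<^sup>2 / 2 * indicator {0..1} t + d\<^sup>2 / 2 * (G t * indicator {0..1} t)" for t
      using pw[of t] by (simp add: indicator_def)
  qed
  also have "\<dots> = (norm E)\<^sup>2 / 2 + d\<^sup>2 / 2 * (\<integral>t. G t * indicator {0..1} t \<partial>lborel)"
    using ii iG by (subst Bochner_Integration.integral_add) auto
  finally have "(norm E)\<^sup>2 \<le> (\<integral>t. d\<^sup>2 * (G t * indicator {0..1} t) \<partial>lborel)" by simp
  then have "ennreal ((norm E)\<^sup>2) \<le> ennreal (\<integral>t. d\<^sup>2 * (G t * indicator {0..1} t) \<partial>lborel)" by (rule ennreal_leI)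
  also have "\<dots> = (\<integral>\<^sup>+t. ennreal (d\<^sup>2 * (G t * indicator {0..1} t)) \<partial>lborel)"
    by (rule nn_integral_eq_integral[symmetric]) (use iG G0 in auto)
  also have "\<dots> = (\<integral>\<^sup>+t. indicator {0..1} t * ennreal (d\<^sup>2 * G t) \<partial>lborel)"
    by (rule nn_integral_cong) (simp add: indicator_def)
  finally show ?thesis unfolding E_def G_def p_def v_def .
qed

text \<open>The factor bounds the Jacobian \<open>1 / t\<^sup>2\<close> of the substitution in the
  plane.\<close>

lemma nn_integral_affine:
  fixes g :: "real^2 \<Rightarrow> ennreal"
  assumes [measurable]: "g \<in> borel_measurable borel" and t: "t \<ge> 1/2"
  shows "(\<integral>\<^sup>+x. g (a + t *\<^sub>R x) \<partial>lborel) \<le> 4 * (\<integral>\<^sup>+x. g x \<partial>lborel)"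
proof -
  have "(\<integral>\<^sup>+x. g x \<partial>lborel) = (\<integral>\<^sup>+x. g x \<partial>density (distr lborel borel (\<lambda>x. a + t *\<^sub>R x)) (\<lambda>_. ennreal (\<bar>t\<bar> ^ DIM(real^2))))"
    using lborel_affine[of t a] t by simp
  also have "\<dots> = ennreal (t\<^sup>2) * (\<integral>\<^sup>+x. g (a + t *\<^sub>R x) \<partial>lborel)"
    by (subst nn_integral_density) (auto simp: nn_integral_distr nn_integral_cmult)
  finally have eq: "(\<integral>\<^sup>+x. g x \<partial>lborel) = ennreal (t\<^sup>2) * (\<integral>\<^sup>+x. g (a + t *\<^sub>R x) \<partial>lborel)" .
  have "(1/2)\<^sup>2 \<le> t\<^sup>2" using t by (intro power_mono) auto
  then have "ennreal 1 \<le> ennreal (4 * t\<^sup>2)" by (intro ennreal_leI) (simp add: power2_eq_square)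
  also have "ennreal (4 * t\<^sup>2) = 4 * ennreal (t\<^sup>2)" by (simp add: ennreal_mult)
  finally have "1 * (\<integral>\<^sup>+x. g (a + t *\<^sub>R x) \<partial>lborel) \<le> (4 * ennreal (t\<^sup>2)) * (\<integral>\<^sup>+x. g (a + t *\<^sub>R x) \<partial>lborel)"
    by (intro mult_right_mono) auto
  then show ?thesis unfolding eq by (simp add: mult.assoc)
qed

text \<open>For each \<open>t\<close> one of \<open>t\<close> and \<open>1 - t\<close> is at least \<open>1/2\<close>, and the corresponding variable is substituted.\<close>

lemma nn_integral_convex_combination:
  fixes g :: "real^2 \<Rightarrow> ennreal"
  assumes [measurable]: "g \<in> borel_measurable borel" "K \<in> sets borel" and K: "convex K" and t: "0 \<le> t" "t \<le> 1"
  shows "(\<integral>\<^sup>+x. \<integral>\<^sup>+z. indicator K x * indicator K z * g (z + t *\<^sub>R (x - z)) \<partial>lborel \<partial>lborel)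
    \<le> 4 * emeasure lborel K * (\<integral>\<^sup>+x. indicator K x * g x \<partial>lborel)"
proof -
  have half: "(\<integral>\<^sup>+z. \<integral>\<^sup>+x. indicator K x * indicator K z * g ((1 - s) *\<^sub>R z + s *\<^sub>R x) \<partial>lborel \<partial>lborel)
      \<le> 4 * emeasure lborel K * (\<integral>\<^sup>+x. indicator K x * g x \<partial>lborel)" if s: "1/2 \<le> s" "s \<le> 1" for s
  proof -
    have "(\<integral>\<^sup>+x. indicator K x * indicator K z * g ((1 - s) *\<^sub>R z + s *\<^sub>R x) \<partial>lborel)
        \<le> indicator K z * (4 * (\<integral>\<^sup>+x. indicator K x * g x \<partial>lborel))" for z
    proof (cases "z \<in> K")
      case True
      have "(\<integral>\<^sup>+x. indicator K x * indicator K z * g ((1 - s) *\<^sub>R z + s *\<^sub>R x) \<partial>lborel)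
          \<le> (\<integral>\<^sup>+x. indicator K ((1 - s) *\<^sub>R z + s *\<^sub>R x) * g ((1 - s) *\<^sub>R z + s *\<^sub>R x) \<partial>lborel)"
      proof (rule nn_integral_mono)
        fix x
        show "indicator K x * indicator K z * g ((1 - s) *\<^sub>R z + s *\<^sub>R x) \<le> indicator K ((1 - s) *\<^sub>R z + s *\<^sub>R x) * g ((1 - s) *\<^sub>R z + s *\<^sub>R x)"
        proof (cases "x \<in> K")
          case x: True
          have "(1 - s) *\<^sub>R z + s *\<^sub>R x \<in> K" by (rule convexD[OF K True x]) (use s in auto)
          then show ?thesis using x True by simp
        qed simp
      qed
      also have "\<dots> \<le> 4 * (\<integral>\<^sup>+x. indicator K x * g x \<partial>lborel)"
        by (rule nn_integral_affine[of "\<lambda>x. indicator K x * g x"]) (use s in auto)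
      finally show ?thesis using True by simp
    qed simp
    then have "(\<integral>\<^sup>+z. \<integral>\<^sup>+x. indicator K x * indicator K z * g ((1 - s) *\<^sub>R z + s *\<^sub>R x) \<partial>lborel \<partial>lborel)
        \<le> (\<integral>\<^sup>+z. indicator K z * (4 * (\<integral>\<^sup>+x. indicator K x * g x \<partial>lborel)) \<partial>lborel)"
      by (intro nn_integral_mono)
    also have "\<dots> = 4 * emeasure lborel K * (\<integral>\<^sup>+x. indicator K x * g x \<partial>lborel)"
      by (subst nn_integral_multc) (auto simp: mult_ac)
    finally show ?thesis .
  qed
  show ?thesis
  proof (cases "t \<ge> 1/2")
    case True
    have "(\<integral>\<^sup>+x. \<integral>\<^sup>+z. indicator K x * indicator K z * g (z + t *\<^sub>R (x - z)) \<partial>lborel \<partial>lborel)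
      = (\<integral>\<^sup>+z. \<integral>\<^sup>+x. indicator K x * indicator K z * g (z + t *\<^sub>R (x - z)) \<partial>lborel \<partial>lborel)"
      by (rule lborel_pair.Fubini'[symmetric]) measurable
    also have "\<dots> = (\<integral>\<^sup>+z. \<integral>\<^sup>+x. indicator K x * indicator K z * g ((1 - t) *\<^sub>R z + t *\<^sub>R x) \<partial>lborel \<partial>lborel)"
      by (simp add: algebra_simps)
    finally show ?thesis using half[OF True t(2)] by simp
  next
    case False
    have "(\<integral>\<^sup>+x. \<integral>\<^sup>+z. indicator K x * indicator K z * g (z + t *\<^sub>R (x - z)) \<partial>lborel \<partial>lborel)
      = (\<integral>\<^sup>+x. \<integral>\<^sup>+z. indicator K z * indicator K x * g ((1 - (1 - t)) *\<^sub>R x + (1 - t) *\<^sub>R z) \<partial>lborel \<partial>lborel)"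
      by (simp add: algebra_simps)
    then show ?thesis using half[of "1 - t"] False t by simp
  qed
qed

text \<open>Convexity keeps all segments between points of \<open>K\<close> inside \<open>K\<close>.
  Only the diameter and the measure enter the constant, not the shape, which matters for thin cells
  at the boundary of the disc.\<close>

lemma Poincare_double:
  fixes f :: "real^2 \<Rightarrow> 'b::euclidean_space"
  assumes D: "\<And>x. (f has_derivative (\<lambda>v. v $ 1 *\<^sub>R f1 x + v $ 2 *\<^sub>R f2 x)) (at x)"
    and c: "continuous_on UNIV f1" "continuous_on UNIV f2"
    and K [measurable]: "K \<in> sets borel" and cv: "convex K" and d: "\<And>x z. x \<in> K \<Longrightarrow> z \<in> K \<Longrightarrow> norm (x - z) \<le> d"
  shows "(\<integral>\<^sup>+x. \<integral>\<^sup>+z. indicator K x * indicator K z * ennreal ((norm (f x - f z))\<^sup>2) \<partial>lborel \<partial>lborel)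
    \<le> 4 * emeasure lborel K * (\<integral>\<^sup>+x. indicator K x * ennreal (d\<^sup>2 * ((norm (f1 x))\<^sup>2 + (norm (f2 x))\<^sup>2)) \<partial>lborel)"
proof -
  have [measurable]: "f1 \<in> borel_measurable borel" "f2 \<in> borel_measurable borel"
    using c by (auto intro: borel_measurable_continuous_onI)
  define g where "g x = ennreal (d\<^sup>2 * ((norm (f1 x))\<^sup>2 + (norm (f2 x))\<^sup>2))" for x
  have [measurable]: "g \<in> borel_measurable borel" unfolding g_def by measurable
  have "(\<integral>\<^sup>+x. \<integral>\<^sup>+z. indicator K x * indicator K z * ennreal ((norm (f x - f z))\<^sup>2) \<partial>lborel \<partial>lborel)
    \<le> (\<integral>\<^sup>+x. \<integral>\<^sup>+z. indicator K x * indicator K z * (\<integral>\<^sup>+t. indicator {0..1} t * g (z + t *\<^sub>R (x - z)) \<partial>lborel) \<partial>lborel \<partial>lborel)"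
  proof (intro nn_integral_mono)
    fix x z
    show "indicator K x * indicator K z * ennreal ((norm (f x - f z))\<^sup>2)
      \<le> indicator K x * indicator K z * (\<integral>\<^sup>+t. indicator {0..1} t * g (z + t *\<^sub>R (x - z)) \<partial>lborel)"
    proof (cases "x \<in> K \<and> z \<in> K")
      case True
      then show ?thesis using segment_difference_le[OF D c d[of x z]] unfolding g_def by simp
    qed auto
  qed
  also have "\<dots> = (\<integral>\<^sup>+x. \<integral>\<^sup>+z. (\<integral>\<^sup>+t. indicator {0..1} t * (indicator K x * indicator K z * g (z + t *\<^sub>R (x - z))) \<partial>lborel) \<partial>lborel \<partial>lborel)"
    by (subst nn_integral_cmult[symmetric]) (auto simp: mult_ac)
  also have "\<dots> = (\<integral>\<^sup>+x. \<integral>\<^sup>+t. (\<integral>\<^sup>+z. indicator {0..1} t * (indicator K x * indicator K z * g (z + t *\<^sub>R (x - z))) \<partial>lborel) \<partial>lborel \<partial>lborel)"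
    by (intro nn_integral_cong lborel_pair.Fubini') measurable
  also have "\<dots> = (\<integral>\<^sup>+t. \<integral>\<^sup>+x. (\<integral>\<^sup>+z. indicator {0..1} t * (indicator K x * indicator K z * g (z + t *\<^sub>R (x - z))) \<partial>lborel) \<partial>lborel \<partial>lborel)"
    by (rule lborel_pair.Fubini') measurable
  also have "\<dots> \<le> (\<integral>\<^sup>+t. indicator {0..1::real} t * (4 * emeasure lborel K * (\<integral>\<^sup>+x. indicator K x * g x \<partial>lborel)) \<partial>lborel)"
  proof (rule nn_integral_mono)
    fix t :: real
    show "(\<integral>\<^sup>+x. (\<integral>\<^sup>+z. indicator {0..1} t * (indicator K x * indicator K z * g (z + t *\<^sub>R (x - z))) \<partial>lborel) \<partial>lborel)
      \<le> indicator {0..1} t * (4 * emeasure lborel K * (\<integral>\<^sup>+x. indicator K x * g x \<partial>lborel))"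
      using nn_integral_convex_combination[of g K t] cv by (cases "t \<in> {0..1}") auto
  qed
  also have "\<dots> = 4 * emeasure lborel K * (\<integral>\<^sup>+x. indicator K x * g x \<partial>lborel)"
    by (subst nn_integral_multc) auto
  finally show ?thesis unfolding g_def .
qed

text \<open>Expanding the square turns the double integral into twice the measure times the
  mean-square oscillation of \<open>f\<close> about its mean on \<open>K\<close>. This converts the
  bound for differences into the Poincare inequality without subtracting the mean explicitly, and
  null sets need no division.\<close>

lemma double_integral_difference:
  fixes f :: "real^2 \<Rightarrow> 'b::euclidean_space"
  assumes f: "f \<in> L2" and K: "K \<in> sets borel" "emeasure lborel K < \<infinity>"
  shows "(\<integral>\<^sup>+x. \<integral>\<^sup>+z. indicator K x * indicator K z * ennreal ((norm (f x - f z))\<^sup>2) \<partial>lborel \<partial>lborel)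
    = ennreal (2 * measure lborel K * (\<integral>x. indicator K x * (norm (f x))\<^sup>2 \<partial>lborel) - 2 * (norm (\<integral>x. indicator K x *\<^sub>R f x \<partial>lborel))\<^sup>2)"
proof -
  have [measurable]: "K \<in> sets borel" "f \<in> borel_measurable borel" using f K by auto
  define m where "m = (\<integral>x. indicator K x *\<^sub>R f x \<partial>lborel)"
  define S where "S = (\<integral>x. indicator K x * (norm (f x))\<^sup>2 \<partial>lborel)"
  define k where "k = measure lborel K"
  have iK: "integrable lborel (\<lambda>x. indicator K x :: real)" using K by (intro integrable_real_indicator) auto
  have iS: "integrable lborel (\<lambda>x. indicator K x * (norm (f x))\<^sup>2)"
    by (rule Bochner_Integration.integrable_bound[OF L2_integrable[OF f]]) (auto simp: indicator_def)
  have indL2: "(\<lambda>x. indicator K x :: real) \<in> L2"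
    using L2_indicator_const(1)[OF K, of "1::real"] by simp
  have im: "integrable lborel (\<lambda>x. indicator K x *\<^sub>R f x)" by (rule L2_scaleR_integrable[OF indL2 f])
  have ip: "integrable lborel (\<lambda>x. indicator K x * (a \<bullet> f x))" for a
    using integrable_inner_right[OF im, of a] by (auto simp: inner_scaleR_right)
  have pm: "(\<integral>x. indicator K x * (a \<bullet> f x) \<partial>lborel) = a \<bullet> m" for a
    using integral_inner_right[OF im, of a] by (simp add: m_def inner_scaleR_right)
  have inner: "(\<integral>\<^sup>+z. indicator K x * indicator K z * ennreal ((norm (f x - f z))\<^sup>2) \<partial>lborel)
     = ennreal (indicator K x * (k * (norm (f x))\<^sup>2 - 2 * (f x \<bullet> m) + S))"
    and nn: "0 \<le> indicator K x * (k * (norm (f x))\<^sup>2 - 2 * (f x \<bullet> m) + S)" for x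
  proof -
    let ?u = "\<lambda>z. indicator K x * ((norm (f x))\<^sup>2 * indicator K z - 2 * (indicator K z * (f x \<bullet> f z)) + indicator K z * (norm (f z))\<^sup>2)"
    have iu: "integrable lborel ?u"
      by (intro integrable_mult_right Bochner_Integration.integrable_add Bochner_Integration.integrable_diff iK ip iS)
    have vu: "integral\<^sup>L lborel ?u = indicator K x * (k * (norm (f x))\<^sup>2 - 2 * (f x \<bullet> m) + S)"
      using iK ip[of "f x"] iS by (simp add: k_def pm S_def[symmetric] mult.commute)
    have eq: "indicator K x * indicator K z * (norm (f x - f z))\<^sup>2 = ?u z" for z
      unfolding power2_norm_eq_inner by (simp add: indicator_def inner_diff inner_commute)
    have "(\<integral>\<^sup>+z. indicator K x * indicator K z * ennreal ((norm (f x - f z))\<^sup>2) \<partial>lborel) = (\<integral>\<^sup>+z. ennreal (?u z) \<partial>lborel)"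
      by (rule nn_integral_cong, unfold eq[symmetric]) (simp add: indicator_def)
    also have "\<dots> = ennreal (integral\<^sup>L lborel ?u)"
      by (rule nn_integral_eq_integral[OF iu]) (simp add: eq[symmetric])
    finally show "(\<integral>\<^sup>+z. indicator K x * indicator K z * ennreal ((norm (f x - f z))\<^sup>2) \<partial>lborel)
     = ennreal (indicator K x * (k * (norm (f x))\<^sup>2 - 2 * (f x \<bullet> m) + S))" unfolding vu .
    have "0 \<le> integral\<^sup>L lborel ?u" by (rule Bochner_Integration.integral_nonneg) (simp add: eq[symmetric])
    then show "0 \<le> indicator K x * (k * (norm (f x))\<^sup>2 - 2 * (f x \<bullet> m) + S)" unfolding vu .
  qed
  let ?w = "\<lambda>x. k * (indicator K x * (norm (f x))\<^sup>2) - 2 * (indicator K x * (m \<bullet> f x)) + S * indicator K x"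
  have weq: "indicator K x * (k * (norm (f x))\<^sup>2 - 2 * (f x \<bullet> m) + S) = ?w x" for x
    by (simp add: algebra_simps inner_commute)
  have iw: "integrable lborel ?w"
    by (intro integrable_mult_right Bochner_Integration.integrable_add Bochner_Integration.integrable_diff iK ip iS)
  have "(\<integral>\<^sup>+x. \<integral>\<^sup>+z. indicator K x * indicator K z * ennreal ((norm (f x - f z))\<^sup>2) \<partial>lborel \<partial>lborel) = (\<integral>\<^sup>+x. ennreal (?w x) \<partial>lborel)"
    unfolding inner weq ..
  also have "\<dots> = ennreal (integral\<^sup>L lborel ?w)"
    by (rule nn_integral_eq_integral[OF iw]) (use nn in \<open>simp add: weq\<close>)
  also have "integral\<^sup>L lborel ?w = k * S - 2 * (m \<bullet> m) + S * k"
    using iK ip[of m] iS by (simp add: k_def pm S_def[symmetric])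
  also have "\<dots> = 2 * k * S - 2 * (norm m)\<^sup>2" by (simp add: power2_norm_eq_inner)
  finally show ?thesis unfolding k_def m_def S_def .
qed

lemma Poincare_smooth:
  fixes f :: "real^2 \<Rightarrow> 'b::euclidean_space"
  assumes D: "\<And>x. (f has_derivative (\<lambda>v. v $ 1 *\<^sub>R f1 x + v $ 2 *\<^sub>R f2 x)) (at x)"
    and c: "continuous_on UNIV f1" "continuous_on UNIV f2" and L: "f \<in> L2"
    and i: "integrable lborel (\<lambda>x. indicator K x * (norm (f1 x))\<^sup>2)" "integrable lborel (\<lambda>x. indicator K x * (norm (f2 x))\<^sup>2)"
    and K: "K \<in> sets borel" "emeasure lborel K < \<infinity>" "convex K" and d: "\<And>x z. x \<in> K \<Longrightarrow> z \<in> K \<Longrightarrow> norm (x - z) \<le> d"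
  shows "measure lborel K * (\<integral>x. indicator K x * (norm (f x))\<^sup>2 \<partial>lborel)
    \<le> (norm (\<integral>x. indicator K x *\<^sub>R f x \<partial>lborel))\<^sup>2
      + 2 * d\<^sup>2 * measure lborel K * ((\<integral>x. indicator K x * (norm (f1 x))\<^sup>2 \<partial>lborel) + (\<integral>x. indicator K x * (norm (f2 x))\<^sup>2 \<partial>lborel))"
proof -
  let ?I = "(\<integral>x. indicator K x * (norm (f1 x))\<^sup>2 \<partial>lborel) + (\<integral>x. indicator K x * (norm (f2 x))\<^sup>2 \<partial>lborel)"
  have I0: "0 \<le> ?I" by (intro add_nonneg_nonneg Bochner_Integration.integral_nonneg) auto
  have "(\<integral>\<^sup>+x. indicator K x * ennreal (d\<^sup>2 * ((norm (f1 x))\<^sup>2 + (norm (f2 x))\<^sup>2)) \<partial>lborel)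
    = (\<integral>\<^sup>+x. ennreal (d\<^sup>2 * (indicator K x * (norm (f1 x))\<^sup>2 + indicator K x * (norm (f2 x))\<^sup>2)) \<partial>lborel)"
    by (rule nn_integral_cong) (simp add: indicator_def)
  also have "\<dots> = ennreal (\<integral>x. d\<^sup>2 * (indicator K x * (norm (f1 x))\<^sup>2 + indicator K x * (norm (f2 x))\<^sup>2) \<partial>lborel)"
    by (rule nn_integral_eq_integral) (intro integrable_mult_right Bochner_Integration.integrable_add i, simp)
  also have "(\<integral>x. d\<^sup>2 * (indicator K x * (norm (f1 x))\<^sup>2 + indicator K x * (norm (f2 x))\<^sup>2) \<partial>lborel) = d\<^sup>2 * ?I"
    using i by simp
  finally have R: "(\<integral>\<^sup>+x. indicator K x * ennreal (d\<^sup>2 * ((norm (f1 x))\<^sup>2 + (norm (f2 x))\<^sup>2)) \<partial>lborel) = ennreal (d\<^sup>2 * ?I)" .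
  have e: "emeasure lborel K = ennreal (measure lborel K)" using K(2) by (intro emeasure_eq_ennreal_measure) auto
  have "ennreal (2 * measure lborel K * (\<integral>x. indicator K x * (norm (f x))\<^sup>2 \<partial>lborel) - 2 * (norm (\<integral>x. indicator K x *\<^sub>R f x \<partial>lborel))\<^sup>2)
    \<le> 4 * ennreal (measure lborel K) * ennreal (d\<^sup>2 * ?I)"
    using Poincare_double[OF D c K(1,3) d] unfolding double_integral_difference[OF L K(1,2)] R e .
  also have "\<dots> = ennreal (4 * measure lborel K * (d\<^sup>2 * ?I))"
    using I0 by (simp add: ennreal_mult)
  finally have "2 * measure lborel K * (\<integral>x. indicator K x * (norm (f x))\<^sup>2 \<partial>lborel) - 2 * (norm (\<integral>x. indicator K x *\<^sub>R f x \<partial>lborel))\<^sup>2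
     \<le> 4 * measure lborel K * (d\<^sup>2 * ?I)"
    using I0 by (subst (asm) ennreal_le_iff) auto
  then show ?thesis by (simp add: algebra_simps)
qed

section \<open>From smooth functions to weak derivatives in the Poincare inequality\<close>

lemma integral_exhaust_disc:
  fixes u :: "real^2 \<Rightarrow> 'b::euclidean_space"
  assumes u: "integrable lborel u" and K: "K \<in> sets borel" "K \<subseteq> disc 1"
  shows "(\<lambda>j. \<integral>x. indicator (K \<inter> disc (1 - 1 / (real j + 2))) x *\<^sub>R u x \<partial>lborel) \<longlonglongrightarrow> (\<integral>x. indicator K x *\<^sub>R u x \<partial>lborel)"
proof (rule integral_dominated_convergence[where w="\<lambda>x. norm (u x)"])
  have [measurable]: "u \<in> borel_measurable borel" using u by simp
  show "(\<lambda>x. indicator K x *\<^sub>R u x) \<in> borel_measurable lborel"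
    "(\<lambda>x. indicator (K \<inter> disc (1 - 1 / (real j + 2))) x *\<^sub>R u x) \<in> borel_measurable lborel" for j
    using K by (auto intro!: borel_measurable_scaleR borel_measurable_indicator)
  show "AE x in lborel. (\<lambda>j. indicator (K \<inter> disc (1 - 1 / (real j + 2))) x *\<^sub>R u x) \<longlonglongrightarrow> indicator K x *\<^sub>R u x"
  proof (rule AE_I2)
    fix x :: "real^2"
    show "(\<lambda>j. indicator (K \<inter> disc (1 - 1 / (real j + 2))) x *\<^sub>R u x) \<longlonglongrightarrow> indicator K x *\<^sub>R u x"
    proof (cases "x \<in> K")
      case True
      then have "norm x < 1" using K by auto
      moreover have "(\<lambda>j. 1 - 1 / (real j + 2)) \<longlonglongrightarrow> 1" by real_asymp
      ultimately have "\<forall>\<^sub>F j in sequentially. norm x < 1 - 1 / (real j + 2)" by (rule order_tendstoD(1)[rotated])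
      then have "\<forall>\<^sub>F j in sequentially. indicator (K \<inter> disc (1 - 1 / (real j + 2))) x *\<^sub>R u x = indicator K x *\<^sub>R u x"
        by eventually_elim (simp add: True indicator_def)
      then show ?thesis by (rule tendsto_eventually)
    qed simp
  qed
  show "AE x in lborel. norm (indicator (K \<inter> disc (1 - 1 / (real j + 2))) x *\<^sub>R u x) \<le> norm (u x)" for j
    by (rule AE_I2) (simp add: indicator_def)
  show "integrable lborel (\<lambda>x. norm (u x))" using u by simp
qed

text \<open>A set inside a strictly smaller disc keeps distance \<open>1 - r\<close> from the
  boundary, so for large \<open>n\<close> the derivatives of the mollification are the mollified
  weak derivatives on all of \<open>K\<close>.\<close>

lemma Poincare_interior:
  fixes f :: "real^2 \<Rightarrow> 'b::euclidean_space"
  assumes f: "f \<in> cL2" "f1 \<in> cL2" "f2 \<in> cL2" and w: "wderiv (disc 1) (axis 1 1) f f1" "wderiv (disc 1) (axis 2 1) f f2"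
    and K: "K \<in> sets borel" "convex K" "K \<subseteq> disc r" "r < 1" and d: "\<And>x z. x \<in> K \<Longrightarrow> z \<in> K \<Longrightarrow> norm (x - z) \<le> d"
  shows "measure lborel K * (\<integral>x. indicator K x * (norm (f x))\<^sup>2 \<partial>lborel)
    \<le> (norm (\<integral>x. indicator K x *\<^sub>R f x \<partial>lborel))\<^sup>2
      + 2 * d\<^sup>2 * measure lborel K * ((\<integral>x. indicator K x * (norm (f1 x))\<^sup>2 \<partial>lborel) + (\<integral>x. indicator K x * (norm (f2 x))\<^sup>2 \<partial>lborel))"
proof -
  let ?c = "\<lambda>n g. conv (mollifier n) g"
  let ?W = "\<lambda>g. \<integral>x. indicator K x * (norm (g x))\<^sup>2 \<partial>lborel"
  have fin: "emeasure lborel K < \<infinity>"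
    using emeasure_bounded_finite[of K] bounded_subset[OF bounded_ball K(3)] by simp
  have mK: "(indicator K :: real^2 \<Rightarrow> real) \<in> borel_measurable borel" using K by simp
  have lim: "(\<lambda>n. ?W (?c n g)) \<longlonglongrightarrow> ?W g" if "g \<in> cL2" for g :: "real^2 \<Rightarrow> 'b"
    by (rule L2_tendsto_weighted[where M=1, OF mollify_L2(1)[OF cL2_L2[OF that] cL2_integrable[OF that]] cL2_L2[OF that]
        mollify_L2(2)[OF cL2_L2[OF that] cL2_integrable[OF that]] mK]) (simp add: indicator_def)
  have limi: "(\<lambda>n. \<integral>x. indicator K x *\<^sub>R ?c n f x \<partial>lborel) \<longlonglongrightarrow> (\<integral>x. indicator K x *\<^sub>R f x \<partial>lborel)"
    by (rule L2_tendsto_integral[OF mollify_L2(1)[OF cL2_L2[OF f(1)] cL2_integrable[OF f(1)]] cL2_L2[OF f(1)]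
        mollify_L2(2)[OF cL2_L2[OF f(1)] cL2_integrable[OF f(1)]]]) (use L2_indicator_const(1)[OF K(1) fin, of "1::real"] in simp)
  have iK: "integrable lborel (\<lambda>x. indicator K x * (norm (?c n g x))\<^sup>2)" if "g \<in> cL2" for g :: "real^2 \<Rightarrow> 'b" and n
  proof -
    note L = mollify_L2(1)[OF cL2_L2[OF that] cL2_integrable[OF that], of n]
    have [measurable]: "?c n g \<in> borel_measurable borel" "K \<in> sets borel" using L K by auto
    show ?thesis by (rule Bochner_Integration.integrable_bound[OF L2_integrable[OF L]]) (auto simp: indicator_def)
  qed
  have "(\<lambda>n. 1 / (real n + 1)) \<longlonglongrightarrow> 0" by real_asymp
  then have ev: "\<forall>\<^sub>F n in sequentially. 1 / (real n + 1) < 1 - r" by (rule order_tendstoD) (use K in simp)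
  have ev2: "\<forall>\<^sub>F n in sequentially. measure lborel K * ?W (?c n f)
      \<le> (norm (\<integral>x. indicator K x *\<^sub>R ?c n f x \<partial>lborel))\<^sup>2 + 2 * d\<^sup>2 * measure lborel K * (?W (?c n f1) + ?W (?c n f2))"
    using ev
  proof eventually_elim
    case (elim n)
    let ?g = "\<lambda>i::2. conv (pderiv_dir (axis i 1) (mollifier n)) f"
    have sub: "cball x (1 / (real n + 1)) \<subseteq> disc 1" if "x \<in> K" for x
    proof
      fix z assume z: "z \<in> cball x (1 / (real n + 1))"
      have "norm z \<le> norm x + dist x z" using norm_triangle_sub[of z x] by (simp add: dist_norm norm_minus_commute)
      moreover have "norm x < r" using that K(3) by auto
      ultimately show "z \<in> disc 1" using z elim by simp
    qed
    have g1: "indicator K x * (norm (?g 1 x))\<^sup>2 = indicator K x * (norm (?c n f1 x))\<^sup>2" for x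
      by (cases "x \<in> K") (simp_all add: conv_wderiv[OF w(1) sub])
    have g2: "indicator K x * (norm (?g 2 x))\<^sup>2 = indicator K x * (norm (?c n f2 x))\<^sup>2" for x
      by (cases "x \<in> K") (simp_all add: conv_wderiv[OF w(2) sub])
    have B: "(Basis :: (real^2) set) = {axis 1 1, axis 2 1}"
      by (auto simp: Basis_vec_def UNIV_2)
    have ne: "axis 1 1 \<noteq> (axis 2 1 :: real^2)" by (simp add: axis_eq_axis)
    have D: "(?c n f has_derivative (\<lambda>v. v $ 1 *\<^sub>R ?g 1 x + v $ 2 *\<^sub>R ?g 2 x)) (at x)" for x
      using conv_has_derivative[OF mollifier_test cL2_integrable[OF f(1)], of n x] unfolding B
      by (simp add: ne inner_axis)
    have cg: "continuous_on UNIV (?g i)" for i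
      by (rule conv_continuous[OF test_functions_pderiv[OF mollifier_test axis_Basis2] cL2_integrable[OF f(1)]])
    show ?case
      using Poincare_smooth[OF D cg cg mollify_L2(1)[OF cL2_L2[OF f(1)] cL2_integrable[OF f(1)]] _ _ K(1) fin K(2) d]
      unfolding g1 g2 using iK[OF f(2), of n] iK[OF f(3), of n] by simp
  qed
  show ?thesis
    by (rule tendsto_le[OF sequentially_bot _ _ ev2]) (intro tendsto_intros lim limi f)+
qed

text \<open>Sets that reach the boundary are exhausted by their intersections with smaller discs.
  These remain convex with the same bound on the diameter, so the constant is uniform and no
  extension of \<open>f\<close> across the boundary is required.\<close>

lemma Poincare:
  fixes f :: "real^2 \<Rightarrow> 'b::euclidean_space"
  assumes f: "f \<in> cL2" "f1 \<in> cL2" "f2 \<in> cL2" and w: "wderiv (disc 1) (axis 1 1) f f1" "wderiv (disc 1) (axis 2 1) f f2"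
    and K: "K \<in> sets borel" "convex K" "K \<subseteq> disc 1" and d: "\<And>x z. x \<in> K \<Longrightarrow> z \<in> K \<Longrightarrow> norm (x - z) \<le> d"
  shows "measure lborel K * (\<integral>x. indicator K x * (norm (f x))\<^sup>2 \<partial>lborel)
    \<le> (norm (\<integral>x. indicator K x *\<^sub>R f x \<partial>lborel))\<^sup>2
      + 2 * d\<^sup>2 * measure lborel K * ((\<integral>x. indicator K x * (norm (f1 x))\<^sup>2 \<partial>lborel) + (\<integral>x. indicator K x * (norm (f2 x))\<^sup>2 \<partial>lborel))"
proof -
  define k where "k j = K \<inter> disc (1 - 1 / (real j + 2))" for j :: nat
  have W: "(\<lambda>j. \<integral>x. indicator (k j) x * (norm (g x))\<^sup>2 \<partial>lborel) \<longlonglongrightarrow> (\<integral>x. indicator K x * (norm (g x))\<^sup>2 \<partial>lborel)" if "g \<in> cL2" for g :: "real^2 \<Rightarrow> 'b"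
    using integral_exhaust_disc[OF L2_integrable[OF cL2_L2[OF that]] K(1,3)] unfolding k_def by simp
  have I: "(\<lambda>j. \<integral>x. indicator (k j) x *\<^sub>R f x \<partial>lborel) \<longlonglongrightarrow> (\<integral>x. indicator K x *\<^sub>R f x \<partial>lborel)"
    using integral_exhaust_disc[OF cL2_integrable[OF f(1)] K(1,3)] unfolding k_def .
  have M: "(\<lambda>j. measure lborel (k j)) \<longlonglongrightarrow> measure lborel K"
  proof -
    have "emeasure lborel (disc 1 :: (real^2) set) < \<infinity>" using emeasure_bounded_finite[of "disc 1 :: (real^2) set"] by simp
    then have "integrable lborel (indicator (disc 1) :: real^2 \<Rightarrow> real)" by (intro integrable_real_indicator) auto
    note L = integral_exhaust_disc[OF this K(1,3)]
    have e: "indicator (k j) x *\<^sub>R (indicator (disc 1) x :: real) = indicator (k j) x" "indicator K x *\<^sub>R (indicator (disc 1) x :: real) = indicator K x" for j x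
      using K(3) unfolding k_def by (auto simp: indicator_def)
    show ?thesis using L unfolding k_def[symmetric] e by simp
  qed
  have ev: "\<forall>\<^sub>F j in sequentially. measure lborel (k j) * (\<integral>x. indicator (k j) x * (norm (f x))\<^sup>2 \<partial>lborel)
    \<le> (norm (\<integral>x. indicator (k j) x *\<^sub>R f x \<partial>lborel))\<^sup>2
      + 2 * d\<^sup>2 * measure lborel (k j) * ((\<integral>x. indicator (k j) x * (norm (f1 x))\<^sup>2 \<partial>lborel) + (\<integral>x. indicator (k j) x * (norm (f2 x))\<^sup>2 \<partial>lborel))"
  proof (rule always_eventually, rule allI)
    fix j
    have k: "k j \<in> sets borel" "convex (k j)" "k j \<subseteq> disc (1 - 1 / (real j + 2))" "1 - 1 / (real j + 2) < 1"
      using K by (auto simp: k_def intro: convex_Int convex_ball)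
    show "measure lborel (k j) * (\<integral>x. indicator (k j) x * (norm (f x))\<^sup>2 \<partial>lborel)
    \<le> (norm (\<integral>x. indicator (k j) x *\<^sub>R f x \<partial>lborel))\<^sup>2
      + 2 * d\<^sup>2 * measure lborel (k j) * ((\<integral>x. indicator (k j) x * (norm (f1 x))\<^sup>2 \<partial>lborel) + (\<integral>x. indicator (k j) x * (norm (f2 x))\<^sup>2 \<partial>lborel))"
      by (rule Poincare_interior[OF f w k d]) (simp_all add: k_def)
  qed
  show ?thesis
    by (rule tendsto_le[OF sequentially_bot _ _ ev]) (intro tendsto_intros W I M f)+
qed

section \<open>Linear combinations\<close>

lemma cL2_lincomb:
  assumes "f \<in> cL2" "g \<in> cL2"
  shows "(\<lambda>x. a *\<^sub>R f x + b *\<^sub>R g x) \<in> cL2"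
  using assms by (auto simp: cL2_def intro!: L2_add L2_scaleR)

lemma wderiv_lincomb:
  fixes f g f' g' :: "real^2 \<Rightarrow> 'b::euclidean_space"
  assumes c: "f \<in> cL2" "g \<in> cL2" "f' \<in> cL2" "g' \<in> cL2" and b: "v \<in> Basis"
    and w: "wderiv U v f f'" "wderiv U v g g'"
  shows "wderiv U v (\<lambda>x. \<alpha> *\<^sub>R f x + \<beta> *\<^sub>R g x) (\<lambda>x. \<alpha> *\<^sub>R f' x + \<beta> *\<^sub>R g' x)"
  unfolding wderiv_def
proof
  fix \<phi> assume \<phi>: "\<phi> \<in> test_functions U"
  have lin: "(\<integral>x. \<psi> x *\<^sub>R (\<alpha> *\<^sub>R k x + \<beta> *\<^sub>R l x) \<partial>lborel) = \<alpha> *\<^sub>R (\<integral>x. \<psi> x *\<^sub>R k x \<partial>lborel) + \<beta> *\<^sub>R (\<integral>x. \<psi> x *\<^sub>R l x \<partial>lborel)"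
    if "\<psi> \<in> test_functions U" "k \<in> cL2" "l \<in> cL2" for \<psi> and k l :: "real^2 \<Rightarrow> 'b"
  proof -
    have i: "integrable lborel (\<lambda>x. \<psi> x *\<^sub>R k x)" "integrable lborel (\<lambda>x. \<psi> x *\<^sub>R l x)"
      by (rule L2_scaleR_integrable, rule test_functions_L2[OF that(1)], rule cL2_L2, rule that)+
    have i': "integrable lborel (\<lambda>x. \<alpha> *\<^sub>R (\<psi> x *\<^sub>R k x))" "integrable lborel (\<lambda>x. \<beta> *\<^sub>R (\<psi> x *\<^sub>R l x))"
      by (rule integrable_scaleR_right, rule i)+
    have "(\<integral>x. \<psi> x *\<^sub>R (\<alpha> *\<^sub>R k x + \<beta> *\<^sub>R l x) \<partial>lborel) = (\<integral>x. \<alpha> *\<^sub>R (\<psi> x *\<^sub>R k x) + \<beta> *\<^sub>R (\<psi> x *\<^sub>R l x) \<partial>lborel)"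
      by (simp add: scaleR_add_right mult.commute)
    then show ?thesis unfolding Bochner_Integration.integral_add[OF i'] integral_scaleR_right .
  qed
  show "(\<integral>x. pderiv_dir v \<phi> x *\<^sub>R (\<alpha> *\<^sub>R f x + \<beta> *\<^sub>R g x) \<partial>lborel) = - (\<integral>x. \<phi> x *\<^sub>R (\<alpha> *\<^sub>R f' x + \<beta> *\<^sub>R g' x) \<partial>lborel)"
    unfolding lin[OF \<phi> c(3,4)] lin[OF test_functions_pderiv[OF \<phi> b] c(1,2)]
      w(1)[unfolded wderiv_def, rule_format, OF \<phi>] w(2)[unfolded wderiv_def, rule_format, OF \<phi>] by simp
qed

lemma wderiv_limit:
  fixes f :: "nat \<Rightarrow> real^2 \<Rightarrow> 'b::euclidean_space"
  assumes L: "\<And>n. f n \<in> L2" "g \<in> L2" "\<And>n. f' n \<in> L2" "g' \<in> L2" and b: "v \<in> Basis"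
    and lim: "(\<lambda>n. sqn (\<lambda>x. f n x - g x)) \<longlonglongrightarrow> 0" "(\<lambda>n. sqn (\<lambda>x. f' n x - g' x)) \<longlonglongrightarrow> 0"
    and w: "\<And>n. wderiv U v (f n) (f' n)"
  shows "wderiv U v g g'"
  unfolding wderiv_def
proof
  fix \<phi> assume \<phi>: "\<phi> \<in> test_functions U"
  have 1: "(\<lambda>n. \<integral>x. pderiv_dir v \<phi> x *\<^sub>R f n x \<partial>lborel) \<longlonglongrightarrow> (\<integral>x. pderiv_dir v \<phi> x *\<^sub>R g x \<partial>lborel)"
    by (rule L2_tendsto_integral[OF L(1,2) lim(1) test_functions_L2[OF test_functions_pderiv[OF \<phi> b]]])
  have 2: "(\<lambda>n. - (\<integral>x. \<phi> x *\<^sub>R f' n x \<partial>lborel)) \<longlonglongrightarrow> - (\<integral>x. \<phi> x *\<^sub>R g' x \<partial>lborel)"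
    by (rule tendsto_minus[OF L2_tendsto_integral[OF L(3,4) lim(2) test_functions_L2[OF \<phi>]]])
  from 1 2 show "(\<integral>x. pderiv_dir v \<phi> x *\<^sub>R g x \<partial>lborel) = - (\<integral>x. \<phi> x *\<^sub>R g' x \<partial>lborel)"
    unfolding w[unfolded wderiv_def, rule_format, OF \<phi>] by (rule LIMSEQ_unique)
qed

section \<open>Rellich compactness on the disc\<close>

text \<open>Half-open squares of side \<open>1 / N\<close> intersected with the disc. They partition
  the disc and stay convex, so cells at the boundary obey the same Poincare inequality as interior
  ones.\<close>

definition cell :: "nat \<Rightarrow> int \<times> int \<Rightarrow> (real^2) set" where
  "cell N p = disc 1 \<inter> (\<lambda>x. real N * x $ 1) -` {of_int (fst p)..<of_int (fst p) + 1}
     \<inter> (\<lambda>x. real N * x $ 2) -` {of_int (snd p)..<of_int (snd p) + 1}"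

lemma cell_convex: "convex (cell N p)"
proof -
  have l: "linear (\<lambda>x::real^2. real N * x $ i)" for i
    by (rule linearI) (simp_all add: algebra_simps)
  show ?thesis unfolding cell_def
    by (intro convex_Int convex_ball convex_linear_vimage[OF l] convex_real_interval)
qed

lemma cell_borel [measurable]: "cell N p \<in> sets borel"
  unfolding cell_def using measurable_sets_borel[of "\<lambda>x::real^2. real N * x $ 1" borel] measurable_sets_borel[of "\<lambda>x::real^2. real N * x $ 2" borel]
  by (intro sets.Int) auto

lemma cell_diameter:
  assumes "x \<in> cell N p" "z \<in> cell N p" "N > 0"
  shows "norm (x - z) \<le> 2 / real N"
proof -
  have "\<bar>real N * x $ i - real N * z $ i\<bar> \<le> 1" for i
    using assms exhaust_2[of i] by (auto simp: cell_def)
  moreover have "real N * \<bar>(x - z) $ i\<bar> = \<bar>real N * x $ i - real N * z $ i\<bar>" for i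
    unfolding right_diff_distrib[symmetric] abs_mult by simp
  ultimately have "\<bar>(x - z) $ i\<bar> \<le> 1 / real N" for i
    using assms(3) by (simp add: pos_le_divide_eq mult.commute)
  then have "\<bar>(x - z) $ 1\<bar> + \<bar>(x - z) $ 2\<bar> \<le> 1 / real N + 1 / real N" by (intro add_mono)
  moreover have "norm (x - z) \<le> \<bar>(x - z) $ 1\<bar> + \<bar>(x - z) $ 2\<bar>"
    using norm_le_l1_cart[of "x - z"] by (simp add: sum_2)
  ultimately show ?thesis by simp
qed

lemma sum_indicator_cell:
  assumes "N > 0"
  shows "(\<Sum>p\<in>{-int N..int N} \<times> {-int N..int N}. indicator (cell N p) x) = (indicator (disc 1) x :: real)"
proof (cases "x \<in> disc 1")
  case True
  let ?P = "{-int N..int N} \<times> {-int N..int N}"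
  let ?q = "(\<lfloor>real N * x $ 1\<rfloor>, \<lfloor>real N * x $ 2\<rfloor>)"
  have b: "\<bar>real N * x $ i\<bar> \<le> real N" for i
  proof -
    have "\<bar>x $ i\<bar> \<le> 1" using component_le_norm_cart[of x i] True by simp
    then show ?thesis using assms by (simp add: abs_mult mult_left_le)
  qed
  have "?q \<in> ?P" using b[of 1] b[of 2] by (auto simp: le_floor_iff floor_le_iff abs_le_iff)
  have "indicator (cell N p) x = (if ?q = p then 1 else 0 :: real)" for p
    using True by (cases p) (auto simp: cell_def indicator_def floor_eq_iff)
  then have "(\<Sum>p\<in>?P. indicator (cell N p) x) = (\<Sum>p\<in>?P. if ?q = p then 1 else 0 :: real)" by simp
  also have "\<dots> = 1" using \<open>?q \<in> ?P\<close> by (subst sum.delta') auto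
  finally show ?thesis using True by simp
next
  case False
  then have "indicator (cell N p) x = (0::real)" for p by (simp add: cell_def)
  then show ?thesis using False by simp
qed

lemma integral_sum_cells:
  fixes u :: "real^2 \<Rightarrow> real"
  assumes u: "integrable lborel u" "\<And>x. x \<notin> disc 1 \<Longrightarrow> u x = 0" and N: "N > 0"
  shows "(\<integral>x. u x \<partial>lborel) = (\<Sum>p\<in>{-int N..int N} \<times> {-int N..int N}. \<integral>x. indicator (cell N p) x * u x \<partial>lborel)"
proof -
  have i: "integrable lborel (\<lambda>x. indicator (cell N p) x * u x)" for p
    using integrable_mult_indicator[OF _ u(1), of "cell N p"] by simp
  have ue: "u x = (\<Sum>p\<in>{-int N..int N} \<times> {-int N..int N}. indicator (cell N p) x * u x)" for x
    unfolding sum_distrib_right[symmetric] sum_indicator_cell[OF N] using u(2)[of x] by (cases "x \<in> disc 1") auto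
  have "(\<integral>x. u x \<partial>lborel) = (\<integral>x. (\<Sum>p\<in>{-int N..int N} \<times> {-int N..int N}. indicator (cell N p) x * u x) \<partial>lborel)"
    by (rule Bochner_Integration.integral_cong[OF refl]) (rule ue)
  also have "\<dots> = (\<Sum>p\<in>{-int N..int N} \<times> {-int N..int N}. \<integral>x. indicator (cell N p) x * u x \<partial>lborel)"
    by (rule Bochner_Integration.integral_sum) (rule i)
  finally show ?thesis .
qed

text \<open>The Poincare inequality summed over the cells. Their diameter is at most
  \<open>2 / N\<close>, and twice its square gives \<open>8 / (real N)\<^sup>2\<close>; up to this
  small multiple of the gradient, finitely many cell integrals control the norm.\<close>

lemma sqn_le_cells:
  fixes f :: "real^2 \<Rightarrow> 'b::euclidean_space"
  assumes f: "f \<in> cL2" "f1 \<in> cL2" "f2 \<in> cL2" and w: "wderiv (disc 1) (axis 1 1) f f1" "wderiv (disc 1) (axis 2 1) f f2" and N: "N > 0"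
  shows "sqn f \<le> (\<Sum>p\<in>{-int N..int N} \<times> {-int N..int N}. (norm (\<integral>x. indicator (cell N p) x *\<^sub>R f x \<partial>lborel))\<^sup>2 / measure lborel (cell N p))
     + 8 / (real N)\<^sup>2 * (sqn f1 + sqn f2)"
proof -
  let ?W = "\<lambda>p g. \<integral>x. indicator (cell N p) x * (norm (g x))\<^sup>2 \<partial>lborel"
  let ?P = "{-int N..int N} \<times> {-int N..int N}"
  let ?a = "\<lambda>p. norm (\<integral>x. indicator (cell N p) x *\<^sub>R f x \<partial>lborel)"
  have dec: "sqn g = (\<Sum>p\<in>?P. ?W p g)" if "g \<in> cL2" for g :: "real^2 \<Rightarrow> 'b"
    unfolding sqn_def by (rule integral_sum_cells[OF L2_integrable[OF cL2_L2[OF that]] _ N]) (use that in \<open>auto simp: cL2_def\<close>)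
  have W0: "0 \<le> ?W p g" for p and g :: "real^2 \<Rightarrow> 'b" by (rule Bochner_Integration.integral_nonneg) simp
  have "?W p f \<le> (?a p)\<^sup>2 / measure lborel (cell N p) + 8 / (real N)\<^sup>2 * (?W p f1 + ?W p f2)" for p
  proof (cases "measure lborel (cell N p) = 0")
    \<comment> \<open>On a null cell the quotient is 0 by the convention for division, so it has to
      be checked separately that the integral over the cell vanishes.\<close>
    case True
    have "bounded (cell N p)" by (rule bounded_subset[OF bounded_ball[of 0 1]]) (auto simp: cell_def)
    then have "emeasure lborel (cell N p) < \<infinity>" using emeasure_bounded_finite by simp
    then have "emeasure lborel (cell N p) = 0" using emeasure_eq_ennreal_measure[of lborel "cell N p"] True by simp
    then have "AE x in lborel. x \<notin> cell N p" by (intro AE_not_in) (simp add: null_sets_def)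
    then have "AE x in lborel. indicator (cell N p) x * (norm (f x))\<^sup>2 = 0" by eventually_elim simp
    then have "?W p f = 0" by (rule integral_eq_zero_AE)
    then show ?thesis using W0[of p f1] W0[of p f2] by (simp add: True)
  next
    case False
    then have pos: "0 < measure lborel (cell N p)" by (simp add: less_le)
    have "measure lborel (cell N p) * ?W p f \<le> (?a p)\<^sup>2 + 2 * (2 / real N)\<^sup>2 * measure lborel (cell N p) * (?W p f1 + ?W p f2)"
      by (rule Poincare[OF f w cell_borel cell_convex _ cell_diameter[OF _ _ N]]) (auto simp: cell_def)
    also have "\<dots> = measure lborel (cell N p) * ((?a p)\<^sup>2 / measure lborel (cell N p) + 8 / (real N)\<^sup>2 * (?W p f1 + ?W p f2))"
      using pos by (simp add: field_simps power_divide)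
    finally show ?thesis using pos by (simp add: mult_le_cancel_left)
  qed
  then have "(\<Sum>p\<in>?P. ?W p f) \<le> (\<Sum>p\<in>?P. (?a p)\<^sup>2 / measure lborel (cell N p) + 8 / (real N)\<^sup>2 * (?W p f1 + ?W p f2))"
    by (intro sum_mono)
  also have "\<dots> = (\<Sum>p\<in>?P. (?a p)\<^sup>2 / measure lborel (cell N p)) + 8 / (real N)\<^sup>2 * (sqn f1 + sqn f2)"
    unfolding dec[OF f(2)] dec[OF f(3)] by (simp only: sum.distrib sum_distrib_left[symmetric])
  finally show ?thesis unfolding dec[OF f(1)] .
qed

text \<open>For each grid the problem is finite-dimensional up to an error of order
  \<open>1 / N\<^sup>2\<close>. The cell integrals for all grids together form a countable family of
  bounded sequences, so one diagonal subsequence makes all of them converge.\<close>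

lemma Rellich:
  fixes f :: "nat \<Rightarrow> real^2 \<Rightarrow> 'b::euclidean_space"
  assumes f: "\<And>n. f n \<in> cL2" "\<And>n. f1 n \<in> cL2" "\<And>n. f2 n \<in> cL2"
    and w: "\<And>n. wderiv (disc 1) (axis 1 1) (f n) (f1 n)" "\<And>n. wderiv (disc 1) (axis 2 1) (f n) (f2 n)"
    and C: "\<And>n. sqn (f n) \<le> C" "\<And>n. sqn (f1 n) \<le> C" "\<And>n. sqn (f2 n) \<le> C"
  shows "\<exists>r. strict_mono (r :: nat \<Rightarrow> nat) \<and> (\<forall>e>0. \<exists>M::nat. \<forall>m\<ge>M. \<forall>n\<ge>M. sqn (\<lambda>x. f (r m) x - f (r n) x) \<le> e)"
proof -
  define a where "a n q = (\<integral>x. indicator (cell (fst q) (snd q)) x *\<^sub>R f n x \<partial>lborel)" for n and q :: "nat \<times> int \<times> int"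
  have fin: "emeasure lborel (disc 1 :: (real^2) set) < \<infinity>" using emeasure_bounded_finite[of "disc 1 :: (real^2) set"] by simp
  have iD: "integrable lborel (indicator (disc 1) :: real^2 \<Rightarrow> real)" using fin by (intro integrable_real_indicator) auto
  have ic: "integrable lborel (\<lambda>x. indicator (cell N p) x *\<^sub>R f n x)" for N p n
    using integrable_mult_indicator[OF _ cL2_integrable[OF f(1)], of "cell N p" n] by simp
  have bound: "norm (a n q) \<le> measure lborel (disc 1 :: (real^2) set) + C" for n q
  proof -
    have "norm (a n q) \<le> (\<integral>x. norm (indicator (cell (fst q) (snd q)) x *\<^sub>R f n x) \<partial>lborel)"
      unfolding a_def by (rule integral_norm_bound)
    also have "\<dots> \<le> (\<integral>x. indicator (disc 1) x + (norm (f n x))\<^sup>2 \<partial>lborel)"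
    proof (rule integral_mono)
      show "norm (indicator (cell (fst q) (snd q)) x *\<^sub>R f n x) \<le> indicator (disc 1) x + (norm (f n x))\<^sup>2" for x
      proof -
        have "0 \<le> (norm (f n x) - 1)\<^sup>2" by simp
        then have "norm (f n x) \<le> 1 + (norm (f n x))\<^sup>2"
          unfolding power2_diff power_one using norm_ge_zero[of "f n x"] by linarith
        then show ?thesis by (auto simp: indicator_def cell_def)
      qed
      show "integrable lborel (\<lambda>x. norm (indicator (cell (fst q) (snd q)) x *\<^sub>R f n x))"
        by (rule integrable_norm[OF ic])
      show "integrable lborel (\<lambda>x. indicator (disc 1) x + (norm (f n x))\<^sup>2)"
        by (intro Bochner_Integration.integrable_add iD L2_integrable cL2_L2 f)
    qed
    also have "\<dots> = measure lborel (disc 1 :: (real^2) set) + sqn (f n)"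
      using iD L2_integrable[OF cL2_L2[OF f(1)], of n] by (simp add: sqn_def)
    finally show ?thesis using C(1)[of n] by simp
  qed
  obtain r where r: "strict_mono (r :: nat \<Rightarrow> nat)" "\<And>q. q \<in> UNIV \<Longrightarrow> \<exists>l. (\<lambda>n. a (r n) q) \<longlonglongrightarrow> l"
    by (rule function_convergent_subsequence[of "UNIV :: (nat \<times> int \<times> int) set" a "measure lborel (disc 1 :: (real^2) set) + C"])
      (use bound in auto)
  define l where "l q = (SOME l. (\<lambda>n. a (r n) q) \<longlonglongrightarrow> l)" for q
  have l: "(\<lambda>n. a (r n) q) \<longlonglongrightarrow> l q" for q
    unfolding l_def by (rule someI_ex[OF r(2)[OF UNIV_I]])
  have C0: "0 \<le> C" using C(1)[of 0] sqn_nonneg[of "f 0"] by linarith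
  have "\<exists>M. \<forall>m\<ge>M. \<forall>n\<ge>M. sqn (\<lambda>x. f (r m) x - f (r n) x) \<le> e" if e: "e > 0" for e
  proof -
    \<comment> \<open>Differences of the derivatives have squared norm at most \<open>4 * C\<close>,
      so the gradient part is \<open>8 * (4 * C + 4 * C) = 64 * C\<close> over the square of
      \<open>N\<close>; this \<open>N\<close> makes it at most \<open>e / 2\<close>. The cell sums,
      each below \<open>e / 8\<close> and counted twice, supply the other half.\<close>
    obtain N0 :: nat where N0: "128 * C / e < real N0" using reals_Archimedean2 by blast
    define N where "N = Suc N0"
    have N: "N > 0" "128 * C / e \<le> real N" using N0 by (auto simp: N_def)
    have "64 * C / (real N)\<^sup>2 \<le> 64 * C / real N"
      using N C0 by (intro divide_left_mono) (auto simp: power2_eq_square N_def)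
    also have "\<dots> \<le> e / 2" using N e by (simp add: field_simps)
    finally have small: "64 * C / (real N)\<^sup>2 \<le> e / 2" .
    let ?P = "{-int N..int N} \<times> {-int N..int N}"
    define s where "s n = (\<Sum>p\<in>?P. (norm (a (r n) (N, p) - l (N, p)))\<^sup>2 / measure lborel (cell N p))" for n
    have "s \<longlonglongrightarrow> (\<Sum>p\<in>?P. (norm (l (N, p) - l (N, p)))\<^sup>2 / measure lborel (cell N p))"
      unfolding s_def[abs_def] divide_inverse by (intro tendsto_intros l)
    then have "s \<longlonglongrightarrow> 0" by simp
    then have "\<forall>\<^sub>F n in sequentially. s n < e / 8" by (rule order_tendstoD) (use e in simp)
    then obtain M where M: "\<And>n. n \<ge> M \<Longrightarrow> s n < e / 8" unfolding eventually_sequentially by blast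
    have "sqn (\<lambda>x. f (r m) x - f (r n) x) \<le> e" if mn: "m \<ge> M" "n \<ge> M" for m n
    proof -
      let ?g = "\<lambda>h x. 1 *\<^sub>R h (r m) x + (-1) *\<^sub>R h (r n) x :: 'b"
      have ag: "(\<integral>x. indicator (cell N p) x *\<^sub>R ?g f x \<partial>lborel) = a (r m) (N, p) - a (r n) (N, p)" for p
        using ic[of N p "r m"] ic[of N p "r n"] by (simp add: a_def scaleR_diff_right)
      have sg: "sqn (?g h) \<le> 4 * C" if "\<And>n. h n \<in> cL2" "\<And>n. sqn (h n) \<le> C" for h
        using sqn_diff_le[OF cL2_L2[OF that(1)] cL2_L2[OF that(1)], of "r m" "r n"] that(2)[of "r m"] that(2)[of "r n"] by simp
      have "sqn (?g f) \<le> (\<Sum>p\<in>?P. (norm (\<integral>x. indicator (cell N p) x *\<^sub>R ?g f x \<partial>lborel))\<^sup>2 / measure lborel (cell N p))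
         + 8 / (real N)\<^sup>2 * (sqn (?g f1) + sqn (?g f2))"
        by (rule sqn_le_cells[OF cL2_lincomb[OF f(1) f(1)] cL2_lincomb[OF f(2) f(2)] cL2_lincomb[OF f(3) f(3)]
            wderiv_lincomb[OF f(1) f(1) f(2) f(2) axis_Basis2 w(1) w(1)] wderiv_lincomb[OF f(1) f(1) f(3) f(3) axis_Basis2 w(2) w(2)] N(1)])
      also have "\<dots> \<le> (\<Sum>p\<in>?P. 2 * ((norm (a (r m) (N, p) - l (N, p)))\<^sup>2 / measure lborel (cell N p))
          + 2 * ((norm (a (r n) (N, p) - l (N, p)))\<^sup>2 / measure lborel (cell N p))) + 8 / (real N)\<^sup>2 * (4 * C + 4 * C)"
      proof (intro add_mono sum_mono mult_left_mono sg f C)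
        fix p
        have "(norm (a (r m) (N, p) - a (r n) (N, p)))\<^sup>2 \<le> 2 * (norm (a (r m) (N, p) - l (N, p)))\<^sup>2 + 2 * (norm (a (r n) (N, p) - l (N, p)))\<^sup>2"
          using norm_diff_sq_le[of "a (r m) (N, p) - l (N, p)" "a (r n) (N, p) - l (N, p)"] by simp
        from divide_right_mono[OF this, of "measure lborel (cell N p)"]
        show "(norm (\<integral>x. indicator (cell N p) x *\<^sub>R ?g f x \<partial>lborel))\<^sup>2 / measure lborel (cell N p)
          \<le> 2 * ((norm (a (r m) (N, p) - l (N, p)))\<^sup>2 / measure lborel (cell N p))
          + 2 * ((norm (a (r n) (N, p) - l (N, p)))\<^sup>2 / measure lborel (cell N p))"
          unfolding ag by (simp add: add_divide_distrib)
      qed simp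
      also have "\<dots> = 2 * s m + 2 * s n + 64 * C / (real N)\<^sup>2"
        by (simp add: s_def sum.distrib sum_distrib_left)
      also have "\<dots> \<le> e" using M[OF mn(1)] M[OF mn(2)] small by linarith
      finally show ?thesis by simp
    qed
    then show ?thesis by blast
  qed
  with r(1) show ?thesis by (intro exI[of _ r]) simp
qed

section \<open>Existence of minimizers\<close>

definition mem :: "real \<Rightarrow> (2 \<Rightarrow> real^2 \<Rightarrow> 'b::euclidean_space) \<Rightarrow> ennreal" where
  "mem \<Delta> Y = (\<integral>\<^sup>+x. indicator (disc 1) x * ennreal ((norm (gram Y x - coneg \<Delta> x))\<^sup>2) \<partial>lborel)"

definition hnorm :: "(2 \<Rightarrow> 2 \<Rightarrow> real^2 \<Rightarrow> 'b::euclidean_space) \<Rightarrow> real" where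
  "hnorm H = sqn (H 1 1) + sqn (H 1 2) + sqn (H 2 1) + sqn (H 2 2)"

lemma mem_measurable:
  assumes "\<And>i. Y i \<in> cL2"
  shows "(\<lambda>x. indicator (disc 1) x * ennreal ((norm (gram Y x - coneg \<Delta> x))\<^sup>2)) \<in> borel_measurable borel"
proof -
  have [measurable]: "gram Y \<in> borel_measurable borel"
    by (rule gram_borel) (rule L2_borel[OF cL2_L2[OF assms]])
  have "(\<lambda>x. ennreal ((norm (gram Y x - coneg \<Delta> x))\<^sup>2)) \<in> borel_measurable borel" by measurable
  then show ?thesis by (intro borel_measurable_times_ennreal borel_measurable_indicator) auto
qed

lemma hsq_integrable:
  assumes "\<And>i j. H i j \<in> cL2"
  shows "integrable lborel (hsq H)" "integral\<^sup>L lborel (hsq H) = hnorm H"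
proof -
  note i = L2_integrable[OF cL2_L2[OF assms]]
  show "integrable lborel (hsq H)" unfolding hsq_def[abs_def] by (intro Bochner_Integration.integrable_add i)
  show "integral\<^sup>L lborel (hsq H) = hnorm H"
    unfolding hsq_def[abs_def] hnorm_def sqn_def using i by simp
qed

lemma hsq_nonneg: "0 \<le> hsq H x"
  by (simp add: hsq_def)

lemma hsq_outside: "(\<And>i j. H i j \<in> cL2) \<Longrightarrow> x \<notin> disc 1 \<Longrightarrow> hsq H x = 0"
  by (simp add: hsq_def cL2_def)

lemma hnorm_nonneg: "0 \<le> hnorm H"
  by (simp add: hnorm_def)

lemma sqn_le_hnorm: "sqn (H i j) \<le> hnorm H"
  using exhaust_2[of i] exhaust_2[of j] by (auto simp: hnorm_def)

lemma wenergy_split: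
  assumes "\<And>i. Y i \<in> cL2" "\<And>i j. H i j \<in> cL2"
  shows "wenergy h \<Delta> Y H = mem \<Delta> Y + ennreal (h\<^sup>2 * hnorm H)"
proof -
  have "wenergy h \<Delta> Y H = (\<integral>\<^sup>+x. indicator (disc 1) x * ennreal ((norm (gram Y x - coneg \<Delta> x))\<^sup>2) + ennreal (h\<^sup>2 * hsq H x) \<partial>lborel)"
    unfolding wenergy_def
  proof (rule nn_integral_cong)
    fix x :: "real^2"
    have "0 \<le> h\<^sup>2 * hsq H x" by (simp add: hsq_nonneg)
    then show "indicator (disc 1) x * ennreal ((norm (gram Y x - coneg \<Delta> x))\<^sup>2 + h\<^sup>2 * hsq H x)
      = indicator (disc 1) x * ennreal ((norm (gram Y x - coneg \<Delta> x))\<^sup>2) + ennreal (h\<^sup>2 * hsq H x)"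
      using hsq_outside[OF assms(2), of x] by (cases "x \<in> disc 1") simp_all
  qed
  also have "\<dots> = mem \<Delta> Y + (\<integral>\<^sup>+x. ennreal (h\<^sup>2 * hsq H x) \<partial>lborel)"
    unfolding mem_def using mem_measurable[OF assms(1)] borel_measurable_integrable[OF hsq_integrable(1)[OF assms(2)]]
    by (subst nn_integral_add) auto
  also have "(\<integral>\<^sup>+x. ennreal (h\<^sup>2 * hsq H x) \<partial>lborel) = ennreal (h\<^sup>2 * hnorm H)"
    using nn_integral_eq_integral[OF integrable_mult_right[OF hsq_integrable(1)[OF assms(2)]], of "h\<^sup>2"]
    by (simp add: hsq_nonneg hsq_integrable(2)[OF assms(2)])
  finally show ?thesis .
qed

text \<open>Diagonal entries of the metric are squares of derivatives, and the diagonal of the cone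
  metric is at most 1. Hence the membrane term, quartic in the gradient, bounds the gradient in mean
  square.\<close>

lemma gradient_bound:
  assumes Y: "\<And>i. Y i \<in> cL2" and B: "0 \<le> B" "mem \<Delta> Y \<le> ennreal B"
  shows "sqn (Y i) \<le> 2 * measure lborel (disc 1 :: (real^2) set) + B"
proof -
  have fin: "emeasure lborel (disc 1 :: (real^2) set) < \<infinity>" using emeasure_bounded_finite[of "disc 1 :: (real^2) set"] by simp
  have e: "emeasure lborel (disc 1 :: (real^2) set) = ennreal (measure lborel (disc 1 :: (real^2) set))"
    using fin by (intro emeasure_eq_ennreal_measure) auto
  have "ennreal (sqn (Y i)) = (\<integral>\<^sup>+x. ennreal ((norm (Y i x))\<^sup>2) \<partial>lborel)"
    by (rule L2_nn_integral[symmetric]) (rule cL2_L2[OF Y])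
  also have "\<dots> \<le> (\<integral>\<^sup>+x. 2 * indicator (disc 1) x + indicator (disc 1) x * ennreal ((norm (gram Y x - coneg \<Delta> x))\<^sup>2) \<partial>lborel)"
  proof (rule nn_integral_mono)
    fix x :: "real^2"
    define M where "M = gram Y x - coneg \<Delta> x"
    show "ennreal ((norm (Y i x))\<^sup>2) \<le> 2 * indicator (disc 1) x + indicator (disc 1) x * ennreal ((norm (gram Y x - coneg \<Delta> x))\<^sup>2)"
    proof (cases "x \<in> disc 1")
      case True
      have "(norm (Y i x))\<^sup>2 = M $ i $ i + coneg \<Delta> x $ i $ i" by (simp add: M_def gram_def power2_norm_eq_inner)
      moreover have "coneg \<Delta> x $ i $ i \<le> 1" by (simp add: coneg_def)
      moreover have "M $ i $ i \<le> norm M" using abs_entry_le[of M i i] by linarith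
      moreover have "norm M \<le> 1 + (norm M)\<^sup>2"
      proof -
        have "0 \<le> (norm M - 1)\<^sup>2" by simp
        then show ?thesis unfolding power2_diff power_one using norm_ge_zero[of M] by linarith
      qed
      ultimately have "(norm (Y i x))\<^sup>2 \<le> 2 + (norm M)\<^sup>2" by linarith
      then have "ennreal ((norm (Y i x))\<^sup>2) \<le> ennreal (2 + (norm M)\<^sup>2)" by (rule ennreal_leI)
      then show ?thesis using True by (simp add: M_def)
    next
      case False
      then show ?thesis using Y[of i] by (simp add: cL2_def)
    qed
  qed
  also have "\<dots> = 2 * emeasure lborel (disc 1 :: (real^2) set) + mem \<Delta> Y"
  proof -
    have m2: "(\<lambda>x::real^2. 2 * indicator (disc 1) x :: ennreal) \<in> borel_measurable lborel"
      by (intro borel_measurable_times_ennreal borel_measurable_indicator borel_measurable_const) auto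
    have m3: "(\<lambda>x. indicator (disc 1) x * ennreal ((norm (gram Y x - coneg \<Delta> x))\<^sup>2)) \<in> borel_measurable lborel"
      using mem_measurable[of Y, OF Y] by simp
    show ?thesis
      unfolding mem_def nn_integral_add[OF m2 m3] by (subst nn_integral_cmult_indicator) auto
  qed
  also have "\<dots> \<le> 2 * ennreal (measure lborel (disc 1 :: (real^2) set)) + ennreal B"
    unfolding e by (intro add_left_mono B)
  also have "\<dots> = ennreal (2 * measure lborel (disc 1 :: (real^2) set) + B)"
    using B by (simp add: ennreal_mult)
  finally show ?thesis using B by (subst (asm) ennreal_le_iff) auto
qed

section \<open>Convexity, limits and compactness of triples\<close>

lemma weak_triple_lincomb:
  assumes "weak_triple y Y H" "weak_triple y' Y' H'"
  shows "weak_triple (\<lambda>x. a *\<^sub>R y x + b *\<^sub>R y' x) (\<lambda>i x. a *\<^sub>R Y i x + b *\<^sub>R Y' i x) (\<lambda>i j x. a *\<^sub>R H i j x + b *\<^sub>R H' i j x)"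
proof -
  note T = weak_tripleD[OF assms(1)] and T' = weak_tripleD[OF assms(2)]
  show ?thesis unfolding weak_triple_def
    by (intro conjI allI cL2_lincomb wderiv_lincomb axis_Basis2 T T')
qed

lemma weak_triple_limit:
  assumes T: "\<And>n. weak_triple (y n) (Y n) (H n)" and c: "y' \<in> cL2" "\<And>i. Y' i \<in> cL2" "\<And>i j. H' i j \<in> cL2"
    and lim: "(\<lambda>n. sqn (\<lambda>x. y n x - y' x)) \<longlonglongrightarrow> 0" "\<And>i. (\<lambda>n. sqn (\<lambda>x. Y n i x - Y' i x)) \<longlonglongrightarrow> 0"
      "\<And>i j. (\<lambda>n. sqn (\<lambda>x. H n i j x - H' i j x)) \<longlonglongrightarrow> 0"
  shows "weak_triple y' Y' H'"
proof -
  have t: "y n \<in> L2" "Y n i \<in> L2" "H n i j \<in> L2" for n i j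
    using weak_tripleD(1,2,3)[OF T[of n]] by (auto intro: cL2_L2)
  have "wderiv (disc 1) (axis i 1) y' (Y' i)" for i
    by (rule wderiv_limit[OF t(1) cL2_L2[OF c(1)] t(2) cL2_L2[OF c(2)] axis_Basis2 lim(1) lim(2) weak_tripleD(4)[OF T]])
  moreover have "wderiv (disc 1) (axis j 1) (Y' i) (H' i j)" for i j
    by (rule wderiv_limit[OF t(2) cL2_L2[OF c(2)] t(3) cL2_L2[OF c(3)] axis_Basis2 lim(2) lim(3) weak_tripleD(5)[OF T]])
  ultimately show ?thesis unfolding weak_triple_def using c by simp
qed

text \<open>The parallelogram identity; its negative defect term later forces almost minimal second
  derivatives to lie close to each other.\<close>

lemma sqn_midpoint:
  assumes f: "f \<in> L2" "g \<in> L2"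
  shows "sqn (\<lambda>x. (1/2) *\<^sub>R f x + (1/2) *\<^sub>R g x) = (sqn f + sqn g) / 2 - sqn (\<lambda>x. f x - g x) / 4"
proof -
  have "(norm ((1/2) *\<^sub>R f x + (1/2) *\<^sub>R g x))\<^sup>2 = 1/2 * (norm (f x))\<^sup>2 + 1/2 * (norm (g x))\<^sup>2 - 1/4 * (norm (f x - g x))\<^sup>2" for x
    unfolding power2_norm_eq_inner by (simp add: inner_add inner_diff inner_commute field_simps)
  then have "sqn (\<lambda>x. (1/2) *\<^sub>R f x + (1/2) *\<^sub>R g x) = (\<integral>x. 1/2 * (norm (f x))\<^sup>2 + 1/2 * (norm (g x))\<^sup>2 - 1/4 * (norm (f x - g x))\<^sup>2 \<partial>lborel)"
    unfolding sqn_def by simp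
  also have "\<dots> = 1/2 * sqn f + 1/2 * sqn g - 1/4 * sqn (\<lambda>x. f x - g x)"
    unfolding sqn_def using L2_integrable[OF f(1)] L2_integrable[OF f(2)] L2_integrable[OF L2_diff[OF f]] by simp
  finally show ?thesis by simp
qed

text \<open>Mean-square balls are convex, so that closeness to a given limit survives taking
  midpoints of triples.\<close>

lemma sqn_midpoint_le:
  assumes "f \<in> L2" "g \<in> L2" "l \<in> L2" "sqn (\<lambda>x. f x - l x) \<le> \<delta>" "sqn (\<lambda>x. g x - l x) \<le> \<delta>"
  shows "sqn (\<lambda>x. ((1/2) *\<^sub>R f x + (1/2) *\<^sub>R g x) - l x) \<le> \<delta>"
proof -
  have "((1/2) *\<^sub>R f x + (1/2) *\<^sub>R g x) - l x = (1/2) *\<^sub>R (f x - l x) + (1/2) *\<^sub>R (g x - l x)" for x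
  proof -
    have "(1/2) *\<^sub>R l x + (1/2) *\<^sub>R l x = l x" unfolding scaleR_add_left[symmetric] by simp
    then show ?thesis unfolding scaleR_diff_right by (metis (no_types, lifting) add_diff_add)
  qed
  then have eq: "sqn (\<lambda>x. ((1/2) *\<^sub>R f x + (1/2) *\<^sub>R g x) - l x) = sqn (\<lambda>x. (1/2) *\<^sub>R (f x - l x) + (1/2) *\<^sub>R (g x - l x))"
    by presburger
  have average: "X \<le> \<delta>" if X: "X = (A + B) / 2 - D / 4" and AB: "A \<le> \<delta>" "B \<le> \<delta>" and D: "0 \<le> D" for X A B D :: real
  proof -
    have "X \<le> (A + B) / 2" unfolding X using divide_nonneg_pos[OF D, of 4] by (simp only: diff_le_eq le_add_same_cancel1)
    also have "\<dots> \<le> (\<delta> + \<delta>) / 2" by (intro divide_right_mono add_mono AB) simp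
    finally show ?thesis by simp
  qed
  show ?thesis
    unfolding eq by (rule average[OF sqn_midpoint[OF L2_diff[OF assms(1,3)] L2_diff[OF assms(2,3)]] assms(4,5) sqn_nonneg])
qed

lemma hnorm_midpoint:
  assumes "\<And>i j. H i j \<in> cL2" "\<And>i j. H' i j \<in> cL2"
  shows "hnorm (\<lambda>i j x. (1/2) *\<^sub>R H i j x + (1/2) *\<^sub>R H' i j x) = (hnorm H + hnorm H') / 2 - hnorm (\<lambda>i j x. H i j x - H' i j x) / 4"
  unfolding hnorm_def sqn_midpoint[OF cL2_L2[OF assms(1)] cL2_L2[OF assms(2)]] by (simp add: field_simps)

lemma Rellich_limit:
  fixes f :: "nat \<Rightarrow> real^2 \<Rightarrow> 'b::euclidean_space"
  assumes f: "\<And>n. f n \<in> cL2" "\<And>n. f1 n \<in> cL2" "\<And>n. f2 n \<in> cL2"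
    and w: "\<And>n. wderiv (disc 1) (axis 1 1) (f n) (f1 n)" "\<And>n. wderiv (disc 1) (axis 2 1) (f n) (f2 n)"
    and C: "\<And>n. sqn (f n) \<le> C" "\<And>n. sqn (f1 n) \<le> C" "\<And>n. sqn (f2 n) \<le> C"
  shows "\<exists>r g. strict_mono r \<and> g \<in> cL2 \<and> (\<lambda>n. sqn (\<lambda>x. f (r n) x - g x)) \<longlonglongrightarrow> 0 \<and> (AE x in lborel. (\<lambda>n. f (r n) x) \<longlonglongrightarrow> g x)"
proof -
  obtain r where "strict_mono (r :: nat \<Rightarrow> nat) \<and> (\<forall>e>0. \<exists>M::nat. \<forall>m\<ge>M. \<forall>n\<ge>M. sqn (\<lambda>x. f (r m) x - f (r n) x) \<le> e)"
    using Rellich[of f f1 f2 C, OF f w C] by (elim exE)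
  then have r: "strict_mono r" and cau: "\<And>e. e > 0 \<Longrightarrow> \<exists>M. \<forall>m\<ge>M. \<forall>n\<ge>M. sqn (\<lambda>x. f (r m) x - f (r n) x) \<le> e" by auto
  show ?thesis
  proof (rule L2_complete[of "\<lambda>n. f (r n)", OF cL2_L2[OF f(1)] cau])
    fix g s
    assume g: "g \<in> L2" "strict_mono s" "AE x in lborel. (\<lambda>n. f (r (s n)) x) \<longlonglongrightarrow> g x"
      "(\<lambda>n. sqn (\<lambda>x. f (r n) x - g x)) \<longlonglongrightarrow> 0" "\<And>x. (\<forall>n. f (r n) x = 0) \<Longrightarrow> g x = 0"
    have "g \<in> cL2" using g(1,5) f(1) by (simp add: cL2_def)
    moreover have "(\<lambda>n. sqn (\<lambda>x. f (r (s n)) x - g x)) \<longlonglongrightarrow> 0"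
      using LIMSEQ_subseq_LIMSEQ[OF g(4,2)] by (simp add: o_def)
    moreover have "strict_mono (r \<circ> s)" by (rule strict_mono_o[OF r g(2)])
    ultimately show ?thesis using g(3) by (intro exI[of _ "r \<circ> s"] exI[of _ g]) simp
  qed
qed

text \<open>Rellich's theorem is used three times along nested subsequences: for \<open>y\<close>
  with the gradient as derivative, and for each \<open>Y i\<close> with the second derivatives.
  Nothing better than boundedness is available for the second derivatives themselves.\<close>

lemma weak_triple_compactness:
  fixes y :: "nat \<Rightarrow> real^2 \<Rightarrow> 'b::euclidean_space"
  assumes T: "\<And>n. weak_triple (y n) (Y n) (H n)"
    and C: "\<And>n. sqn (y n) \<le> C" "\<And>n i. sqn (Y n i) \<le> C" "\<And>n i j. sqn (H n i j) \<le> C"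
  shows "\<exists>r y' Y'. strict_mono r \<and> y' \<in> cL2 \<and> (\<forall>i. Y' i \<in> cL2) \<and> (\<lambda>n. sqn (\<lambda>x. y (r n) x - y' x)) \<longlonglongrightarrow> 0
    \<and> (\<forall>i. (\<lambda>n. sqn (\<lambda>x. Y (r n) i x - Y' i x)) \<longlonglongrightarrow> 0 \<and> (AE x in lborel. (\<lambda>n. Y (r n) i x) \<longlonglongrightarrow> Y' i x))"
proof -
  note t = weak_tripleD[OF T]
  obtain r0 y' where r0: "strict_mono r0 \<and> y' \<in> cL2 \<and> (\<lambda>n. sqn (\<lambda>x. y (r0 n) x - y' x)) \<longlonglongrightarrow> 0 \<and> (AE x in lborel. (\<lambda>n. y (r0 n) x) \<longlonglongrightarrow> y' x)"
    using Rellich_limit[of y "\<lambda>n. Y n 1" "\<lambda>n. Y n 2" C, OF t(1) t(2) t(2) t(4) t(4) C(1) C(2) C(2)] by (elim exE)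
  obtain r1 g1 where r1: "strict_mono r1 \<and> g1 \<in> cL2 \<and> (\<lambda>n. sqn (\<lambda>x. Y (r0 (r1 n)) 1 x - g1 x)) \<longlonglongrightarrow> 0 \<and> (AE x in lborel. (\<lambda>n. Y (r0 (r1 n)) 1 x) \<longlonglongrightarrow> g1 x)"
    using Rellich_limit[of "\<lambda>n. Y (r0 n) 1" "\<lambda>n. H (r0 n) 1 1" "\<lambda>n. H (r0 n) 1 2", OF t(2) t(3) t(3) t(5) t(5) C(2) C(3) C(3)] by (elim exE)
  obtain r2 g2 where r2: "strict_mono r2 \<and> g2 \<in> cL2 \<and> (\<lambda>n. sqn (\<lambda>x. Y (r0 (r1 (r2 n))) 2 x - g2 x)) \<longlonglongrightarrow> 0 \<and> (AE x in lborel. (\<lambda>n. Y (r0 (r1 (r2 n))) 2 x) \<longlonglongrightarrow> g2 x)"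
    using Rellich_limit[of "\<lambda>n. Y (r0 (r1 n)) 2" "\<lambda>n. H (r0 (r1 n)) 2 1" "\<lambda>n. H (r0 (r1 n)) 2 2", OF t(2) t(3) t(3) t(5) t(5) C(2) C(3) C(3)] by (elim exE)
  define Y' where "Y' i = (if i = 1 then g1 else g2)" for i :: 2
  have m12: "strict_mono (r1 \<circ> r2)" by (rule strict_mono_o) (use r1 r2 in auto)
  have m: "strict_mono (\<lambda>n. r0 (r1 (r2 n)))"
    using strict_mono_o[OF conjunct1[OF r0] m12] by (simp add: o_def)
  have y: "(\<lambda>n. sqn (\<lambda>x. y (r0 (r1 (r2 n))) x - y' x)) \<longlonglongrightarrow> 0"
    using LIMSEQ_subseq_LIMSEQ[OF conjunct1[OF conjunct2[OF conjunct2[OF r0]]] m12] by (simp add: o_def)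
  have 1: "(\<lambda>n. sqn (\<lambda>x. Y (r0 (r1 (r2 n))) 1 x - g1 x)) \<longlonglongrightarrow> 0"
    using LIMSEQ_subseq_LIMSEQ[OF conjunct1[OF conjunct2[OF conjunct2[OF r1]]] conjunct1[OF r2]] by (simp add: o_def)
  have "AE x in lborel. (\<lambda>n. Y (r0 (r1 n)) 1 x) \<longlonglongrightarrow> g1 x" using r1 by simp
  then have 2: "AE x in lborel. (\<lambda>n. Y (r0 (r1 (r2 n))) 1 x) \<longlonglongrightarrow> g1 x"
  proof eventually_elim
    case (elim x)
    show ?case using LIMSEQ_subseq_LIMSEQ[OF elim conjunct1[OF r2]] by (simp add: o_def)
  qed
  have "\<forall>i. (\<lambda>n. sqn (\<lambda>x. Y (r0 (r1 (r2 n))) i x - Y' i x)) \<longlonglongrightarrow> 0 \<and> (AE x in lborel. (\<lambda>n. Y (r0 (r1 (r2 n))) i x) \<longlonglongrightarrow> Y' i x)"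
    unfolding forall_2 Y'_def using 1 2 r2 by simp
  moreover have "\<forall>i. Y' i \<in> cL2" using r1 r2 by (simp add: Y'_def)
  ultimately show ?thesis using m y r0
    by (intro exI[of _ "\<lambda>n. r0 (r1 (r2 n))"] exI[of _ y'] exI[of _ Y'] conjI) simp_all
qed

text \<open>The density is not convex in the gradient, so weak convergence would not be enough; with
  gradients converging almost everywhere, Fatou's lemma applies to the nonnegative density.\<close>

lemma mem_lower_semicontinuous:
  assumes Y: "\<And>n i. Y n i \<in> cL2" and Y': "\<And>i. Y' i \<in> cL2" and lim: "\<And>i. AE x in lborel. (\<lambda>n. Y n i x) \<longlonglongrightarrow> Y' i x"
    and le: "\<forall>\<^sub>F n in sequentially. mem \<Delta> (Y n) \<le> c"
  shows "mem \<Delta> Y' \<le> c"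
proof -
  let ?u = "\<lambda>Y x. indicator (disc 1) x * ennreal ((norm (gram Y x - coneg \<Delta> x))\<^sup>2)"
  have "AE x in lborel. (\<lambda>n. Y n 1 x) \<longlonglongrightarrow> Y' 1 x \<and> (\<lambda>n. Y n 2 x) \<longlonglongrightarrow> Y' 2 x"
    using lim[of 1] lim[of 2] by eventually_elim simp
  then have "AE x in lborel. ?u Y' x \<le> liminf (\<lambda>n. ?u (Y n) x)"
  proof eventually_elim
    case (elim x)
    then have c: "(\<lambda>n. Y n i x) \<longlonglongrightarrow> Y' i x" for i using exhaust_2[of i] by auto
    have "(\<lambda>n. gram (Y n) x) \<longlonglongrightarrow> gram Y' x"
      unfolding gram_def by (intro tendsto_vec_lambda tendsto_inner c)
    then have "(\<lambda>n. ennreal ((norm (gram (Y n) x - coneg \<Delta> x))\<^sup>2)) \<longlonglongrightarrow> ennreal ((norm (gram Y' x - coneg \<Delta> x))\<^sup>2)"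
      by (intro tendsto_intros tendsto_ennrealI)
    then have "(\<lambda>n. ?u (Y n) x) \<longlonglongrightarrow> ?u Y' x" by (cases "x \<in> disc 1") simp_all
    then have "liminf (\<lambda>n. ?u (Y n) x) = ?u Y' x" by (rule lim_imp_Liminf[OF sequentially_bot])
    then show ?case by simp
  qed
  then have "mem \<Delta> Y' \<le> (\<integral>\<^sup>+x. liminf (\<lambda>n. ?u (Y n) x) \<partial>lborel)"
    unfolding mem_def by (rule nn_integral_mono_AE)
  also have "\<dots> \<le> liminf (\<lambda>n. mem \<Delta> (Y n))"
    unfolding mem_def by (rule nn_integral_liminf) (use mem_measurable[OF Y] in simp)
  also have "\<dots> \<le> liminf (\<lambda>n::nat. c)" by (rule Liminf_mono[OF le])
  also have "\<dots> = c" by (simp add: Liminf_const)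
  finally show ?thesis .
qed

text \<open>Subtracting a constant from \<open>y\<close> does not change the energy.\<close>

lemma weak_triple_normalize:
  fixes y :: "real^2 \<Rightarrow> 'b::euclidean_space"
  assumes w: "weak_triple y Y H"
  shows "\<exists>y'. weak_triple y' Y H \<and> sqn y' \<le> 8 * (sqn (Y 1) + sqn (Y 2))"
proof -
  define m where "m = measure lborel (disc 1 :: (real^2) set)"
  have fin: "emeasure lborel (disc 1 :: (real^2) set) < \<infinity>" using emeasure_bounded_finite[of "disc 1 :: (real^2) set"] by simp
  have m: "0 < m" unfolding m_def by (simp add: content_ball_pos)
  define c where "c = (1 / m) *\<^sub>R integral\<^sup>L lborel y"
  define y' where "y' x = 1 *\<^sub>R y x + (-1) *\<^sub>R (indicator (disc 1) x *\<^sub>R c)" for x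
  have "weak_triple (\<lambda>x. indicator (disc 1) x *\<^sub>R c) (\<lambda>i x. indicator (disc 1) x *\<^sub>R 0) (\<lambda>i j x. indicator (disc 1) x *\<^sub>R (0::'b))"
    by (rule weak_triple_classical[where y="\<lambda>x. c" and y'="\<lambda>x v. 0" and Y'="\<lambda>i x v. 0" and Y="\<lambda>i x. 0" and H="\<lambda>i j x. 0"])
      (auto intro: has_derivative_const)
  from weak_triple_lincomb[OF w this, of 1 "-1"]
  have w': "weak_triple y' Y H" unfolding y'_def[abs_def] by simp
  note T = weak_tripleD[OF w']
  have ii: "integrable lborel (\<lambda>x::real^2. indicator (disc 1) x *\<^sub>R c)"
    using fin by (intro integrable_scaleR_left integrable_real_indicator) auto
  have "(\<integral>x. indicator (disc 1) x *\<^sub>R y' x \<partial>lborel) = (\<integral>x. y x - indicator (disc 1) x *\<^sub>R c \<partial>lborel)"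
  proof (rule Bochner_Integration.integral_cong[OF refl])
    show "indicator (disc 1) x *\<^sub>R y' x = y x - indicator (disc 1) x *\<^sub>R c" for x
      using weak_tripleD(1)[OF w] by (cases "x \<in> disc 1") (auto simp: y'_def cL2_def)
  qed
  also have "\<dots> = integral\<^sup>L lborel y - m *\<^sub>R c"
    using cL2_integrable[OF weak_tripleD(1)[OF w]] ii fin by (simp add: m_def)
  also have "\<dots> = 0" using m by (simp add: c_def)
  finally have z: "(\<integral>x. indicator (disc 1) x *\<^sub>R y' x \<partial>lborel) = 0" .
  have W: "(\<integral>x. indicator (disc 1) x * (norm (g x))\<^sup>2 \<partial>lborel) = sqn g" if "g \<in> cL2" for g :: "real^2 \<Rightarrow> 'b"
    unfolding sqn_def
  proof (rule Bochner_Integration.integral_cong[OF refl])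
    show "indicator (disc 1) x * (norm (g x))\<^sup>2 = (norm (g x))\<^sup>2" for x
      using that by (cases "x \<in> disc 1") (auto simp: cL2_def)
  qed
  have d: "norm (x - z) \<le> 2" if "x \<in> disc 1" "z \<in> disc 1" for x z :: "real^2"
    using norm_triangle_ineq4[of x z] that by simp
  have "m * sqn y' \<le> (norm (0::'b))\<^sup>2 + 2 * 2\<^sup>2 * m * (sqn (Y 1) + sqn (Y 2))"
    using Poincare[OF T(1) T(2) T(2) T(4) T(4) _ convex_ball subset_refl d] unfolding z W[OF T(1)] W[OF T(2)] m_def[symmetric] by simp
  then have "m * sqn y' \<le> m * (8 * (sqn (Y 1) + sqn (Y 2)))" by (simp add: algebra_simps)
  then have "sqn y' \<le> 8 * (sqn (Y 1) + sqn (Y 2))" using m by (simp only: mult_le_cancel_left_pos)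
  then show ?thesis using w' by blast
qed

text \<open>The infimum is extracted as a real number \<open>E\<close>, finite thanks to the given
  competitor, because the existence proof subtracts bending energies from total energies and this
  has no good meaning in \<open>ennreal\<close>.\<close>

lemma minimizing_sequence:
  assumes T: "weak_triple y0 (Y0 :: 2 \<Rightarrow> real^2 \<Rightarrow> 'b::euclidean_space) H0" and fin: "wenergy h \<Delta> Y0 H0 < \<infinity>"
  shows "\<exists>E y Y H. 0 \<le> E \<and> (\<forall>n::nat. weak_triple (y n) (Y n :: 2 \<Rightarrow> real^2 \<Rightarrow> 'b) (H n) \<and> wenergy h \<Delta> (Y n) (H n) \<le> ennreal (E + 1 / (real n + 1)))
    \<and> (\<forall>y (Y :: 2 \<Rightarrow> real^2 \<Rightarrow> 'b) H. weak_triple y Y H \<longrightarrow> ennreal E \<le> wenergy h \<Delta> Y H)"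
proof -
  let ?P = "\<lambda>t :: (real^2 \<Rightarrow> 'b) \<times> (2 \<Rightarrow> real^2 \<Rightarrow> 'b) \<times> (2 \<Rightarrow> 2 \<Rightarrow> real^2 \<Rightarrow> 'b). weak_triple (fst t) (fst (snd t)) (snd (snd t))"
  let ?e = "\<lambda>t :: (real^2 \<Rightarrow> 'b) \<times> (2 \<Rightarrow> real^2 \<Rightarrow> 'b) \<times> (2 \<Rightarrow> 2 \<Rightarrow> real^2 \<Rightarrow> 'b). wenergy h \<Delta> (fst (snd t)) (snd (snd t))"
  define I where "I = Inf (?e ` {t. ?P t})"
  have low: "I \<le> ?e t" if "?P t" for t
    unfolding I_def by (rule Inf_lower) (use that in simp)
  have "I < \<infinity>" using low[of "(y0, Y0, H0)"] T fin by (simp add: order_le_less_trans)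
  then have I: "I = ennreal (enn2real I)" by simp
  have "\<exists>t. ?P t \<and> ?e t < ennreal (enn2real I + 1 / (real n + 1))" for n
  proof -
    have "I < ennreal (enn2real I + 1 / (real n + 1))"
      by (subst I, subst ennreal_less_iff) auto
    then show ?thesis unfolding I_def Inf_less_iff by auto
  qed
  then have "\<forall>n. \<exists>t. ?P t \<and> ?e t < ennreal (enn2real I + 1 / (real n + 1))" by blast
  from choice[OF this] obtain t where t: "\<forall>n. ?P (t n) \<and> ?e (t n) < ennreal (enn2real I + 1 / (real n + 1))" by (elim exE)
  have "\<forall>y (Y :: 2 \<Rightarrow> real^2 \<Rightarrow> 'b) H. weak_triple y Y H \<longrightarrow> ennreal (enn2real I) \<le> wenergy h \<Delta> Y H"
  proof (intro allI impI)
    fix y and Y :: "2 \<Rightarrow> real^2 \<Rightarrow> 'b" and H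
    assume "weak_triple y Y H"
    then show "ennreal (enn2real I) \<le> wenergy h \<Delta> Y H" using low[of "(y, Y, H)"] I by simp
  qed
  then show ?thesis
    using t by (intro exI[of _ "enn2real I"] exI[of _ "\<lambda>n. fst (t n)"] exI[of _ "\<lambda>n. fst (snd (t n))"] exI[of _ "\<lambda>n. snd (snd (t n))"])
      (auto intro: less_imp_le)
qed

text \<open>
  The gradients of a minimizing sequence converge strongly, but the second derivatives only weakly.
  Instead of the weak limit we use minimizers \<open>z k\<close> of the second derivative term in the convex sets
  of triples whose lower order part is \<open>1 / (k + 1)\<close>-close to the limit. They form a Cauchy sequence by
  the parallelogram identity.
\<close>

lemma minimizer_exists:
  assumes T0: "weak_triple y0 (Y0 :: 2 \<Rightarrow> real^2 \<Rightarrow> 'b::euclidean_space) H0" and fin: "wenergy h \<Delta> Y0 H0 < \<infinity>" and h: "h > 0"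
  shows "\<exists>y (Y :: 2 \<Rightarrow> real^2 \<Rightarrow> 'b) H. weak_triple y Y H \<and>
    (\<forall>y' (Y' :: 2 \<Rightarrow> real^2 \<Rightarrow> 'b) H'. weak_triple y' Y' H' \<longrightarrow> wenergy h \<Delta> Y H \<le> wenergy h \<Delta> Y' H')"
proof -
  obtain E and y1 and Y1 :: "nat \<Rightarrow> 2 \<Rightarrow> real^2 \<Rightarrow> 'b" and H1 where E: "0 \<le> E \<and> (\<forall>n::nat. weak_triple (y1 n) (Y1 n) (H1 n) \<and> wenergy h \<Delta> (Y1 n) (H1 n) \<le> ennreal (E + 1 / (real n + 1)))
    \<and> (\<forall>y (Y :: 2 \<Rightarrow> real^2 \<Rightarrow> 'b) H. weak_triple y Y H \<longrightarrow> ennreal E \<le> wenergy h \<Delta> Y H)"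
    using minimizing_sequence[OF T0 fin] by (elim exE)
  then have E0: "0 \<le> E" and E1: "weak_triple (y1 n) (Y1 n) (H1 n)" "wenergy h \<Delta> (Y1 n) (H1 n) \<le> ennreal (E + 1 / (real n + 1))"
    and E2: "weak_triple y Y H \<Longrightarrow> ennreal E \<le> wenergy h \<Delta> Y H" for n y and Y :: "2 \<Rightarrow> real^2 \<Rightarrow> 'b" and H by blast+
  have "\<forall>n. \<exists>y'. weak_triple y' (Y1 n) (H1 n) \<and> sqn y' \<le> 8 * (sqn (Y1 n 1) + sqn (Y1 n 2))"
    by (intro allI weak_triple_normalize[OF E1(1)])
  from choice[OF this] obtain y2 where y2: "\<forall>n. weak_triple (y2 n) (Y1 n) (H1 n) \<and> sqn (y2 n) \<le> 8 * (sqn (Y1 n 1) + sqn (Y1 n 2))" by (elim exE)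
  have T1: "weak_triple (y2 n) (Y1 n) (H1 n)" for n using y2 by simp
  note t1 = weak_tripleD[OF T1]
  have en: "mem \<Delta> (Y1 n) + ennreal (h\<^sup>2 * hnorm (H1 n)) \<le> ennreal (E + 1 / (real n + 1))" for n
    using E1(2)[of n] unfolding wenergy_split[of "Y1 n" "H1 n" h \<Delta>, OF t1(2) t1(3)] .
  have one: "1 / (real n + 1) \<le> 1" for n by simp
  have le1: "ennreal (E + 1 / (real n + 1)) \<le> ennreal (E + 1)" for n by (intro ennreal_leI add_left_mono one)
  have hb: "hnorm (H1 n) \<le> (E + 1) / h\<^sup>2" for n
  proof -
    have "ennreal (h\<^sup>2 * hnorm (H1 n)) \<le> ennreal (E + 1)"
      using order_trans[OF order_trans[OF _ en[of n]] le1[of n], of "ennreal (h\<^sup>2 * hnorm (H1 n))"] by simp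
    then have "h\<^sup>2 * hnorm (H1 n) \<le> E + 1" using E0 by (subst (asm) ennreal_le_iff) auto
    then show ?thesis using h by (simp add: field_simps)
  qed
  have mb: "mem \<Delta> (Y1 n) \<le> ennreal (E + 1)" for n
    using order_trans[OF order_trans[OF _ en[of n]] le1[of n], of "mem \<Delta> (Y1 n)"] by simp
  define B where "B = 2 * measure lborel (disc 1 :: (real^2) set) + (E + 1)"
  have B0: "0 \<le> B" using E0 by (simp add: B_def)
  have gb: "sqn (Y1 n i) \<le> B" for n i
    unfolding B_def by (rule gradient_bound[of "Y1 n", OF t1(2) _ mb]) (use E0 in simp)
  \<comment> \<open>A common bound: \<open>16 * B\<close> covers the normalized functions, whose
    squared norm is at most \<open>8 * (B + B)\<close>, and the second summand covers the second
    derivatives.\<close>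
  define C where "C = 16 * B + (E + 1) / h\<^sup>2"
  have q0: "0 \<le> (E + 1) / h\<^sup>2" using E0 by simp
  have C: "sqn (y2 n) \<le> C" "sqn (Y1 n i) \<le> C" "sqn (H1 n i j) \<le> C" for n i j
  proof -
    have "sqn (y2 n) \<le> 8 * (sqn (Y1 n 1) + sqn (Y1 n 2))" using y2 by simp
    also have "\<dots> \<le> 8 * (B + B)" by (intro mult_left_mono add_mono gb) simp
    also have "\<dots> \<le> C" using q0 by (simp add: C_def)
    finally show "sqn (y2 n) \<le> C" .
    show "sqn (Y1 n i) \<le> C" using gb[of n i] B0 q0 unfolding C_def by linarith
    show "sqn (H1 n i j) \<le> C" using sqn_le_hnorm[of "H1 n" i j] hb[of n] B0 unfolding C_def by linarith
  qed
  obtain r y' Y' where R: "strict_mono r \<and> y' \<in> cL2 \<and> (\<forall>i. Y' i \<in> cL2) \<and> (\<lambda>n. sqn (\<lambda>x. y2 (r n) x - y' x)) \<longlonglongrightarrow> 0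
    \<and> (\<forall>i. (\<lambda>n. sqn (\<lambda>x. Y1 (r n) i x - Y' i x)) \<longlonglongrightarrow> 0 \<and> (AE x in lborel. (\<lambda>n. Y1 (r n) i x) \<longlonglongrightarrow> Y' i x))"
    using weak_triple_compactness[of y2 Y1 H1 C, OF T1 C] by (elim exE)
  define S where "S k = {t. weak_triple (fst t) (fst (snd t)) (snd (snd t)) \<and> sqn (\<lambda>x. fst t x - y' x) \<le> 1 / (real k + 1)
    \<and> (\<forall>i. sqn (\<lambda>x. fst (snd t) i x - Y' i x) \<le> 1 / (real k + 1))}" for k :: nat
  define J where "J t = hnorm (snd (snd t))" for t :: "(real^2 \<Rightarrow> 'b) \<times> (2 \<Rightarrow> real^2 \<Rightarrow> 'b) \<times> (2 \<Rightarrow> 2 \<Rightarrow> real^2 \<Rightarrow> 'b)"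
  have J0: "0 \<le> J t" for t by (simp add: J_def hnorm_nonneg)
  define t where "t n = (y2 (r n), Y1 (r n), H1 (r n))" for n
  have tS: "\<forall>\<^sub>F n in sequentially. t n \<in> S k" for k
  proof -
    have p: "0 < 1 / (real k + 1)" by simp
    have "\<forall>\<^sub>F n in sequentially. sqn (\<lambda>x. y2 (r n) x - y' x) < 1 / (real k + 1)"
      by (rule order_tendstoD(2)[OF _ p]) (use R in simp)
    moreover have "\<forall>\<^sub>F n in sequentially. sqn (\<lambda>x. Y1 (r n) i x - Y' i x) < 1 / (real k + 1)" for i
      by (rule order_tendstoD(2)[OF _ p]) (use R in simp)
    note this[of 1] this[of 2]
    ultimately show ?thesis
      by eventually_elim (simp add: S_def t_def T1 forall_2 less_imp_le)
  qed
  have bdd: "bdd_below (J ` S k)" for k by (rule bdd_belowI[of _ 0]) (use J0 in auto)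
  \<comment> \<open>The sets \<open>S k\<close> shrink, so \<open>d\<close> increases to a limit
    \<open>D\<close>: the least bending energy, in the limit, among triples whose lower order part
    approaches \<open>y'\<close> and \<open>Y'\<close>. It plays the role of the weak lower
    limit.\<close>
  define d where "d k = Inf (J ` S k)" for k
  have d_le: "d k \<le> J u" if "u \<in> S k" for k u
    unfolding d_def by (rule cInf_lower[OF imageI[OF that] bdd])
  have Jt: "J (t n) \<le> (E + 1) / h\<^sup>2" for n using hb by (simp add: J_def t_def)
  have S_ne: "\<exists>n. t n \<in> S k" for k
    using eventually_happens'[OF sequentially_bot tS[of k]] .
  have d_bound: "d k \<le> (E + 1) / h\<^sup>2" for k
  proof -
    obtain n where "t n \<in> S k" using S_ne[of k] by (elim exE)
    from order_trans[OF d_le[OF this] Jt] show ?thesis .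
  qed
  have S_mono: "S k \<subseteq> S l" if "l \<le> k" for k l
  proof -
    have "1 / (real k + 1) \<le> 1 / (real l + 1)" using that by (intro divide_left_mono) auto
    then show ?thesis unfolding S_def using order_trans by fastforce
  qed
  have "incseq d"
    unfolding incseq_def d_def
  proof (intro allI impI)
    fix l k :: nat assume "l \<le> k"
    show "Inf (J ` S l) \<le> Inf (J ` S k)"
      by (rule cInf_superset_mono[OF _ bdd image_mono[OF S_mono[OF \<open>l \<le> k\<close>]]]) (use S_ne[of k] in auto)
  qed
  then obtain D where D: "d \<longlonglongrightarrow> D" "\<And>k. d k \<le> D"
    using incseq_convergent[OF _ allI[of "\<lambda>k. d k \<le> (E + 1) / h\<^sup>2", OF d_bound]] by auto
  have "\<exists>z. z \<in> S k \<and> J z < d k + 1 / (real k + 1)" for k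
  proof -
    have ne: "J ` S k \<noteq> {}" using S_ne[of k] by auto
    have "Inf (J ` S k) < d k + 1 / (real k + 1)" unfolding d_def by simp
    then show ?thesis unfolding cInf_less_iff[OF ne bdd] by auto
  qed
  then have "\<forall>k. \<exists>z. z \<in> S k \<and> J z < d k + 1 / (real k + 1)" by blast
  from choice[OF this] obtain z where z: "\<forall>k. z k \<in> S k \<and> J (z k) < d k + 1 / (real k + 1)" by (elim exE)
  define H2 where "H2 k = snd (snd (z k))" for k
  have zT: "weak_triple (fst (z k)) (fst (snd (z k))) (H2 k)" and zy: "sqn (\<lambda>x. fst (z k) x - y' x) \<le> 1 / (real k + 1)"
    and zY: "sqn (\<lambda>x. fst (snd (z k)) i x - Y' i x) \<le> 1 / (real k + 1)" for k i
    using z unfolding S_def H2_def by auto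
  have zJ: "hnorm (H2 k) \<le> D + 1 / (real k + 1)" for k
    using z D(2)[of k] unfolding H2_def J_def by (meson add_right_mono less_imp_le order_trans)
  note zt = weak_tripleD[OF zT]
  have y'c: "y' \<in> cL2" and Y'c: "Y' i \<in> cL2" for i using R by auto
  have mid: "d k \<le> (hnorm (H2 m) + hnorm (H2 n)) / 2 - hnorm (\<lambda>i j x. H2 m i j x - H2 n i j x) / 4" if "k \<le> m" "k \<le> n" for k m n
  proof -
    have k: "1 / (real l + 1) \<le> 1 / (real k + 1)" if "k \<le> l" for l using that by (intro divide_left_mono) auto
    have y: "sqn (\<lambda>x. ((1/2) *\<^sub>R fst (z m) x + (1/2) *\<^sub>R fst (z n) x) - y' x) \<le> 1 / (real k + 1)"
      by (rule sqn_midpoint_le[OF cL2_L2[OF zt(1)] cL2_L2[OF zt(1)] cL2_L2[OF y'c] order_trans[OF zy k] order_trans[OF zy k]]) (rule that)+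
    have Y: "sqn (\<lambda>x. ((1/2) *\<^sub>R fst (snd (z m)) i x + (1/2) *\<^sub>R fst (snd (z n)) i x) - Y' i x) \<le> 1 / (real k + 1)" for i
      by (rule sqn_midpoint_le[OF cL2_L2[OF zt(2)] cL2_L2[OF zt(2)] cL2_L2[OF Y'c] order_trans[OF zY k] order_trans[OF zY k]]) (rule that)+
    have "(\<lambda>x. (1/2) *\<^sub>R fst (z m) x + (1/2) *\<^sub>R fst (z n) x, \<lambda>i x. (1/2) *\<^sub>R fst (snd (z m)) i x + (1/2) *\<^sub>R fst (snd (z n)) i x,
        \<lambda>i j x. (1/2) *\<^sub>R H2 m i j x + (1/2) *\<^sub>R H2 n i j x) \<in> S k"
      unfolding S_def using weak_triple_lincomb[OF zT[of m] zT[of n], of "1/2" "1/2"] y Y by simp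
    from d_le[OF this] have "d k \<le> hnorm (\<lambda>i j x. (1/2) *\<^sub>R H2 m i j x + (1/2) *\<^sub>R H2 n i j x)" by (simp only: J_def snd_conv)
    then show ?thesis unfolding hnorm_midpoint[of "H2 m" "H2 n", OF zt(3) zt(3)] .
  qed
  have lim1: "(\<lambda>k. 1 / (real k + 1)) \<longlonglongrightarrow> 0" by real_asymp
  \<comment> \<open>For members of index at least \<open>k\<close> the parallelogram identity bounds
    the distance by four times the excess \<open>D + 1 / (k + 1) - d k\<close>. Two errors below
    \<open>e / 8\<close> make this smaller than \<open>e\<close>.\<close>
  have cauchy: "\<exists>N. \<forall>m\<ge>N. \<forall>n\<ge>N. sqn (\<lambda>x. H2 m i j x - H2 n i j x) \<le> e" if e: "e > 0" for e i j
  proof -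
    have "\<forall>\<^sub>F k in sequentially. 1 / (real k + 1) < e / 8" by (rule order_tendstoD(2)[OF lim1]) (use e in simp)
    moreover have "\<forall>\<^sub>F k in sequentially. D - e / 8 < d k" by (rule order_tendstoD(1)[OF D(1)]) (use e in simp)
    ultimately have "\<forall>\<^sub>F k in sequentially. 1 / (real k + 1) < e / 8 \<and> D - e / 8 < d k" by eventually_elim simp
    from eventually_happens'[OF sequentially_bot this] obtain k where k: "1 / (real k + 1) < e / 8" "D - e / 8 < d k" by auto
    have "sqn (\<lambda>x. H2 m i j x - H2 n i j x) \<le> e" if mn: "k \<le> m" "k \<le> n" for m n
    proof -
      have l: "1 / (real l + 1) \<le> 1 / (real k + 1)" if "k \<le> l" for l using that by (intro divide_left_mono) auto
      have "sqn (\<lambda>x. H2 m i j x - H2 n i j x) \<le> hnorm (\<lambda>i j x. H2 m i j x - H2 n i j x)"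
        by (rule sqn_le_hnorm[of "\<lambda>i j x. H2 m i j x - H2 n i j x"])
      also have "\<dots> \<le> e"
        using mid[OF mn, unfolded add_divide_distrib] zJ[of m] zJ[of n] l[OF mn(1)] l[OF mn(2)] k by linarith
      finally show ?thesis .
    qed
    then show ?thesis by blast
  qed
  have "\<exists>g. g \<in> cL2 \<and> (\<lambda>n. sqn (\<lambda>x. H2 n i j x - g x)) \<longlonglongrightarrow> 0" for i j
  proof (rule L2_complete[of "\<lambda>n. H2 n i j", OF cL2_L2[OF zt(3)] cauchy])
    fix g s
    assume g: "g \<in> L2" "(\<lambda>n. sqn (\<lambda>x. H2 n i j x - g x)) \<longlonglongrightarrow> 0" "\<And>x. (\<forall>n. H2 n i j x = 0) \<Longrightarrow> g x = 0"
    then have "g \<in> cL2" using zt(3) by (simp add: cL2_def)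
    then show ?thesis using g(2) by blast
  qed
  then have "\<forall>i. \<exists>G. \<forall>j. G j \<in> cL2 \<and> (\<lambda>n. sqn (\<lambda>x. H2 n i j x - G j x)) \<longlonglongrightarrow> 0" by (intro allI choice)
  from choice[OF this] obtain H' where H': "\<forall>i j. H' i j \<in> cL2 \<and> (\<lambda>n. sqn (\<lambda>x. H2 n i j x - H' i j x)) \<longlonglongrightarrow> 0" by (elim exE)
  then have H'c: "H' i j \<in> cL2" and H'l: "(\<lambda>n. sqn (\<lambda>x. H2 n i j x - H' i j x)) \<longlonglongrightarrow> 0" for i j by auto
  have yl: "(\<lambda>n. sqn (\<lambda>x. fst (z n) x - y' x)) \<longlonglongrightarrow> 0"
    by (rule tendsto_sandwich[OF _ _ tendsto_const lim1]) (use zy in simp_all)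
  have Yl: "(\<lambda>n. sqn (\<lambda>x. fst (snd (z n)) i x - Y' i x)) \<longlonglongrightarrow> 0" for i
    by (rule tendsto_sandwich[OF _ _ tendsto_const lim1]) (use zY in simp_all)
  have T': "weak_triple y' Y' H'"
    by (rule weak_triple_limit[OF zT y'c Y'c H'c yl Yl H'l])
  have HD: "hnorm H' \<le> D"
  proof -
    have "(\<lambda>n. sqn (H2 n i j)) \<longlonglongrightarrow> sqn (H' i j)" for i j
      using L2_tendsto_weighted[of "\<lambda>n. H2 n i j" "H' i j" "\<lambda>x. 1" 1, OF cL2_L2[OF zt(3)] cL2_L2[OF H'c] H'l] unfolding sqn_def by simp
    then have "(\<lambda>n. hnorm (H2 n)) \<longlonglongrightarrow> hnorm H'" unfolding hnorm_def by (intro tendsto_add)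
    moreover have "(\<lambda>n. D + 1 / (real n + 1)) \<longlonglongrightarrow> D + 0" by (intro tendsto_add tendsto_const lim1)
    ultimately show ?thesis using zJ LIMSEQ_le[of "\<lambda>n. hnorm (H2 n)" "hnorm H'" "\<lambda>n. D + 1 / (real n + 1)" "D + 0"] by simp
  qed
  have D0: "0 \<le> D" using HD hnorm_nonneg[of H'] by linarith
  \<comment> \<open>The minimizing sequence eventually lies in every \<open>S k\<close>, so its
    bending energy is at least \<open>d k\<close>, and the rest of its energy bounds its membrane
    term; this bound passes to \<open>Y'\<close> by Fatou's lemma. The limit \<open>H'\<close> comes
    from a different sequence, the \<open>z k\<close>, but belongs to the same gradient
    \<open>Y'\<close> and costs at most \<open>D\<close>, so the two bounds add up.\<close>
  have close: "wenergy h \<Delta> Y' H' \<le> ennreal E + ennreal e" if e: "e > 0" for e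
  proof -
    have "\<forall>\<^sub>F k in sequentially. D - e / (2 * h\<^sup>2) < d k" by (rule order_tendstoD(1)[OF D(1)]) (use e h in simp)
    from eventually_happens'[OF sequentially_bot this] obtain k where k: "D - e / (2 * h\<^sup>2) < d k" by auto
    have hk: "h\<^sup>2 * D - e / 2 \<le> h\<^sup>2 * d k" using k h by (simp add: field_simps)
    have "\<forall>\<^sub>F n in sequentially. 1 / (real n + 1) < e / 2" by (rule order_tendstoD(2)[OF lim1]) (use e in simp)
    \<comment> \<open>The sign of the right-hand side is recorded because \<open>ennreal\<close>
      truncates negative numbers to 0, and the two bounds can be added below only for nonnegative
      summands.\<close>
    then have ev: "\<forall>\<^sub>F n in sequentially. mem \<Delta> (Y1 (r n)) \<le> ennreal (E + e - h\<^sup>2 * D) \<and> 0 \<le> E + e - h\<^sup>2 * D"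
      using tS[of k]
    proof eventually_elim
      case (elim n)
      have "n \<le> r n" using R by (intro seq_suble) simp
      then have "1 / (real (r n) + 1) \<le> 1 / (real n + 1)" by (intro divide_left_mono) auto
      then have en': "mem \<Delta> (Y1 (r n)) + ennreal (h\<^sup>2 * hnorm (H1 (r n))) \<le> ennreal (E + e / 2)"
        using elim(1) by (intro order_trans[OF en] ennreal_leI) linarith
      have "d k \<le> hnorm (H1 (r n))" using d_le[OF elim(2)] by (simp add: J_def t_def)
      then have dk: "h\<^sup>2 * d k \<le> h\<^sup>2 * hnorm (H1 (r n))" by (intro mult_left_mono) auto
      have "mem \<Delta> (Y1 (r n)) < \<infinity>" using order_le_less_trans[OF mb[of "r n"]] by simp
      then have m: "mem \<Delta> (Y1 (r n)) = ennreal (enn2real (mem \<Delta> (Y1 (r n))))" by simp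
      have "ennreal (enn2real (mem \<Delta> (Y1 (r n))) + h\<^sup>2 * hnorm (H1 (r n))) \<le> ennreal (E + e / 2)"
        using en' m by (subst ennreal_plus) (auto simp: hnorm_nonneg)
      then have "enn2real (mem \<Delta> (Y1 (r n))) + h\<^sup>2 * hnorm (H1 (r n)) \<le> E + e / 2"
        using E0 e by (subst (asm) ennreal_le_iff) auto
      then have le: "enn2real (mem \<Delta> (Y1 (r n))) \<le> E + e - h\<^sup>2 * D" using dk hk by linarith
      have "0 \<le> enn2real (mem \<Delta> (Y1 (r n)))" by simp
      then have "0 \<le> E + e - h\<^sup>2 * D" using le by linarith
      then show ?case using ennreal_leI[OF le] m by simp
    qed
    have nonneg: "0 \<le> E + e - h\<^sup>2 * D" using eventually_happens'[OF sequentially_bot ev] by auto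
    have "mem \<Delta> Y' \<le> ennreal (E + e - h\<^sup>2 * D)"
      by (rule mem_lower_semicontinuous[of "\<lambda>n. Y1 (r n)", OF t1(2) Y'c]) (use R ev in \<open>auto elim: eventually_mono\<close>)
    moreover have "ennreal (h\<^sup>2 * hnorm H') \<le> ennreal (h\<^sup>2 * D)" by (intro ennreal_leI mult_left_mono HD) simp
    ultimately have "wenergy h \<Delta> Y' H' \<le> ennreal (E + e - h\<^sup>2 * D) + ennreal (h\<^sup>2 * D)"
      unfolding wenergy_split[of Y' H' h \<Delta>, OF Y'c H'c] by (rule add_mono)
    also have "\<dots> = ennreal (E + e)" using nonneg D0 by (subst ennreal_plus[symmetric]) auto
    also have "\<dots> = ennreal E + ennreal e" using E0 e by (subst ennreal_plus) auto
    finally show ?thesis .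
  qed
  have le: "wenergy h \<Delta> Y' H' \<le> ennreal E"
  proof (rule ennreal_le_epsilon)
    fix e :: real assume "0 < e"
    then show "wenergy h \<Delta> Y' H' \<le> ennreal E + ennreal e" by (rule close)
  qed
  show ?thesis
  proof (intro exI conjI allI impI)
    show "weak_triple y' Y' H'" by (rule T')
    fix y3 and Y3 :: "2 \<Rightarrow> real^2 \<Rightarrow> 'b" and H3 assume "weak_triple y3 Y3 H3"
    from order_trans[OF le E2[OF this]] show "wenergy h \<Delta> Y' H' \<le> wenergy h \<Delta> Y3 H3" .
  qed
qed

section \<open>Energy bounds\<close>

text \<open>Finite energy turns the extended integrals into real numbers. Afterwards the estimates
  of the theorem are linear arithmetic in the membrane energy \<open>m\<close>, the total bending
  \<open>hnorm H\<close> and the bending inside discs.\<close>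

lemma energy_estimates:
  fixes Y :: "2 \<Rightarrow> real^2 \<Rightarrow> 'b::euclidean_space"
  assumes w: "weak_triple y Y H" and fin: "wenergy h \<Delta> Y H < \<infinity>" and h: "0 < h" and \<Delta>: "0 \<le> \<Delta>" "\<Delta> \<le> 1"
  shows "\<exists>m\<ge>0. mem \<Delta> Y = ennreal m \<and> wenergy h \<Delta> Y H = ennreal (m + h\<^sup>2 * hnorm H) \<and>
    (\<forall>R. 0 < R \<and> R < 1 \<longrightarrow> 2 * pi * \<Delta>\<^sup>2 * (ln (R / h) - 1) - 98 * pi - m / (2 * h\<^sup>2) \<le> (\<integral>x. indicator (disc R) x * hsq H x \<partial>lborel))"
proof -
  note T = weak_tripleD[OF w]
  define m where "m = enn2real (mem \<Delta> Y)"
  have m0: "0 \<le> m" by (simp add: m_def)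
  have sp: "wenergy h \<Delta> Y H = mem \<Delta> Y + ennreal (h\<^sup>2 * hnorm H)" by (rule wenergy_split[of Y H, OF T(2) T(3)])
  have "mem \<Delta> Y \<le> wenergy h \<Delta> Y H" unfolding sp by simp
  then have "mem \<Delta> Y < \<infinity>" using fin by (rule order_le_less_trans)
  then have m: "mem \<Delta> Y = ennreal m" by (simp add: m_def)
  have e: "wenergy h \<Delta> Y H = ennreal (m + h\<^sup>2 * hnorm H)"
    unfolding sp m using m0 by (simp add: hnorm_nonneg)
  let ?M = "\<lambda>x. indicator (disc 1) x * (norm (gram Y x - coneg \<Delta> x))\<^sup>2 :: real"
  have [measurable]: "gram Y \<in> borel_measurable borel"
    by (rule gram_borel) (rule L2_borel[OF cL2_L2[OF T(2)]])
  have meas: "?M \<in> borel_measurable lborel"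
    by (intro borel_measurable_times borel_measurable_indicator) (simp, measurable)
  have nn: "(\<integral>\<^sup>+x. ennreal (?M x) \<partial>lborel) = ennreal m"
    unfolding m[symmetric] mem_def by (rule nn_integral_cong) (simp add: indicator_def)
  have int: "integrable lborel ?M"
    by (rule integrableI_nonneg[OF meas]) (use nn in simp_all)
  have val: "integral\<^sup>L lborel ?M = m"
    by (rule integral_eq_nn_integral[OF meas, THEN trans]) (use nn m0 in simp_all)
  have "2 * pi * \<Delta>\<^sup>2 * (ln (R / h) - 1) - 98 * pi - m / (2 * h\<^sup>2) \<le> (\<integral>x. indicator (disc R) x * hsq H x \<partial>lborel)"
    if "0 < R" "R < 1" for R
    using lower_bound[OF that h w \<Delta> int] unfolding val .
  then show ?thesis using m0 m e by (intro exI[of _ m]) simp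
qed

lemma hessian_disc:
  assumes H: "\<And>i j. H i j \<in> cL2" and R: "R < 1"
  shows "(\<integral>x. indicator (disc R) x * hsq H x \<partial>lborel) \<le> hnorm H"
    "(\<integral>\<^sup>+x. indicator (disc 1 - disc R) x * ennreal (hsq H x) \<partial>lborel) = ennreal (hnorm H - (\<integral>x. indicator (disc R) x * hsq H x \<partial>lborel))"
proof -
  note i = hsq_integrable[of H, OF H]
  have iR: "integrable lborel (\<lambda>x. indicator (disc R) x * hsq H x)"
    using integrable_mult_indicator[OF _ i(1), of "disc R"] by simp
  have eq: "indicator (disc 1 - disc R) x * hsq H x = hsq H x - indicator (disc R) x * hsq H x" for x
    using hsq_outside[of H, OF H, of x] R by (cases "x \<in> disc 1"; cases "x \<in> disc R") simp_all
  have v: "(\<integral>x. hsq H x - indicator (disc R) x * hsq H x \<partial>lborel) = hnorm H - (\<integral>x. indicator (disc R) x * hsq H x \<partial>lborel)"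
    unfolding Bochner_Integration.integral_diff[OF i(1) iR] i(2) ..
  have nn: "0 \<le> hsq H x - indicator (disc R) x * hsq H x" for x
    unfolding eq[symmetric] by (simp add: hsq_nonneg)
  have "0 \<le> (\<integral>x. hsq H x - indicator (disc R) x * hsq H x \<partial>lborel)"
    by (rule Bochner_Integration.integral_nonneg) (rule nn)
  then show "(\<integral>x. indicator (disc R) x * hsq H x \<partial>lborel) \<le> hnorm H" unfolding v by simp
  have "(\<integral>\<^sup>+x. indicator (disc 1 - disc R) x * ennreal (hsq H x) \<partial>lborel) = (\<integral>\<^sup>+x. ennreal (hsq H x - indicator (disc R) x * hsq H x) \<partial>lborel)"
    unfolding eq[symmetric] by (rule nn_integral_cong) (simp add: indicator_def)
  also have "\<dots> = ennreal (\<integral>x. hsq H x - indicator (disc R) x * hsq H x \<partial>lborel)"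
    by (rule nn_integral_eq_integral) (use i(1) iR nn in auto)
  finally show "(\<integral>\<^sup>+x. indicator (disc 1 - disc R) x * ennreal (hsq H x) \<partial>lborel) = ennreal (hnorm H - (\<integral>x. indicator (disc R) x * hsq H x \<partial>lborel))"
    unfolding v .
qed

theorem theorem1:
  fixes \<Delta> :: real
  assumes "0 < \<Delta>" and "\<Delta> < 1"
  shows "\<exists>C\<^sub>1 > 0. \<exists>C\<^sub>2 > 0. \<exists>C\<^sub>3 > 0. \<forall>\<^sub>F h in at_right 0.
    (\<exists>y\<^sub>0. is_arg_min (energy h \<Delta>) (\<lambda>y. y \<in> sobolev2 2 (disc 1)) y\<^sub>0 \<and>
       ennreal (2 * pi * \<Delta>\<^sup>2 * h\<^sup>2 * (ln (1 / h) - C\<^sub>1)) \<le> energy h \<Delta> y\<^sub>0 \<and>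
       energy h \<Delta> y\<^sub>0 \<le> ennreal (2 * pi * \<Delta>\<^sup>2 * h\<^sup>2 * (ln (1 / h) + C\<^sub>2))) \<and>
    (\<forall>y\<in>sobolev2 2 (disc 1).
       energy h \<Delta> y \<le> ennreal (2 * pi * \<Delta>\<^sup>2 * h\<^sup>2 * (ln (1 / h) + C\<^sub>2)) \<longrightarrow>
       (\<forall>R\<in>{2 * h<..<1}.
          (\<integral>\<^sup>+x\<in>disc 1 - disc R. ennreal ((norm (weak_hessian (disc 1) y x))\<^sup>2) \<partial>lebesgue)
            \<le> ennreal (2 * pi * \<Delta>\<^sup>2 * ln (1 / R) + C\<^sub>3)) \<and>
       (\<integral>\<^sup>+x\<in>disc 1. ennreal ((norm (induced_metric y x - cone_metric \<Delta> x))\<^sup>2) \<partial>lebesgue)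
            \<le> ennreal (C\<^sub>3 * h\<^sup>2))"
proof -
  define a where "a = 2 * pi * \<Delta>\<^sup>2"
  have a: "0 < a" using assms by (simp add: a_def)
  \<comment> \<open>The lower bound is used on the disc of radius 1/2: \<open>ln 2\<close> is the
    cost of that radius, and the other summands are the additive constants of
    \<open>lower_bound\<close> divided by the leading factor \<open>a\<close>.\<close>
  define C1 where "C1 = 1 + ln 2 + 98 * pi / a"
  have aC1: "a * C1 = a + a * ln 2 + 98 * pi" using a by (simp add: C1_def field_simps)
  have "0 < ln (2::real)" by simp
  moreover have "0 < 98 * pi / a" using a by simp
  ultimately have C1: "0 < C1" unfolding C1_def by linarith
  \<comment> \<open>The first summand bounds the membrane energy over \<open>h\<^sup>2\<close>. The
    second bounds the bending outside a disc: \<open>3 * a\<close> is 2 from the upper and 1 from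
    the lower energy bound, and \<open>98 * pi\<close> is the Young remainder.\<close>
  define C3 where "C3 = 2 * (a * (2 + C1)) + (3 * a + 98 * pi)"
  have p1: "0 < a * (2 + C1)" using a C1 by simp
  have p2: "0 < 3 * a + 98 * pi" using a by (simp add: add_pos_pos)
  have C3: "0 < C3" using p1 p2 by (simp add: C3_def)
  have \<Delta>: "0 \<le> \<Delta>" "\<Delta> \<le> 1" "\<bar>\<Delta>\<bar> \<le> 1" using assms by auto
  have main: "(\<exists>y\<^sub>0. is_arg_min (energy h \<Delta>) (\<lambda>y. y \<in> sobolev2 2 (disc 1)) y\<^sub>0 \<and>
       ennreal (2 * pi * \<Delta>\<^sup>2 * h\<^sup>2 * (ln (1 / h) - C1)) \<le> energy h \<Delta> y\<^sub>0 \<and>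
       energy h \<Delta> y\<^sub>0 \<le> ennreal (2 * pi * \<Delta>\<^sup>2 * h\<^sup>2 * (ln (1 / h) + 2))) \<and>
    (\<forall>y\<in>sobolev2 2 (disc 1).
       energy h \<Delta> y \<le> ennreal (2 * pi * \<Delta>\<^sup>2 * h\<^sup>2 * (ln (1 / h) + 2)) \<longrightarrow>
       (\<forall>R\<in>{2 * h<..<1}.
          (\<integral>\<^sup>+x\<in>disc 1 - disc R. ennreal ((norm (weak_hessian (disc 1) y x))\<^sup>2) \<partial>lebesgue)
            \<le> ennreal (2 * pi * \<Delta>\<^sup>2 * ln (1 / R) + C3)) \<and>
       (\<integral>\<^sup>+x\<in>disc 1. ennreal ((norm (induced_metric y x - cone_metric \<Delta> x))\<^sup>2) \<partial>lebesgue)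
            \<le> ennreal (C3 * h\<^sup>2))"
    if h: "0 < h" "h < 1" for h
  proof -
    define L where "L = ln (1 / h)"
    have L0: "0 \<le> L" using h by (simp add: L_def ln_div)
    have h2: "0 < h\<^sup>2" using h by simp
    have lnR: "ln (R / h) = L - ln (1 / R)" if "0 < R" for R using that h by (simp add: L_def ln_div)
    have upper0: "0 \<le> a * h\<^sup>2 * (L + 2)" using a h2 L0 by simp
    \<comment> \<open>Half of the membrane energy survives the absorption. Dropping it gives the
      lower bound for the minimum; keeping it and comparing with the upper bound gives the membrane
      estimate.\<close>
    have base: "m / 2 + h\<^sup>2 * (a * (L - C1)) \<le> m + h\<^sup>2 * hnorm H"
      if w: "weak_triple y Y H" and low: "\<forall>R. 0 < R \<and> R < 1 \<longrightarrow> 2 * pi * \<Delta>\<^sup>2 * (ln (R / h) - 1) - 98 * pi - m / (2 * h\<^sup>2) \<le> (\<integral>x. indicator (disc R) x * hsq H x \<partial>lborel)"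
      for m and y :: "real^2 \<Rightarrow> real^3" and Y H
    proof -
      have "a * (L - ln 2 - 1) - 98 * pi - m / (2 * h\<^sup>2) \<le> (\<integral>x. indicator (disc (1/2)) x * hsq H x \<partial>lborel)"
        using low[rule_format, of "1/2"] lnR[of "1/2"] unfolding a_def[symmetric] by simp
      also have "\<dots> \<le> hnorm H" by (rule hessian_disc(1)[OF weak_tripleD(3)[OF w]]) simp
      finally have "h\<^sup>2 * (a * (L - ln 2 - 1) - 98 * pi - m / (2 * h\<^sup>2)) \<le> h\<^sup>2 * hnorm H" using h2 by simp
      moreover have "h\<^sup>2 * (a * (L - ln 2 - 1) - 98 * pi - m / (2 * h\<^sup>2)) = h\<^sup>2 * (a * (L - ln 2 - 1) - 98 * pi) - m / 2"
        using h2 by (simp add: right_diff_distrib)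
      moreover have "a * (L - ln 2 - 1) - 98 * pi = a * (L - C1)" using aC1 by (simp add: algebra_simps)
      ultimately show ?thesis by simp
    qed
    note hc = hcone_triple[of h \<Delta>, OF h(1) less_imp_le[OF h(2)] \<Delta>(1,2)]
      and ub = upper_bound[of h \<Delta>, OF h(1) less_imp_le[OF h(2)] \<Delta>(1,2)]
    have fin: "wenergy h \<Delta> (\<lambda>i x. indicator (disc 1) x *\<^sub>R hcone1 h \<Delta> i x) (\<lambda>i j x. indicator (disc 1) x *\<^sub>R hcone2 h \<Delta> i j x) < \<infinity>"
      using ub by (rule order_le_less_trans) simp
    obtain y\<^sub>0 :: "real^2 \<Rightarrow> real^3" and Y H where min: "weak_triple y\<^sub>0 Y H \<and>
      (\<forall>y' (Y' :: 2 \<Rightarrow> real^2 \<Rightarrow> real^3) H'. weak_triple y' Y' H' \<longrightarrow> wenergy h \<Delta> Y H \<le> wenergy h \<Delta> Y' H')"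
      using minimizer_exists[OF hc fin h(1)] by (elim exE)
    then have w0: "weak_triple y\<^sub>0 Y H" by simp
    have e0: "energy h \<Delta> y\<^sub>0 = wenergy h \<Delta> Y H"
      by (rule represents_nn_integrals(1)[OF weak_triple_sobolev(2)[OF w0] \<Delta>(3)])
    have le: "energy h \<Delta> y\<^sub>0 \<le> energy h \<Delta> y" if ys: "y \<in> sobolev2 2 (disc 1)" for y
    proof -
      obtain y' Y' H' where "weak_triple y' Y' H' \<and> represents y Y' H'" using sobolev_weak_triple[OF ys] by (elim exE)
      then show ?thesis unfolding e0 using min represents_nn_integrals(1)[OF _ \<Delta>(3), of y Y' H' h] by auto
    qed
    have arg: "is_arg_min (energy h \<Delta>) (\<lambda>y. y \<in> sobolev2 2 (disc 1)) y\<^sub>0"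
      unfolding is_arg_min_def using weak_triple_sobolev(1)[OF w0] le by (auto simp: not_less)
    have up: "wenergy h \<Delta> Y H \<le> ennreal (2 * pi * \<Delta>\<^sup>2 * h\<^sup>2 * (ln (1 / h) + 2))"
      using order_trans[OF _ ub] min hc by blast
    have fin0: "wenergy h \<Delta> Y H < \<infinity>" using up by (rule order_le_less_trans) simp
    obtain m where m: "0 \<le> m \<and> mem \<Delta> Y = ennreal m \<and> wenergy h \<Delta> Y H = ennreal (m + h\<^sup>2 * hnorm H) \<and>
      (\<forall>R. 0 < R \<and> R < 1 \<longrightarrow> 2 * pi * \<Delta>\<^sup>2 * (ln (R / h) - 1) - 98 * pi - m / (2 * h\<^sup>2) \<le> (\<integral>x. indicator (disc R) x * hsq H x \<partial>lborel))"
      using energy_estimates[OF w0 fin0 h(1) \<Delta>(1,2)] by (elim exE)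
    have "2 * pi * \<Delta>\<^sup>2 * h\<^sup>2 * (ln (1 / h) - C1) = h\<^sup>2 * (a * (L - C1))" by (simp add: a_def L_def)
    also have "\<dots> \<le> m / 2 + h\<^sup>2 * (a * (L - C1))" using m by simp
    also have "\<dots> \<le> m + h\<^sup>2 * hnorm H" by (rule base[OF w0]) (use m in blast)
    finally have "ennreal (2 * pi * \<Delta>\<^sup>2 * h\<^sup>2 * (ln (1 / h) - C1)) \<le> ennreal (m + h\<^sup>2 * hnorm H)" by (rule ennreal_leI)
    moreover have "ennreal (m + h\<^sup>2 * hnorm H) = energy h \<Delta> y\<^sub>0" unfolding e0 using m by metis
    ultimately have lo: "ennreal (2 * pi * \<Delta>\<^sup>2 * h\<^sup>2 * (ln (1 / h) - C1)) \<le> energy h \<Delta> y\<^sub>0" by (rule ord_le_eq_trans)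
    have "(\<forall>R\<in>{2 * h<..<1}.
          (\<integral>\<^sup>+x\<in>disc 1 - disc R. ennreal ((norm (weak_hessian (disc 1) y x))\<^sup>2) \<partial>lebesgue)
            \<le> ennreal (2 * pi * \<Delta>\<^sup>2 * ln (1 / R) + C3)) \<and>
       (\<integral>\<^sup>+x\<in>disc 1. ennreal ((norm (induced_metric y x - cone_metric \<Delta> x))\<^sup>2) \<partial>lebesgue)
            \<le> ennreal (C3 * h\<^sup>2)"
      if y: "y \<in> sobolev2 2 (disc 1)" and en: "energy h \<Delta> y \<le> ennreal (2 * pi * \<Delta>\<^sup>2 * h\<^sup>2 * (ln (1 / h) + 2))" for y
    proof -
      obtain y' Y' H' where yw: "weak_triple y' Y' H' \<and> represents y Y' H'" using sobolev_weak_triple[OF y] by (elim exE)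
      then have w: "weak_triple y' Y' H'" by simp
      note rep = represents_nn_integrals[OF conjunct2[OF yw] \<Delta>(3)]
      have enw: "wenergy h \<Delta> Y' H' \<le> ennreal (a * h\<^sup>2 * (L + 2))" using en unfolding rep(1) a_def L_def .
      have finw: "wenergy h \<Delta> Y' H' < \<infinity>" using enw by (rule order_le_less_trans) simp
      obtain m where m: "0 \<le> m \<and> mem \<Delta> Y' = ennreal m \<and> wenergy h \<Delta> Y' H' = ennreal (m + h\<^sup>2 * hnorm H') \<and>
        (\<forall>R. 0 < R \<and> R < 1 \<longrightarrow> 2 * pi * \<Delta>\<^sup>2 * (ln (R / h) - 1) - 98 * pi - m / (2 * h\<^sup>2) \<le> (\<integral>x. indicator (disc R) x * hsq H' x \<partial>lborel))"
        using energy_estimates[OF w finw h(1) \<Delta>(1,2)] by (elim exE)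
      then have m0: "0 \<le> m" and mm: "mem \<Delta> Y' = ennreal m" and me: "wenergy h \<Delta> Y' H' = ennreal (m + h\<^sup>2 * hnorm H')"
        and ml: "\<forall>R. 0 < R \<and> R < 1 \<longrightarrow> 2 * pi * \<Delta>\<^sup>2 * (ln (R / h) - 1) - 98 * pi - m / (2 * h\<^sup>2) \<le> (\<integral>x. indicator (disc R) x * hsq H' x \<partial>lborel)"
        by blast+
      have total: "m + h\<^sup>2 * hnorm H' \<le> a * h\<^sup>2 * (L + 2)"
        using enw[unfolded me] unfolding ennreal_le_iff[OF upper0] .
      have "m / 2 + h\<^sup>2 * (a * (L - C1)) \<le> a * h\<^sup>2 * (L + 2)" using order_trans[OF base[OF w ml] total] .
      then have "m \<le> 2 * (a * (2 + C1)) * h\<^sup>2" by (simp add: algebra_simps)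
      also have "\<dots> \<le> C3 * h\<^sup>2" using p2 h2 by (intro mult_right_mono) (simp_all add: C3_def)
      finally have mC: "m \<le> C3 * h\<^sup>2" .
      have "(\<integral>\<^sup>+x\<in>disc 1 - disc R. ennreal ((norm (weak_hessian (disc 1) y x))\<^sup>2) \<partial>lebesgue)
            \<le> ennreal (2 * pi * \<Delta>\<^sup>2 * ln (1 / R) + C3)" if R: "R \<in> {2 * h<..<1}" for R
      proof -
        have R': "0 < R" "R < 1" using R h by auto
        have "h\<^sup>2 * hnorm H' \<le> h\<^sup>2 * (a * (L + 2) - m / h\<^sup>2)" using total h2 by (simp add: algebra_simps)
        then have hn: "hnorm H' \<le> a * (L + 2) - m / h\<^sup>2" using h2 by (simp only: mult_le_cancel_left_pos)
        have lo: "a * (L - ln (1 / R) - 1) - 98 * pi - m / (2 * h\<^sup>2) \<le> (\<integral>x. indicator (disc R) x * hsq H' x \<partial>lborel)"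
          using ml[rule_format, of R] R' unfolding a_def lnR[OF R'(1)] by simp
        \<comment> \<open>The total energy removes the full \<open>m / h\<^sup>2\<close> from the
          bending, while the bound on the disc gives up only half of it; so the membrane terms
          together have a favourable sign.\<close>
        have q: "m / (2 * h\<^sup>2) \<le> m / h\<^sup>2" using m0 h2 by (intro divide_left_mono) auto
        have "hnorm H' - (\<integral>x. indicator (disc R) x * hsq H' x \<partial>lborel)
           \<le> (a * (L + 2) - m / h\<^sup>2) - (a * (L - ln (1 / R) - 1) - 98 * pi - m / (2 * h\<^sup>2))"
          using hn lo by (rule diff_mono)
        also have "\<dots> = a * ln (1 / R) + (3 * a + 98 * pi) + (m / (2 * h\<^sup>2) - m / h\<^sup>2)"
          by (simp add: algebra_simps)
        also have "\<dots> \<le> a * ln (1 / R) + C3" using q p1 unfolding C3_def by linarith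
        finally have "hnorm H' - (\<integral>x. indicator (disc R) x * hsq H' x \<partial>lborel) \<le> 2 * pi * \<Delta>\<^sup>2 * ln (1 / R) + C3"
          unfolding a_def .
        then show ?thesis unfolding rep(3) hessian_disc(2)[of H', OF weak_tripleD(3)[OF w] R'(2)] by (rule ennreal_leI)
      qed
      moreover have "(\<integral>\<^sup>+x\<in>disc 1. ennreal ((norm (induced_metric y x - cone_metric \<Delta> x))\<^sup>2) \<partial>lebesgue) \<le> ennreal (C3 * h\<^sup>2)"
        unfolding rep(2) mem_def[symmetric] mm by (rule ennreal_leI[OF mC])
      ultimately show ?thesis by blast
    qed
    note second = this
    have up': "energy h \<Delta> y\<^sub>0 \<le> ennreal (2 * pi * \<Delta>\<^sup>2 * h\<^sup>2 * (ln (1 / h) + 2))" unfolding e0 by (rule up)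
    show ?thesis
      by (rule conjI, rule exI[of _ y\<^sub>0], rule conjI, rule arg, rule conjI, rule lo, rule up', rule ballI, rule impI, rule second)
  qed
  have "\<forall>\<^sub>F h in at_right (0::real). 0 < h \<and> h < 1"
    unfolding eventually_at_right_field by (intro exI[of _ 1]) simp
  then have "\<forall>\<^sub>F h in at_right 0. (\<exists>y\<^sub>0. is_arg_min (energy h \<Delta>) (\<lambda>y. y \<in> sobolev2 2 (disc 1)) y\<^sub>0 \<and>
       ennreal (2 * pi * \<Delta>\<^sup>2 * h\<^sup>2 * (ln (1 / h) - C1)) \<le> energy h \<Delta> y\<^sub>0 \<and>
       energy h \<Delta> y\<^sub>0 \<le> ennreal (2 * pi * \<Delta>\<^sup>2 * h\<^sup>2 * (ln (1 / h) + 2))) \<and>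
    (\<forall>y\<in>sobolev2 2 (disc 1).
       energy h \<Delta> y \<le> ennreal (2 * pi * \<Delta>\<^sup>2 * h\<^sup>2 * (ln (1 / h) + 2)) \<longrightarrow>
       (\<forall>R\<in>{2 * h<..<1}.
          (\<integral>\<^sup>+x\<in>disc 1 - disc R. ennreal ((norm (weak_hessian (disc 1) y x))\<^sup>2) \<partial>lebesgue)
            \<le> ennreal (2 * pi * \<Delta>\<^sup>2 * ln (1 / R) + C3)) \<and>
       (\<integral>\<^sup>+x\<in>disc 1. ennreal ((norm (induced_metric y x - cone_metric \<Delta> x))\<^sup>2) \<partial>lebesgue)
            \<le> ennreal (C3 * h\<^sup>2))"
    by (rule eventually_mono) (rule main; simp)
  moreover have "(0::real) < 2" by simp
  ultimately show ?thesis using C1 C3 by (intro exI[of _ C1] exI[of _ "2::real"] exI[of _ C3] conjI)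
qed

end
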